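(* (1) Let $\alpha,\beta\in\mathbb{P}^1(\mathbb{R})$, $\alpha\neq\beta$, let $\varpi=\varpi_{\beta\to\alpha}$, and let $B_0^{-1}\varpi=\llbracket i_1,i_2,i_3,\dots\rrbracket_{\Delta(2,3,7)}$ be its geodesic continued fraction expansion. For $k\ge1$ set $A_k=g_7^{i_k}g_2$ and $B_k=B_0A_1\cdots A_k$. Then the following are equivalent: (i) there exist $z,w\in L$ with $D_{z,w}:=(z-\bar z)^2+4\eta w\bar w>0$ such that $\alpha=\frac{1}{2w}(z-\bar z\pm\sqrt{D_{z,w}})$ (if $w=0$: $\alpha=\infty$ for the sign $+$ and $\alpha=0$ for the sign $-$); (ii) there exist $l_0\ge1$ and $k_0\ge0$ such that $B_{k+l_0}^{-1}\alpha=B_k^{-1}\alpha$ for all $k\ge k_0$; (iii) there exist $l_0\ge1$ and $k_0\ge0$ such that $i_{k+l_0}=i_k$ for all $k>k_0$. (2) Suppose these conditions hold for $z,w\in L$ and $l_0,k_0\ge1$, with $l_0$ minimal such that (iii) holds. Put $\gamma_0=B_{k_0+l_0}B_{k_0}^{-1}=B_{k_0}A_{k_0+1}\cdots A_{k_0+l_0}B_{k_0}^{-1}$. Then $\gamma_0\in\mathcal O^1_{z,w}$ and $\gamma_0$ is a fundamental unit of $\mathcal O^1_{z,w}$, i.e. $\mathcal O^1_{z,w}=\{\pm\gamma_0^k:k\in\mathbb Z\}$; equivalently $\rho_\alpha(\gamma_0)\in F(\sqrt{D_{z,w}})$ is a fundamental unit of $U_{\mathcal O,z,w/F}$.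
   Context: Let $\eta=2\cos(2\pi/7)$, $F=\mathbb{Q}(\eta)\subset\mathbb{R}$, $L=F(\sqrt\eta)\subset\mathbb{R}$, and $\overline{x+y\sqrt\eta}=x-y\sqrt\eta$ for $x,y\in F$. $A=F+Fi+Fj+Fk$ ($i^2=j^2=\eta$, $ij=-ji=k$) is identified with $\left\{\begin{pmatrix}z&\eta\bar w\\ w&\bar z\end{pmatrix}:z,w\in L\right\}\subset M_2(\mathbb{R})$ via $i\mapsto\begin{pmatrix}0&\eta\\1&0\end{pmatrix}$, $j\mapsto\begin{pmatrix}\sqrt\eta&0\\0&-\sqrt\eta\end{pmatrix}$; $\mathcal O=\mathbb Z[\eta][i,j,\frac12(1+\eta i+(1+\eta+\eta^2)j)]$, $\Delta(2,3,7)=\mathcal O^1=\{x\in\mathcal O^\times:\det x=1\}$, acting on $\mathfrak h$ and $\mathbb{P}^1(\mathbb{R})$ by linear fractional transformations. $g_2=\begin{pmatrix}0&-\sqrt\eta\\1/\sqrt\eta&0\end{pmatrix}$, $g_3=\frac12\begin{pmatrix}1+(\eta^2-2)\sqrt\eta&-(\eta^2+\eta-1)\sqrt\eta\\(3-\eta^2)\sqrt\eta&1-(\eta^2-2)\sqrt\eta\end{pmatrix}$, $g_7=\frac12\begin{pmatrix}\eta^2+\eta-1&\eta^2-1-\sqrt\eta\\2-\eta^2+(\eta^2+\eta-2)\sqrt\eta&\eta^2+\eta-1\end{pmatrix}$; $\tau_3,\tau_7$ fixed points in $\mathfrak h$ of $g_3,g_7$, $\tau_3'=g_2\tau_3$.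 $\mathcal F$ = closed geodesic triangle with vertices $\tau_3,\tau_3',\tau_7$; $\mathcal D=\bigcup_{i=0}^6g_7^i\mathcal F$; $\mathbf e_0=[\tau_3,\tau_3')$, $\mathbf e_0'=(\tau_3,\tau_3']$ (half-open geodesic segments), $\mathbf e_i=g_7^i\mathbf e_0$, $\mathbf e_i'=g_7^i\mathbf e_0'$. $\varpi_{\beta\to\alpha}$ = geodesic oriented from $\beta$ to $\alpha$; $\varpi\cap\mathcal D$ (if nonempty) is an oriented segment from $P$ to $Q$; $\varpi$ enters from $\mathbf e_i$ if $P\in\mathbf e_i$, leaves from $\mathbf e_i'$ if $Q\in\mathbf e_i'$; $\varpi_{\beta\to\alpha}$ is reduced if it enters from $\mathbf e_0$ and $|\alpha|<\sqrt\eta$. Geodesic continued fraction expansion: choose $B_0\in\Delta(2,3,7)$ with $\varpi_0=B_0^{-1}\varpi$ reduced; given reduced $\varpi_k$, $i_{k+1}\in\mathbb Z/7\mathbb Z\setminus\{0\}$ is the unique index with $\varpi_k$ leaving $\mathcal D$ from $\mathbf e'_{i_{k+1}}$, and $\varpi_{k+1}=(g_7^{i_{k+1}}g_2)^{-1}\varpi_k$. For $z,w$ as in (i): $\theta_{z,w}=\begin{pmatrix}z&\eta\bar w\\ w&\bar z\end{pmatrix}$, $K_{z,w}=F[\theta_{z,w}]\subset A$ (a quadratic field), $\mathcal O_{z,w}=K_{z,w}\cap\mathcal O$, $\mathcal O^1_{z,w}=\mathcal O_{z,w}^\times\cap\mathcal O^1$; $\rho_\alpha:K_{z,w}\to F(\sqrt{D_{z,w}})\subset\mathbb{R}$,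 $\begin{pmatrix}q&r\\ s&t\end{pmatrix}\mapsto s\alpha+t$ (a field isomorphism), and $U_{\mathcal O,z,w/F}=\rho_\alpha(\mathcal O^1_{z,w})$. A fundamental unit means a generator modulo $\pm1$. *)

theory Defs
  imports "HOL-Analysis.Analysis"
begin

section \<open>The fields \<open>F \<subseteq> L\<close>\<close>

definition eta :: real where
  "eta = 2 * cos (2 * pi / 7)"

definition real_subring :: "real set \<Rightarrow> bool" where
  "real_subring S \<longleftrightarrow> 1 \<in> S \<and> (\<forall>x\<in>S. \<forall>y\<in>S. x - y \<in> S \<and> x * y \<in> S)"

definition real_subfield :: "real set \<Rightarrow> bool" where
  "real_subfield S \<longleftrightarrow> real_subring S \<and> (\<forall>x\<in>S. inverse x \<in> S)"

definition Z_eta :: "real set" where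
  "Z_eta = real_subring hull {eta}"

definition field_F :: "real set" where
  "field_F = real_subfield hull {eta}"

definition adjoin_F :: "real \<Rightarrow> real set" where
  "adjoin_F x = real_subfield hull (insert x field_F)"

definition field_L :: "real set" where
  "field_L = adjoin_F (sqrt eta)"

text \<open>The nontrivial automorphism of \<open>L\<close> over \<open>F\<close>; as \<open>sqrt eta\<close> is not in \<open>F\<close>, it is
  well defined on \<open>L\<close>.\<close>

definition conj_L :: "real \<Rightarrow> real" where
  "conj_L u = (THE v. \<exists>x\<in>field_F. \<exists>y\<in>field_F. u = x + y * sqrt eta \<and> v = x - y * sqrt eta)"


section \<open>The order \<open>\<O>\<close> and the group \<open>\<Delta>(2,3,7)\<close>\<close>

text \<open>Elements of the quaternion algebra \<open>A\<close> are represented by their images in \<open>M\<^sub>2(\<real>)\<close>.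
  Matrix multiplication is \<open>**\<close>; the type class operations \<open>*\<close>, \<open>1\<close> and \<open>^\<close> on
  \<^typ>\<open>real^2^2\<close> are componentwise and are not used.\<close>

definition mat2 :: "real \<Rightarrow> real \<Rightarrow> real \<Rightarrow> real \<Rightarrow> real^2^2" where
  "mat2 a b c d = vector [vector [a, b], vector [c, d]]"

primrec mpow :: "real^2^2 \<Rightarrow> nat \<Rightarrow> real^2^2" where
  "mpow M 0 = mat 1"
| "mpow M (Suc n) = M ** mpow M n"

definition mpowi :: "real^2^2 \<Rightarrow> int \<Rightarrow> real^2^2" where
  "mpowi M k = (if k \<ge> 0 then mpow M (nat k) else mpow (matrix_inv M) (nat (- k)))"

definition mat_subring :: "(real^2^2) set \<Rightarrow> bool" where
  "mat_subring S \<longleftrightarrow> mat 1 \<in> S \<and> (\<forall>x\<in>S. \<forall>y\<in>S. x - y \<in> S \<and> x ** y \<in> S)"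

definition mat_units :: "(real^2^2) set \<Rightarrow> (real^2^2) set" where
  "mat_units S = {x \<in> S. \<exists>y\<in>S. x ** y = mat 1 \<and> y ** x = mat 1}"

text \<open>The subring generated by the scalar matrices with entries in \<open>R\<close> and by \<open>X\<close>; this is
  \<open>R[X]\<close>.\<close>

definition mat_adjoin :: "real set \<Rightarrow> (real^2^2) set \<Rightarrow> (real^2^2) set" where
  "mat_adjoin R X = mat_subring hull (mat ` R \<union> X)"

definition quat_i :: "real^2^2" where
  "quat_i = mat2 0 eta 1 0"

definition quat_j :: "real^2^2" where
  "quat_j = mat2 (sqrt eta) 0 0 (- sqrt eta)"

definition order_O :: "(real^2^2) set" where
  "order_O = mat_adjoin Z_eta
     {quat_i, quat_j,
      (1/2) *\<^sub>R (mat 1 + eta *\<^sub>R quat_i + (1 + eta + eta^2) *\<^sub>R quat_j)}"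

definition Delta237 :: "(real^2^2) set" where
  "Delta237 = {x \<in> mat_units order_O. det x = 1}"

definition g2 :: "real^2^2" where
  "g2 = mat2 0 (- sqrt eta) (1 / sqrt eta) 0"

definition g3 :: "real^2^2" where
  "g3 = (1/2) *\<^sub>R mat2 (1 + (eta^2 - 2) * sqrt eta) (- (eta^2 + eta - 1) * sqrt eta)
                       ((3 - eta^2) * sqrt eta) (1 - (eta^2 - 2) * sqrt eta)"

definition g7 :: "real^2^2" where
  "g7 = (1/2) *\<^sub>R mat2 (eta^2 + eta - 1) (eta^2 - 1 - sqrt eta)
                       (2 - eta^2 + (eta^2 + eta - 2) * sqrt eta) (eta^2 + eta - 1)"


section \<open>Geometry of the upper half plane\<close>

definition upper_half :: "complex set" where
  "upper_half = {z. Im z > 0}"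

definition moebius :: "real^2^2 \<Rightarrow> complex \<Rightarrow> complex" where
  "moebius M z = (of_real (M$1$1) * z + of_real (M$1$2)) / (of_real (M$2$1) * z + of_real (M$2$2))"

datatype rp1 = Pt real | Infty

fun act :: "real^2^2 \<Rightarrow> rp1 \<Rightarrow> rp1" where
  "act M (Pt x) = (if M$2$1 * x + M$2$2 = 0 then Infty
                   else Pt ((M$1$1 * x + M$1$2) / (M$2$1 * x + M$2$2)))"
| "act M Infty = (if M$2$1 = 0 then Infty else Pt (M$1$1 / M$2$1))"

definition hyp_dist :: "complex \<Rightarrow> complex \<Rightarrow> real" where
  "hyp_dist z w = arcosh (1 + (cmod (z - w))^2 / (2 * Im z * Im w))"

definition hyp_segment :: "complex \<Rightarrow> complex \<Rightarrow> complex set" where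
  "hyp_segment p q = {z \<in> upper_half. hyp_dist p z + hyp_dist z q = hyp_dist p q}"

definition hyp_convex :: "complex set \<Rightarrow> bool" where
  "hyp_convex S \<longleftrightarrow> S \<subseteq> upper_half \<and> (\<forall>p\<in>S. \<forall>q\<in>S. hyp_segment p q \<subseteq> S)"

text \<open>\<open>geodesic \<beta> \<alpha>\<close> is the unit speed parametrisation of the geodesic oriented from \<open>\<beta>\<close>
  (the limit at \<open>-\<infinity>\<close>) to \<open>\<alpha>\<close> (the limit at \<open>+\<infinity>\<close>).  It is only meaningful for
  \<open>\<alpha> \<noteq> \<beta>\<close>.  A matrix of positive determinant maps the oriented geodesic from \<open>\<beta>\<close> to \<open>\<alpha>\<close>
  to the one from \<open>act M \<beta>\<close> to \<open>act M \<alpha>\<close>, so geodesics are represented below by their pairs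
  of end points.\<close>

fun geodesic :: "rp1 \<Rightarrow> rp1 \<Rightarrow> real \<Rightarrow> complex" where
  "geodesic (Pt b) (Pt a) t = Complex ((a + b) / 2 + (a - b) / 2 * tanh t) (\<bar>a - b\<bar> / 2 / cosh t)"
| "geodesic (Pt b) Infty t = Complex b (exp t)"
| "geodesic Infty (Pt a) t = Complex a (exp (- t))"
| "geodesic Infty Infty t = undefined"


section \<open>The fundamental heptagon and the continued fraction expansion\<close>

definition tau3 :: complex where
  "tau3 = (THE z. z \<in> upper_half \<and> moebius g3 z = z)"

definition tau7 :: complex where
  "tau7 = (THE z. z \<in> upper_half \<and> moebius g7 z = z)"

definition tau3' :: complex where
  "tau3' = moebius g2 tau3"

definition triangle_F :: "complex set" where
  "triangle_F = hyp_convex hull {tau3, tau3', tau7}"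

definition heptagon_D :: "complex set" where
  "heptagon_D = (\<Union>i<7. moebius (mpow g7 i) ` triangle_F)"

text \<open>The indices in \<open>\<int>/7\<int>\<close> are represented by \<open>0, \<dots>, 6\<close>.  As \<open>g7\<close> has seventh power \<open>-1\<close>,
  this also fixes the sign of \<open>cf_A\<close>, hence of all \<open>cf_B\<close>, below.\<close>

definition side_e :: "nat \<Rightarrow> complex set" where
  "side_e i = moebius (mpow g7 i) ` (hyp_segment tau3 tau3' - {tau3'})"

definition side_e' :: "nat \<Rightarrow> complex set" where
  "side_e' i = moebius (mpow g7 i) ` (hyp_segment tau3 tau3' - {tau3})"

text \<open>The intersection of the geodesic with \<open>heptagon_D\<close> is the (possibly degenerate) segment
  from \<open>P\<close> to \<open>Q\<close>.\<close>

definition crosses_D :: "rp1 \<Rightarrow> rp1 \<Rightarrow> complex \<Rightarrow> complex \<Rightarrow> bool" where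
  "crosses_D \<beta> \<alpha> P Q \<longleftrightarrow> (\<exists>s t. s \<le> t \<and> {u. geodesic \<beta> \<alpha> u \<in> heptagon_D} = {s..t} \<and>
      P = geodesic \<beta> \<alpha> s \<and> Q = geodesic \<beta> \<alpha> t)"

definition enters_from :: "rp1 \<Rightarrow> rp1 \<Rightarrow> nat \<Rightarrow> bool" where
  "enters_from \<beta> \<alpha> i \<longleftrightarrow> (\<exists>P Q. crosses_D \<beta> \<alpha> P Q \<and> P \<in> side_e i)"

definition leaves_from :: "rp1 \<Rightarrow> rp1 \<Rightarrow> nat \<Rightarrow> bool" where
  "leaves_from \<beta> \<alpha> i \<longleftrightarrow> (\<exists>P Q. crosses_D \<beta> \<alpha> P Q \<and> Q \<in> side_e' i)"

definition reduced :: "rp1 \<Rightarrow> rp1 \<Rightarrow> bool" where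
  "reduced \<beta> \<alpha> \<longleftrightarrow> enters_from \<beta> \<alpha> 0 \<and> (\<exists>a. \<alpha> = Pt a \<and> \<bar>a\<bar> < sqrt eta)"

text \<open>Index sequences \<open>i\<close> start at \<open>i 1\<close>; the value \<open>i 0\<close> is irrelevant.\<close>

definition cf_A :: "nat \<Rightarrow> real^2^2" where
  "cf_A j = mpow g7 j ** g2"

primrec cf_B :: "real^2^2 \<Rightarrow> (nat \<Rightarrow> nat) \<Rightarrow> nat \<Rightarrow> real^2^2" where
  "cf_B B0 i 0 = B0"
| "cf_B B0 i (Suc k) = cf_B B0 i k ** cf_A (i (Suc k))"

text \<open>The image of the end point \<open>x\<close> of the given geodesic in the \<open>k\<close>-th geodesic of the
  expansion.\<close>

primrec cf_endpoint :: "real^2^2 \<Rightarrow> (nat \<Rightarrow> nat) \<Rightarrow> rp1 \<Rightarrow> nat \<Rightarrow> rp1" where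
  "cf_endpoint B0 i x 0 = act (matrix_inv B0) x"
| "cf_endpoint B0 i x (Suc k) = act (matrix_inv (cf_A (i (Suc k)))) (cf_endpoint B0 i x k)"

definition geodesic_cf_expansion :: "rp1 \<Rightarrow> rp1 \<Rightarrow> real^2^2 \<Rightarrow> (nat \<Rightarrow> nat) \<Rightarrow> bool" where
  "geodesic_cf_expansion \<beta> \<alpha> B0 i \<longleftrightarrow>
     B0 \<in> Delta237 \<and>
     reduced (cf_endpoint B0 i \<beta> 0) (cf_endpoint B0 i \<alpha> 0) \<and>
     (\<forall>k. i (Suc k) \<in> {1..6} \<and>
          (\<forall>j\<in>{1..6}. leaves_from (cf_endpoint B0 i \<beta> k) (cf_endpoint B0 i \<alpha> k) j
                       \<longleftrightarrow> j = i (Suc k)))"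


section \<open>Quadratic points and their unit groups\<close>

definition disc :: "real \<Rightarrow> real \<Rightarrow> real" where
  "disc z w = (z - conj_L z)^2 + 4 * eta * w * conj_L w"

definition quad_point :: "real \<Rightarrow> real \<Rightarrow> real \<Rightarrow> rp1" where
  "quad_point \<sigma> z w =
     (if w = 0 then (if \<sigma> = 1 then Infty else Pt 0)
      else Pt ((z - conj_L z + \<sigma> * sqrt (disc z w)) / (2 * w)))"

definition is_quad_point :: "rp1 \<Rightarrow> real \<Rightarrow> real \<Rightarrow> bool" where
  "is_quad_point \<alpha> z w \<longleftrightarrow> z \<in> field_L \<and> w \<in> field_L \<and> disc z w > 0 \<and>
     (\<exists>\<sigma>\<in>{1, -1}. \<alpha> = quad_point \<sigma> z w)"

definition theta :: "real \<Rightarrow> real \<Rightarrow> real^2^2" where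
  "theta z w = mat2 z (eta * conj_L w) w (conj_L z)"

definition field_K :: "real \<Rightarrow> real \<Rightarrow> (real^2^2) set" where
  "field_K z w = mat_adjoin field_F {theta z w}"

definition order_zw :: "real \<Rightarrow> real \<Rightarrow> (real^2^2) set" where
  "order_zw z w = field_K z w \<inter> order_O"

definition order1_zw :: "real \<Rightarrow> real \<Rightarrow> (real^2^2) set" where
  "order1_zw z w = mat_units (order_zw z w) \<inter> Delta237"

text \<open>\<open>rho \<alpha> M\<close> is the eigenvalue of \<open>M \<in> K\<close> on the column vector \<open>(\<alpha>, 1)\<close>, which is
  \<open>s * \<alpha> + t\<close> for the bottom row \<open>(s, t)\<close> of \<open>M\<close>.  For \<open>\<alpha> = \<infinity>\<close> (where \<open>s = 0\<close>) the vector
  is \<open>(1, 0)\<close>.\<close>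

fun rho :: "rp1 \<Rightarrow> real^2^2 \<Rightarrow> real" where
  "rho (Pt a) M = M$2$1 * a + M$2$2"
| "rho Infty M = M$1$1"

definition U_zw :: "rp1 \<Rightarrow> real \<Rightarrow> real \<Rightarrow> real set" where
  "U_zw \<alpha> z w = rho \<alpha> ` order1_zw z w"

definition endpoint_periodic ::
    "rp1 \<Rightarrow> real^2^2 \<Rightarrow> (nat \<Rightarrow> nat) \<Rightarrow> nat \<Rightarrow> nat \<Rightarrow> bool" where
  "endpoint_periodic \<alpha> B0 i l k0 \<longleftrightarrow>
     (\<forall>k\<ge>k0. act (matrix_inv (cf_B B0 i (k + l))) \<alpha> = act (matrix_inv (cf_B B0 i k)) \<alpha>)"

definition index_periodic :: "(nat \<Rightarrow> nat) \<Rightarrow> nat \<Rightarrow> nat \<Rightarrow> bool" where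
  "index_periodic i l k0 \<longleftrightarrow> (\<forall>k>k0. i (k + l) = i k)"

end

(* The oriented geodesic from beta to alpha is lifted to vectors b, a of R^2, and everything is read off from
   the real numbers F_j(a,b), whose signs tell on which side of the geodesic the j-th vertex of the heptagon lies:
   the geodesic enters through e_0 iff F_0 <= 0 < F_1 and leaves through e'_j iff F_j > 0 >= F_(j+1).  One step of
   the expansion turns the second condition into the first one.

   Put a_k = B_k^-1 a, b_k = B_k^-1 b.  A definite quadratic form q decreases strictly along a_k, and q(a_k) q(b_k)
   is bounded; as the group is discrete (the algebra is definite at the two other real places), q(a_k) tends to 0.
   If the indices have period l, then det(a_k, a_(k+l)) is eventually constant, hence 0, so that the end points are
   periodic; then B_(k+l) B_k^-1 is hyperbolic and fixes alpha, which is therefore a quadratic point.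
   Conversely, if theta fixes alpha, the conjugates B_k^-1 theta B_k have bounded entries and so form a finite set.
   Writing b = c + tau a with the second eigenvector c, the sign of F_j(a_k, b_k) is for large k determined by
   F_j(a_k, c_k), a function of B_k^-1 theta B_k, and the sign of tau.  Hence the indices are eventually periodic.

   Let M in the group fix alpha.  Apart from the value of tau, the geodesics from b and from M^-1 b to alpha have the
   same other data, so for large k they meet the same tiles; equivalently B_k D and M B_k D are two sequences of tiles
   along one geodesic.  Since translates of D with a common interior point coincide (an estimate of norms in Z[eta]),
   M B_m = +- B_k for some k and m, whence |k - m| is a period and M is up to sign a power of gamma_0. *)
theory Submission
  imports Defs
begin


section \<open>Arithmetic of the cubic field\<close>

text \<open>The Klein model centred at the fixed point of \<open>g7\<close> makes the geometry
  algebraic: geodesics are chords, the edges of the heptagon are seven linear forms permuted by a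
  rotation, and on square roots of isotropic vectors, where matrices act linearly, the edge
  functions are quadratic and the F_j bilinear. The delicate geodesics are those through vertices.
  The half-open edges match exactly the pattern of weak and strict inequalities between the F_j, so
  these geodesics follow the general rule. They return in the limit: F_j(a_k, c_k) may vanish for
  infinitely many k, and then the sign of tau decides. To compare two sequences of tiles, tau = 0 is
  therefore replaced by -1: this eventually gives the same tiles, but for large k no vertex lies on
  the geodesic, so that a common interior point can be chosen. Uniqueness of tiles comes from two
  facts: centres of tiles with a common point are at most two circumradii apart, and the distance of
  two centres can be read off from the trace of a product of conjugates of \<open>g7\<close>, an
  integer of F whose other conjugates are bounded.\<close>

lemma eta_cubic: "eta^3 = 1 + 2 * eta - eta^2"
proof -
  define x :: real where "x = 2 * pi / 7"
  \<comment> \<open>Since 7 x = 2 pi, cos 4x = cos 3x. In terms of cos x this is a quartic with the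
    spurious root 1; the cubic is the other factor.\<close>
  have "cos (4 * x) = cos (2 * pi - 3 * x)" by (rule arg_cong[of _ _ cos]) (simp add: x_def)
  hence "cos (2 * (2 * x)) = cos (3 * x)" by (simp add: cos_diff)
  hence "2 * (2 * (cos x)^2 - 1)^2 - 1 = 4 * (cos x)^3 - 3 * cos x"
    by (simp only: cos_double_cos cos_treble_cos)
  hence e: "(cos x - 1) * (8 * (cos x)^3 + 4 * (cos x)^2 - 4 * cos x - 1) = 0" by algebra
  have "cos x < cos 0" using pi_gt_zero by (intro cos_monotone_0_pi) (auto simp: x_def)
  hence "8 * (cos x)^3 + 4 * (cos x)^2 - 4 * cos x - 1 = 0" using e by simp
  thus ?thesis unfolding eta_def x_def[symmetric] by (simp add: power_mult_distrib algebra_simps)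
qed

lemma eta_gt_1: "eta > 1"
proof -
  have "cos (pi/3) < cos (2*pi/7)" using pi_gt_zero by (intro cos_monotone_0_pi) auto
  thus ?thesis by (simp add: eta_def cos_60)
qed

text \<open>For a > 1 the cofactor of \<open>eta - a\<close> in \<open>id\<close> is positive, so
  the sign of the cubic polynomial at a rational a decides on which side of a the number
  \<open>eta\<close> lies.\<close>

lemma eta_bounds: "1.24697 < eta" "eta < 1.24699"
proof -
  have c: "eta^3 + eta^2 - 2*eta - 1 = 0" using eta_cubic by simp
  have id: "eta^3 + eta^2 - 2*eta - 1 - (a^3 + a^2 - 2*a - 1) = (eta - a) * (eta^2 + eta * a + a^2 + eta + a - 2)" for a
    by algebra
  have pos: "eta^2 + eta * a + a^2 + eta + a - 2 > 0" if "a > 1" for a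
  proof -
    have "eta^2 > 1" "eta * a > 0" "a^2 > 0" using eta_gt_1 that by (auto simp: one_less_power)
    thus ?thesis using eta_gt_1 that by linarith
  qed
  show "1.24697 < eta"
  proof (rule ccontr)
    assume "\<not> 1.24697 < eta"
    hence "(eta - 1.24697) * (eta^2 + eta * 1.24697 + 1.24697^2 + eta + 1.24697 - 2) \<le> 0"
      using pos[of "1.24697"] by (intro mult_nonpos_nonneg) auto
    thus False using id[of "1.24697"] c by (simp add: power2_eq_square power3_eq_cube)
  qed
  show "eta < 1.24699"
  proof (rule ccontr)
    assume "\<not> eta < 1.24699"
    hence "(eta - 1.24699) * (eta^2 + eta * 1.24699 + 1.24699^2 + eta + 1.24699 - 2) \<ge> 0"
      using pos[of "1.24699"] by (intro mult_nonneg_nonneg) auto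
    thus False using id[of "1.24699"] c by (simp add: power2_eq_square power3_eq_cube)
  qed
qed

lemma eta_pos [simp]: "eta > 0" "eta \<noteq> 0" using eta_gt_1 by auto

lemma eta_sq_bounds: "1.5549 < eta^2" "eta^2 < 1.555"
proof -
  have "1.24697 * 1.24697 < eta * eta" "eta * eta < 1.24699 * 1.24699"
    using eta_bounds by (intro mult_strict_mono; simp)+
  thus "1.5549 < eta^2" "eta^2 < 1.555" by (auto simp: power2_eq_square)
qed

text \<open>The other two conjugates of \<open>eta\<close>, 2 cos(4 pi/7) and 2 cos(6 pi/7), as
  polynomials in \<open>eta\<close>. Both are negative, which makes the quaternion algebra definite
  at the corresponding places.\<close>

definition eta2 :: real where "eta2 = eta^2 - 2"
definition eta3 :: real where "eta3 = 1 - eta - eta^2"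

lemma eta2_sq: "eta2^2 = eta3 + 2"
  unfolding eta2_def eta3_def using eta_cubic by algebra

lemma eta3_sq: "eta3^2 = eta + 2"
  unfolding eta2_def eta3_def using eta_cubic by algebra

lemma eta2_cubic: "eta2^3 = 1 + 2 * eta2 - eta2^2"
  unfolding eta2_def eta3_def using eta_cubic by algebra

lemma eta3_cubic: "eta3^3 = 1 + 2 * eta3 - eta3^2"
  unfolding eta2_def eta3_def using eta_cubic by algebra

lemma eta2_bounds: "-0.4451 < eta2" "eta2 < -0.445"
  unfolding eta2_def using eta_sq_bounds by auto

lemma eta3_bounds: "-1.80199 < eta3" "eta3 < -1.80187"
  unfolding eta3_def using eta_sq_bounds eta_bounds by auto

lemma eta23_neg [simp]: "eta2 < 0" "eta3 < 0" using eta2_bounds eta3_bounds by auto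

text \<open>\<open>zrel x y z\<close>: the numbers \<open>x, y, z\<close> are the three conjugates of one element of \<open>\<int>[\<eta>]\<close>.\<close>

definition zrel :: "real \<Rightarrow> real \<Rightarrow> real \<Rightarrow> bool" where
  "zrel x y z \<longleftrightarrow> (\<exists>a b c :: int. x = of_int a + of_int b * eta + of_int c * eta^2
     \<and> y = of_int a + of_int b * eta2 + of_int c * eta2^2
     \<and> z = of_int a + of_int b * eta3 + of_int c * eta3^2)"

lemma zrel_of_int: "zrel (of_int a) (of_int a) (of_int a)"
  unfolding zrel_def by (rule exI[of _ a], rule exI[of _ 0], rule exI[of _ 0]) simp

lemma zrel_0: "zrel 0 0 0" using zrel_of_int[of 0] by simp
lemma zrel_1: "zrel 1 1 1" using zrel_of_int[of 1] by simp
lemma zrel_numeral: "zrel (numeral n) (numeral n) (numeral n)" using zrel_of_int[of "numeral n"] by simp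

lemma zrel_eta: "zrel eta eta2 eta3"
  unfolding zrel_def by (rule exI[of _ 0], rule exI[of _ 1], rule exI[of _ 0]) simp

lemma zrel_add: "zrel x y z \<Longrightarrow> zrel x' y' z' \<Longrightarrow> zrel (x + x') (y + y') (z + z')"
  unfolding zrel_def
proof safe
  fix a b c a' b' c' :: int
  show "\<exists>aa ba ca. real_of_int a + real_of_int b * eta + real_of_int c * eta\<^sup>2 + (real_of_int a' + real_of_int b' * eta + real_of_int c' * eta\<^sup>2) = real_of_int aa + real_of_int ba * eta + real_of_int ca * eta\<^sup>2 \<and>
     real_of_int a + real_of_int b * eta2 + real_of_int c * eta2\<^sup>2 + (real_of_int a' + real_of_int b' * eta2 + real_of_int c' * eta2\<^sup>2) = real_of_int aa + real_of_int ba * eta2 + real_of_int ca * eta2\<^sup>2 \<and>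
     real_of_int a + real_of_int b * eta3 + real_of_int c * eta3\<^sup>2 + (real_of_int a' + real_of_int b' * eta3 + real_of_int c' * eta3\<^sup>2) = real_of_int aa + real_of_int ba * eta3 + real_of_int ca * eta3\<^sup>2"
    by (rule exI[of _ "a + a'"], rule exI[of _ "b + b'"], rule exI[of _ "c + c'"]) (simp add: algebra_simps)
qed

lemma zrel_mult: assumes "zrel x y z" "zrel x' y' z'" shows "zrel (x * x') (y * y') (z * z')"
proof -
  obtain a b c :: int where 1: "x = a + b * eta + c * eta^2" "y = a + b * eta2 + c * eta2^2" "z = a + b * eta3 + c * eta3^2"
    using assms(1) unfolding zrel_def by blast
  obtain a' b' c' :: int where 2: "x' = a' + b' * eta + c' * eta^2" "y' = a' + b' * eta2 + c' * eta2^2" "z' = a' + b' * eta3 + c' * eta3^2"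
    using assms(2) unfolding zrel_def by blast
  \<comment> \<open>\<open>p\<close> and \<open>q\<close> are the coefficients of e^3 and e^4 in the
    product, and e^4 = 3 e^2 - e - 1.\<close>
  define p q where "p = b * c' + c * b'" and "q = c * c'"
  define A B C where "A = a * a' + p - q" and "B = a * b' + b * a' + 2 * p - q" and "C = a * c' + b * b' + c * a' - p + 3 * q"
  have gen: "(a + b * e + c * e^2) * (a' + b' * e + c' * e^2)
      = (a * a' + (b * c' + c * b') - c * c') + (a * b' + b * a' + 2 * (b * c' + c * b') - c * c') * e
      + (a * c' + b * b' + c * a' - (b * c' + c * b') + 3 * (c * c')) * e^2"
    if "e^3 = 1 + 2 * e - e^2" for e a b c a' b' c' :: real
    using that by algebra
  have mult: "(a + b * e + c * e^2) * (a' + b' * e + c' * e^2) = A + B * e + C * e^2" if "e^3 = 1 + 2 * e - e^2" for e :: real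
    unfolding gen[OF that] A_def B_def C_def p_def q_def by simp
  show ?thesis unfolding zrel_def 1 2
    by (rule exI[of _ A], rule exI[of _ B], rule exI[of _ C]) (simp only: mult eta_cubic eta2_cubic eta3_cubic simp_thms)
qed

lemma zrel_minus: "zrel x y z \<Longrightarrow> zrel (- x) (- y) (- z)"
  using zrel_mult[OF zrel_of_int[of "-1"], of x y z] by simp

lemma zrel_diff: "zrel x y z \<Longrightarrow> zrel x' y' z' \<Longrightarrow> zrel (x - x') (y - y') (z - z')"
  using zrel_add[OF _ zrel_minus, of x y z x' y' z'] by simp

lemma zrel_power: "zrel x y z \<Longrightarrow> zrel (x^n) (y^n) (z^n)"
  by (induction n) (auto intro: zrel_1 zrel_mult)

lemmas zrel_intros = zrel_0 zrel_1 zrel_numeral zrel_eta zrel_add zrel_diff zrel_minus zrel_mult zrel_power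

text \<open>Doubling the angle, x -> x^2 - 2, permutes the three conjugates cyclically;
  \<open>zrel_cycle\<close> extends this Galois action to all of Z[eta].\<close>

lemma zrel_eta2: "zrel eta2 eta3 eta"
proof -
  have "zrel (eta^2 - 2) (eta2^2 - 2) (eta3^2 - 2)" by (intro zrel_intros)
  thus ?thesis by (simp add: eta2_sq eta3_sq eta2_def[symmetric])
qed

lemma zrel_cycle: assumes "zrel x y z" shows "zrel y z x"
proof -
  obtain a b c :: int where 1: "x = a + b * eta + c * eta^2" "y = a + b * eta2 + c * eta2^2" "z = a + b * eta3 + c * eta3^2"
    using assms(1) unfolding zrel_def by blast
  show ?thesis unfolding 1 by (intro zrel_add zrel_mult zrel_power zrel_eta2 zrel_of_int)
qed

section \<open>Norms of elements of Z[eta]\<close>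

definition norm_form :: "int \<Rightarrow> int \<Rightarrow> int \<Rightarrow> int" where
  "norm_form a b c = a^3 - a^2*b + 5*a^2*c - 2*a*b^2 - a*b*c + 6*a*c^2 + b^3 - b^2*c - 2*b*c^2 + c^3"

lemma norm_form_eq:
  "(real_of_int a + b * eta + c * eta^2) * (a + b * eta2 + c * eta2^2) * (a + b * eta3 + c * eta3^2) = norm_form a b c"
proof -
  have gen: "(a + b * x + c * x^2) * (a + b * y + c * y^2) * (a + b * z + c * z^2)
     = a^3 + a^2*b*(x+y+z) + a^2*c*((x+y+z)^2 - 2*(x*y+y*z+z*x)) + a*b^2*(x*y+y*z+z*x)
     + a*b*c*((x+y+z)*(x*y+y*z+z*x) - 3*(x*y*z)) + a*c^2*((x*y+y*z+z*x)^2 - 2*(x+y+z)*(x*y*z)) + b^3*(x*y*z)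
     + b^2*c*((x+y+z)*(x*y*z)) + b*c^2*((x*y+y*z+z*x)*(x*y*z)) + c^3*(x*y*z)^2" for a b c x y z :: real
    by algebra
  have s: "eta + eta2 + eta3 = -1" "eta * eta2 + eta2 * eta3 + eta3 * eta = -2" "eta * eta2 * eta3 = 1"
    unfolding eta2_def eta3_def using eta_cubic by (simp, algebra, algebra)
  show ?thesis unfolding gen s norm_form_def by simp
qed

lemma zrel_norm_int: assumes "zrel x y z" shows "\<exists>n::int. x * y * z = n"
proof -
  obtain a b c :: int where 1: "x = a + b * eta + c * eta^2" "y = a + b * eta2 + c * eta2^2" "z = a + b * eta3 + c * eta3^2"
    using assms(1) unfolding zrel_def by blast
  show ?thesis unfolding 1 using norm_form_eq by blast
qed

text \<open>Infinite descent: the cubic is irreducible modulo 2, so a zero of the norm form has even coordinates.\<close>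

lemma norm_form_zero: "norm_form a b c = 0 \<Longrightarrow> a = 0 \<and> b = 0 \<and> c = 0"
proof (induction "nat (\<bar>a\<bar> + \<bar>b\<bar> + \<bar>c\<bar>)" arbitrary: a b c rule: less_induct)
  case less
  have "even (norm_form a b c)" using less.prems by simp
  hence ev: "even a \<and> even b \<and> even c"
    unfolding norm_form_def by (cases "even a"; cases "even b"; cases "even c"; simp)
  then obtain a' b' c' where s: "a = 2 * a'" "b = 2 * b'" "c = 2 * c'" by (auto elim!: evenE)
  have n: "norm_form a b c = 8 * norm_form a' b' c'"
    unfolding s norm_form_def by (simp add: power2_eq_square power3_eq_cube)
  show ?case
  proof (cases "a = 0 \<and> b = 0 \<and> c = 0")
    case False
    hence "nat (\<bar>a'\<bar> + \<bar>b'\<bar> + \<bar>c'\<bar>) < nat (\<bar>a\<bar> + \<bar>b\<bar> + \<bar>c\<bar>)" unfolding s by auto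
    hence "a' = 0 \<and> b' = 0 \<and> c' = 0" using less.hyps n less.prems by auto
    thus ?thesis using s by simp
  qed
qed

lemma zrel_prod_zero: assumes "zrel x y z" "x * y * z = 0" shows "x = 0 \<and> y = 0 \<and> z = 0"
proof -
  obtain a b c :: int where 1: "x = a + b * eta + c * eta^2" "y = a + b * eta2 + c * eta2^2" "z = a + b * eta3 + c * eta3^2"
    using assms(1) unfolding zrel_def by blast
  have "norm_form a b c = 0" using assms(2) norm_form_eq[of a b c] unfolding 1 by simp
  from norm_form_zero[OF this] show ?thesis unfolding 1 by simp
qed

lemma zrel_zero: "zrel 0 y z \<Longrightarrow> y = 0 \<and> z = 0"
  and zrel_zero2: "zrel x 0 z \<Longrightarrow> x = 0 \<and> z = 0"
  using zrel_prod_zero by fastforce+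

text \<open>An element is determined by its first conjugate, so equations in Z[eta] can be
  transported to the other two places without constructing automorphisms.\<close>

lemma zrel_unique: "zrel x y z \<Longrightarrow> zrel x y' z' \<Longrightarrow> y = y' \<and> z = z'"
  using zrel_zero[of "y - y'" "z - z'"] zrel_diff[of x y z x y' z'] by auto

text \<open>The norm is a nonzero integer. The separation estimates for rotations and for tiles rest
  on this bound.\<close>

lemma zrel_norm_ge_1: assumes "zrel x y z" "x \<noteq> 0" shows "\<bar>x * y * z\<bar> \<ge> 1"
proof -
  obtain n :: int where n: "x * y * z = n" using zrel_norm_int assms by blast
  have "n \<noteq> 0" using zrel_prod_zero[OF assms(1)] assms(2) n by auto
  thus ?thesis unfolding n by linarith
qed

section \<open>Z[eta], its quotient field F and the quadratic extension L\<close>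

definition Zring :: "real set" where "Zring = {x. \<exists>y z. zrel x y z}"

lemma zrel_ZringI: "zrel x y z \<Longrightarrow> x \<in> Zring" unfolding Zring_def by blast
lemma ZringE: assumes "x \<in> Zring" obtains y z where "zrel x y z" using assms unfolding Zring_def by blast

lemma Zring_closed:
  "0 \<in> Zring" "1 \<in> Zring" "eta \<in> Zring" "of_int n \<in> Zring" "numeral k \<in> Zring" 
  "x \<in> Zring \<Longrightarrow> y \<in> Zring \<Longrightarrow> x + y \<in> Zring"
  "x \<in> Zring \<Longrightarrow> y \<in> Zring \<Longrightarrow> x - y \<in> Zring"
  "x \<in> Zring \<Longrightarrow> y \<in> Zring \<Longrightarrow> x * y \<in> Zring"
  "x \<in> Zring \<Longrightarrow> - x \<in> Zring"
  "x \<in> Zring \<Longrightarrow> x ^ m \<in> Zring"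
proof -
  show "x \<in> Zring \<Longrightarrow> x ^ m \<in> Zring"
    by (elim ZringE) (rule zrel_ZringI, rule zrel_power)
qed (auto elim!: ZringE intro: zrel_ZringI[OF zrel_0] zrel_ZringI[OF zrel_1] zrel_ZringI[OF zrel_eta] zrel_ZringI[OF zrel_of_int]
  zrel_ZringI[OF zrel_numeral] zrel_ZringI[OF zrel_add] zrel_ZringI[OF zrel_diff] zrel_ZringI[OF zrel_mult] zrel_ZringI[OF zrel_minus])

lemma real_subring_Zring: "real_subring Zring"
  unfolding real_subring_def using Zring_closed by blast

lemma real_subring_hull: "real_subring (real_subring hull S)"
  by (rule hull_in) (auto simp: real_subring_def)

lemma real_subring_add: assumes "real_subring S" "x \<in> S" "y \<in> S" shows "x + y \<in> S" "- x \<in> S" "0 \<in> S"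
proof -
  show z: "0 \<in> S" using assms unfolding real_subring_def by force
  have "0 - y \<in> S" using assms z unfolding real_subring_def by blast
  hence "x - (0 - y) \<in> S" using assms unfolding real_subring_def by blast
  thus "x + y \<in> S" by simp
  have "0 - x \<in> S" using assms z unfolding real_subring_def by blast
  thus "- x \<in> S" by simp
qed

lemma real_subring_of_int: assumes "real_subring S" shows "of_int n \<in> S"
proof (induction n)
  case (nonneg n) show ?case
  proof (induction n)
    case 0 thus ?case using assms unfolding real_subring_def by force
  next
    case (Suc n) thus ?case using real_subring_add[OF assms, of "real n" 1] assms unfolding real_subring_def by (auto simp: add.commute)
  qed
next
  case (neg n)
  have "real k \<in> S" for k
  proof (induction k)
    case 0 thus ?case using assms unfolding real_subring_def by force
  next
    case (Suc n) thus ?case using real_subring_add[OF assms, of "real n" 1] assms unfolding real_subring_def by (auto simp: add.commute)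
  qed
  from this[of "Suc n"] show ?case using real_subring_add(2)[OF assms] by fastforce
qed

lemma Z_eta_eq: "Z_eta = Zring"
proof
  show "Z_eta \<subseteq> Zring" unfolding Z_eta_def by (rule hull_minimal) (auto intro: Zring_closed real_subring_Zring)
  have R: "real_subring Z_eta" unfolding Z_eta_def by (rule real_subring_hull)
  have e: "eta \<in> Z_eta" unfolding Z_eta_def using hull_subset[of "{eta}"] by blast
  have m: "x * y \<in> Z_eta" if "x \<in> Z_eta" "y \<in> Z_eta" for x y using R that unfolding real_subring_def by blast
  show "Zring \<subseteq> Z_eta"
  proof
    fix x assume "x \<in> Zring"
    then obtain a b c :: int where 1: "x = a + b * eta + c * eta^2" unfolding Zring_def zrel_def by blast
    show "x \<in> Z_eta" unfolding 1 power2_eq_square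
      by (intro real_subring_add(1)[OF R] m e real_subring_of_int R)
  qed
qed

lemma real_subfield_hull: "real_subfield (real_subfield hull S)"
  by (rule hull_in) (auto simp: real_subfield_def real_subring_def)

lemma field_closed:
  assumes "real_subfield S"
  shows "0 \<in> S" "1 \<in> S" "of_int n \<in> S" "x \<in> S \<Longrightarrow> y \<in> S \<Longrightarrow> x + y \<in> S" "x \<in> S \<Longrightarrow> y \<in> S \<Longrightarrow> x - y \<in> S"
   "x \<in> S \<Longrightarrow> y \<in> S \<Longrightarrow> x * y \<in> S" "x \<in> S \<Longrightarrow> - x \<in> S" "x \<in> S \<Longrightarrow> y \<in> S \<Longrightarrow> x / y \<in> S"
   "numeral k \<in> S" "x \<in> S \<Longrightarrow> x ^ m \<in> S"
proof -
  have R: "real_subring S" using assms unfolding real_subfield_def by blast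
  show 1: "1 \<in> S" using R unfolding real_subring_def by blast
  show "0 \<in> S" using real_subring_add(3)[OF R 1 1] .
  show "of_int n \<in> S" by (rule real_subring_of_int[OF R])
  show "x \<in> S \<Longrightarrow> y \<in> S \<Longrightarrow> x + y \<in> S" "x \<in> S \<Longrightarrow> - x \<in> S" using real_subring_add[OF R] by blast+
  show "x \<in> S \<Longrightarrow> y \<in> S \<Longrightarrow> x - y \<in> S" using R unfolding real_subring_def by blast
  show m: "x \<in> S \<Longrightarrow> y \<in> S \<Longrightarrow> x * y \<in> S" for x y using R unfolding real_subring_def by blast
  show "x \<in> S \<Longrightarrow> y \<in> S \<Longrightarrow> x / y \<in> S"
    using m[of x "inverse y"] assms unfolding real_subfield_def by (simp add: divide_inverse)
  show "numeral k \<in> S" using real_subring_of_int[OF R, of "numeral k"] by simp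
  show "x \<in> S \<Longrightarrow> x ^ m \<in> S" by (induction m) (auto intro: m 1)
qed

lemma real_subfield_F: "real_subfield field_F" unfolding field_F_def by (rule real_subfield_hull)
lemmas F_closed = field_closed[OF real_subfield_F]

lemma eta_in_F: "eta \<in> field_F" unfolding field_F_def using hull_subset[of "{eta}"] by blast

lemma Zring_subset_F: "x \<in> Zring \<Longrightarrow> x \<in> field_F"
proof -
  assume "x \<in> Zring"
  then obtain a b c :: int where 1: "x = a + b * eta + c * eta^2" unfolding Zring_def zrel_def by blast
  show "x \<in> field_F" unfolding 1 by (intro F_closed eta_in_F)
qed

definition frac_Z :: "real set" where "frac_Z = {x. \<exists>n::int. n \<noteq> 0 \<and> of_int n * x \<in> Zring}"

text \<open>The inverse of an element is the product of its other two conjugates divided by its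
  integral norm, so rational integers suffice as denominators.\<close>

lemma real_subfield_frac_Z: "real_subfield frac_Z"
proof -
  have sub: "x - y \<in> frac_Z" and mul: "x * y \<in> frac_Z" if xy: "x \<in> frac_Z" "y \<in> frac_Z" for x y
  proof -
    obtain n :: int where n: "n \<noteq> 0" "of_int n * x \<in> Zring" using xy unfolding frac_Z_def by blast
    obtain m :: int where m: "m \<noteq> 0" "of_int m * y \<in> Zring" using xy unfolding frac_Z_def by blast
    have "of_int m * (of_int n * x) - of_int n * (of_int m * y) \<in> Zring" using n m by - (assumption | rule Zring_closed)+
    hence "of_int (n * m) * (x - y) \<in> Zring" by (simp add: algebra_simps)
    moreover have "n * m \<noteq> 0" using n m by simp
    ultimately show "x - y \<in> frac_Z" unfolding frac_Z_def by blast
    have "(of_int n * x) * (of_int m * y) \<in> Zring" using n m by - (assumption | rule Zring_closed)+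
    hence "of_int (n * m) * (x * y) \<in> Zring" by (simp add: algebra_simps)
    moreover have "n * m \<noteq> 0" using n m by simp
    ultimately show "x * y \<in> frac_Z" unfolding frac_Z_def by blast
  qed
  have inv: "inverse x \<in> frac_Z" if xx: "x \<in> frac_Z" for x
  proof (cases "x = 0")
    case True thus ?thesis using xx by simp
  next
    case False
    obtain n :: int where n: "n \<noteq> 0" "of_int n * x \<in> Zring" using xx unfolding frac_Z_def by blast
    obtain y z where r: "zrel (of_int n * x) y z" using n(2) ZringE by blast
    obtain m :: int where m: "of_int n * x * y * z = m" using zrel_norm_int[OF r] by blast
    have ne: "y * z \<noteq> 0" "m \<noteq> 0" using zrel_prod_zero[OF r] False n(1) m by auto
    have "zrel (y * z) (z * (of_int n * x)) ((of_int n * x) * y)" by (intro zrel_mult r zrel_cycle[OF r] zrel_cycle[OF zrel_cycle[OF r]])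
    hence "of_int n * (y * z) \<in> Zring" by (rule Zring_closed(8)[OF Zring_closed(4) zrel_ZringI])
    moreover have "of_int m * inverse x = of_int n * (y * z)" using m False by (simp add: field_simps)
    ultimately show ?thesis unfolding frac_Z_def using ne by auto
  qed
  have "1 \<in> frac_Z" unfolding frac_Z_def by (auto intro!: exI[of _ 1] Zring_closed)
  thus ?thesis unfolding real_subfield_def real_subring_def using sub mul inv by blast
qed

lemma F_subset_frac_Z: "field_F \<subseteq> frac_Z"
proof -
  have "eta \<in> frac_Z" unfolding frac_Z_def by (auto intro!: exI[of _ 1] Zring_closed)
  thus ?thesis unfolding field_F_def by (intro hull_minimal real_subfield_frac_Z) auto
qed

lemma F_scale: assumes "x \<in> field_F" obtains n :: int where "n \<noteq> 0" "of_int n * x \<in> Zring"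
  using assms F_subset_frac_Z unfolding frac_Z_def by blast

lemma sqrt_eta_pos [simp]: "sqrt eta > 0" "sqrt eta \<noteq> 0" by auto
lemma sqrt_eta_sq [simp]: "sqrt eta * sqrt eta = eta" "(sqrt eta)^2 = eta" 
  using eta_pos(1) by (auto simp del: eta_pos)

text \<open>At the second place \<open>eta\<close> becomes the negative number \<open>eta2\<close>,
  and the equation says that a sum of two nonnegative terms vanishes. This is why
  \<open>sqrt eta\<close> is not in F.\<close>

lemma Zring_sq_eta: assumes "x \<in> Zring" "y \<in> Zring" "x^2 = eta * y^2" shows "x = 0 \<and> y = 0"
proof -
  obtain x2 x3 where x: "zrel x x2 x3" using assms ZringE by blast
  obtain y2 y3 where y: "zrel y y2 y3" using assms ZringE by blast
  have "zrel (x^2 - eta * y^2) (x2^2 - eta2 * y2^2) (x3^2 - eta3 * y3^2)" by (intro zrel_intros x y)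
  hence "x2^2 - eta2 * y2^2 = 0" using assms(3) zrel_zero(1) by fastforce
  moreover have "- eta2 * y2^2 \<ge> 0" using eta23_neg(1) by (intro mult_nonneg_nonneg) (auto simp del: eta23_neg)
  ultimately have "x2^2 = 0 \<and> - eta2 * y2^2 = 0" using zero_le_power2[of x2] by linarith
  hence "x2 = 0" "y2 = 0" using eta23_neg by auto
  thus ?thesis using zrel_zero2 x y by blast
qed

lemma F_sqrt_indep: assumes "x \<in> field_F" "y \<in> field_F" "x = y * sqrt eta" shows "x = 0 \<and> y = 0"
proof -
  obtain n where n: "n \<noteq> 0" "of_int n * x \<in> Zring" using F_scale assms by blast
  obtain m where m: "m \<noteq> 0" "of_int m * y \<in> Zring" using F_scale assms by blast
  have "of_int m * (of_int n * x) \<in> Zring" "of_int n * (of_int m * y) \<in> Zring" using n m Zring_closed(4,8) by blast+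
  moreover have "(of_int m * (of_int n * x))^2 = eta * (of_int n * (of_int m * y))^2"
    unfolding assms(3) power_mult_distrib sqrt_eta_sq by (simp add: ac_simps)
  ultimately have "of_int m * (of_int n * x) = 0 \<and> of_int n * (of_int m * y) = 0" by (rule Zring_sq_eta)
  thus ?thesis using n m by simp
qed

definition FL :: "real set" where "FL = {u. \<exists>x\<in>field_F. \<exists>y\<in>field_F. u = x + y * sqrt eta}"

lemma real_subfield_FL: "real_subfield FL"
proof -
  have sub: "u - v \<in> FL" and mul: "u * v \<in> FL" if uv: "u \<in> FL" "v \<in> FL" for u v
  proof -
    obtain x y where u: "x \<in> field_F" "y \<in> field_F" "u = x + y * sqrt eta" using uv unfolding FL_def by blast
    obtain z w where v: "z \<in> field_F" "w \<in> field_F" "v = z + w * sqrt eta" using uv unfolding FL_def by blast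
    have "u - v = (x - z) + (y - w) * sqrt eta" unfolding u v by (simp add: algebra_simps)
    moreover have "x - z \<in> field_F" "y - w \<in> field_F" using u v by (auto intro!: F_closed)
    ultimately show "u - v \<in> FL" unfolding FL_def by blast
    have "u * v = x * z + y * w * (sqrt eta * sqrt eta) + (x * w + y * z) * sqrt eta" unfolding u v by algebra
    hence "u * v = (x * z + y * w * eta) + (x * w + y * z) * sqrt eta" by (simp only: sqrt_eta_sq)
    moreover have "x * z + y * w * eta \<in> field_F" "x * w + y * z \<in> field_F" using u v by (auto intro!: F_closed eta_in_F)
    ultimately show "u * v \<in> FL" unfolding FL_def by blast
  qed
  have inv: "inverse u \<in> FL" if uu: "u \<in> FL" for u
  proof (cases "u = 0")
    case True thus ?thesis using uu by simp
  next
    case False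
    obtain x y where u: "x \<in> field_F" "y \<in> field_F" "u = x + y * sqrt eta" using uu unfolding FL_def by blast
    have ne: "x - y * sqrt eta \<noteq> 0" using F_sqrt_indep[OF u(1,2)] u(3) False by auto
    have e: "u * (x - y * sqrt eta) = x^2 - y^2 * eta" proof -
      have "(x + y * s) * (x - y * s) = x^2 - y^2 * (s * s)" for s by algebra
      from this[of "sqrt eta"] show ?thesis unfolding u sqrt_eta_sq .
    qed
    hence ne2: "x^2 - y^2 * eta \<noteq> 0" using ne False by auto
    have "inverse u = (x - y * sqrt eta) / (x^2 - y^2 * eta)" unfolding e[symmetric] using ne False by (simp add: field_simps)
    also have "\<dots> = x / (x^2 - y^2 * eta) + (- y / (x^2 - y^2 * eta)) * sqrt eta" by (simp add: diff_divide_distrib)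
    finally have "inverse u = x / (x^2 - y^2 * eta) + (- y / (x^2 - y^2 * eta)) * sqrt eta" .
    moreover have "x / (x^2 - y^2 * eta) \<in> field_F" "- y / (x^2 - y^2 * eta) \<in> field_F" using u by (auto intro!: F_closed eta_in_F)
    ultimately show ?thesis unfolding FL_def by blast
  qed
  have "1 \<in> FL" unfolding FL_def by (rule CollectI, rule bexI[of _ 1], rule bexI[of _ 0]) (auto intro: F_closed)
  thus ?thesis unfolding real_subfield_def real_subring_def using sub mul inv by blast
qed

lemma field_L_eq: "field_L = FL"
proof
  have "x \<in> FL" if "x \<in> field_F" for x
    unfolding FL_def by (rule CollectI, rule bexI[of _ x], rule bexI[of _ 0]) (auto intro: F_closed that)
  hence "field_F \<subseteq> FL" by blast
  moreover have "sqrt eta \<in> FL" unfolding FL_def by (rule CollectI, rule bexI[of _ 0], rule bexI[of _ 1]) (auto intro: F_closed)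
  ultimately show "field_L \<subseteq> FL" unfolding field_L_def adjoin_F_def
    by (intro hull_minimal real_subfield_FL) auto
  have L: "real_subfield field_L" unfolding field_L_def adjoin_F_def by (rule real_subfield_hull)
  have "insert (sqrt eta) field_F \<subseteq> field_L" unfolding field_L_def adjoin_F_def by (rule hull_subset)
  thus "FL \<subseteq> field_L" unfolding FL_def using field_closed(4,6)[OF L] by blast
qed

lemma conj_L_eq: assumes "x \<in> field_F" "y \<in> field_F" shows "conj_L (x + y * sqrt eta) = x - y * sqrt eta"
  unfolding conj_L_def
proof (rule the_equality)
  show "\<exists>x'\<in>field_F. \<exists>y'\<in>field_F. x + y * sqrt eta = x' + y' * sqrt eta \<and> x - y * sqrt eta = x' - y' * sqrt eta"
    by (rule bexI[of _ x], rule bexI[of _ y]) (simp_all add: assms)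
next
  fix v assume "\<exists>x'\<in>field_F. \<exists>y'\<in>field_F. x + y * sqrt eta = x' + y' * sqrt eta \<and> v = x' - y' * sqrt eta"
  then obtain x' y' where 1: "x' \<in> field_F" "y' \<in> field_F" "x + y * sqrt eta = x' + y' * sqrt eta" "v = x' - y' * sqrt eta" by blast
  have "x - x' = (y' - y) * sqrt eta" using 1(3) unfolding left_diff_distrib by linarith
  hence "x - x' = 0 \<and> y' - y = 0" using F_sqrt_indep[OF F_closed(5)[OF assms(1) 1(1)] F_closed(5)[OF 1(2) assms(2)]] by blast
  hence "x' = x" "y' = y" by simp_all
  thus "v = x - y * sqrt eta" unfolding 1(4) by simp
qed

section \<open>The quaternion order\<close>

lemma abs_eta [simp]: "\<bar>eta\<bar> = eta" using eta_gt_1 by simp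

lemma mat2_nth [simp]: "mat2 a b c d $ 1 $ 1 = a" "mat2 a b c d $ 1 $ 2 = b"
  "mat2 a b c d $ 2 $ 1 = c" "mat2 a b c d $ 2 $ 2 = d"
  by (simp_all add: mat2_def)

lemma mat2_eqI: "M$1$1 = N$1$1 \<Longrightarrow> M$1$2 = N$1$2 \<Longrightarrow> M$2$1 = N$2$1 \<Longrightarrow> M$2$2 = N$2$2 \<Longrightarrow> M = (N::real^2^2)"
  by (simp add: vec_eq_iff forall_2)

lemma matmul_nth [simp]: "(M ** N) $ i $ j = M$i$1 * N$1$j + M$i$2 * N$2$j" for M N :: "real^2^2"
  by (simp add: matrix_matrix_mult_def sum_2)

lemma matvec_nth [simp]: "(M *v v) $ i = M$i$1 * v$1 + M$i$2 * v$2" for M :: "real^2^2"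
  by (simp add: matrix_vector_mult_def sum_2)

lemma mat_nth [simp]: "(mat x :: real^2^2) $ 1 $ 1 = x" "(mat x :: real^2^2) $ 1 $ 2 = 0"
  "(mat x :: real^2^2) $ 2 $ 1 = 0" "(mat x :: real^2^2) $ 2 $ 2 = x"
  by (simp_all add: mat_def)

lemma arg_cong4: "a = a' \<Longrightarrow> b = b' \<Longrightarrow> c = c' \<Longrightarrow> d = d' \<Longrightarrow> f a b c d = f a' b' c' d'"
  by simp

text \<open>The quaternion with coordinates \<open>x0, x1, x2, x3\<close> with respect to 1, i, j,
  k.\<close>

definition om :: "real \<Rightarrow> real \<Rightarrow> real \<Rightarrow> real \<Rightarrow> real^2^2" where
  "om x0 x1 x2 x3 = mat2 (x0 + x2 * sqrt eta) (eta * (x1 - x3 * sqrt eta)) (x1 + x3 * sqrt eta) (x0 - x2 * sqrt eta)"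

lemma om_mult: "om x0 x1 x2 x3 ** om y0 y1 y2 y3 =
   om (x0*y0 + eta*x1*y1 + eta*x2*y2 - eta^2*x3*y3) (x0*y1 + x1*y0 - eta*x2*y3 + eta*x3*y2)
      (x0*y2 + x2*y0 + eta*x1*y3 - eta*x3*y1) (x0*y3 + x3*y0 + x1*y2 - x2*y1)"
proof -
  \<comment> \<open>For an abstract square root s of \<open>eta\<close> the four entries are
    polynomial identities.\<close>
  have *: "(x0 + x2 * s) * (y0 + y2 * s) + (eta * (x1 - x3 * s)) * (y1 + y3 * s) =
     (x0*y0 + eta*x1*y1 + eta*x2*y2 - eta^2*x3*y3) + (x0*y2 + x2*y0 + eta*x1*y3 - eta*x3*y1) * s"
   "(x0 + x2 * s) * (eta * (y1 - y3 * s)) + (eta * (x1 - x3 * s)) * (y0 - y2 * s) =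
     eta * ((x0*y1 + x1*y0 - eta*x2*y3 + eta*x3*y2) - (x0*y3 + x3*y0 + x1*y2 - x2*y1) * s)"
   "(x1 + x3 * s) * (y0 + y2 * s) + (x0 - x2 * s) * (y1 + y3 * s) =
     (x0*y1 + x1*y0 - eta*x2*y3 + eta*x3*y2) + (x0*y3 + x3*y0 + x1*y2 - x2*y1) * s"
   "(x1 + x3 * s) * (eta * (y1 - y3 * s)) + (x0 - x2 * s) * (y0 - y2 * s) =
     (x0*y0 + eta*x1*y1 + eta*x2*y2 - eta^2*x3*y3) - (x0*y2 + x2*y0 + eta*x1*y3 - eta*x3*y1) * s"
    if "s * s = eta" for s
    unfolding that[symmetric] by algebra+
  show ?thesis unfolding om_def
    by (rule mat2_eqI) (simp_all only: matmul_nth mat2_nth * [OF sqrt_eta_sq(1)])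
qed

lemma om_det: "det (om x0 x1 x2 x3) = x0^2 - eta * x1^2 - eta * x2^2 + eta^2 * x3^2"
proof -
  have "(x0 + x2 * s) * (x0 - x2 * s) - (eta * (x1 - x3 * s)) * (x1 + x3 * s)
     = x0^2 - eta * x1^2 - eta * x2^2 + eta^2 * x3^2" if "s * s = eta" for s
    unfolding that[symmetric] by algebra
  from this[OF sqrt_eta_sq(1)] show ?thesis unfolding om_def det_2 mat2_nth .
qed

lemma om_add: "om x0 x1 x2 x3 + om y0 y1 y2 y3 = om (x0 + y0) (x1 + y1) (x2 + y2) (x3 + y3)"
  and om_diff: "om x0 x1 x2 x3 - om y0 y1 y2 y3 = om (x0 - y0) (x1 - y1) (x2 - y2) (x3 - y3)"
  and om_scaleR: "r *\<^sub>R om x0 x1 x2 x3 = om (r * x0) (r * x1) (r * x2) (r * x3)"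
  by (rule mat2_eqI; simp add: om_def algebra_simps)+

lemma mat_om: "mat x = om x 0 0 0" by (rule mat2_eqI) (simp_all add: om_def)

lemma om_inject:
  assumes "om x0 x1 x2 x3 = om y0 y1 y2 y3"
    and "x0 \<in> field_F" "x1 \<in> field_F" "x2 \<in> field_F" "x3 \<in> field_F"
    and "y0 \<in> field_F" "y1 \<in> field_F" "y2 \<in> field_F" "y3 \<in> field_F"
  shows "x0 = y0 \<and> x1 = y1 \<and> x2 = y2 \<and> x3 = y3"
proof -
  have e: "om x0 x1 x2 x3 $ i $ j = om y0 y1 y2 y3 $ i $ j" for i j using assms(1) by simp
  have "x0 + x2 * sqrt eta = y0 + y2 * sqrt eta" "x1 + x3 * sqrt eta = y1 + y3 * sqrt eta"
    using e[of 1 1] e[of 2 1] by (simp_all add: om_def)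
  hence "x0 - y0 = (y2 - x2) * sqrt eta" "x1 - y1 = (y3 - x3) * sqrt eta"
    unfolding left_diff_distrib by linarith+
  hence "x0 - y0 = 0 \<and> y2 - x2 = 0" "x1 - y1 = 0 \<and> y3 - x3 = 0"
    using assms by (auto dest!: F_sqrt_indep[rotated 2] intro: F_closed(5))
  thus ?thesis by simp
qed

text \<open>As \<open>1 + \<eta> + \<eta>\<^sup>2\<close> has odd norm, the order has a \<open>\<int>[\<eta>]\<close>-basis \<open>1, i, J, iJ\<close> with
  \<open>J = (kt + kk i + j) / 2\<close>, where \<open>J\<^sup>2 = kt J - kn\<close>.\<close>

definition kk :: real where "kk = 1 + eta + eta^2"
definition kt :: real where "kt = 1 + eta^2"
definition kn :: real where "kn = eta^2 - 3 * eta - 1"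

lemma kn_eq: "4 * kn = kt^2 - eta * kk^2 - eta"
  unfolding kn_def kt_def kk_def using eta_cubic by algebra

lemma kZ: "kk \<in> Zring" "kt \<in> Zring" "kn \<in> Zring"
  unfolding kk_def kt_def kn_def by (intro Zring_closed)+

definition ob :: "real \<Rightarrow> real \<Rightarrow> real \<Rightarrow> real \<Rightarrow> real^2^2" where
  "ob a b c d = om ((2*a + kt*c + kk*eta*d)/2) ((2*b + kk*c + kt*d)/2) (c/2) (d/2)"

lemma ob_mult: "ob a b c d ** ob a' b' c' d' =
   ob (a*a' + eta*b*b' + kk*eta*c*b' - kn*c*c' + kt*eta*d*b' + kn*eta*d*d')
      (a*b' + b*a' + kt*c*b' + kn*c*d' + kk*eta*d*b' - kn*d*c')
      (a*c' + c*a' + eta*b*d' + kt*c*c' + kk*eta*c*d' - eta*d*b')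
      (a*d' + d*a' + b*c' - c*b' + kt*d*c' + kk*eta*d*d')"
proof -
  have kn: "kn = (kt^2 - eta * kk^2 - eta)/4" using kn_eq by simp
  show ?thesis unfolding ob_def om_mult
    by (rule arg_cong[where f="\<lambda>(x,y,z,w). om x y z w" and x="(_,_,_,_)" and y="(_,_,_,_)", simplified prod.case])
       (simp add: kn field_simps power2_eq_square; algebra?)
qed

definition Oset :: "(real^2^2) set" where
  "Oset = {M. \<exists>a\<in>Zring. \<exists>b\<in>Zring. \<exists>c\<in>Zring. \<exists>d\<in>Zring. M = ob a b c d}"

lemma Oset_I: "a \<in> Zring \<Longrightarrow> b \<in> Zring \<Longrightarrow> c \<in> Zring \<Longrightarrow> d \<in> Zring \<Longrightarrow> ob a b c d \<in> Oset"
  unfolding Oset_def by blast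

lemma ob_diff: "ob a b c d - ob a' b' c' d' = ob (a - a') (b - b') (c - c') (d - d')"
  unfolding ob_def om_diff by (simp add: diff_divide_distrib[symmetric] algebra_simps)

lemma mat_ob: "mat x = ob x 0 0 0" unfolding ob_def mat_om by simp

lemma mat_subring_Oset: "mat_subring Oset"
  unfolding mat_subring_def
proof (intro conjI ballI)
  show "mat 1 \<in> Oset" unfolding mat_ob by (intro Oset_I Zring_closed)
next
  fix x y assume "x \<in> Oset" "y \<in> Oset"
  then obtain a b c d a' b' c' d' where *: "a \<in> Zring" "b \<in> Zring" "c \<in> Zring" "d \<in> Zring" "x = ob a b c d"
     "a' \<in> Zring" "b' \<in> Zring" "c' \<in> Zring" "d' \<in> Zring" "y = ob a' b' c' d'" unfolding Oset_def by blast
  show "x - y \<in> Oset" unfolding *(5,10) ob_diff using * by (intro Oset_I Zring_closed)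
  show "x ** y \<in> Oset" unfolding *(5,10) ob_mult 
    using *(1-4,6-9) kZ by - (assumption | rule Oset_I Zring_closed)+
qed

lemma order_O_subset: "order_O \<subseteq> Oset"
  unfolding order_O_def mat_adjoin_def
proof (rule hull_minimal[where S = mat_subring, OF _ mat_subring_Oset], safe)
  fix x assume "x \<in> Z_eta"
  thus "mat x \<in> Oset" unfolding mat_ob Z_eta_eq by (intro Oset_I Zring_closed)
next
  have e: "quat_i = ob 0 1 0 0" unfolding quat_i_def ob_def om_def by (simp add: power2_eq_square)
  show "quat_i \<in> Oset" unfolding e by (intro Oset_I Zring_closed)
next
  have e: "quat_j = ob (- kt) (- kk) 2 0" unfolding quat_j_def ob_def om_def by simp
  show "quat_j \<in> Oset" unfolding e using kZ by - (assumption | rule Oset_I Zring_closed)+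
next
  have e: "kk * kt = 1 + 2 * eta + 4 * eta^2" "kk * kk = 2 + 5 * eta + 4 * eta^2"
    unfolding kk_def kt_def using eta_cubic by algebra+
  \<comment> \<open>As j = 2 J - kt - kk i, the generator is kk J + (1 - kk kt)/2 + ((eta - kk^2)/2)
    i, and \<open>e\<close> shows that both fractions are integral.\<close>
  have "(1/2) *\<^sub>R (mat 1 + eta *\<^sub>R quat_i + (1 + eta + eta^2) *\<^sub>R quat_j)
      = ob (- eta - 2 * eta^2) (- 1 - 2 * eta - 2 * eta^2) kk 0"
    unfolding kk_def[symmetric] ob_def using e by (intro mat2_eqI) (simp_all add: om_def quat_i_def quat_j_def field_simps)
  moreover have "\<dots> \<in> Oset" using kZ by - (assumption | rule Oset_I Zring_closed)+
  ultimately show "(1/2) *\<^sub>R (mat 1 + eta *\<^sub>R quat_i + (1 + eta + eta^2) *\<^sub>R quat_j) \<in> Oset" by simp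
qed

lemma order_O_om: assumes "M \<in> order_O"
  obtains x0 x1 x2 x3 where "x0 \<in> Zring" "x1 \<in> Zring" "x2 \<in> Zring" "x3 \<in> Zring"
    "M = om (x0/2) (x1/2) (x2/2) (x3/2)"
proof -
  obtain a b c d where *: "a \<in> Zring" "b \<in> Zring" "c \<in> Zring" "d \<in> Zring" "M = ob a b c d"
    using assms order_O_subset unfolding Oset_def by blast
  have "2*a + kt*c + kk*eta*d \<in> Zring" "2*b + kk*c + kt*d \<in> Zring"
    using * kZ by - (assumption | rule Zring_closed)+
  thus thesis using that * unfolding ob_def by blast
qed

section \<open>The order as a ring and its elements of norm one\<close>

lemma mat_subring_order_O: "mat_subring order_O"
  unfolding order_O_def mat_adjoin_def by (rule hull_in) (auto simp: mat_subring_def)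

lemma mat_subring_closed: assumes "mat_subring S"
  shows "mat 1 \<in> S" "x \<in> S \<Longrightarrow> y \<in> S \<Longrightarrow> x - y \<in> S" "x \<in> S \<Longrightarrow> y \<in> S \<Longrightarrow> x ** y \<in> S"
    "x \<in> S \<Longrightarrow> y \<in> S \<Longrightarrow> x + y \<in> S" "x \<in> S \<Longrightarrow> - x \<in> S"
proof -
  show 1: "mat 1 \<in> S" and d: "\<And>x y. x \<in> S \<Longrightarrow> y \<in> S \<Longrightarrow> x - y \<in> S" and "x \<in> S \<Longrightarrow> y \<in> S \<Longrightarrow> x ** y \<in> S"
    using assms unfolding mat_subring_def by blast+
  have z: "0 \<in> S" using d[OF 1 1] by simp
  show m: "x \<in> S \<Longrightarrow> - x \<in> S" for x using d[OF z, of x] by simp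
  show "x \<in> S \<Longrightarrow> y \<in> S \<Longrightarrow> x + y \<in> S" using d[of x "- y"] m[of y] by simp
qed

lemmas O_closed = mat_subring_closed[OF mat_subring_order_O]

lemma O_generators: "x \<in> Zring \<Longrightarrow> mat x \<in> order_O" "quat_i \<in> order_O" "quat_j \<in> order_O"
  "(1/2) *\<^sub>R (mat 1 + eta *\<^sub>R quat_i + (1 + eta + eta^2) *\<^sub>R quat_j) \<in> order_O"
  unfolding order_O_def mat_adjoin_def Z_eta_eq
  by (rule set_mp[OF hull_subset], blast)+

lemma mat_mult_scaleR: "mat x ** M = x *\<^sub>R M" for M :: "real^2^2"
  by (rule mat2_eqI) simp_all

lemma O_scaleR: "x \<in> Zring \<Longrightarrow> M \<in> order_O \<Longrightarrow> x *\<^sub>R M \<in> order_O"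
  using O_closed(3)[OF O_generators(1)] by (simp add: mat_mult_scaleR)

lemma om_basis: "om x0 x1 x2 x3 = mat x0 + x1 *\<^sub>R quat_i + x2 *\<^sub>R quat_j + x3 *\<^sub>R (quat_i ** quat_j)"
  by (rule mat2_eqI) (simp_all add: om_def quat_i_def quat_j_def algebra_simps)

lemma om_in_O: "x0 \<in> Zring \<Longrightarrow> x1 \<in> Zring \<Longrightarrow> x2 \<in> Zring \<Longrightarrow> x3 \<in> Zring \<Longrightarrow> om x0 x1 x2 x3 \<in> order_O"
  unfolding om_basis by (intro O_closed(4) O_scaleR O_closed(3) O_generators)

text \<open>Trace minus \<open>M\<close> is the quaternion conjugate, which is the adjugate matrix;
  it stays in the order because the reduced trace is the integral coordinate
  \<open>x0\<close>.\<close>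

lemma adj_O: assumes "M \<in> order_O"
  shows "mat (M$1$1 + M$2$2) - M \<in> order_O"
proof -
  obtain x0 x1 x2 x3 where x: "x0 \<in> Zring" "x1 \<in> Zring" "x2 \<in> Zring" "x3 \<in> Zring"
    "M = om (x0/2) (x1/2) (x2/2) (x3/2)" using order_O_om assms by blast
  have "M$1$1 + M$2$2 = x0" unfolding x by (simp add: om_def)
  thus ?thesis using x(1) assms by (auto intro: O_closed O_generators)
qed

lemma adj_mult: "M ** (mat (M$1$1 + M$2$2) - M) = mat (det M)" "(mat (M$1$1 + M$2$2) - M) ** M = mat (det M)"
  for M :: "real^2^2"
  by (rule mat2_eqI; simp add: det_2 algebra_simps)+

text \<open>For determinant one the quaternion conjugate is the inverse, and it lies in the order by
  \<open>adj_O\<close>.\<close>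

lemma Delta_eq: "Delta237 = {M \<in> order_O. det M = 1}"
proof -
  have "M \<in> mat_units order_O" if "M \<in> order_O" "det M = 1" for M
    using adj_mult[of M] adj_O that unfolding mat_units_def by force
  thus ?thesis unfolding Delta237_def mat_units_def by blast
qed

lemma matrix_inv_unique: assumes "M ** N = mat 1" "N ** M = mat 1" shows "matrix_inv M = (N::real^2^2)"
proof -
  have "invertible M" using assms unfolding invertible_def by blast
  hence "M ** matrix_inv M = mat 1 \<and> matrix_inv M ** M = mat 1" unfolding invertible_def matrix_inv_def by (rule someI_ex)
  hence "N ** (M ** matrix_inv M) = N" by simp
  thus ?thesis using assms by (simp add: matrix_mul_assoc)
qed

lemma matrix_inv_det1: "det M = 1 \<Longrightarrow> matrix_inv M = mat (M$1$1 + M$2$2) - (M::real^2^2)"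
  by (rule matrix_inv_unique) (simp_all add: adj_mult)

lemma matrix_inv_mult_det1: assumes "det M = 1"
  shows "M ** matrix_inv M = mat 1" "matrix_inv M ** M = (mat 1 :: real^2^2)"
  using adj_mult[of M] assms by (simp_all add: matrix_inv_det1)

lemma Delta_det: "M \<in> Delta237 \<Longrightarrow> det M = 1" unfolding Delta_eq by blast

lemma Delta_mult: "M \<in> Delta237 \<Longrightarrow> N \<in> Delta237 \<Longrightarrow> M ** N \<in> Delta237"
  unfolding Delta_eq by (auto simp: det_mul intro: O_closed)

lemma det_minus2: "det (- M) = det M" for M :: "real^2^2" by (simp add: det_2)

lemma Delta_inv: "M \<in> Delta237 \<Longrightarrow> matrix_inv M \<in> Delta237"
  using adj_O[of M] unfolding Delta_eq by (auto simp: matrix_inv_det1 det_2 algebra_simps)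

lemma Delta_minus: "M \<in> Delta237 \<Longrightarrow> - M \<in> Delta237"
  unfolding Delta_eq by (auto simp: det_minus2 intro: O_closed)

lemma Delta_1: "mat 1 \<in> Delta237" unfolding Delta_eq by (auto intro: O_closed)

lemma inv_eta: "1 / eta = eta^2 + eta - 2"
  using eta_cubic by (simp add: field_simps power2_eq_square power3_eq_cube)

lemma g2_Delta: "g2 \<in> Delta237"
proof -
  have e: "g2 = om 0 0 0 (eta^2 + eta - 2)"
    unfolding g2_def om_def inv_eta[symmetric] by (rule mat2_eqI) (simp_all add: field_simps)
  have "g2 \<in> order_O" unfolding e by (intro om_in_O Zring_closed)
  moreover have "det g2 = 1" by (simp add: det_2 g2_def)
  ultimately show ?thesis unfolding Delta_eq by blast
qed

lemma g7_om: "g7 = om ((eta^2 + eta - 1)/2) ((2 - eta^2)/2) 0 ((eta^2 + eta - 2)/2)"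
proof -
  have "eta * (2 - eta^2) = eta^2 - 1" "eta * (eta^2 + eta - 2) = 1" using eta_cubic by algebra+
  hence "eta * ((2 - eta^2)/2 - (eta^2 + eta - 2)/2 * s) = (eta^2 - 1 - s)/2" for s by algebra
  thus ?thesis unfolding g7_def om_def by (intro mat2_eqI) simp_all
qed

lemma g7_Delta: "g7 \<in> Delta237"
proof -
  have e4: "eta^2 * eta^2 = 3*eta^2 - eta - 1" "eta^2 * kk = eta + 3*eta^2" unfolding kk_def using eta_cubic by algebra+
  let ?J = "(1/2) *\<^sub>R (mat 1 + eta *\<^sub>R quat_i + kk *\<^sub>R quat_j)"
  have J: "?J = om (1/2) (eta/2) (kk/2) 0"
    by (intro mat2_eqI) (simp_all add: om_def quat_i_def quat_j_def field_simps)
  have i: "quat_i = om 0 1 0 0" by (intro mat2_eqI) (simp_all add: om_def quat_i_def)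
  \<comment> \<open>The halves in the coordinates of \<open>g7\<close> are, up to integral elements,
    those of \<open>eta^2\<close> times the product of \<open>quat_i\<close> with the third
    generator.\<close>
  have "g7 = om (eta - eta^2) (1 - eta^2) 0 (- 1 - eta^2) + eta^2 *\<^sub>R (quat_i ** ?J)"
    unfolding J unfolding g7_om i om_mult om_scaleR om_add using e4
    by (intro arg_cong4[of _ _ _ _ _ _ _ _ om]) (simp_all add: field_simps power2_eq_square)
  moreover have "\<dots> \<in> order_O"
    unfolding kk_def by (intro O_closed(4) om_in_O O_scaleR O_closed(3) O_generators Zring_closed)
  ultimately have "g7 \<in> order_O" by simp
  moreover have "(eta^2 + eta - 1)^2 - eta * (2 - eta^2)^2 + eta^2 * (eta^2 + eta - 2)^2 = 4" using eta_cubic by algebra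
  hence "det g7 = 1" unfolding g7_om om_det by (simp add: power_divide)
  ultimately show ?thesis unfolding Delta_eq by blast
qed

lemma mpow_Delta: "M \<in> Delta237 \<Longrightarrow> mpow M n \<in> Delta237"
  by (induction n) (auto intro: Delta_1 Delta_mult)

lemma cf_A_Delta: "cf_A j \<in> Delta237"
  unfolding cf_A_def by (intro Delta_mult mpow_Delta g2_Delta g7_Delta)

section \<open>Definiteness at the other two real places\<close>

text \<open>Conjugates of the norm equation. With the negative numbers \<open>eta2\<close> and
  \<open>eta3\<close> in place of \<open>eta\<close>, the left-hand sides are positive definite, so
  by \<open>definite_bound\<close> the norm alone bounds all coordinates at these two
  places.\<close>

lemma definite_forms:
  assumes "zrel x0 y0 z0" "zrel x1 y1 z1" "zrel x2 y2 z2" "zrel x3 y3 z3"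
    and "zrel d d' d''" and "x0^2 - eta * x1^2 - eta * x2^2 + eta^2 * x3^2 = d"
  shows "y0^2 - eta2 * y1^2 - eta2 * y2^2 + eta2^2 * y3^2 = d'"
    "z0^2 - eta3 * z1^2 - eta3 * z2^2 + eta3^2 * z3^2 = d''"
proof -
  have "zrel (x0^2 - eta * x1^2 - eta * x2^2 + eta^2 * x3^2) (y0^2 - eta2 * y1^2 - eta2 * y2^2 + eta2^2 * y3^2)
     (z0^2 - eta3 * z1^2 - eta3 * z2^2 + eta3^2 * z3^2)"
    by (intro zrel_diff zrel_add zrel_mult zrel_power zrel_eta assms)
  from zrel_unique[OF this[unfolded assms(6)] assms(5)]
  show "y0^2 - eta2 * y1^2 - eta2 * y2^2 + eta2^2 * y3^2 = d'"
    "z0^2 - eta3 * z1^2 - eta3 * z2^2 + eta3^2 * z3^2 = d''" by auto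
qed

lemma definite_bound:
  assumes "e < (0::real)" "y0^2 - e * y1^2 - e * y2^2 + e^2 * y3^2 = d"
  shows "y0^2 \<le> d" "- e * y1^2 \<le> d" "- e * y2^2 \<le> d" "e^2 * y3^2 \<le> d"
proof -
  have "- e * y1^2 \<ge> 0" "- e * y2^2 \<ge> 0" "e^2 * y3^2 \<ge> 0" "y0^2 \<ge> 0"
    using assms(1) by (simp_all add: mult_nonneg_nonneg mult_nonpos_nonneg)
  thus "y0^2 \<le> d" "- e * y1^2 \<le> d" "- e * y2^2 \<le> d" "e^2 * y3^2 \<le> d" using assms(2) by linarith+
qed

text \<open>At a definite place norm zero forces every coordinate to vanish: the algebra is a
  division algebra.\<close>

lemma O_division: assumes "M \<in> order_O" "det M = 0" shows "M = 0"
proof -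
  obtain x0 x1 x2 x3 where x: "x0 \<in> Zring" "x1 \<in> Zring" "x2 \<in> Zring" "x3 \<in> Zring"
    "M = om (x0/2) (x1/2) (x2/2) (x3/2)" using order_O_om assms(1) by blast
  obtain y0 z0 y1 z1 y2 z2 y3 z3 where z: "zrel x0 y0 z0" "zrel x1 y1 z1" "zrel x2 y2 z2" "zrel x3 y3 z3"
    using x ZringE by metis
  have "x0^2 - eta * x1^2 - eta * x2^2 + eta^2 * x3^2 = 0"
    using assms(2) unfolding x om_det by (simp add: field_simps)
  from definite_forms(1)[OF z zrel_0 this] have "y0^2 - eta2 * y1^2 - eta2 * y2^2 + eta2^2 * y3^2 = 0" .
  from definite_bound[OF eta23_neg(1) this] have "y0 = 0 \<and> y1 = 0 \<and> y2 = 0 \<and> y3 = 0"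
    using eta23_neg by (auto simp: mult_le_0_iff zero_le_mult_iff)
  hence "x0 = 0 \<and> x1 = 0 \<and> x2 = 0 \<and> x3 = 0" using z zrel_zero2 by blast
  thus ?thesis unfolding x by (intro mat2_eqI) (simp_all add: om_def)
qed

text \<open>In doubled coordinates the norm form takes the value 4, and at a definite place the
  square of the conjugate trace is one of its nonnegative terms.\<close>

lemma Delta_trace: assumes "M \<in> Delta237"
  shows "\<exists>y z. zrel (M$1$1 + M$2$2) y z \<and> \<bar>y\<bar> \<le> 2 \<and> \<bar>z\<bar> \<le> 2"
proof -
  have M: "M \<in> order_O" "det M = 1" using assms unfolding Delta_eq by auto
  obtain x0 x1 x2 x3 where x: "x0 \<in> Zring" "x1 \<in> Zring" "x2 \<in> Zring" "x3 \<in> Zring"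
    "M = om (x0/2) (x1/2) (x2/2) (x3/2)" using order_O_om M(1) by blast
  obtain y0 z0 y1 z1 y2 z2 y3 z3 where z: "zrel x0 y0 z0" "zrel x1 y1 z1" "zrel x2 y2 z2" "zrel x3 y3 z3"
    using x ZringE by metis
  have "x0^2 - eta * x1^2 - eta * x2^2 + eta^2 * x3^2 = 4"
    using M(2) unfolding x om_det by (simp add: field_simps)
  from definite_forms[OF z zrel_numeral this]
  have "y0^2 - eta2 * y1^2 - eta2 * y2^2 + eta2^2 * y3^2 = 4" "z0^2 - eta3 * z1^2 - eta3 * z2^2 + eta3^2 * z3^2 = 4" .
  from definite_bound(1)[OF eta23_neg(1) this(1)] definite_bound(1)[OF eta23_neg(2) this(2)]
  have "y0^2 \<le> 2^2" "z0^2 \<le> 2^2" by simp_all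
  hence "\<bar>y0\<bar> \<le> 2" "\<bar>z0\<bar> \<le> 2" by (simp_all only: abs_le_square_iff[symmetric] abs_numeral)
  moreover have "M$1$1 + M$2$2 = x0" unfolding x by (simp add: om_def)
  ultimately show ?thesis using z(1) by auto
qed

lemma finite_zrel: "finite {x. \<exists>y z. zrel x y z \<and> \<bar>x\<bar> \<le> C \<and> \<bar>y\<bar> \<le> C \<and> \<bar>z\<bar> \<le> C}"
proof (rule finite_subset)
  \<comment> \<open>The traces of x, eta x and eta^2 x are at most 12 C. The trace form in the basis
    1, eta, eta^2 has determinant 49, and 100 is a generous constant for inverting it.\<close>
  let ?N = "\<lceil>100 * C\<rceil>"
  let ?f = "\<lambda>(a::int, b::int, c::int). real_of_int a + of_int b * eta + of_int c * eta^2"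
  show "finite (?f ` ({-?N..?N} \<times> {-?N..?N} \<times> {-?N..?N}))" by (intro finite_imageI finite_cartesian_product) auto
  show "{x. \<exists>y z. zrel x y z \<and> \<bar>x\<bar> \<le> C \<and> \<bar>y\<bar> \<le> C \<and> \<bar>z\<bar> \<le> C} \<subseteq> ?f ` ({-?N..?N} \<times> {-?N..?N} \<times> {-?N..?N})"
  proof safe
    fix x y z assume z: "zrel x y z" and b: "\<bar>x\<bar> \<le> C" "\<bar>y\<bar> \<le> C" "\<bar>z\<bar> \<le> C"
    obtain a b c :: int where 1: "x = a + b * eta + c * eta^2" "y = a + b * eta2 + c * eta2^2" "z = a + b * eta3 + c * eta3^2"
      using z unfolding zrel_def by blast
    have C: "C \<ge> 0" using b by linarith
    have m: "\<bar>u * v\<bar> \<le> 4 * C" if "\<bar>u\<bar> \<le> 4" "\<bar>v\<bar> \<le> C" for u v :: real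
      unfolding abs_mult using that by (intro mult_mono) auto
    have E: "\<bar>eta\<bar> \<le> 4" "\<bar>eta2\<bar> \<le> 4" "\<bar>eta3\<bar> \<le> 4" "\<bar>eta^2\<bar> \<le> 4" "\<bar>eta2^2\<bar> \<le> 4" "\<bar>eta3^2\<bar> \<le> 4"
      using eta_bounds eta2_bounds eta3_bounds eta_sq_bounds unfolding eta2_sq eta3_sq by auto
    have gen: "(a + b * e + c * e^2) + (a + b * (e^2 - 2) + c * (e^2 - 2)^2) + (a + b * (1 - e - e^2) + c * (1 - e - e^2)^2)
        = 3*a - b + 5*c"
      "e * (a + b * e + c * e^2) + (e^2 - 2) * (a + b * (e^2 - 2) + c * (e^2 - 2)^2) + (1 - e - e^2) * (a + b * (1 - e - e^2) + c * (1 - e - e^2)^2)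
        = - a + 5*b - 4*c"
      "e^2 * (a + b * e + c * e^2) + (e^2 - 2)^2 * (a + b * (e^2 - 2) + c * (e^2 - 2)^2) + (1 - e - e^2)^2 * (a + b * (1 - e - e^2) + c * (1 - e - e^2)^2)
        = 5*a - 4*b + 13*c"
      if "e^3 = 1 + 2 * e - e^2" for a b c e :: real
      using that by algebra+
    have "x + y + z = 3*a - b + 5*c" "eta * x + eta2 * y + eta3 * z = - a + 5*b - 4*c"
      "eta^2 * x + eta2^2 * y + eta3^2 * z = 5*a - 4*b + 13*c"
      unfolding 1 unfolding eta2_def eta3_def gen[OF eta_cubic] by simp_all
    moreover have "\<bar>x + y + z\<bar> \<le> 12 * C" using b C by linarith
    moreover have "\<bar>eta * x + eta2 * y + eta3 * z\<bar> \<le> 12 * C"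
      using m[OF E(1) b(1)] m[OF E(2) b(2)] m[OF E(3) b(3)] by linarith
    moreover have "\<bar>eta^2 * x + eta2^2 * y + eta3^2 * z\<bar> \<le> 12 * C"
      using m[OF E(4) b(1)] m[OF E(5) b(2)] m[OF E(6) b(3)] by linarith
    ultimately have "3*a - b + 5*c \<le> 12 * C" "- (12 * C) \<le> 3*a - b + 5*c" 
      "- a + 5*b - 4*c \<le> 12 * C" "- (12 * C) \<le> - a + 5*b - 4*c"
      "5*a - 4*b + 13*c \<le> 12 * C" "- (12 * C) \<le> 5*a - 4*b + 13*c"
      by (simp_all only: abs_le_iff) linarith+
    hence "real_of_int a \<le> 100 * C" "- real_of_int a \<le> 100 * C" "real_of_int b \<le> 100 * C" "- real_of_int b \<le> 100 * C"
      "real_of_int c \<le> 100 * C" "- real_of_int c \<le> 100 * C"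
      using C by linarith+
    hence "a \<in> {-?N..?N}" "b \<in> {-?N..?N}" "c \<in> {-?N..?N}" by (auto, linarith+)
    thus "x \<in> ?f ` ({-?N..?N} \<times> {-?N..?N} \<times> {-?N..?N})" unfolding 1(1) by (intro image_eqI[of _ _ "(a, b, c)"]) auto
  qed
qed

text \<open>Discreteness: the matrix entries bound the coordinates at the first place, the
  determinant bounds them at the two definite places. The determinant is left arbitrary because the
  lemma is applied both to the group and to the conjugates of a quadratic element.\<close>

lemma O_finite: "finite {M \<in> order_O. det M = d \<and> (\<forall>i j. \<bar>M$i$j\<bar> \<le> R)}"
proof (cases "\<exists>M. M \<in> order_O \<and> det M = d")
  case False
  hence e: "{M \<in> order_O. det M = d \<and> (\<forall>i j. \<bar>M$i$j\<bar> \<le> R)} = {}" by blast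
  show ?thesis unfolding e by simp
next
  case True
  have "4 * d \<in> Zring"
  proof -
    obtain M where M: "M \<in> order_O" "det M = d" using True by blast
    obtain x0 x1 x2 x3 where x: "x0 \<in> Zring" "x1 \<in> Zring" "x2 \<in> Zring" "x3 \<in> Zring"
      "M = om (x0/2) (x1/2) (x2/2) (x3/2)" using order_O_om M(1) by blast
    have "x0^2 - eta * x1^2 - eta * x2^2 + eta^2 * x3^2 = 4 * d"
      using M(2) unfolding x om_det by (simp add: field_simps)
    moreover have "x0^2 - eta * x1^2 - eta * x2^2 + eta^2 * x3^2 \<in> Zring" 
      using x(1-4) by - (assumption | rule Zring_closed)+
    ultimately show ?thesis by simp
  qed
  then obtain d' d'' where d: "zrel (4 * d) d' d''" using ZringE by blast
  define C where "C = 2 * \<bar>R\<bar> + (1 + \<bar>d'\<bar> * 6) + (1 + \<bar>d''\<bar> * 6)"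
  let ?S = "{x. \<exists>y z. zrel x y z \<and> \<bar>x\<bar> \<le> C \<and> \<bar>y\<bar> \<le> C \<and> \<bar>z\<bar> \<le> C}"
  let ?f = "\<lambda>(x0, x1, x2, x3). om (x0/2) (x1/2) (x2/2) (x3/2)"
  show ?thesis
  proof (rule finite_subset)
    show "finite (?f ` (?S \<times> ?S \<times> ?S \<times> ?S))" by (intro finite_imageI finite_cartesian_product finite_zrel)
    show "{M \<in> order_O. det M = d \<and> (\<forall>i j. \<bar>M$i$j\<bar> \<le> R)} \<subseteq> ?f ` (?S \<times> ?S \<times> ?S \<times> ?S)"
    proof safe
      fix M assume M: "M \<in> order_O" "d = det M" "\<forall>i j. \<bar>M$i$j\<bar> \<le> R"
      obtain x0 x1 x2 x3 where x: "x0 \<in> Zring" "x1 \<in> Zring" "x2 \<in> Zring" "x3 \<in> Zring"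
        "M = om (x0/2) (x1/2) (x2/2) (x3/2)" using order_O_om M(1) by blast
      obtain y0 z0 y1 z1 y2 z2 y3 z3 where z: "zrel x0 y0 z0" "zrel x1 y1 z1" "zrel x2 y2 z2" "zrel x3 y3 z3"
        using x ZringE by metis
      have "x0^2 - eta * x1^2 - eta * x2^2 + eta^2 * x3^2 = 4 * d"
        unfolding M(2) x om_det by (simp add: field_simps)
      from definite_forms[OF z d this]
      have Y: "y0^2 - eta2 * y1^2 - eta2 * y2^2 + eta2^2 * y3^2 = d'" and Z: "z0^2 - eta3 * z1^2 - eta3 * z2^2 + eta3^2 * z3^2 = d''" .
      \<comment> \<open>All coefficients of the definite forms are at least 1/6; the smallest one is
        \<open>eta2^2\<close>, about 0.198.\<close>
      have sq: "\<bar>y\<bar> \<le> 1 + \<bar>b\<bar> * 6" if "a * y^2 \<le> b" "a \<ge> 1/6" for a b y :: real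
      proof -
        have "y^2 * (1/6) \<le> y^2 * a" using that by (intro mult_left_mono) auto
        hence "y^2 \<le> \<bar>b\<bar> * 6" using that by (simp add: mult.commute)
        also have "\<dots> \<le> (1 + \<bar>b\<bar> * 6)^2" by (simp add: power2_eq_square algebra_simps)
        finally have "\<bar>y\<bar>^2 \<le> (1 + \<bar>b\<bar> * 6)^2" by simp
        thus ?thesis by (rule power2_le_imp_le) simp
      qed
      have e2: "1/6 \<le> - eta2" "1/6 \<le> - eta3" "1/6 \<le> eta2^2" "1/6 \<le> eta3^2" 
        using eta2_bounds eta3_bounds eta_bounds unfolding eta2_sq eta3_sq by auto
      have yb: "\<bar>y0\<bar> \<le> 1 + \<bar>d'\<bar> * 6" "\<bar>y1\<bar> \<le> 1 + \<bar>d'\<bar> * 6" "\<bar>y2\<bar> \<le> 1 + \<bar>d'\<bar> * 6" "\<bar>y3\<bar> \<le> 1 + \<bar>d'\<bar> * 6"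
        using definite_bound[OF eta23_neg(1) Y] e2 sq[of 1 y0] sq[of "- eta2"] sq[of "eta2^2"] by auto
      have zb: "\<bar>z0\<bar> \<le> 1 + \<bar>d''\<bar> * 6" "\<bar>z1\<bar> \<le> 1 + \<bar>d''\<bar> * 6" "\<bar>z2\<bar> \<le> 1 + \<bar>d''\<bar> * 6" "\<bar>z3\<bar> \<le> 1 + \<bar>d''\<bar> * 6"
        using definite_bound[OF eta23_neg(2) Z] e2 sq[of 1 z0] sq[of "- eta3"] sq[of "eta3^2"] by auto
      define m where "m = M"
      have "x0 = m$1$1 + m$2$2" "sqrt eta * x2 = m$1$1 - m$2$2" "eta * x1 = eta * m$2$1 + m$1$2"
        "eta * sqrt eta * x3 = eta * m$2$1 - m$1$2"
        unfolding m_def x by (simp_all add: om_def algebra_simps)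
      moreover have mb: "\<bar>m$i$j\<bar> \<le> \<bar>R\<bar>" for i j using M(3) unfolding m_def by (meson abs_ge_self order_trans)
      ultimately have "\<bar>x0\<bar> \<le> 2 * \<bar>R\<bar>" "\<bar>sqrt eta * x2\<bar> \<le> 2 * \<bar>R\<bar>" 
        using mb[of 1 1] mb[of 2 2] by linarith+
      have em: "\<bar>eta * m$2$1\<bar> \<le> eta * \<bar>R\<bar>" "\<bar>m$1$2\<bar> \<le> eta * \<bar>R\<bar>"
        using mb[of 2 1] mb[of 1 2] eta_gt_1 mult_right_mono[of 1 eta "\<bar>R\<bar>"] by (auto simp: abs_mult)
      have "\<bar>eta * x1\<bar> \<le> eta * (2 * \<bar>R\<bar>)" "\<bar>eta * sqrt eta * x3\<bar> \<le> eta * (2 * \<bar>R\<bar>)"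
        using em \<open>eta * x1 = eta * m$2$1 + m$1$2\<close> \<open>eta * sqrt eta * x3 = eta * m$2$1 - m$1$2\<close> by linarith+
      hence "\<bar>x1\<bar> \<le> 2 * \<bar>R\<bar>" "\<bar>sqrt eta * x3\<bar> \<le> 2 * \<bar>R\<bar>" by (simp_all add: abs_mult)
      have sx: "\<bar>x\<bar> \<le> 2 * \<bar>R\<bar>" if "\<bar>sqrt eta * x\<bar> \<le> 2 * \<bar>R\<bar>" for x
      proof -
        have "1 * \<bar>x\<bar> \<le> sqrt eta * \<bar>x\<bar>" using eta_gt_1 by (intro mult_right_mono) auto
        thus ?thesis using that by (simp add: abs_mult abs_of_pos[OF sqrt_eta_pos(1)])
      qed
      have xb: "\<bar>x0\<bar> \<le> 2 * \<bar>R\<bar>" "\<bar>x1\<bar> \<le> 2 * \<bar>R\<bar>" "\<bar>x2\<bar> \<le> 2 * \<bar>R\<bar>" "\<bar>x3\<bar> \<le> 2 * \<bar>R\<bar>"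
        using \<open>\<bar>x0\<bar> \<le> 2 * \<bar>R\<bar>\<close> \<open>\<bar>x1\<bar> \<le> 2 * \<bar>R\<bar>\<close> sx[OF \<open>\<bar>sqrt eta * x2\<bar> \<le> 2 * \<bar>R\<bar>\<close>] sx[OF \<open>\<bar>sqrt eta * x3\<bar> \<le> 2 * \<bar>R\<bar>\<close>]
        by blast+
      have S: "x \<in> ?S" if "zrel x y z" "\<bar>x\<bar> \<le> 2 * \<bar>R\<bar>" "\<bar>y\<bar> \<le> 1 + \<bar>d'\<bar> * 6" "\<bar>z\<bar> \<le> 1 + \<bar>d''\<bar> * 6" for x y z
      proof -
        have "\<bar>x\<bar> \<le> C" "\<bar>y\<bar> \<le> C" "\<bar>z\<bar> \<le> C" using that unfolding C_def by linarith+
        thus ?thesis using that(1) by blast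
      qed
      have "x0 \<in> ?S" "x1 \<in> ?S" "x2 \<in> ?S" "x3 \<in> ?S"
        using S[OF z(1) xb(1) yb(1) zb(1)] S[OF z(2) xb(2) yb(2) zb(2)] S[OF z(3) xb(3) yb(3) zb(3)] S[OF z(4) xb(4) yb(4) zb(4)]
        by blast+
      thus "M \<in> ?f ` (?S \<times> ?S \<times> ?S \<times> ?S)" unfolding x(5)
        by (intro image_eqI[of _ _ "(x0, x1, x2, x3)"]) auto
    qed
  qed
qed

section \<open>The Klein model centred at the fixed point of \<open>g7\<close>\<close>

text \<open>\<open>hh\<close> is the Euclidean inradius of the heptagon in the Klein model, and \<open>c0 i = tau7\<close>.\<close>

definition hh :: real where "hh = (2 - eta^2) * sqrt eta"
definition c0 :: real where "c0 = sqrt (eta * (1 - hh) / (1 + hh))"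

lemma hh_sq: "hh^2 = eta - 1"
proof -
  have "(2 - eta^2)^2 * eta = eta - 1" using eta_cubic by algebra
  thus ?thesis unfolding hh_def power_mult_distrib sqrt_eta_sq .
qed

lemma hh_bounds: "0 < hh" "hh < 1"
proof -
  show "0 < hh" unfolding hh_def using eta_sq_bounds by simp
  show "hh < 1" using hh_sq eta_bounds by (intro power2_less_imp_less[of hh 1]) auto
qed

lemma c0_sq: "c0^2 = eta * (1 - hh) / (1 + hh)"
  unfolding c0_def using hh_bounds eta_gt_1 by (simp add: zero_le_mult_iff)

lemma c0_pos [simp]: "c0 > 0" "c0 \<noteq> 0"
proof -
  show "c0 > 0" unfolding c0_def using hh_bounds eta_gt_1 by simp
  thus "c0 \<noteq> 0" by simp
qed

lemma abs_c0 [simp]: "\<bar>c0\<bar> = c0" using c0_pos(1) by (simp del: c0_pos)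

text \<open>The Beltrami-Klein model of the half plane with the point i \<open>c0\<close> at the
  origin. Geodesics become chords, so hyperbolic segments and hulls become Euclidean ones and edges
  become linear conditions.\<close>

definition kl :: "complex \<Rightarrow> complex" where
  "kl z = Complex (((Re z)^2 + (Im z)^2 - c0^2) / ((Re z)^2 + (Im z)^2 + c0^2))
                  (2 * c0 * Re z / ((Re z)^2 + (Im z)^2 + c0^2))"

lemma kl_denom_pos: "(Re z)^2 + (Im z)^2 + c0^2 > 0"
  by (simp add: add_nonneg_pos)

lemma kl_norm: "1 - kl z \<bullet> kl z = (2 * c0 * Im z / ((Re z)^2 + (Im z)^2 + c0^2))^2"
proof -
  define m where "m = (Re z)^2 + (Im z)^2 + c0^2"
  have m: "m > 0" unfolding m_def by (rule kl_denom_pos)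
  have "kl z \<bullet> kl z = ((m - 2 * c0^2)^2 + (2 * c0 * Re z)^2) / m^2"
    using m unfolding kl_def m_def[symmetric] inner_complex_def 
    by (simp add: m_def power2_eq_square add_divide_distrib)
  hence "1 - kl z \<bullet> kl z = (m^2 - (m - 2 * c0^2)^2 - (2 * c0 * Re z)^2) / m^2"
    using m by (simp add: field_simps)
  also have "m^2 - (m - 2 * c0^2)^2 - (2 * c0 * Re z)^2 = (2 * c0 * Im z)^2" unfolding m_def by algebra
  finally show ?thesis unfolding m_def[symmetric] by (simp add: power_divide)
qed

lemma kl_in_disc: "z \<in> upper_half \<Longrightarrow> kl z \<bullet> kl z < 1"
proof -
  assume "z \<in> upper_half"
  hence "1 - kl z \<bullet> kl z > 0" unfolding kl_norm using kl_denom_pos[of z]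
    by (intro zero_less_power divide_pos_pos mult_pos_pos) (auto simp: upper_half_def)
  thus ?thesis by simp
qed

text \<open>Both sides are the hyperbolic cosine of the distance, in the half plane and in the Klein
  model.\<close>

lemma kl_cosh: assumes "z \<in> upper_half" "w \<in> upper_half"
  shows "1 + (cmod (z - w))^2 / (2 * Im z * Im w) = (1 - kl z \<bullet> kl w) / (sqrt (1 - kl z \<bullet> kl z) * sqrt (1 - kl w \<bullet> kl w))"
proof -
  define m where "m = (Re z)^2 + (Im z)^2 + c0^2"
  define n where "n = (Re w)^2 + (Im w)^2 + c0^2"
  have mn: "m > 0" "n > 0" unfolding m_def n_def by (rule kl_denom_pos)+
  have y: "Im z > 0" "Im w > 0" using assms by (auto simp: upper_half_def)
  have s: "sqrt (1 - kl z \<bullet> kl z) = 2 * c0 * Im z / m" "sqrt (1 - kl w \<bullet> kl w) = 2 * c0 * Im w / n"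
    unfolding kl_norm m_def[symmetric] n_def[symmetric] using y mn by (auto simp: real_sqrt_abs abs_mult)
  have "kl z \<bullet> kl w = ((m - 2 * c0^2) * (n - 2 * c0^2) + 4 * c0^2 * Re z * Re w) / (m * n)"
  proof -
    have "kl z = Complex ((m - 2 * c0^2) / m) (2 * c0 * Re z / m)" "kl w = Complex ((n - 2 * c0^2) / n) (2 * c0 * Re w / n)"
      unfolding kl_def m_def n_def by simp_all
    thus ?thesis unfolding inner_complex_def by (simp add: add_divide_distrib[symmetric] power2_eq_square ac_simps)
  qed
  hence "1 - kl z \<bullet> kl w = (m * n - (m - 2 * c0^2) * (n - 2 * c0^2) - 4 * c0^2 * Re z * Re w) / (m * n)"
    using mn by (simp add: field_simps)
  also have "m * n - (m - 2 * c0^2) * (n - 2 * c0^2) - 4 * c0^2 * Re z * Re w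
     = 2 * c0^2 * (2 * Im z * Im w + ((Re z - Re w)^2 + (Im z - Im w)^2))" unfolding m_def n_def by algebra
  also have "(Re z - Re w)^2 + (Im z - Im w)^2 = (cmod (z - w))^2" by (simp add: cmod_power2)
  finally have k: "1 - kl z \<bullet> kl w = 2 * c0^2 * (2 * Im z * Im w + (cmod (z - w))^2) / (m * n)" .
  show ?thesis unfolding s k using y mn by (simp add: field_simps power2_eq_square)
qed

lemma kl_surj: assumes "P \<bullet> P < (1::real)" shows "\<exists>z\<in>upper_half. kl z = P"
proof -
  define X Y where "X = Re P" and "Y = Im P"
  have d: "X^2 + Y^2 < 1" using assms unfolding X_def Y_def inner_complex_def by (simp add: power2_eq_square)
  hence "X^2 < 1" using zero_le_power2[of Y] by linarith
  hence X: "X < 1" by (simp add: abs_square_less_1)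
  \<comment> \<open>\<open>N\<close> is the value of |z|^2 and \<open>x\<close> the real part that
    result from solving kl z = P.\<close>
  define N where "N = c0^2 * (1 + X) / (1 - X)"
  define x where "x = Y * c0 / (1 - X)"
  have "N - x^2 = c0^2 * (1 - X^2 - Y^2) / (1 - X)^2" 
  proof -
    have "(1 + X) / (1 - X) = (1 - X^2) / (1 - X)^2" 
    proof -
      have "1 - X^2 = (1 + X) * (1 - X)" by algebra
      thus ?thesis using X by (simp add: power2_eq_square)
    qed
    hence "N = c0^2 * (1 - X^2) / (1 - X)^2" unfolding N_def by (simp add: times_divide_eq_right[symmetric] del: times_divide_eq_right)
    thus ?thesis unfolding x_def by (simp add: power_divide power_mult_distrib diff_divide_distrib[symmetric] right_diff_distrib mult.commute)
  qed
  moreover have "\<dots> > 0" using d X by simp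
  ultimately have p: "N - x^2 > 0" by simp
  define z where "z = Complex x (sqrt (N - x^2))"
  have N: "(Re z)^2 + (Im z)^2 = N" using p unfolding z_def by simp
  have "N + c0^2 = 2 * c0^2 / (1 - X)" "N - c0^2 = 2 * c0^2 * X / (1 - X)" unfolding N_def using X by (simp_all add: field_simps)
  hence "kl z = P" unfolding kl_def N using X
    by (simp add: complex_eq_iff X_def[symmetric] Y_def[symmetric] z_def x_def power2_eq_square)
  moreover have "z \<in> upper_half" using p unfolding z_def upper_half_def by simp
  ultimately show ?thesis by blast
qed

lemma kl_inj: assumes "z \<in> upper_half" "w \<in> upper_half" "kl z = kl w" shows "z = w"
proof -
  have "1 + (cmod (z - w))^2 / (2 * Im z * Im w) = (1 - kl z \<bullet> kl z) / (sqrt (1 - kl z \<bullet> kl z) * sqrt (1 - kl z \<bullet> kl z))"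
    using kl_cosh[OF assms(1,2)] unfolding assms(3)[symmetric] .
  also have "\<dots> = 1" using kl_in_disc[OF assms(1)] by simp
  finally show ?thesis using assms by (auto simp: upper_half_def)
qed

text \<open>With \<open>u = P - Z\<close>, \<open>v = Q - Z\<close> and the positive definite form
  \<open>g(u,v) = (1 - \<bar>Z\<bar>\<^sup>2) u\<cdot>v + (Z\<cdot>u)(Z\<cdot>v)\<close>, the triangle equality at \<open>Z\<close> is equality in Cauchy-Schwarz
  for \<open>g\<close>.\<close>

lemma segment_condition:
  fixes P Z Q :: complex
  assumes "P \<bullet> P < 1" "Z \<bullet> Z < 1" "Q \<bullet> Q < 1"
  defines "p \<equiv> 1 - P \<bullet> P" and "z \<equiv> 1 - Z \<bullet> Z" and "q \<equiv> 1 - Q \<bullet> Q"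
    and "a \<equiv> 1 - P \<bullet> Z" and "b \<equiv> 1 - Z \<bullet> Q" and "c \<equiv> 1 - P \<bullet> Q"
  shows "a^2 \<ge> p * z" "b^2 \<ge> z * q" 
    "(c * z \<ge> a * b \<and> (c * z - a * b)^2 = (a^2 - p * z) * (b^2 - z * q)) \<longleftrightarrow> Z \<in> closed_segment P Q"
proof -
  define u v where "u = P - Z" and "v = Q - Z"
  define g where "g = (\<lambda>u v. z * (u \<bullet> v) + (Z \<bullet> u) * (Z \<bullet> v))"
  have z: "z > 0" using assms by simp
  have id1: "a^2 - p * z = g u u" and id2: "b^2 - z * q = g v v" and id3: "c * z - a * b = - g u v"
    unfolding g_def u_def v_def assms(4-9) inner_complex_def by (simp; algebra)+
  have gpos: "g u u \<ge> 0" for u unfolding g_def using z by simp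
  show "a^2 \<ge> p * z" "b^2 \<ge> z * q" using id1 id2 gpos[of u] gpos[of v] by linarith+
  have gram: "g u u * g v v - (g u v)^2 = z * (Re u * Im v - Im u * Re v)^2"
  proof -
    have "g u u * g v v - (g u v)^2 = z * (z + Z \<bullet> Z) * (Re u * Im v - Im u * Re v)^2"
      unfolding g_def inner_complex_def by algebra
    moreover have "z + Z \<bullet> Z = 1" unfolding z_def by simp
    ultimately show ?thesis by simp
  qed
  have "(c * z \<ge> a * b \<and> (c * z - a * b)^2 = (a^2 - p * z) * (b^2 - z * q))
     \<longleftrightarrow> g u v \<le> 0 \<and> Re u * Im v - Im u * Re v = 0"
  proof -
    have "c * z \<ge> a * b \<longleftrightarrow> g u v \<le> 0" using id3 by linarith
    moreover have "(c * z - a * b)^2 = (a^2 - p * z) * (b^2 - z * q) \<longleftrightarrow> z * (Re u * Im v - Im u * Re v)^2 = 0"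
      unfolding id1 id2 id3 gram[symmetric] by auto
    ultimately show ?thesis using z by simp
  qed
  also have "\<dots> \<longleftrightarrow> Z \<in> closed_segment P Q"
  proof
    assume "Z \<in> closed_segment P Q"
    then obtain t where t: "0 \<le> t" "t \<le> 1" "Z = (1 - t) *\<^sub>R P + t *\<^sub>R Q" unfolding in_segment by blast
    have uv: "u = t *\<^sub>R (P - Q)" "v = - (1 - t) *\<^sub>R (P - Q)" unfolding u_def v_def t by (simp_all add: algebra_simps)
    have "g u v = - (t * (1 - t)) * g (P - Q) (P - Q)" unfolding g_def uv by (simp add: algebra_simps)
    moreover have "t * (1 - t) * g (P - Q) (P - Q) \<ge> 0" using t gpos by (intro mult_nonneg_nonneg) auto
    ultimately show "g u v \<le> 0 \<and> Re u * Im v - Im u * Re v = 0" unfolding uv by simp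
  next
    assume c: "g u v \<le> 0 \<and> Re u * Im v - Im u * Re v = 0"
    show "Z \<in> closed_segment P Q"
    proof (cases "u = 0")
      case True thus ?thesis unfolding u_def by simp
    next
      case False
      have "\<exists>l. v = l *\<^sub>R u"
      proof (cases "Re u = 0")
        case True
        hence "Im u \<noteq> 0" "Re v = 0" using False c by (auto simp: complex_eq_iff)
        hence "v = (Im v / Im u) *\<^sub>R u" using True by (simp add: complex_eq_iff)
        thus ?thesis by blast
      next
        case F: False
        hence "v = (Re v / Re u) *\<^sub>R u" using c by (simp add: complex_eq_iff field_simps)
        thus ?thesis by blast
      qed
      then obtain l where l: "v = l *\<^sub>R u" by blast
      have "u \<bullet> u > 0" using False by simp
      hence "g u u > 0" unfolding g_def using z by (simp add: add_pos_nonneg)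
      moreover have "g u v = l * g u u" unfolding g_def l by (simp add: algebra_simps)
      ultimately have l0: "l \<le> 0" using c by (auto simp: mult_le_0_iff)
      have Q: "Q = Z + l *\<^sub>R u" "P = Z + u" using l unfolding u_def v_def by (auto simp: algebra_simps)
      have "Z = (1 - 1 / (1 - l)) *\<^sub>R P + (1 / (1 - l)) *\<^sub>R Q"
      proof -
        have "(1 - 1 / (1 - l)) + (1 / (1 - l)) * l = 0" using l0 by (simp add: field_simps)
        hence "(1 - 1 / (1 - l)) *\<^sub>R u + ((1 / (1 - l)) * l) *\<^sub>R u = 0" by (metis scaleR_left_distrib scaleR_zero_left)
        thus ?thesis unfolding Q by (simp add: scaleR_right_distrib scaleR_left_diff_distrib algebra_simps)
      qed
      moreover have "0 \<le> 1 / (1 - l)" "1 / (1 - l) \<le> 1" using l0 by auto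
      ultimately show ?thesis unfolding in_segment by blast
    qed
  qed
  finally show "(c * z \<ge> a * b \<and> (c * z - a * b)^2 = (a^2 - p * z) * (b^2 - z * q)) \<longleftrightarrow> Z \<in> closed_segment P Q" .
qed

section \<open>Hyperbolic segments and hulls as Euclidean ones\<close>

lemma arcosh_sum_eq: assumes "A \<ge> 1" "B \<ge> 1" "C \<ge> (1::real)"
  shows "arcosh A + arcosh B = arcosh C \<longleftrightarrow> C \<ge> A * B \<and> (C - A * B)^2 = (A^2 - 1) * (B^2 - 1)"
proof -
  have nn: "arcosh A \<ge> 0" "arcosh B \<ge> 0" "arcosh C \<ge> 0" using assms by (auto intro: arcosh_nonneg_real)
  have "arcosh A + arcosh B = arcosh C \<longleftrightarrow> cosh (arcosh A + arcosh B) = cosh (arcosh C)"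
    using nn cosh_real_nonneg_less_iff[of "arcosh A + arcosh B" "arcosh C"] cosh_real_nonneg_less_iff[of "arcosh C" "arcosh A + arcosh B"]
    by (metis add_nonneg_nonneg less_irrefl linorder_neqE_linordered_idom)
  also have "cosh (arcosh A + arcosh B) = A * B + sqrt (A^2 - 1) * sqrt (B^2 - 1)"
    using assms by (simp add: cosh_add sinh_arcosh_real cosh_arcosh_real)
  also have "cosh (arcosh C) = C" using assms(3) by (rule cosh_arcosh_real)
  also have "A * B + sqrt (A^2 - 1) * sqrt (B^2 - 1) = C \<longleftrightarrow> C - A * B = sqrt ((A^2 - 1) * (B^2 - 1))"
    by (auto simp: real_sqrt_mult)
  also have "\<dots> \<longleftrightarrow> C \<ge> A * B \<and> (C - A * B)^2 = (A^2 - 1) * (B^2 - 1)"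
  proof -
    have "(A^2 - 1) * (B^2 - 1) \<ge> 0" using assms by (intro mult_nonneg_nonneg) auto
    thus ?thesis by (smt (verit) real_sqrt_ge_zero real_sqrt_pow2 real_sqrt_unique)
  qed
  finally show ?thesis .
qed

text \<open>By \<open>kl_cosh\<close> and the addition theorem, additivity of the distances is a
  relation between three normalized products; clearing the positive denominators gives the condition
  of \<open>segment_condition\<close>.\<close>

lemma hyp_segment_iff:
  assumes "p \<in> upper_half" "q \<in> upper_half" "r \<in> upper_half"
  shows "r \<in> hyp_segment p q \<longleftrightarrow> kl r \<in> closed_segment (kl p) (kl q)"
proof -
  note d = kl_in_disc[OF assms(1)] kl_in_disc[OF assms(3)] kl_in_disc[OF assms(2)]
  define P Z Q where "P = kl p" and "Z = kl r" and "Q = kl q"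
  define pp zz qq where "pp = 1 - P \<bullet> P" and "zz = 1 - Z \<bullet> Z" and "qq = 1 - Q \<bullet> Q"
  define a b c where "a = 1 - P \<bullet> Z" and "b = 1 - Z \<bullet> Q" and "c = 1 - P \<bullet> Q"
  define A B C where "A = a / (sqrt pp * sqrt zz)" and "B = b / (sqrt zz * sqrt qq)" and "C = c / (sqrt pp * sqrt qq)"
  have pos: "pp > 0" "zz > 0" "qq > 0" using d unfolding pp_def zz_def qq_def P_def Z_def Q_def by auto
  have ge1: "1 + (cmod (z - w))^2 / (2 * Im z * Im w) \<ge> 1" if "z \<in> upper_half" "w \<in> upper_half" for z w
    using that by (auto simp: upper_half_def)
  have eqs: "A = 1 + (cmod (p - r))^2 / (2 * Im p * Im r)" "B = 1 + (cmod (r - q))^2 / (2 * Im r * Im q)"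
    "C = 1 + (cmod (p - q))^2 / (2 * Im p * Im q)"
    unfolding kl_cosh[OF assms(1,3)] kl_cosh[OF assms(3,2)] kl_cosh[OF assms(1,2)]
    by (simp_all add: A_def B_def C_def a_def b_def c_def pp_def qq_def zz_def P_def Q_def Z_def)
  have "r \<in> hyp_segment p q \<longleftrightarrow> arcosh A + arcosh B = arcosh C"
    unfolding hyp_segment_def hyp_dist_def eqs using assms by simp
  also have "\<dots> \<longleftrightarrow> C \<ge> A * B \<and> (C - A * B)^2 = (A^2 - 1) * (B^2 - 1)"
    using ge1 assms unfolding eqs by (intro arcosh_sum_eq) auto
  also have "\<dots> \<longleftrightarrow> c * zz \<ge> a * b \<and> (c * zz - a * b)^2 = (a^2 - pp * zz) * (b^2 - zz * qq)"
  proof -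
    have k: "sqrt pp * sqrt pp = pp" "sqrt zz * sqrt zz = zz" "sqrt qq * sqrt qq = qq" using pos by auto
    define s where "s = sqrt pp * sqrt qq"
    have s: "s > 0" using pos unfolding s_def by simp
    have s2: "s * s = pp * qq" unfolding s_def using k(1,3) by (metis mult.assoc mult.commute)
    have "A * B = a * b / ((sqrt zz * sqrt zz) * s)" unfolding A_def B_def s_def by (simp add: ac_simps)
    hence AB: "A * B = a * b / (zz * s)" unfolding k(2) .
    have "C = c / s" unfolding C_def s_def ..
    hence D: "C - A * B = (c * zz - a * b) / (zz * s)" unfolding AB using pos s by (simp add: diff_divide_distrib)
    have A2: "A^2 - 1 = (a^2 - pp * zz) / (pp * zz)" using pos by (simp add: A_def power_divide power_mult_distrib field_simps)
    have B2: "B^2 - 1 = (b^2 - zz * qq) / (zz * qq)" using pos by (simp add: B_def power_divide power_mult_distrib field_simps)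
    have "C \<ge> A * B \<longleftrightarrow> C - A * B \<ge> 0" by auto
    also have "\<dots> \<longleftrightarrow> c * zz \<ge> a * b" unfolding D using mult_pos_pos[OF pos(2) s] by (simp add: zero_le_divide_iff)
    finally have 1: "C \<ge> A * B \<longleftrightarrow> c * zz \<ge> a * b" .
    have "(C - A * B)^2 = (c * zz - a * b)^2 / (zz * zz * (pp * qq))" unfolding D power_divide power2_eq_square s2[symmetric] by (simp add: ac_simps)
    moreover have "(A^2 - 1) * (B^2 - 1) = (a^2 - pp * zz) * (b^2 - zz * qq) / (zz * zz * (pp * qq))" unfolding A2 B2 by (simp add: ac_simps)
    ultimately have 2: "(C - A * B)^2 = (A^2 - 1) * (B^2 - 1) \<longleftrightarrow> (c * zz - a * b)^2 = (a^2 - pp * zz) * (b^2 - zz * qq)"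
      using pos by simp
    show ?thesis using 1 2 by simp
  qed
  also have "\<dots> \<longleftrightarrow> Z \<in> closed_segment P Q"
    unfolding a_def b_def c_def pp_def zz_def qq_def
    using d unfolding P_def Q_def Z_def by (rule segment_condition(3))
  finally show ?thesis unfolding P_def Q_def Z_def .
qed

lemma disc_convex: "convex {P::complex. P \<bullet> P < 1}"
proof -
  have "{P::complex. P \<bullet> P < 1} = ball 0 1"
    by (auto simp: dist_norm norm_eq_sqrt_inner)
  thus ?thesis by simp
qed

lemma hyp_convex_image: assumes "hyp_convex S" shows "convex (kl ` S)"
  unfolding convex_contains_segment
proof (intro ballI subsetI)
  fix P Q R assume "P \<in> kl ` S" "Q \<in> kl ` S" and R: "R \<in> closed_segment P Q"
  then obtain p q where pq: "p \<in> S" "q \<in> S" "P = kl p" "Q = kl q" by blast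
  have u: "p \<in> upper_half" "q \<in> upper_half" using pq assms unfolding hyp_convex_def by auto
  have "closed_segment P Q \<subseteq> {P. P \<bullet> P < 1}"
    using kl_in_disc u pq by (intro closed_segment_subset disc_convex) auto
  then obtain r where r: "r \<in> upper_half" "kl r = R" using kl_surj R by blast
  have "r \<in> hyp_segment p q" using hyp_segment_iff u r R pq by blast
  thus "R \<in> kl ` S" using r assms pq unfolding hyp_convex_def by blast
qed

text \<open>The preimage of a Euclidean convex hull is hyperbolically convex, and conversely the
  image of a hyperbolically convex set is convex by \<open>hyp_convex_image\<close>.\<close>

lemma hyp_hull_eq: assumes "T \<subseteq> upper_half"
  shows "hyp_convex hull T = {z \<in> upper_half. kl z \<in> convex hull (kl ` T)}"
proof
  have "hyp_convex {z \<in> upper_half. kl z \<in> convex hull (kl ` T)}"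
    unfolding hyp_convex_def
  proof (intro conjI ballI subsetI)
    fix p q r assume p: "p \<in> {z \<in> upper_half. kl z \<in> convex hull kl ` T}" and q: "q \<in> {z \<in> upper_half. kl z \<in> convex hull kl ` T}"
      and r: "r \<in> hyp_segment p q"
    have ru: "r \<in> upper_half" using r unfolding hyp_segment_def by blast
    hence "kl r \<in> closed_segment (kl p) (kl q)" using r hyp_segment_iff p q by blast
    moreover have "closed_segment (kl p) (kl q) \<subseteq> convex hull (kl ` T)"
      using p q by (intro closed_segment_subset convex_convex_hull) auto
    ultimately show "r \<in> {z \<in> upper_half. kl z \<in> convex hull kl ` T}" using ru by blast
  qed auto
  moreover have "T \<subseteq> {z \<in> upper_half. kl z \<in> convex hull (kl ` T)}" using assms hull_subset[of "kl ` T"] by auto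
  ultimately show "hyp_convex hull T \<subseteq> {z \<in> upper_half. kl z \<in> convex hull (kl ` T)}" by (intro hull_minimal)
next
  show "{z \<in> upper_half. kl z \<in> convex hull (kl ` T)} \<subseteq> hyp_convex hull T"
    unfolding hull_def[of hyp_convex]
  proof safe
    fix z S assume z: "z \<in> upper_half" "kl z \<in> convex hull (kl ` T)" and S: "hyp_convex S" "T \<subseteq> S"
    have "convex hull (kl ` T) \<subseteq> kl ` S" using S by (intro hull_minimal hyp_convex_image) auto
    then obtain s where s: "s \<in> S" "kl z = kl s" using z by blast
    hence "s \<in> upper_half" using S unfolding hyp_convex_def by blast
    thus "z \<in> S" using kl_inj z s by metis
  qed
qed

section \<open>The heptagon in the Klein model\<close>

definition w7 :: complex where "w7 = cis (2 * pi / 7)"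
definition s7 :: real where "s7 = sin (2 * pi / 7)"

lemma w7_eq: "w7 = Complex (eta / 2) s7"
  by (simp add: w7_def s7_def eta_def cis.code)

lemma s7_sq: "s7 * s7 = 1 - eta * eta / 4"
  using sin_squared_eq[of "2 * pi / 7"] by (simp add: s7_def eta_def power2_eq_square)

lemma s7_pos [simp]: "s7 > 0" "s7 \<noteq> 0"
proof -
  show "s7 > 0" unfolding s7_def by (rule sin_gt_zero) auto
  thus "s7 \<noteq> 0" by simp
qed

lemma w7_7: "w7 ^ 7 = 1" unfolding w7_def Complex.DeMoivre by simp

lemma w7_cnj: "w7 * cnj w7 = 1" "cnj w7 * w7 = 1" by (simp_all add: w7_def cis_cnj cis_mult)

lemma w7_pow_cnj: "w7 ^ n * cnj w7 ^ n = 1" "cnj w7 ^ n * w7 ^ n = 1"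
  by (simp_all add: power_mult_distrib[symmetric] w7_cnj)

lemma w7_powers: "w7^2 = Complex (eta2 / 2) (eta * s7)" "w7^3 = Complex (eta3 / 2) ((eta^2 - 1) * s7)"
  "w7^4 = Complex (eta3 / 2) (- ((eta^2 - 1) * s7))" "w7^5 = Complex (eta2 / 2) (- eta * s7)"
  "w7^6 = Complex (eta / 2) (- s7)"
proof -
  show 2: "w7^2 = Complex (eta2 / 2) (eta * s7)"
    by (simp add: power2_eq_square w7_eq complex_eq_iff s7_sq eta2_def)
  have e3: "eta * (eta * eta) = 1 + 2 * eta - eta * eta" using eta_cubic by (simp add: power2_eq_square power3_eq_cube)
  show 3: "w7^3 = Complex (eta3 / 2) ((eta^2 - 1) * s7)"
  proof -
    have "w7^3 = w7 * w7^2" by (simp add: power3_eq_cube power2_eq_square)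
    hence "w7^3 = Complex (eta / 2) s7 * Complex (eta2 / 2) (eta * s7)" unfolding 2 by (simp only: w7_eq)
    moreover have "eta * eta2 / 4 - eta * (s7 * s7) = eta3 / 2" 
      unfolding s7_sq eta2_def eta3_def using e3 by (simp add: power2_eq_square field_simps)
    moreover have "eta / 2 * (eta * s7) + s7 * (eta2 / 2) = (eta^2 - 1) * s7"
      unfolding eta2_def by (simp add: power2_eq_square field_simps)
    ultimately show ?thesis by (simp add: complex_eq_iff algebra_simps)
  qed
  have c: "w7 ^ k = cnj (w7 ^ (7 - k))" if "k \<le> 7" for k
  proof -
    have "w7 ^ (7 - k) * w7 ^ k = 1" using that w7_7 by (simp add: power_add[symmetric])
    hence "cnj (w7 ^ (7 - k)) * (w7 ^ (7 - k) * w7 ^ k) = cnj (w7 ^ (7 - k))" by simp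
    thus ?thesis using w7_pow_cnj[of "7 - k"] by (simp add: mult.assoc[symmetric])
  qed
  show "w7^4 = Complex (eta3 / 2) (- ((eta^2 - 1) * s7))" using c[of 4] 3 by (simp add: complex_eq_iff)
  show "w7^5 = Complex (eta2 / 2) (- eta * s7)" using c[of 5] 2 by (simp add: complex_eq_iff)
  show "w7^6 = Complex (eta / 2) (- s7)" using c[of 6] w7_eq by (simp add: complex_eq_iff)
qed

text \<open>\<open>Lf i Z T \<le> 0\<close> says that the Klein point \<open>Z / T\<close> is on the inner side of the \<open>i\<close>-th edge.\<close>

definition Lf :: "nat \<Rightarrow> complex \<Rightarrow> real \<Rightarrow> real" where
  "Lf i Z T = Re (Z * cnj (w7 ^ i)) - hh * T"

lemma Lf_rot: "Lf (i + j) Z T = Lf j (Z * cnj (w7 ^ i)) T"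
  by (simp add: Lf_def power_add mult.assoc)

lemma Lf_rot': "Lf (i + j) (w7 ^ i * Z) T = Lf j Z T"
proof -
  have "w7 ^ i * Z * cnj (w7 ^ i) = (w7 ^ i * cnj w7 ^ i) * Z" by simp
  thus ?thesis unfolding Lf_rot by (simp only: w7_pow_cnj mult_1_left)
qed

lemma Lf_7: "Lf (i + 7) Z T = Lf i Z T" "Lf (7 + i) Z T = Lf i Z T"
  by (simp_all add: Lf_def power_add w7_7)

lemma Lf_mod7: "Lf (i mod 7) Z T = Lf i Z T"
proof -
  have "w7 ^ i = w7 ^ (7 * (i div 7) + i mod 7)" by simp
  also have "\<dots> = w7 ^ (i mod 7)" unfolding power_add power_mult w7_7 by simp
  finally show ?thesis by (simp add: Lf_def)
qed

lemma Lf_scale: "Lf i (of_real r * Z) (r * T) = r * Lf i Z T"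
  by (simp add: Lf_def algebra_simps)

lemma Lf_add: "Lf i (Z + Z') (T + T') = Lf i Z T + Lf i Z' T'"
  by (simp add: Lf_def algebra_simps)

lemma Lf_lin: "Lf i (of_real r * Z + Z') (r * T + T') = r * Lf i Z T + Lf i Z' T'"
  by (simp add: Lf_add Lf_scale)

lemma Lf_table:
  "Lf 0 Z T = Re Z - hh * T" "Lf 1 Z T = Re Z * (eta/2) + Im Z * s7 - hh * T"
  "Lf 2 Z T = Re Z * (eta2/2) + Im Z * (eta * s7) - hh * T"
  "Lf 3 Z T = Re Z * (eta3/2) + Im Z * ((eta^2 - 1) * s7) - hh * T"
  "Lf 4 Z T = Re Z * (eta3/2) - Im Z * ((eta^2 - 1) * s7) - hh * T"
  "Lf 5 Z T = Re Z * (eta2/2) - Im Z * (eta * s7) - hh * T"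
  "Lf 6 Z T = Re Z * (eta/2) - Im Z * s7 - hh * T"
  unfolding Lf_def w7_powers power_0 power_one_right unfolding w7_eq by simp_all

text \<open>On the line of edge 0 the two neighbouring conditions bound the height by half the side
  of the heptagon, and such points stay strictly inside the other four lines. Hence three conditions
  suffice to recognize a point of an edge.\<close>

lemma Lf_edge0:
  assumes "T > 0" "Lf 0 Z T = 0" "Lf 1 Z T \<le> 0" "Lf 6 Z T \<le> 0" "i \<in> {2..5}"
  shows "Lf i Z T < 0"
proof -
  define m y where "m = hh * T" and "y = Im Z * s7"
  have m: "m > 0" using assms hh_bounds unfolding m_def by simp
  have x: "Re Z = m" using assms(2) by (simp add: Lf_table m_def)
  have y1: "y \<le> m * (1 - eta / 2)" "- y \<le> m * (1 - eta / 2)"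
    using assms(3,4) unfolding Lf_table x m_def[symmetric] y_def[symmetric] by (auto simp: algebra_simps)
  have p: "eta * y \<le> eta * (m * (1 - eta / 2))" "eta * (- y) \<le> eta * (m * (1 - eta / 2))"
     "(eta^2 - 1) * y \<le> (eta^2 - 1) * (m * (1 - eta / 2))" "(eta^2 - 1) * (- y) \<le> (eta^2 - 1) * (m * (1 - eta / 2))"
    using eta_sq_bounds eta_gt_1 y1 by (intro mult_left_mono; simp)+
  have n2: "m * (eta2/2) + eta * (m * (1 - eta / 2)) - m < 0"
  proof -
    have "m * (eta2/2) + eta * (m * (1 - eta / 2)) - m = m * (eta - 2)" unfolding eta2_def by (simp add: field_simps power2_eq_square)
    thus ?thesis using m eta_bounds by (simp add: mult_less_0_iff)
  qed
  have n3: "m * (eta3/2) + (eta^2 - 1) * (m * (1 - eta / 2)) - m < 0"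
  proof -
    have "(eta^2 - 1) * (1 - eta / 2) \<le> 0.555 * 0.4" using eta_sq_bounds eta_bounds by (intro mult_mono) auto
    hence "eta3/2 + (eta^2 - 1) * (1 - eta / 2) - 1 < 0" using eta3_bounds by simp
    hence "m * (eta3/2 + (eta^2 - 1) * (1 - eta / 2) - 1) < 0" using m by (simp add: mult_less_0_iff)
    also have "m * (eta3/2 + (eta^2 - 1) * (1 - eta / 2) - 1) = m * (eta3/2) + (eta^2 - 1) * (m * (1 - eta / 2)) - m" by algebra
    finally show ?thesis .
  qed
  have "i = 2 \<or> i = 3 \<or> i = 4 \<or> i = 5" using assms(5) by auto
  moreover have "Im Z * (eta * s7) = eta * y" "Im Z * ((eta^2 - 1) * s7) = (eta^2 - 1) * y" unfolding y_def by simp_all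
  hence "Lf 2 Z T = m * (eta2/2) + eta * y - m" "Lf 3 Z T = m * (eta3/2) + (eta^2 - 1) * y - m"
    "Lf 4 Z T = m * (eta3/2) + (eta^2 - 1) * (- y) - m" "Lf 5 Z T = m * (eta2/2) + eta * (- y) - m"
    unfolding Lf_table x m_def[symmetric] by simp_all
  hence "Lf 2 Z T < 0" "Lf 3 Z T < 0" "Lf 4 Z T < 0" "Lf 5 Z T < 0" using p n2 n3 by linarith+
  ultimately show ?thesis by blast
qed


lemma Lf_edge:
  assumes "T > 0" "Lf j Z T = 0" "Lf (j + 1) Z T \<le> 0" "Lf (j + 6) Z T \<le> 0" "i \<in> {2..5}"
  shows "Lf (j + i) Z T < 0"
  unfolding Lf_rot
proof (rule Lf_edge0[OF assms(1) _ _ _ assms(5)])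
  show "Lf 0 (Z * cnj (w7 ^ j)) T = 0" using assms(2) Lf_rot[of j 0 Z T] by simp
qed (use assms(3,4) in \<open>simp_all only: Lf_rot\<close>)

lemma Lf_edge_all:
  assumes "T > 0" "Lf j Z T = 0" "Lf (j + 1) Z T \<le> 0" "Lf (j + 6) Z T \<le> 0"
  shows "Lf i Z T \<le> 0"
proof -
  have *: "Lf (j + k) Z T \<le> 0" if "k < 7" for k
  proof -
    have "k = 0 \<or> k = 1 \<or> k = 6 \<or> k \<in> {2..5}" using that by auto
    thus ?thesis using Lf_edge[OF assms, of k] assms by fastforce
  qed
  define k where "k = (i + 6 * j) mod 7"
  have "(j + k) mod 7 = i mod 7" unfolding k_def by presburger
  hence "Lf i Z T = Lf (j + k) Z T" using Lf_mod7[of i] Lf_mod7[of "j + k"] by simp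
  thus ?thesis using *[of k] unfolding k_def by simp
qed

section \<open>Vertices, edges and sectors of the heptagon\<close>

definition tt :: real where "tt = s7 / (1 + eta / 2)"
text \<open>\<open>tt\<close> is tan(pi/7), by the half-angle formula. Thus \<open>hh * tt\<close>
  is half the side of the heptagon, and \<open>hh^2 * (1 + tt^2)\<close>, the squared norm of
  \<open>vert0\<close>, is its squared circumradius.\<close>

definition vert0 :: complex where "vert0 = Complex hh (- (hh * tt))"

lemma tt_pos: "tt > 0" unfolding tt_def using eta_gt_1 by simp

lemma tt_s7: "tt * s7 = 1 - eta / 2"
proof -
  have "s7 * s7 = (1 - eta / 2) * (1 + eta / 2)" unfolding s7_sq by (simp add: algebra_simps)
  thus ?thesis unfolding tt_def using eta_gt_1 by (simp add: field_simps)
qed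

lemma tt_eta: "tt + tt * (eta / 2) = s7"
proof -
  have "tt * (1 + eta / 2) = s7" unfolding tt_def using eta_gt_1 by simp
  thus ?thesis by (simp add: distrib_left)
qed

lemma vert1: "w7 * vert0 = Complex hh (hh * tt)"
proof -
  have "hh * (s7 * tt) = hh * (1 - eta / 2)" using tt_s7 by (simp add: mult.commute)
  moreover have "hh * s7 = hh * (tt + tt * (eta / 2))" unfolding tt_eta ..
  ultimately show ?thesis unfolding w7_eq vert0_def by (simp add: complex_eq_iff algebra_simps)
qed

lemma Lf_vert0: "Lf 0 vert0 1 = 0" "Lf 6 vert0 1 = 0" "Lf 1 vert0 1 < 0"
proof -
  have e: "hh * (tt * s7) = hh * (1 - eta/2)" unfolding tt_s7 ..
  show "Lf 0 vert0 1 = 0" by (simp add: Lf_table vert0_def)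
  show "Lf 6 vert0 1 = 0" using e unfolding Lf_table vert0_def by (simp add: algebra_simps)
  have "hh * (eta - 2) < 0" using hh_bounds eta_bounds by (simp add: mult_less_0_iff)
  thus "Lf 1 vert0 1 < 0" using e unfolding Lf_table vert0_def by (simp add: algebra_simps)
qed

lemma edge0_iff:
  "K \<in> closed_segment vert0 (w7 * vert0) - {w7 * vert0} \<longleftrightarrow> Lf 0 K 1 = 0 \<and> Lf 1 K 1 < 0 \<and> Lf 6 K 1 \<le> 0" (is ?A)
  "K \<in> closed_segment vert0 (w7 * vert0) - {vert0} \<longleftrightarrow> Lf 0 K 1 = 0 \<and> Lf 1 K 1 \<le> 0 \<and> Lf 6 K 1 < 0" (is ?B)
proof -
  define b where "b = hh * tt"
  have b: "b > 0" unfolding b_def using hh_bounds tt_pos by simp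
  have seg: "K \<in> closed_segment vert0 (w7 * vert0) \<longleftrightarrow> Re K = hh \<and> - b \<le> Im K \<and> Im K \<le> b"
  proof
    assume "K \<in> closed_segment vert0 (w7 * vert0)"
    then obtain t where t: "0 \<le> t" "t \<le> 1" "K = (1 - t) *\<^sub>R vert0 + t *\<^sub>R (w7 * vert0)" unfolding in_segment by blast
    have "Re K = hh" "Im K = (2 * t - 1) * b" unfolding t(3) vert1 unfolding vert0_def b_def[symmetric] by (simp_all add: algebra_simps)
    moreover have "(2 * t - 1) * b \<le> 1 * b" "(-1) * b \<le> (2 * t - 1) * b" using t b by (intro mult_right_mono; simp)+
    ultimately show "Re K = hh \<and> - b \<le> Im K \<and> Im K \<le> b" by simp
  next
    assume k: "Re K = hh \<and> - b \<le> Im K \<and> Im K \<le> b"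
    define t where "t = (Im K / b + 1) / 2"
    have "- 1 \<le> Im K / b" "Im K / b \<le> 1" using k b by (simp_all add: field_simps)
    hence t: "0 \<le> t" "t \<le> 1" unfolding t_def by auto
    have "2 * t - 1 = Im K / b" unfolding t_def by (simp add: field_simps)
    hence "(2 * t - 1) * b = Im K" using b by simp
    hence "K = (1 - t) *\<^sub>R vert0 + t *\<^sub>R (w7 * vert0)" using k
      unfolding vert1 unfolding vert0_def b_def[symmetric] by (simp add: complex_eq_iff algebra_simps)
    thus "K \<in> closed_segment vert0 (w7 * vert0)" using t unfolding in_segment by blast
  qed
  have e: "b * s7 = hh * (1 - eta / 2)" unfolding b_def using tt_s7 by (simp add: mult.assoc)
  have L1: "Lf 1 K 1 = (Im K - b) * s7" "Lf 6 K 1 = - (Im K + b) * s7" if "Re K = hh"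
    unfolding Lf_table that using e by (simp_all add: algebra_simps)
  have sg: "x * s7 < 0 \<longleftrightarrow> x < 0" "x * s7 \<le> 0 \<longleftrightarrow> x \<le> 0" "- (x * s7) < 0 \<longleftrightarrow> 0 < x" "- (x * s7) \<le> 0 \<longleftrightarrow> 0 \<le> x" 
    "0 < x * s7 \<longleftrightarrow> 0 < x" "0 \<le> x * s7 \<longleftrightarrow> 0 \<le> x" for x
    using less_not_sym[OF s7_pos(1)] less_imp_le[OF s7_pos(1)] not_le[THEN iffD2, OF s7_pos(1)]
    by (simp_all add: mult_less_0_iff mult_le_0_iff zero_less_mult_iff zero_le_mult_iff)
  show ?A
  proof (cases "Re K = hh")
    case True
    show ?thesis using seg True b unfolding L1[OF True] vert1 b_def[symmetric]
      by (auto simp: Lf_table complex_eq_iff sg)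
  next
    case False
    thus ?thesis using seg by (auto simp: Lf_table)
  qed
  show ?B
  proof (cases "Re K = hh")
    case True
    show ?thesis using seg True b unfolding L1[OF True] vert0_def b_def[symmetric]
      by (auto simp: Lf_table complex_eq_iff sg)
  next
    case False
    thus ?thesis using seg by (auto simp: Lf_table)
  qed
qed

text \<open>Rotating by the multiple of 2 pi/7 nearest to the argument leaves an angle of at most
  pi/7, and the single condition for the corresponding edge then puts the point into the
  triangle.\<close>

lemma sector:
  assumes "\<forall>i. Lf i K 1 \<le> 0"
  shows "\<exists>i<7. K * cnj (w7 ^ i) \<in> convex hull {vert0, w7 * vert0, 0}"
proof -
  define r \<phi> where "r = cmod K" and "\<phi> = Arg K"
  have K: "K = of_real r * cis \<phi>" unfolding r_def \<phi>_def by (metis Arg_eq_0 Arg_def cis_conv_exp complex_norm_eq_1_exp mult_zero_left norm_eq_zero of_real_0 rcis_cmod_Arg rcis_def)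
  define n where "n = \<lfloor>\<phi> * 7 / (2 * pi) + 1 / 2\<rfloor>"
  define \<psi> where "\<psi> = \<phi> - 2 * pi / 7 * of_int n"
  have "of_int n \<le> \<phi> * 7 / (2 * pi) + 1 / 2" "\<phi> * 7 / (2 * pi) + 1 / 2 < of_int n + 1" unfolding n_def by linarith+
  hence "\<phi> * 7 / (2 * pi) - of_int n \<le> 1/2" "- 1/2 \<le> \<phi> * 7 / (2 * pi) - of_int n" by linarith+
  moreover have e: "(\<phi> * 7 / (2 * pi) - of_int n) * (2 * pi / 7) = \<psi>" unfolding \<psi>_def by (simp add: field_simps)
  ultimately have "(\<phi> * 7 / (2 * pi) - of_int n) * (2 * pi / 7) \<le> 1/2 * (2 * pi / 7)" "- 1/2 * (2 * pi / 7) \<le> (\<phi> * 7 / (2 * pi) - of_int n) * (2 * pi / 7)"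
    by (intro mult_right_mono; simp)+
  hence "\<psi> \<le> 1/2 * (2 * pi / 7)" "- 1/2 * (2 * pi / 7) \<le> \<psi>" unfolding e .
  hence \<psi>: "\<bar>\<psi>\<bar> \<le> pi / 7" by linarith
  define i where "i = nat (n mod 7)"
  have i: "i < 7" unfolding i_def by (simp add: nat_less_iff)
  have wi: "w7 ^ i = cis (2 * pi / 7 * of_int n)"
  proof -
    have "of_int n = real i + 7 * of_int (n div 7)" unfolding i_def by (simp add: of_nat_nat) (metis mult_div_mod_eq add.commute of_int_add of_int_mult of_int_numeral)
    hence "2 * pi / 7 * of_int n = real i * (2 * pi / 7) + 2 * pi * of_int (n div 7)" by (simp add: field_simps)
    hence "cis (2 * pi / 7 * of_int n) = cis (real i * (2 * pi / 7)) * cis (2 * pi * of_int (n div 7))" by (simp only: cis_mult)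
    also have "cis (2 * pi * of_int (n div 7)) = 1" by (rule cis_multiple_2pi) simp
    finally show ?thesis unfolding w7_def Complex.DeMoivre by simp
  qed
  define K' where "K' = K * cnj (w7 ^ i)"
  have K': "K' = of_real r * cis \<psi>" unfolding K'_def K wi \<psi>_def by (simp add: cis_cnj cis_mult)
  define x y where "x = r * cos \<psi>" and "y = r * sin \<psi>"
  have Kxy: "K' = Complex x y" unfolding K' x_def y_def by (simp add: complex_eq_iff)
  have r: "r \<ge> 0" unfolding r_def by simp
  define t where "t = pi / 7"
  have t: "0 < t" "t < pi / 2" unfolding t_def by auto
  have ct: "cos t > 0" "sin t > 0" using t by (auto intro: cos_gt_zero_pi sin_gt_zero)
  have tt: "tt = sin t / cos t"
  proof -
    have "s7 = 2 * sin t * cos t" unfolding s7_def t_def using sin_double[of "pi/7"] by simp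
    moreover have "eta / 2 = 2 * (cos t)^2 - 1" unfolding eta_def t_def using cos_double_cos[of "pi/7"] by simp
    ultimately have "s7 = 2 * sin t * cos t" "1 + eta / 2 = 2 * (cos t * cos t)" by (simp_all add: power2_eq_square)
    hence "tt = (2 * sin t * cos t) / (2 * (cos t * cos t))" unfolding tt_def by (simp only:)
    thus ?thesis using ct by simp
  qed
  have "cos t \<le> cos \<bar>\<psi>\<bar>" using \<psi> t by (intro cos_monotone_0_pi_le) (auto simp: t_def)
  hence c: "cos t \<le> cos \<psi>" by simp
  have "sin \<bar>\<psi>\<bar> \<le> sin t" using \<psi> t by (intro sin_monotone_2pi_le) (auto simp: t_def)
  hence s: "\<bar>sin \<psi>\<bar> \<le> sin t" by (cases "\<psi> \<ge> 0") (use \<psi> sin_ge_zero[of "\<bar>\<psi>\<bar>"] t in \<open>auto simp: t_def abs_if\<close>)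
  have "\<bar>y\<bar> * cos t = r * (\<bar>sin \<psi>\<bar> * cos t)" unfolding y_def using r by (simp add: abs_mult)
  also have "\<dots> \<le> r * (sin t * cos \<psi>)" using r s c ct by (intro mult_left_mono mult_mono) auto
  also have "\<dots> = x * sin t" unfolding x_def by simp
  finally have y: "\<bar>y\<bar> \<le> x * tt" unfolding tt using ct by (simp add: field_simps)
  have x0: "x \<ge> 0" using r c ct unfolding x_def by simp
  have "Lf i K 1 \<le> 0" using assms by blast
  hence x1: "x \<le> hh" unfolding Lf_def K'_def[symmetric] Kxy by simp
  \<comment> \<open>Barycentric coordinates with respect to the two vertices; the remaining weight
    goes to the centre.\<close>
  define l1 l0 where "l1 = (x + y / tt) / (2 * hh)" and "l0 = (x - y / tt) / (2 * hh)"
  have "\<bar>y / tt\<bar> \<le> x" using y tt_pos by (simp add: abs_divide field_simps)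
  hence "x - y / tt \<ge> 0" "x + y / tt \<ge> 0" by linarith+
  hence l: "l0 \<ge> 0" "l1 \<ge> 0" unfolding l0_def l1_def using hh_bounds by simp_all
  have sum: "l0 + l1 = x / hh" "l1 - l0 = y / (tt * hh)" unfolding l0_def l1_def using hh_bounds tt_pos by (simp_all add: field_simps)
  have lx: "l0 * hh + l1 * hh = x" using sum(1) hh_bounds by (simp add: field_simps)
  have ly: "l1 * (hh * tt) - l0 * (hh * tt) = y" using sum(2) hh_bounds tt_pos by (simp add: field_simps)
  have "K' = l0 *\<^sub>R vert0 + l1 *\<^sub>R (w7 * vert0) + (1 - l0 - l1) *\<^sub>R 0"
    unfolding Kxy vert1 unfolding vert0_def using lx ly by (simp add: complex_eq_iff)
  moreover have "l0 + l1 \<le> 1" unfolding sum(1) using x1 hh_bounds by simp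
  hence "1 - l0 - l1 \<ge> 0" by simp
  ultimately have "K' \<in> convex hull {vert0, w7 * vert0, 0}" unfolding convex_hull_3 using l
    by (intro CollectI exI[of _ l0] exI[of _ l1] exI[of _ "1 - l0 - l1"]) simp
  thus ?thesis using i unfolding K'_def by blast
qed

lemma Lf_vert0_all: "Lf i vert0 1 \<le> 0"
  using Lf_edge_all[of 1 0 vert0 i] Lf_vert0 by simp

lemma hull_Lf:
  assumes "K \<in> convex hull {vert0, w7 * vert0, 0}" shows "Lf i K 1 \<le> 0"
proof -
  obtain u v w where *: "0 \<le> u" "0 \<le> v" "0 \<le> w" "u + v + w = 1" "K = u *\<^sub>R vert0 + v *\<^sub>R (w7 * vert0) + w *\<^sub>R 0"
    using assms unfolding convex_hull_3 by blast
  have "Lf i K 1 = u * Lf i vert0 1 + v * Lf i (w7 * vert0) 1 - w * hh"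
  proof -
    have "hh = (u + v + w) * hh" using * by simp
    thus ?thesis unfolding *(5) Lf_def by (simp add: algebra_simps)
  qed
  moreover have "Lf i (w7 * vert0) 1 = Lf (i + 6) vert0 1"
    using Lf_rot'[of 1 "i + 6" vert0 1] Lf_7(1)[of i "w7 * vert0" 1] by (simp add: add.commute)
  moreover have "u * Lf i vert0 1 \<le> 0" "v * Lf (i + 6) vert0 1 \<le> 0" "w * hh \<ge> 0"
    using * hh_bounds Lf_vert0_all by (auto simp: mult_nonneg_nonpos)
  ultimately show ?thesis by simp
qed

section \<open>Moebius transformations and the vertices\<close>

lemma moebius_denom: fixes M :: "real^2^2" assumes "z \<in> upper_half" "det M = 1"
  shows "of_real (M$2$1) * z + of_real (M$2$2) \<noteq> 0"
proof
  assume 0: "of_real (M$2$1) * z + of_real (M$2$2) = 0"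
  have "Im (of_real (M$2$1) * z + of_real (M$2$2)) = M$2$1 * Im z" "Re (of_real (M$2$1) * z + of_real (M$2$2)) = M$2$1 * Re z + M$2$2" by simp_all
  hence "M$2$1 = 0" "M$2$2 = 0" using 0 assms(1) by (auto simp: upper_half_def)
  thus False using assms(2) by (simp add: det_2)
qed

lemma moebius_upper: assumes "z \<in> upper_half" "det M = 1" shows "moebius M z \<in> upper_half"
proof -
  define d where "d = of_real (M$2$1) * z + of_real (M$2$2)"
  have d: "d \<noteq> 0" using moebius_denom[OF assms] unfolding d_def .
  have "moebius M z = (of_real (M$1$1) * z + of_real (M$1$2)) * cnj d / of_real ((cmod d)^2)"
    unfolding moebius_def d_def[symmetric] complex_norm_square using d by simp
  hence "Im (moebius M z) = Im ((of_real (M$1$1) * z + of_real (M$1$2)) * cnj d) / (cmod d)^2"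
    by (simp only: Im_divide_of_real)
  also have "Im ((of_real (M$1$1) * z + of_real (M$1$2)) * cnj d) = det M * Im z" unfolding d_def by (simp add: det_2 algebra_simps)
  finally have "Im (moebius M z) = Im z / (cmod d)^2" using assms by simp
  thus ?thesis using assms d by (simp add: upper_half_def)
qed

lemma moebius_mult: assumes "z \<in> upper_half" "det M = 1" "det N = 1"
  shows "moebius (M ** N) z = moebius M (moebius N z)"
proof -
  define d where "d = of_real (N$2$1) * z + of_real (N$2$2)"
  have d: "d \<noteq> 0" using moebius_denom[OF assms(1,3)] unfolding d_def .
  have N: "moebius N z = (of_real (N$1$1) * z + of_real (N$1$2)) / d" unfolding moebius_def d_def ..
  have "of_real (M$2$1) * moebius N z + of_real (M$2$2) \<noteq> 0"
    by (rule moebius_denom[OF moebius_upper[OF assms(1,3)] assms(2)])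
  define p where "p = of_real (N$1$1) * z + of_real (N$1$2)"
  have frac: "(A * (p / d) + B) / (C * (p / d) + D) = (A * p + B * d) / (C * p + D * d)" for A B C D
  proof -
    have "A * (p / d) + B = (A * p + B * d) / d" "C * (p / d) + D = (C * p + D * d) / d" using d by (simp_all add: add_divide_distrib)
    thus ?thesis using d by simp
  qed
  have "moebius M (moebius N z) = (of_real (M$1$1) * p + of_real (M$1$2) * d) / (of_real (M$2$1) * p + of_real (M$2$2) * d)"
    unfolding N p_def[symmetric] unfolding moebius_def frac ..
  thus ?thesis unfolding moebius_def matmul_nth by (simp add: p_def d_def algebra_simps)
qed

section \<open>The rotation \<open>g7\<close> about its fixed point\<close>

definition g7c :: real where "g7c = (eta^2 + eta - 1) / 2"
definition g7s :: real where "g7s = (2 - eta^2 + (eta^2 + eta - 2) * sqrt eta) / 2"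

text \<open>A matrix of this shape fixes the point i \<open>c0\<close>; the value of
  \<open>c0\<close> is dictated by the ratio of the off-diagonal entries of
  \<open>g7\<close>.\<close>

lemma g7_c0: "g7 = mat2 g7c (- (c0^2) * g7s) g7s g7c"
proof -
  have h: "1 + hh > 0" using hh_bounds by simp
  have gen: "eta * (1 - (2 - eta^2) * s) * (2 - eta^2 + (eta^2 + eta - 2) * s) = (1 + (2 - eta^2) * s) * (s + 1 - eta^2)"
    if "s * s = eta" for s
  proof -
    define k m where "k = 2 - eta^2" and "m = eta^2 + eta - 2"
    have km: "eta * k = eta^2 - 1" "m * eta = 1" unfolding k_def m_def using eta_cubic by algebra+
    have "eta * (1 - k * s) * (k + m * s) = eta * k + (m * eta) * s - (eta * k) * k * s - (m * eta) * k * (s * s)" by algebra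
    also have "\<dots> = s - (eta^2 - 1) * k * s + ((eta^2 - 1) - k * eta)" unfolding that km by algebra
    also have "\<dots> = (1 + k * s) * (s + 1 - eta^2)"
    proof -
      have "(1 + k * s) * (s + 1 - eta^2) = s - (eta^2 - 1) * k * s + (1 - eta^2 + k * (s * s))" by algebra
      thus ?thesis unfolding that using km(1) by (simp add: mult.commute)
    qed
    finally show ?thesis unfolding k_def m_def .
  qed
  have "eta * (1 - hh) * (2 * g7s) = (1 + hh) * (sqrt eta + 1 - eta^2)"
  proof -
    have g: "2 * g7s = 2 - eta^2 + (eta^2 + eta - 2) * sqrt eta" unfolding g7s_def by simp
    show ?thesis unfolding hh_def g by (rule gen[OF sqrt_eta_sq(1)])
  qed
  hence "c0^2 * (2 * g7s) = sqrt eta + 1 - eta^2" unfolding c0_sq using h by (simp add: field_simps)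
  hence "(eta^2 - 1 - sqrt eta) / 2 = - (c0^2) * g7s" by simp
  thus ?thesis unfolding g7_def by (intro mat2_eqI) (simp_all add: g7c_def, simp add: g7s_def)
qed

text \<open>\<open>g7c\<close> and \<open>c0 * g7s\<close> are the cosine and the sine of pi/7; the
  second and third identities are the double-angle formulas.\<close>

lemma g7cs: "g7c^2 + c0^2 * g7s^2 = 1" "g7c^2 - (c0^2) * g7s^2 = eta / 2" "2 * g7c * (c0 * g7s) = s7" "g7c > 0" "g7s > 0"
proof -
  show 1: "g7c^2 + c0^2 * g7s^2 = 1" using Delta_det[OF g7_Delta] unfolding g7_c0 by (simp add: det_2 power2_eq_square)
  have "(eta^2 + eta - 1)^2 = 2 + eta" using eta_cubic by algebra
  hence c: "g7c^2 = (2 + eta) / 4" unfolding g7c_def by (simp add: power_divide)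
  show "g7c^2 - (c0^2) * g7s^2 = eta / 2" 
  proof -
    have X: "c0^2 * g7s^2 = 1 - g7c^2" using 1 by simp
    have "u - (1 - u) = e / 2" if "u = (2 + e) / 4" for u e :: real using that by simp
    from this[OF c] show ?thesis unfolding X .
  qed
  show gc: "g7c > 0" unfolding g7c_def using eta_sq_bounds eta_bounds by simp
  have "(eta^2 + eta - 2) * sqrt eta > 0" using eta_sq_bounds eta_bounds by simp
  thus gs: "g7s > 0" unfolding g7s_def using eta_sq_bounds by simp
  have "(2 * g7c * (c0 * g7s))^2 = 4 * g7c^2 * (c0^2 * g7s^2)" by (simp add: power_mult_distrib)
  also have "c0^2 * g7s^2 = 1 - g7c^2" using 1 by simp
  also have "4 * g7c^2 * (1 - g7c^2) = s7^2"
  proof -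
    have gen: "4 * u * (1 - u) = 1 - e * e / 4" if "4 * u = 2 + e" for u e :: real
    proof -
      have e: "e = 4 * u - 2" using that by simp
      show ?thesis unfolding e by (simp add: field_simps)
    qed
    have "4 * g7c^2 = 2 + eta" unfolding c by simp
    thus ?thesis unfolding power2_eq_square[of s7] s7_sq by (rule gen)
  qed
  finally have E: "(2 * g7c * (c0 * g7s))^2 = s7^2" .
  show "2 * g7c * (c0 * g7s) = s7"
    by (rule power2_eq_imp_eq[OF E]) (use gc gs less_imp_le[OF s7_pos(1)] less_imp_le[OF c0_pos(1)] in \<open>simp_all add: mult_nonneg_nonneg less_imp_le\<close>)
qed

text \<open>An elliptic element fixing the point placed at the origin acts on the Klein disc as a
  Euclidean rotation, through twice the angle pi/7 of the matrix.\<close>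

lemma kl_g7: assumes "z \<in> upper_half" shows "kl (moebius g7 z) = w7 * kl z"
proof -
  define x y where "x = Re z" and "y = Im z"
  define d where "d = of_real g7s * z + of_real g7c"
  have d: "d \<noteq> 0" using moebius_denom[OF assms Delta_det[OF g7_Delta]] unfolding d_def g7_c0 by simp
  define e where "e = of_real g7c * z - of_real (c0^2 * g7s)"
  define m where "m = (g7s * x + g7c)^2 + (g7s * y)^2"
  have m: "m = (cmod d)^2" unfolding m_def d_def x_def y_def by (simp add: cmod_power2)
  have m0: "m > 0" unfolding m using d by simp
  have mo: "moebius g7 z = e / d" unfolding moebius_def d_def e_def g7_c0 by simp
  have ed: "e / d = e * cnj d / of_real m" unfolding m complex_norm_square using d by simp
  have re: "Re (e / d) = ((g7c * x - c0^2 * g7s) * (g7s * x + g7c) + (g7c * y) * (g7s * y)) / m"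
    unfolding ed Re_divide_of_real by (simp add: e_def d_def x_def y_def)
  have nm: "(Re (e / d))^2 + (Im (e / d))^2 = ((g7c * x - c0^2 * g7s)^2 + (g7c * y)^2) / m"
    unfolding cmod_power2[symmetric] norm_divide power_divide m[symmetric] by (simp add: e_def cmod_power2 x_def y_def)
  define N where "N = x^2 + y^2"
  have p: "(g7c * x - c0^2 * g7s)^2 + (g7c * y)^2 + c0^2 * m = N + c0^2"
  proof -
    have "(g7c * x - c0^2 * g7s)^2 + (g7c * y)^2 + c0^2 * m = (g7c^2 + c0^2 * g7s^2) * (N + c0^2)"
      unfolding m_def N_def by algebra
    thus ?thesis using g7cs(1) by simp
  qed
  have q: "(g7c * x - c0^2 * g7s)^2 + (g7c * y)^2 - c0^2 * m = (eta / 2) * (N - c0^2) - s7 * (2 * c0 * x)"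
    unfolding g7cs(2,3)[symmetric] m_def N_def by algebra
  have r: "2 * c0 * ((g7c * x - c0^2 * g7s) * (g7s * x + g7c) + (g7c * y) * (g7s * y)) = s7 * (N - c0^2) + (eta / 2) * (2 * c0 * x)"
    unfolding g7cs(2,3)[symmetric] N_def by algebra
  have den: "(Re (e / d))^2 + (Im (e / d))^2 + c0^2 = (N + c0^2) / m" 
    unfolding nm p[symmetric] using m0 by (simp add: field_simps)
  have num: "(Re (e / d))^2 + (Im (e / d))^2 - c0^2 = ((eta / 2) * (N - c0^2) - s7 * (2 * c0 * x)) / m"
    unfolding nm q[symmetric] using m0 by (simp add: field_simps)
  have num2: "2 * c0 * Re (e / d) = (s7 * (N - c0^2) + (eta / 2) * (2 * c0 * x)) / m"
    unfolding re r[symmetric] by simp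
  have "N + c0^2 > 0" unfolding N_def x_def y_def by (rule kl_denom_pos)
  have c: "(A / m) / (B / m) = A / B" for A B using m0 by simp
  have "kl (e / d) = Complex (((eta / 2) * (N - c0^2) - s7 * (2 * c0 * x)) / (N + c0^2)) ((s7 * (N - c0^2) + (eta / 2) * (2 * c0 * x)) / (N + c0^2))"
    unfolding kl_def den num num2 c ..
  also have "\<dots> = w7 * Complex ((N - c0^2) / (N + c0^2)) (2 * c0 * x / (N + c0^2))"
  proof -
    have "Complex ((p * a - q * b) / B) ((q * a + p * b) / B) = Complex p q * Complex (a / B) (b / B)" for p q a b B :: real
      by (simp add: complex_eq_iff diff_divide_distrib add_divide_distrib)
    thus ?thesis unfolding w7_eq .
  qed
  finally show ?thesis unfolding mo kl_def[of z] x_def y_def N_def .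
qed

lemma det_mpow_g7: "det (mpow g7 i) = 1" by (rule Delta_det[OF mpow_Delta[OF g7_Delta]])

lemma kl_g7_pow: assumes "z \<in> upper_half" shows "kl (moebius (mpow g7 i) z) = w7 ^ i * kl z"
proof (induction i)
  case 0 thus ?case by (simp add: moebius_def)
next
  case (Suc i)
  have "moebius (mpow g7 (Suc i)) z = moebius g7 (moebius (mpow g7 i) z)"
    using moebius_mult[OF assms Delta_det[OF g7_Delta] det_mpow_g7] by simp
  thus ?case using kl_g7[OF moebius_upper[OF assms det_mpow_g7]] Suc by simp
qed

lemma g7_pow_surj: assumes "z \<in> upper_half" "kl z * cnj (w7 ^ i) = K"
  shows "\<exists>y\<in>upper_half. kl y = K \<and> z = moebius (mpow g7 i) y"
proof -
  have "cmod K = cmod (kl z)" using assms(2) by (auto simp: norm_mult norm_power w7_def)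
  hence "K \<bullet> K < 1" using kl_in_disc[OF assms(1)] by (simp add: dot_square_norm)
  then obtain y where y: "y \<in> upper_half" "kl y = K" using kl_surj by blast
  have "kl (moebius (mpow g7 i) y) = kl z"
    unfolding kl_g7_pow[OF y(1)] y(2) assms(2)[symmetric] using w7_pow_cnj[of i]
    by (simp add: mult.left_commute)
  hence "z = moebius (mpow g7 i) y" by (rule kl_inj[OF moebius_upper[OF y(1) det_mpow_g7] assms(1), symmetric])
  thus ?thesis using y by blast
qed

section \<open>Coordinates of the centre and of the vertices\<close>

lemma tau7_eq: "tau7 = Complex 0 c0"
  unfolding tau7_def
proof (rule the_equality)
  have fix_iff: "moebius g7 z = z \<longleftrightarrow> z^2 = - of_real (c0^2)" if "z \<in> upper_half" for z
  proof -
    have d: "of_real g7s * z + of_real g7c \<noteq> 0" using moebius_denom[OF that Delta_det[OF g7_Delta]] unfolding g7_c0 by simp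
    have "moebius g7 z = z \<longleftrightarrow> of_real g7c * z + of_real (- (c0^2) * g7s) = z * (of_real g7s * z + of_real g7c)"
      unfolding moebius_def g7_c0 mat2_nth using d by (simp add: divide_eq_eq)
    also have "\<dots> \<longleftrightarrow> of_real g7s * (z^2 + of_real (c0^2)) = 0" by (auto simp: algebra_simps power2_eq_square)
    also have "\<dots> \<longleftrightarrow> z^2 = - of_real (c0^2)" using g7cs(5) by (simp add: eq_neg_iff_add_eq_0)
    finally show ?thesis .
  qed
  show "Complex 0 c0 \<in> upper_half \<and> moebius g7 (Complex 0 c0) = Complex 0 c0"
    using fix_iff[of "Complex 0 c0"] by (simp add: upper_half_def power2_eq_square complex_eq_iff)
  fix z assume z: "z \<in> upper_half \<and> moebius g7 z = z"
  hence "z^2 = - of_real (c0^2)" using fix_iff by blast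
  also have "\<dots> = (Complex 0 c0)^2" by (simp add: complex_eq_iff power2_eq_square)
  finally have "z = Complex 0 c0 \<or> z = - Complex 0 c0" by (simp add: power2_eq_iff)
  thus "z = Complex 0 c0" using z c0_pos(1) by (auto simp: upper_half_def complex_eq_iff simp del: c0_pos)
qed

definition x3 :: real where "x3 = (eta^2 - 2) / (3 - eta^2)"

lemma x3_sq: "x3^2 = eta * (eta - 1) / (2 + eta)"
proof -
  have "(eta^2 - 2)^2 * (2 + eta) = eta * (eta - 1) * (3 - eta^2)^2" using eta_cubic by algebra
  thus ?thesis unfolding x3_def power_divide using eta_sq_bounds eta_gt_1 by (simp add: frac_eq_eq)
qed

lemma x3_neg: "x3 < 0" unfolding x3_def using eta_sq_bounds by (simp add: divide_less_0_iff)

lemma x3_sq_less: "x3^2 < eta"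
proof -
  have "eta * (eta - 1) < eta * (2 + eta)" using eta_gt_1 by (intro mult_strict_left_mono) auto
  thus ?thesis unfolding x3_sq using eta_gt_1 by (simp add: divide_less_eq)
qed

text \<open>The fixed-point equation of \<open>g3\<close> is (z - x3)^2 = x3^2 - eta. It puts
  \<open>tau3\<close> on the circle |z|^2 = eta, which carries edge 0.\<close>

lemma tau3_eq: "tau3 = Complex x3 (sqrt (eta - x3^2))"
  unfolding tau3_def
proof (rule the_equality)
  let ?t = "Complex x3 (sqrt (eta - x3^2))"
  define C where "C = (3 - eta^2) * sqrt eta / 2"
  have C: "C > 0" unfolding C_def using eta_sq_bounds by simp
  have Dg: "det g3 = 1"
  proof -
    have e: "(eta^2 - 2)^2 * eta + 1 * 0 = (eta^2 + eta - 1) * (3 - eta^2) * eta - 3" using eta_cubic by algebra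
    have "(1 + (eta^2 - 2) * s) * (1 - (eta^2 - 2) * s) + (eta^2 + eta - 1) * s * ((3 - eta^2) * s) = 4" if "s * s = eta" for s
    proof -
      have "(1 + (eta^2 - 2) * s) * (1 - (eta^2 - 2) * s) + (eta^2 + eta - 1) * s * ((3 - eta^2) * s)
         = 1 - (eta^2 - 2)^2 * (s * s) + (eta^2 + eta - 1) * (3 - eta^2) * (s * s)" by algebra
      thus ?thesis using e unfolding that by simp
    qed
    from this[OF sqrt_eta_sq(1)] show ?thesis unfolding g3_def det_2 by (simp add: field_simps)
  qed
  have fix_iff: "moebius g3 z = z \<longleftrightarrow> (z - of_real x3)^2 = of_real (x3^2 - eta)" if "z \<in> upper_half" for z
  proof -
    have d: "of_real (g3$2$1) * z + of_real (g3$2$2) \<noteq> 0" by (rule moebius_denom[OF that Dg])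
    have "moebius g3 z = z \<longleftrightarrow> of_real (g3$1$1) * z + of_real (g3$1$2) = z * (of_real (g3$2$1) * z + of_real (g3$2$2))"
      unfolding moebius_def using d by (simp add: divide_eq_eq)
    also have "\<dots> \<longleftrightarrow> of_real (g3$2$1) * z^2 - of_real (g3$1$1 - g3$2$2) * z - of_real (g3$1$2) = 0"
      by (auto simp: algebra_simps power2_eq_square)
    also have "g3$2$1 = C" unfolding g3_def C_def by simp
    also have "g3$1$1 - g3$2$2 = C * (2 * x3)" unfolding g3_def C_def x3_def using eta_sq_bounds by (simp add: field_simps)
    also have "g3$1$2 = - C * eta"
    proof -
      have "eta^2 + eta - 1 = (3 - eta^2) * eta" using eta_cubic by algebra
      thus ?thesis unfolding g3_def C_def by simp
    qed
    also have "of_real C * z^2 - of_real (C * (2 * x3)) * z - of_real (- C * eta) = 0 \<longleftrightarrow> of_real C * ((z - of_real x3)^2 - of_real (x3^2 - eta)) = 0"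
      by (simp add: algebra_simps power2_eq_square)
    also have "\<dots> \<longleftrightarrow> (z - of_real x3)^2 = of_real (x3^2 - eta)" using C by simp
    finally show ?thesis .
  qed
  have e: "(?t - of_real x3)^2 = of_real (x3^2 - eta)" using x3_sq_less
    by (simp add: complex_eq_iff power2_eq_square)
  have u: "?t \<in> upper_half" using x3_sq_less by (simp add: upper_half_def)
  show "?t \<in> upper_half \<and> moebius g3 ?t = ?t" using fix_iff[OF u] e u by blast
  fix z assume z: "z \<in> upper_half \<and> moebius g3 z = z"
  hence "(z - of_real x3)^2 = (?t - of_real x3)^2" using fix_iff e by metis
  hence "z - of_real x3 = ?t - of_real x3 \<or> z - of_real x3 = - (?t - of_real x3)" by (simp only: power2_eq_iff)
  thus "z = ?t" using z u by (auto simp: upper_half_def complex_eq_iff)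
qed

lemma tau3_upper: "tau3 \<in> upper_half" and tau3_norm: "(Re tau3)^2 + (Im tau3)^2 = eta"
  unfolding tau3_eq upper_half_def using x3_sq_less by auto

lemma tau3'_eq: "tau3' = - cnj tau3"
proof -
  have n: "tau3 * cnj tau3 = of_real eta" using tau3_norm by (simp add: complex_mult_cnj)
  have "tau3 \<noteq> 0" using tau3_upper by (auto simp: upper_half_def)
  have "tau3' = of_real (- sqrt eta) / (of_real (1 / sqrt eta) * tau3)" unfolding tau3'_def moebius_def g2_def by simp
  also have "\<dots> = - of_real (sqrt eta * sqrt eta) / tau3" by (simp add: field_simps) (simp flip: of_real_mult)
  also have "\<dots> = - cnj tau3" unfolding sqrt_eta_sq n[symmetric] using \<open>tau3 \<noteq> 0\<close> by simp
  finally show ?thesis .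
qed

lemma eta_c0: "eta + c0^2 = 2 * eta / (1 + hh)" "eta - c0^2 = 2 * eta * hh / (1 + hh)"
  unfolding c0_sq using hh_bounds by (simp_all add: field_simps)

lemma kl_tau3: "kl tau3 = vert0"
proof -
  have re: "(eta - c0^2) / (eta + c0^2) = hh" unfolding eta_c0 using hh_bounds by simp
  have "(2 * c0 * x3 / (eta + c0^2))^2 = (hh * tt)^2"
  proof -
    have "tt^2 = (tt * s7) * tt / s7" by (simp add: power2_eq_square)
    also have "\<dots> = (2 - eta) / (2 + eta)" unfolding tt_s7 unfolding tt_def
    proof -
      have "1 - eta / 2 = (2 - eta) / 2" "1 + eta / 2 = (2 + eta) / 2" by simp_all
      hence "(1 - eta / 2) / (1 + eta / 2) = ((2 - eta) / 2) / ((2 + eta) / 2)" by (simp only:)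
      hence "(1 - eta / 2) / (1 + eta / 2) = (2 - eta) / (2 + eta)" by (simp only: divide_divide_eq_left divide_divide_eq_right times_divide_eq_left nonzero_mult_div_cancel_right mult.commute[of 2])
      thus "(1 - eta / 2) * (s7 / (1 + eta / 2)) / s7 = (2 - eta) / (2 + eta)" by simp
    qed
    finally have t2: "tt^2 = (2 - eta) / (2 + eta)" .
    have "2 * c0 * x3 / (eta + c0^2) = c0 * x3 * (1 + hh) / eta" unfolding eta_c0 using hh_bounds by (simp add: field_simps)
    hence "(2 * c0 * x3 / (eta + c0^2))^2 = c0^2 * x3^2 * (1 + hh)^2 / eta^2" by (simp add: power_divide power_mult_distrib)
    also have "\<dots> = x3^2 * (1 - hh^2) / eta" 
    proof -
      have gen: "(e * q / p) * X * p^2 / e^2 = X * (q * p) / e" if "p \<noteq> 0" "e \<noteq> 0" for e q p X :: real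
        using that by (simp add: power2_eq_square)
      have "(1 - hh) * (1 + hh) = 1 - hh^2" by algebra
      moreover have "1 + hh \<noteq> 0" using hh_bounds by simp
      ultimately show ?thesis unfolding c0_sq using gen[of "1 + hh" eta "1 - hh" "x3^2"] by simp
    qed
    also have "\<dots> = (hh * tt)^2" 
    proof -
      have "1 - (eta - 1) = 2 - eta" by simp
      moreover have "eta * a / b * c / eta = a * (c / b)" for a b c by simp
      ultimately show ?thesis unfolding power_mult_distrib hh_sq x3_sq t2 by (simp only:)
    qed
    finally show ?thesis .
  qed
  moreover have "2 * c0 * x3 / (eta + c0^2) \<le> 0" using x3_neg
    by (intro divide_nonpos_nonneg mult_nonneg_nonpos) (simp_all add: less_imp_le add_nonneg_nonneg)
  ultimately have "- (2 * c0 * x3 / (eta + c0^2)) = hh * tt" using hh_bounds tt_pos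
    by (intro power2_eq_imp_eq[of "- (2 * c0 * x3 / (eta + c0^2))" "hh * tt"]) (simp_all only: power2_minus, simp_all)
  hence "2 * c0 * x3 / (eta + c0^2) = - (hh * tt)" by simp
  thus ?thesis unfolding kl_def tau3_norm vert0_def re by (simp add: tau3_eq)
qed

lemma tau3'_upper: "tau3' \<in> upper_half" using tau3_upper unfolding tau3'_eq upper_half_def by simp

lemma kl_tau3': "kl tau3' = w7 * vert0"
proof -
  have "kl tau3' = cnj (kl tau3)" unfolding tau3'_eq kl_def by (simp add: complex_eq_iff)
  thus ?thesis unfolding kl_tau3 vert1 unfolding vert0_def by (simp add: complex_eq_iff)
qed

lemma tau7_upper: "tau7 \<in> upper_half" and kl_tau7: "kl tau7 = 0"
  unfolding tau7_eq by (simp_all add: upper_half_def kl_def complex_eq_iff)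

lemma triangle_F_eq: "triangle_F = {z \<in> upper_half. kl z \<in> convex hull {vert0, w7 * vert0, 0}}"
  unfolding triangle_F_def using hyp_hull_eq[of "{tau3, tau3', tau7}"] tau3_upper tau3'_upper tau7_upper
  by (simp add: kl_tau3 kl_tau3' kl_tau7)

text \<open>The rotated triangles fill the region cut out by the seven lines
  (\<open>sector\<close>), and each of them satisfies all seven conditions
  (\<open>hull_Lf\<close>).\<close>

lemma heptagon_iff: assumes "z \<in> upper_half" shows "z \<in> heptagon_D \<longleftrightarrow> (\<forall>i. Lf i (kl z) 1 \<le> 0)"
proof
  assume "z \<in> heptagon_D"
  then obtain i y where y: "y \<in> upper_half" "kl y \<in> convex hull {vert0, w7 * vert0, 0}" "z = moebius (mpow g7 i) y"
    unfolding heptagon_D_def triangle_F_eq by blast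
  show "\<forall>j. Lf j (kl z) 1 \<le> 0"
  proof
    fix j
    have "Lf j (kl z) 1 = Lf (i + (j + 6 * i)) (w7 ^ i * kl y) 1"
      unfolding y(3) kl_g7_pow[OF y(1)] using Lf_mod7[of j] Lf_mod7[of "i + (j + 6 * i)"] by simp
    also have "\<dots> = Lf (j + 6 * i) (kl y) 1" by (rule Lf_rot')
    also have "\<dots> \<le> 0" by (rule hull_Lf[OF y(2)])
    finally show "Lf j (kl z) 1 \<le> 0" .
  qed
next
  assume "\<forall>i. Lf i (kl z) 1 \<le> 0"
  then obtain i where i: "i < 7" "kl z * cnj (w7 ^ i) \<in> convex hull {vert0, w7 * vert0, 0}" using sector by blast
  then obtain y where y: "y \<in> upper_half" "kl y = kl z * cnj (w7 ^ i)" "z = moebius (mpow g7 i) y"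
    using g7_pow_surj[OF assms refl] by blast
  have "y \<in> triangle_F" using y(1) i(2) unfolding triangle_F_eq y(2)[symmetric] by simp
  thus "z \<in> heptagon_D" unfolding heptagon_D_def using i(1) y(3) by blast
qed

text \<open>The vertex on the lines \<open>i\<close> and \<open>i + 1\<close> comes from
  \<open>tau3'\<close>, the one on the lines \<open>i\<close> and \<open>i + 6\<close> from
  \<open>tau3\<close>; the vertex that is left out makes its inequality strict.\<close>

lemma side_iff:
  assumes z: "z \<in> upper_half"
  shows "z \<in> side_e i \<longleftrightarrow> Lf i (kl z) 1 = 0 \<and> Lf (i + 1) (kl z) 1 < 0 \<and> Lf (i + 6) (kl z) 1 \<le> 0"
    "z \<in> side_e' i \<longleftrightarrow> Lf i (kl z) 1 = 0 \<and> Lf (i + 1) (kl z) 1 \<le> 0 \<and> Lf (i + 6) (kl z) 1 < 0"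
proof -
  have gen: "z \<in> moebius (mpow g7 i) ` (hyp_segment tau3 tau3' - {t}) \<longleftrightarrow> kl z * cnj (w7 ^ i) \<in> closed_segment vert0 (w7 * vert0) - {kl t}"
    if t: "t \<in> upper_half" for t
  proof
    assume "z \<in> moebius (mpow g7 i) ` (hyp_segment tau3 tau3' - {t})"
    then obtain y where y: "y \<in> hyp_segment tau3 tau3'" "y \<noteq> t" "z = moebius (mpow g7 i) y" by blast
    have yu: "y \<in> upper_half" using y(1) unfolding hyp_segment_def by blast
    have "kl z * cnj (w7 ^ i) = kl y" unfolding y(3) kl_g7_pow[OF yu] using w7_pow_cnj[of i] by (simp add: mult.commute mult.left_commute)
    moreover have "kl y \<in> closed_segment vert0 (w7 * vert0)" using y(1) hyp_segment_iff[OF tau3_upper tau3'_upper yu] by (simp add: kl_tau3 kl_tau3')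
    moreover have "kl y \<noteq> kl t" using y(2) kl_inj[OF yu t] by blast
    ultimately show "kl z * cnj (w7 ^ i) \<in> closed_segment vert0 (w7 * vert0) - {kl t}" by simp
  next
    assume a: "kl z * cnj (w7 ^ i) \<in> closed_segment vert0 (w7 * vert0) - {kl t}"
    obtain y where y: "y \<in> upper_half" "kl y = kl z * cnj (w7 ^ i)" "z = moebius (mpow g7 i) y"
      using g7_pow_surj[OF z refl] by blast
    have "y \<in> hyp_segment tau3 tau3'" using a y hyp_segment_iff[OF tau3_upper tau3'_upper y(1)] by (simp add: kl_tau3 kl_tau3')
    moreover have "y \<noteq> t" using a y by auto
    ultimately show "z \<in> moebius (mpow g7 i) ` (hyp_segment tau3 tau3' - {t})" using y(3) by blast
  qed
  have r: "Lf (i + k) (kl z) 1 = Lf k (kl z * cnj (w7 ^ i)) 1" for k by (rule Lf_rot)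
  show "z \<in> side_e i \<longleftrightarrow> Lf i (kl z) 1 = 0 \<and> Lf (i + 1) (kl z) 1 < 0 \<and> Lf (i + 6) (kl z) 1 \<le> 0"
    unfolding side_e_def gen[OF tau3'_upper] kl_tau3' edge0_iff r using r[of 0] by simp
  show "z \<in> side_e' i \<longleftrightarrow> Lf i (kl z) 1 = 0 \<and> Lf (i + 1) (kl z) 1 \<le> 0 \<and> Lf (i + 6) (kl z) 1 < 0"
    unfolding side_e'_def gen[OF tau3_upper] kl_tau3 edge0_iff r using r[of 0] by simp
qed

section \<open>Isotropic vectors and sides of vertices\<close>

text \<open>For complex \<open>A, B\<close> representing boundary points \<open>A\<^sup>2 / \<bar>A\<bar>\<^sup>2\<close>, \<open>B\<^sup>2 / \<bar>B\<bar>\<^sup>2\<close> of the Klein disc, the sign of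
  \<open>Im (cnj A * B) * Fc j A B\<close> tells on which side of the line through them the \<open>j\<close>-th vertex lies.\<close>

definition Nc :: "nat \<Rightarrow> complex \<Rightarrow> real" where
  "Nc j A = Lf j (A^2) ((cmod A)^2)"

definition Fc :: "nat \<Rightarrow> complex \<Rightarrow> complex \<Rightarrow> real" where
  "Fc j A B = Re (A * cnj B) - Re (w7 ^ j * vert0 * cnj (A * B))"

lemma tt_sq: "tt^2 = (2 - eta) / (2 + eta)"
proof -
  have "tt^2 * (1 + eta/2) = tt * (tt + tt * (eta/2))" by (simp add: power2_eq_square algebra_simps)
  also have "\<dots> = 1 - eta / 2" unfolding tt_eta tt_s7 ..
  finally show ?thesis using eta_gt_1 by (simp add: field_simps)
qed

lemma hh_tt_sq: "hh^2 * (1 + tt^2) = 4 * (eta - 1) / (2 + eta)"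
  unfolding hh_sq tt_sq using eta_gt_1 by (simp add: field_simps)

text \<open>The circumradius is less than 1: the vertices lie inside the disc, and half the side is
  shorter than half the chord carrying it.\<close>

lemma hh_tt_less: "hh^2 * (1 + tt^2) < 1" "hh^2 * tt^2 < 1 - hh^2"
proof -
  show 1: "hh^2 * (1 + tt^2) < 1" unfolding hh_tt_sq using eta_bounds by (simp add: field_simps)
  thus "hh^2 * tt^2 < 1 - hh^2" by (simp add: algebra_simps)
qed

lemma Fc_01:
  "Fc 0 A B = Re (A * cnj B) - hh * Re (A * B) + hh * tt * Im (A * B)"
  "Fc 1 A B = Re (A * cnj B) - hh * Re (A * B) - hh * tt * Im (A * B)"
proof -
  show "Fc 0 A B = Re (A * cnj B) - hh * Re (A * B) + hh * tt * Im (A * B)"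
    unfolding Fc_def by (simp add: vert0_def algebra_simps)
  show "Fc 1 A B = Re (A * cnj B) - hh * Re (A * B) - hh * tt * Im (A * B)"
    unfolding Fc_def power_one_right vert1 by (simp add: algebra_simps)
qed

text \<open>\<open>A\<close> stands for the boundary point A^2 / |A|^2, so rotating the disc by
  \<open>w7\<close> multiplies \<open>A\<close> by a square root \<open>K\<close> of
  \<open>w7\<close>.\<close>

lemma Fc_rot: assumes "K^2 = w7" "K * cnj K = 1"
  shows "Fc (Suc j) (K * A) (K * B) = Fc j A B"
proof -
  have "K * A * cnj (K * B) = K * cnj K * (A * cnj B)" by simp
  hence 1: "K * A * cnj (K * B) = A * cnj B" using assms by simp
  have "w7 ^ Suc j * vert0 * cnj (K * A * (K * B)) = (K * cnj K)^2 * (w7 ^ j * vert0 * cnj (A * B))"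
    unfolding assms(1)[symmetric] by (simp add: power2_eq_square)
  hence 2: "w7 ^ Suc j * vert0 * cnj (K * A * (K * B)) = w7 ^ j * vert0 * cnj (A * B)" using assms by simp
  show ?thesis unfolding Fc_def 1 2 ..
qed

lemma Nc_rot: assumes "K^2 = w7" "K * cnj K = 1"
  shows "Nc (Suc j) (K * A) = Nc j A"
proof -
  have n: "cmod K = 1" using assms(2) by (metis complex_mod_cnj complex_norm_square norm_one of_real_eq_1_iff norm_ge_zero power2_eq_1_iff add.inverse_inverse neg_le_0_iff_le not_one_le_zero)
  have "(K * A)^2 = w7 ^ 1 * A^2" using assms(1) by (simp add: power_mult_distrib)
  thus ?thesis unfolding Nc_def norm_mult n using Lf_rot'[of 1 j "A^2"] by simp
qed

lemma w7_root: obtains K where "K^2 = w7" "K * cnj K = 1"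
proof
  show "(cis (pi/7))^2 = w7" unfolding w7_def Complex.DeMoivre by simp
  show "cis (pi/7) * cnj (cis (pi/7)) = 1" by (simp add: cis_cnj cis_mult)
qed

lemma rot_shift: assumes "K * cnj K = 1" shows "\<exists>A'. A = K ^ j * A'"
  using assms by (intro exI[of _ "cnj K ^ j * A"]) (simp add: mult.assoc[symmetric] power_mult_distrib[symmetric])

lemma Fc_rot_pow: assumes "K^2 = w7" "K * cnj K = 1"
  shows "Fc (j + n) (K ^ j * A) (K ^ j * B) = Fc n A B"
  by (induction j) (simp_all add: Fc_rot[OF assms] mult.assoc)

lemma Nc_rot_pow: assumes "K^2 = w7" "K * cnj K = 1"
  shows "Nc (j + n) (K ^ j * A) = Nc n A"
  by (induction j) (simp_all add: Nc_rot[OF assms] mult.assoc)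

lemma Im_rot: assumes "K * cnj K = 1" shows "Im (cnj (K ^ j * A) * (K ^ j * B)) = Im (cnj A * B)"
proof -
  have "cnj (K ^ j * A) * (K ^ j * B) = (K * cnj K)^j * (cnj A * B)" by (simp add: power_mult_distrib)
  hence "cnj (K ^ j * A) * (K ^ j * B) = cnj A * B" unfolding assms power_one mult_1_left .
  thus ?thesis by (simp only:)
qed

lemma Fc_mod7: "Fc (j mod 7) A B = Fc j A B" 
proof -
  have "w7 ^ j = w7 ^ (7 * (j div 7) + j mod 7)" by simp
  also have "\<dots> = w7 ^ (j mod 7)" unfolding power_add power_mult w7_7 by simp
  finally show ?thesis unfolding Fc_def by simp
qed

text \<open>The products A B = X + i S and A cnj B = Y - i D carry all information on the pair; the
  third identity is the equality of their moduli.\<close>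

lemma Nc_times:
  fixes A B defines "X \<equiv> Re (A * B)" and "S \<equiv> Im (A * B)" and "Y \<equiv> Re (A * cnj B)" and "D \<equiv> Im (cnj A * B)"
  shows "Nc 0 A * (cmod B)^2 = X * (Y - hh * X) - hh * S^2 + S * D"
    "Nc 0 B * (cmod A)^2 = X * (Y - hh * X) - hh * S^2 - S * D"
    "X^2 + S^2 = Y^2 + D^2" "(cmod A)^2 * (cmod B)^2 = X^2 + S^2"
proof -
  obtain a b where A: "A = Complex a b" by (cases A)
  obtain c d where B: "B = Complex c d" by (cases B)
  have *: "X = a * c - b * d" "S = a * d + b * c" "Y = a * c + b * d" "D = a * d - b * c"
    "Nc 0 A = a^2 - b^2 - hh * (a^2 + b^2)" "Nc 0 B = c^2 - d^2 - hh * (c^2 + d^2)"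
    "(cmod A)^2 = a^2 + b^2" "(cmod B)^2 = c^2 + d^2"
    unfolding Nc_def Lf_def assms cmod_power2 A B by (simp_all add: power2_eq_square)
  show "Nc 0 A * (cmod B)^2 = X * (Y - hh * X) - hh * S^2 + S * D" unfolding * by algebra
  show "Nc 0 B * (cmod A)^2 = X * (Y - hh * X) - hh * S^2 - S * D" unfolding * by algebra
  show "X^2 + S^2 = Y^2 + D^2" "(cmod A)^2 * (cmod B)^2 = X^2 + S^2" unfolding * by algebra+
qed

text \<open>A chord that weakly separates the two vertices of edge 0 meets this edge, so its end
  points lie on different sides of the edge line. In formulas, e = Y - hh X is at most hh tt |S| in
  modulus, and this makes S D dominate the other terms of \<open>Nc_times\<close>. The sign of S
  tells the direction of the crossing.\<close>

lemma Nc_sign: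
  assumes D: "Im (cnj A * B) > 0" and F: "(Fc 0 A B \<ge> 0 \<and> 0 \<ge> Fc 1 A B) \<or> (Fc 0 A B \<le> 0 \<and> 0 \<le> Fc 1 A B)"
    and S0: "Im (A * B) \<noteq> 0"
  shows "Im (A * B) > 0 \<Longrightarrow> Nc 0 A > 0 \<and> Nc 0 B < 0" "Im (A * B) < 0 \<Longrightarrow> Nc 0 A < 0 \<and> Nc 0 B > 0"
proof -
  define X S Y D where "X = Re (A * B)" and "S = Im (A * B)" and "Y = Re (A * cnj B)" and "D = Im (cnj A * B)"
  define e where "e = Y - hh * X"
  note N = Nc_times[where A = A and B = B, folded X_def S_def Y_def D_def, folded e_def]
  have "\<bar>e\<bar> \<le> \<bar>hh * tt * S\<bar>" using F unfolding Fc_01 X_def[symmetric] S_def[symmetric] Y_def[symmetric] e_def[symmetric]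
    by linarith
  hence "e^2 \<le> (hh * tt * S)^2" by (rule abs_le_square_iff[THEN iffD1])
  hence "e^2 \<le> hh^2 * tt^2 * S^2" by (simp add: power_mult_distrib)
  also have "\<dots> < (1 - hh^2) * S^2" using hh_tt_less(2) S0 by (intro mult_strict_right_mono) (auto simp: S_def)
  finally have e: "e^2 < (1 - hh^2) * S^2" .
  have D2: "D^2 = X^2 + S^2 - (hh * X + e)^2" using N(3) unfolding e_def by simp
  have "(S * D)^2 - (hh * S^2 - X * e)^2 = (X^2 + S^2) * ((1 - hh^2) * S^2 - e^2)"
    unfolding power_mult_distrib D2 by algebra
  moreover have "X^2 + S^2 > 0" using S0 unfolding S_def by (simp add: add_nonneg_pos)
  ultimately have "(hh * S^2 - X * e)^2 < (S * D)^2" using e by (smt (verit) mult_pos_pos)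
  hence lt: "\<bar>X * e - hh * S^2\<bar> < \<bar>S * D\<bar>" 
    using abs_le_square_iff[of "S * D" "hh * S^2 - X * e"] by linarith
  have AB: "A \<noteq> 0" "B \<noteq> 0" using S0 by auto
  hence p: "(cmod A)^2 > 0" "(cmod B)^2 > 0" by auto
  have D0: "D > 0" using D unfolding D_def .
  show "Nc 0 A > 0 \<and> Nc 0 B < 0" if "Im (A * B) > 0"
  proof -
    have "S * D > 0" using that D0 unfolding S_def by simp
    hence "\<bar>X * e - hh * S^2\<bar> < S * D" using lt by linarith
    hence "X * e - hh * S^2 + S * D > 0" "X * e - hh * S^2 - S * D < 0" by linarith+
    hence "Nc 0 A * (cmod B)^2 > 0" "Nc 0 B * (cmod A)^2 < 0" using N(1,2) by simp_all
    thus ?thesis using p by (simp add: zero_less_mult_iff mult_less_0_iff)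
  qed
  show "Nc 0 A < 0 \<and> Nc 0 B > 0" if "Im (A * B) < 0"
  proof -
    have "S * D < 0" using that D0 unfolding S_def by (simp add: mult_less_0_iff)
    hence "\<bar>X * e - hh * S^2\<bar> < - (S * D)" using lt by linarith
    hence "Nc 0 A * (cmod B)^2 < 0" "Nc 0 B * (cmod A)^2 > 0" unfolding N(1,2) by linarith+
    thus ?thesis using p by (simp add: zero_less_mult_iff mult_less_0_iff)
  qed
qed

lemma descent_sign:
  assumes "Im (cnj A * B) > 0" "Fc j A B > 0" "Fc (Suc j) A B \<le> 0"
  shows "Nc j A > 0" "Nc j B < 0"
proof -
  obtain K where K: "K^2 = w7" "K * cnj K = 1" by (rule w7_root)
  obtain A' B' where AB: "A = K ^ j * A'" "B = K ^ j * B'" using rot_shift[OF K(2)] by meson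
  have F: "Fc 0 A' B' > 0" "Fc 1 A' B' \<le> 0" using assms(2,3) Fc_rot_pow[OF K, of j 0 A' B'] Fc_rot_pow[OF K, of j 1 A' B'] unfolding AB by simp_all
  have D: "Im (cnj A' * B') > 0" using assms(1) unfolding AB Im_rot[OF K(2)] .
  have "hh * tt * Im (A' * B') > 0" using F unfolding Fc_01 by linarith
  hence S: "Im (A' * B') > 0" using mult_pos_pos[OF hh_bounds(1) tt_pos] zero_less_mult_pos by blast
  have "Nc 0 A' > 0 \<and> Nc 0 B' < 0" using Nc_sign(1)[OF D] F S by simp
  thus "Nc j A > 0" "Nc j B < 0" using Nc_rot_pow[OF K, of j 0] unfolding AB by simp_all
qed

text \<open>For the last claim: a chord through the heptagon comes at least as near to the centre as
  the vertices. By Cauchy-Schwarz |Y| is at most the circumradius times |A B|, and Y^2 + D^2 = |A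
  B|^2.\<close>

lemma ascent_sign:
  assumes "Im (cnj A * B) > 0" "Fc 0 A B \<le> 0" "Fc 1 A B > 0"
  shows "Nc 0 A < 0" "Nc 0 B > 0" and "(cmod A)^2 * (cmod B)^2 * (1 - hh^2 * (1 + tt^2)) \<le> (Im (cnj A * B))^2"
proof -
  have "hh * tt * Im (A * B) < 0" using assms(2,3) unfolding Fc_01 by linarith
  hence S: "Im (A * B) < 0" using hh_bounds tt_pos by (simp add: mult_less_0_iff)
  show "Nc 0 A < 0" "Nc 0 B > 0" using Nc_sign(2)[OF assms(1)] assms(2,3) S by simp_all
  define X S Y D where "X = Re (A * B)" and "S = Im (A * B)" and "Y = Re (A * cnj B)" and "D = Im (cnj A * B)"
  note N = Nc_times[where A = A and B = B, folded X_def S_def Y_def D_def]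
  have "\<bar>Y - hh * X\<bar> \<le> hh * tt * \<bar>S\<bar>" using assms(2,3) S unfolding Fc_01 X_def[symmetric] S_def[symmetric] Y_def[symmetric]
    by (simp add: abs_if)
  moreover have "\<bar>hh * X\<bar> = hh * \<bar>X\<bar>" using hh_bounds by (simp add: abs_mult)
  ultimately have "\<bar>Y\<bar> \<le> hh * (\<bar>X\<bar> + tt * \<bar>S\<bar>)" unfolding distrib_left by (simp add: abs_if split: if_splits)
  hence "Y^2 \<le> (hh * (\<bar>X\<bar> + tt * \<bar>S\<bar>))^2" by (metis abs_ge_zero power2_abs power_mono)
  also have "\<dots> = hh^2 * (\<bar>X\<bar> + tt * \<bar>S\<bar>)^2" by (simp add: power_mult_distrib)
  also have "\<dots> \<le> hh^2 * ((1 + tt^2) * (X^2 + S^2))"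
  proof (rule mult_left_mono)
    have "(1 + tt^2) * (\<bar>X\<bar>^2 + \<bar>S\<bar>^2) - (\<bar>X\<bar> + tt * \<bar>S\<bar>)^2 = (tt * \<bar>X\<bar> - \<bar>S\<bar>)^2" by algebra
    thus "(\<bar>X\<bar> + tt * \<bar>S\<bar>)^2 \<le> (1 + tt^2) * (X^2 + S^2)" using zero_le_power2[of "tt * \<bar>X\<bar> - \<bar>S\<bar>"] unfolding power2_abs by linarith
  qed simp
  finally have "Y^2 \<le> hh^2 * (1 + tt^2) * (X^2 + S^2)" by (simp add: mult.assoc)
  moreover have "(X^2 + S^2) * (1 - hh^2 * (1 + tt^2)) = Y^2 + D^2 - hh^2 * (1 + tt^2) * (X^2 + S^2)" using N(3) by (simp add: algebra_simps)
  ultimately show "(cmod A)^2 * (cmod B)^2 * (1 - hh^2 * (1 + tt^2)) \<le> (Im (cnj A * B))^2"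
    unfolding N(4) D_def[symmetric] by linarith
qed

text \<open>The lines \<open>j\<close> and \<open>Suc j\<close> meet in the vertex of index
  \<open>Suc j\<close>, so for independent A and B the wedge of the two edge functions vanishes
  exactly when the chord passes through that vertex. This identity links edge functions to vertex
  functions.\<close>

lemma Nc_wedge:
  "Nc j A * Nc (Suc j) B - Nc j B * Nc (Suc j) A = 2 * s7 * Im (cnj A * B) * Fc (Suc j) A B"
proof -
  have *: "Nc 0 A * Nc 1 B - Nc 0 B * Nc 1 A = 2 * s7 * Im (cnj A * B) * Fc 1 A B" for A B
  proof -
    define X S Y D where "X = Re (A * B)" and "S = Im (A * B)" and "Y = Re (A * cnj B)" and "D = Im (cnj A * B)"
    define c where "c = eta / 2"
    have t: "tt * s7 = 1 - c" unfolding c_def by (rule tt_s7)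
    have i: "Re (A^2) * Im (B^2) - Im (A^2) * Re (B^2) = 2 * Y * D"
      "Re (A^2) * (cmod B)^2 - (cmod A)^2 * Re (B^2) = 2 * D * S"
      "Im (A^2) * (cmod B)^2 - (cmod A)^2 * Im (B^2) = - 2 * D * X"
      unfolding cmod_power2 X_def Y_def S_def D_def by (simp_all add: power2_eq_square; algebra)+
    have "Nc 0 A * Nc 1 B - Nc 0 B * Nc 1 A = s7 * (Re (A^2) * Im (B^2) - Im (A^2) * Re (B^2))
       - hh * (1 - c) * (Re (A^2) * (cmod B)^2 - (cmod A)^2 * Re (B^2)) + hh * s7 * (Im (A^2) * (cmod B)^2 - (cmod A)^2 * Im (B^2))"
      unfolding Nc_def Lf_table c_def[symmetric] by algebra
    also have "\<dots> = 2 * s7 * D * (Y - hh * X - hh * tt * S)" unfolding i t[symmetric] by algebra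
    finally show ?thesis unfolding Fc_01 X_def S_def Y_def D_def .
  qed
  obtain K where K: "K^2 = w7" "K * cnj K = 1" by (rule w7_root)
  obtain A' B' where AB: "A = K ^ j * A'" "B = K ^ j * B'" using rot_shift[OF K(2)] by meson
  show ?thesis unfolding AB using *[of A' B'] Nc_rot_pow[OF K, of j 0] Nc_rot_pow[OF K, of j 1]
    Fc_rot_pow[OF K, of j 1 A' B'] by (simp only: Im_rot[OF K(2)]) simp
qed

section \<open>Lifting end points to vectors\<close>

text \<open>End points are lifted to vectors of \<open>\<real>\<^sup>2\<close>, on which matrices act linearly; \<open>(nu v)\<^sup>2 / qf v\<close> is the boundary point
  in the Klein disc, so that \<open>r * NN i a + NN i b\<close> is, up to a positive factor, the \<open>i\<close>-th edge function at a point of the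
  geodesic from \<open>b\<close> to \<open>a\<close>, and \<open>r\<close> increases along it.\<close>

definition nu :: "real^2 \<Rightarrow> complex" where "nu v = Complex (v$1) (c0 * v$2)"
definition qf :: "real^2 \<Rightarrow> real" where "qf v = (cmod (nu v))^2"
definition NN :: "nat \<Rightarrow> real^2 \<Rightarrow> real" where "NN j v = Nc j (nu v)"
definition Ff :: "nat \<Rightarrow> real^2 \<Rightarrow> real^2 \<Rightarrow> real" where "Ff j a b = Fc j (nu a) (nu b)"
definition d2 :: "real^2 \<Rightarrow> real^2 \<Rightarrow> real" where "d2 a b = a$1 * b$2 - a$2 * b$1"

lemma qf_eq: "qf v = (v$1)^2 + c0^2 * (v$2)^2"
  by (simp add: qf_def nu_def cmod_power2 power_mult_distrib)

lemma Im_nu: "Im (cnj (nu a) * nu b) = c0 * d2 a b"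
  by (simp add: nu_def d2_def algebra_simps)

lemma qf_pos: "v \<noteq> 0 \<Longrightarrow> qf v > 0"
proof -
  assume "v \<noteq> 0"
  hence "nu v \<noteq> 0" by (auto simp: nu_def complex_eq_iff vec_eq_iff forall_2)
  thus ?thesis by (simp add: qf_def)
qed

lemma qf_nonneg: "qf v \<ge> 0" by (simp add: qf_def)

lemma NN_Lf: "NN j v = Lf j ((nu v)^2) (qf v)" by (simp add: NN_def Nc_def qf_def)

lemma NN_7: "NN (j + 7) v = NN j v" "NN 7 v = NN 0 v" using Lf_7 Lf_7(1)[of 0] by (simp_all add: NN_Lf)

lemma Ff_mod7: "Ff (j mod 7) a b = Ff j a b" by (simp add: Ff_def Fc_mod7)

lemma Ff_7: "Ff (j + 7) a b = Ff j a b" "Ff 7 a b = Ff 0 a b"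
  using Ff_mod7[of "j + 7"] Ff_mod7[of j] Ff_mod7[of 7] by simp_all

lemma d2_nz: "d2 a b \<noteq> 0 \<Longrightarrow> a \<noteq> 0 \<and> b \<noteq> 0" by (auto simp: d2_def)

lemma NN_wedge: "NN j a * NN (Suc j) b - NN j b * NN (Suc j) a = 2 * s7 * (c0 * d2 a b) * Ff (Suc j) a b"
  unfolding NN_def Ff_def Im_nu[symmetric] by (rule Nc_wedge)

lemma d2_act: "d2 (M *v a) (M *v b) = det M * d2 a b"
  by (simp add: d2_def det_2 algebra_simps)

lemma d2_swap: "d2 a b = - d2 b a" by (simp add: d2_def)

lemma nu_scale: "nu (r *s v) = of_real r * nu v"
  by (simp add: nu_def complex_eq_iff)

lemma qf_scale: "qf (r *s v) = r^2 * qf v"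
  by (simp add: qf_def nu_scale norm_mult power_mult_distrib)

fun rep :: "rp1 \<Rightarrow> real^2 \<Rightarrow> bool" where
  "rep (Pt x) v \<longleftrightarrow> v$2 \<noteq> 0 \<and> v$1 = x * v$2"
| "rep Infty v \<longleftrightarrow> v$2 = 0 \<and> v$1 \<noteq> 0"

lemma rep_nz: "rep x v \<Longrightarrow> v \<noteq> 0" by (cases x) auto

lemma rep_ex: "\<exists>v. rep x v"
proof (cases x)
  case (Pt y) thus ?thesis by (intro exI[of _ "vector [y, 1]"]) simp
next
  case Infty thus ?thesis by (intro exI[of _ "vector [1, 0]"]) simp
qed

lemma rep_d2: "rep x v \<Longrightarrow> rep y w \<Longrightarrow> d2 v w = 0 \<longleftrightarrow> x = y"
  by (cases x; cases y) (auto simp: d2_def)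

lemma rep_scale: "r \<noteq> 0 \<Longrightarrow> rep x v \<Longrightarrow> rep x (r *s v)"
  by (cases x) (auto simp: algebra_simps)

lemma rep_act: assumes "rep x v" "det M \<noteq> 0" shows "rep (act M x) (M *v v)"
proof (cases x)
  case (Pt y)
  have v: "v$2 \<noteq> 0" "v$1 = y * v$2" using assms(1) Pt by auto
  have e: "M$1$1 * v$1 + M$1$2 * v$2 = (M$1$1 * y + M$1$2) * v$2" "M$2$1 * v$1 + M$2$2 * v$2 = (M$2$1 * y + M$2$2) * v$2"
    unfolding v(2) by (simp_all add: algebra_simps)
  show ?thesis
  proof (cases "M$2$1 * y + M$2$2 = 0")
    case True
    have "M$1$1 * y + M$1$2 \<noteq> 0"
    proof
      assume z: "M$1$1 * y + M$1$2 = 0"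
      have "det M = M$1$1 * (M$2$1 * y + M$2$2) - M$2$1 * (M$1$1 * y + M$1$2)" by (simp add: det_2 algebra_simps)
      thus False using assms(2) z True by simp
    qed
    thus ?thesis using True v Pt e by simp
  next
    case False thus ?thesis using v Pt e by simp
  qed
next
  case Infty
  hence v: "v$2 = 0" "v$1 \<noteq> 0" using assms(1) by auto
  have "M$1$1 \<noteq> 0 \<or> M$2$1 \<noteq> 0" using assms(2) by (auto simp: det_2)
  thus ?thesis using v Infty by auto
qed

section \<open>Geodesics and the heptagon\<close>

fun lift0 :: "rp1 \<Rightarrow> complex" where "lift0 (Pt x) = Complex x c0" | "lift0 Infty = 1"

lemma lift0_norm: "(cmod (lift0 (Pt x)))^2 = x^2 + c0^2" "(cmod (lift0 Infty))^2 = 1"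
  unfolding cmod_power2 by simp_all

lemma rep_lift0: "rep x v \<Longrightarrow> \<exists>s. s \<noteq> 0 \<and> nu v = of_real s * lift0 x"
proof (cases x)
  case (Pt y) thus "rep x v \<Longrightarrow> ?thesis" by (intro exI[of _ "v$2"]) (simp add: nu_def complex_eq_iff)
next
  case Infty thus "rep x v \<Longrightarrow> ?thesis" by (intro exI[of _ "v$1"]) (simp add: nu_def complex_eq_iff)
qed

lemma kl_frac: assumes "(Re z)^2 + (Im z)^2 = N / M" "Re z = R / M" "M > 0"
  shows "of_real (N + c0^2 * M) * kl z = Complex (N - c0^2 * M) (2 * c0 * R)"
proof -
  have p: "N / M + c0^2 > 0" using kl_denom_pos[of z] unfolding assms(1) .
  have e: "N + c0^2 * M = M * (N / M + c0^2)" "N - c0^2 * M = M * (N / M - c0^2)" using assms(3) by (simp_all add: field_simps)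
  have q: "N + c0^2 * M \<noteq> 0" unfolding e using p assms(3) by simp
  have "kl z = Complex ((M * (N / M - c0^2)) / (M * (N / M + c0^2))) ((M * (2 * c0 * (R / M))) / (M * (N / M + c0^2)))"
    unfolding kl_def unfolding assms(1) unfolding assms(2) using assms(3) p by simp
  also have "\<dots> = Complex ((N - c0^2 * M) / (N + c0^2 * M)) ((2 * c0 * R) / (N + c0^2 * M))"
    unfolding e[symmetric] using assms(3) by simp
  finally show ?thesis using q by (simp add: complex_eq_iff)
qed

text \<open>In the hyperboloid picture a unit speed geodesic is e^u times one isotropic vector plus
  e^(-u) times another; up to a common factor the weights are e^(2u) and 1.\<close>

lemma geodesic_kl0:
  assumes "\<alpha> \<noteq> \<beta>"
  shows "geodesic \<beta> \<alpha> u \<in> upper_half"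
    "of_real (exp (2 * u) * (cmod (lift0 \<alpha>))^2 + (cmod (lift0 \<beta>))^2) * kl (geodesic \<beta> \<alpha> u)
      = of_real (exp (2 * u)) * (lift0 \<alpha>)^2 + (lift0 \<beta>)^2"
proof -
  define e where "e = exp (2 * u)"
  have e0: "e > 0" unfolding e_def by simp
  have "geodesic \<beta> \<alpha> u \<in> upper_half \<and> of_real (e * (cmod (lift0 \<alpha>))^2 + (cmod (lift0 \<beta>))^2) * kl (geodesic \<beta> \<alpha> u)
      = of_real e * (lift0 \<alpha>)^2 + (lift0 \<beta>)^2"
  proof (cases \<alpha>)
    case a: (Pt a)
    show ?thesis
    proof (cases \<beta>)
      case b: (Pt b)
      have ab: "a \<noteq> b" using assms a b by simp
      define z where "z = geodesic \<beta> \<alpha> u"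
      have T: "tanh u = (e - 1) / (e + 1)"
      proof -
        have "exp (- 2 * u) = 1 / e" unfolding e_def by (simp add: exp_minus field_simps)
        moreover have "(1 - 1 / e) / (1 + 1 / e) = (e - 1) / (e + 1)"
        proof -
          have "1 - 1 / e = (e - 1) / e" "1 + 1 / e = (e + 1) / e" using e0 by (simp_all add: field_simps)
          thus ?thesis using e0 by simp
        qed
        ultimately show ?thesis unfolding tanh_real_altdef by (simp only:)
      qed
      have z: "Re z = (a + b) / 2 + (a - b) / 2 * tanh u" "Im z = \<bar>a - b\<bar> / 2 / cosh u" unfolding z_def a b by simp_all
      have "(Im z)^2 = (a - b)^2 / 4 * (1 / (cosh u)^2)" unfolding z by (simp add: power_divide)
      also have "1 / (cosh u)^2 = 1 - (tanh u)^2" 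
      proof -
        have "c \<noteq> 0 \<Longrightarrow> 1 / c = 1 - s / c" if "c = s + 1" for c s :: real using that by (simp add: field_simps)
        from this[OF cosh_square_eq[of u]] show ?thesis unfolding tanh_def power_divide using cosh_real_pos[of u] by simp
      qed
      finally have im: "(Im z)^2 = (a - b)^2 / 4 * (1 - (tanh u)^2)" .
      have "(Re z)^2 + (Im z)^2 = (a^2 + b^2) / 2 + (a^2 - b^2) / 2 * tanh u"
        unfolding im z(1) by (simp add: field_simps power2_eq_square)
      also have "\<dots> = (e * a^2 + b^2) / (e + 1)" unfolding T using e0 by (simp add: field_simps)
      finally have 1: "(Re z)^2 + (Im z)^2 = (e * a^2 + b^2) / (e + 1)" .
      have 2: "Re z = (e * a + b) / (e + 1)" unfolding z(1) T using e0 by (simp add: field_simps)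
      have "z \<in> upper_half" using ab z(2) unfolding upper_half_def by (simp add: cosh_real_pos)
      moreover have "of_real ((e * a^2 + b^2) + c0^2 * (e + 1)) * kl z = Complex ((e * a^2 + b^2) - c0^2 * (e + 1)) (2 * c0 * (e * a + b))"
        by (rule kl_frac[OF 1 2]) (use e0 in simp)
      ultimately show ?thesis unfolding z_def[symmetric] unfolding a b lift0_norm
        by (simp add: complex_eq_iff power2_eq_square algebra_simps)
    next
      case b: Infty
      define z where "z = geodesic \<beta> \<alpha> u"
      have z: "Re z = a" "Im z = exp (- u)" unfolding z_def a b by simp_all
      have "e * (exp (- u) * exp (-u)) = 1" unfolding e_def by (simp add: exp_add[symmetric])
      hence 1: "(Re z)^2 + (Im z)^2 = (e * a^2 + 1) / e" unfolding z using e0 by (simp add: field_simps power2_eq_square)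
      have 2: "Re z = (e * a) / e" using z e0 by simp
      have "z \<in> upper_half" using z unfolding upper_half_def by simp
      moreover have "of_real ((e * a^2 + 1) + c0^2 * e) * kl z = Complex ((e * a^2 + 1) - c0^2 * e) (2 * c0 * (e * a))"
        by (rule kl_frac[OF 1 2 e0])
      ultimately show ?thesis unfolding z_def[symmetric] unfolding a b lift0_norm
        by (simp add: complex_eq_iff power2_eq_square algebra_simps)
    qed
  next
    case a: Infty
    then obtain b where b: "\<beta> = Pt b" using assms by (cases \<beta>) auto
    define z where "z = geodesic \<beta> \<alpha> u"
    have z: "Re z = b" "Im z = exp u" unfolding z_def a b by simp_all
    have "exp u * exp u = e" unfolding e_def by (simp add: exp_add[symmetric])
    hence 1: "(Re z)^2 + (Im z)^2 = (e + b^2) / 1" unfolding z by (simp add: power2_eq_square)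
    have 2: "Re z = b / 1" using z by simp
    have "z \<in> upper_half" using z unfolding upper_half_def by simp
    moreover have "of_real ((e + b^2) + c0^2 * 1) * kl z = Complex ((e + b^2) - c0^2 * 1) (2 * c0 * b)"
      by (rule kl_frac[OF 1 2]) simp
    ultimately show ?thesis unfolding z_def[symmetric] unfolding a b lift0_norm
      by (simp add: complex_eq_iff power2_eq_square algebra_simps)
  qed
  thus "geodesic \<beta> \<alpha> u \<in> upper_half"
    "of_real (exp (2 * u) * (cmod (lift0 \<alpha>))^2 + (cmod (lift0 \<beta>))^2) * kl (geodesic \<beta> \<alpha> u)
      = of_real (exp (2 * u)) * (lift0 \<alpha>)^2 + (lift0 \<beta>)^2" unfolding e_def by blast+
qed

text \<open>\<open>\<kappa>\<close> absorbs the scaling of the chosen lifts \<open>a\<close> and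
  \<open>b\<close>; it only shifts the parameter along the geodesic.\<close>

lemma geodesic_Lf:
  assumes "rep \<alpha> a" "rep \<beta> b" "d2 a b \<noteq> 0"
  obtains \<kappa> where "\<kappa> > 0"
    "\<And>u. geodesic \<beta> \<alpha> u \<in> upper_half"
    "\<And>u i. (\<kappa> * exp (2 * u) * qf a + qf b) * Lf i (kl (geodesic \<beta> \<alpha> u)) 1 = \<kappa> * exp (2 * u) * NN i a + NN i b"
proof -
  have ne: "\<alpha> \<noteq> \<beta>" using rep_d2[OF assms(1,2)] assms(3) by blast
  obtain s where s: "s \<noteq> 0" "nu a = of_real s * lift0 \<alpha>" using rep_lift0[OF assms(1)] by blast
  obtain t where t: "t \<noteq> 0" "nu b = of_real t * lift0 \<beta>" using rep_lift0[OF assms(2)] by blast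
  define \<kappa> where "\<kappa> = t^2 / s^2"
  have ks: "\<kappa> * s^2 = t^2" unfolding \<kappa>_def using s by simp
  have q: "qf a = s^2 * (cmod (lift0 \<alpha>))^2" "qf b = t^2 * (cmod (lift0 \<beta>))^2"
    unfolding qf_def s t by (simp_all add: norm_mult power_mult_distrib)
  have n: "(nu a)^2 = of_real (s^2) * (lift0 \<alpha>)^2" "(nu b)^2 = of_real (t^2) * (lift0 \<beta>)^2"
    unfolding s t by (simp_all add: power_mult_distrib)
  have "(\<kappa> * exp (2 * u) * qf a + qf b) * Lf i (kl (geodesic \<beta> \<alpha> u)) 1 = \<kappa> * exp (2 * u) * NN i a + NN i b" for u i
  proof -
    define e where "e = exp (2 * u)"
    define T0 where "T0 = e * (cmod (lift0 \<alpha>))^2 + (cmod (lift0 \<beta>))^2"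
    have k: "of_real T0 * kl (geodesic \<beta> \<alpha> u) = of_real e * (lift0 \<alpha>)^2 + (lift0 \<beta>)^2"
      using geodesic_kl0(2)[OF ne] unfolding T0_def e_def .
    have T: "\<kappa> * e * qf a + qf b = t^2 * T0" 
    proof -
      have "\<kappa> * e * qf a = (\<kappa> * s^2) * e * (cmod (lift0 \<alpha>))^2" unfolding q by (simp only: ac_simps)
      thus ?thesis unfolding ks q(2) T0_def by (simp add: algebra_simps)
    qed
    have Z: "of_real (\<kappa> * e) * (nu a)^2 + (nu b)^2 = of_real (t^2 * T0) * kl (geodesic \<beta> \<alpha> u)"
    proof -
      have "of_real (\<kappa> * e) * (nu a)^2 = of_real (\<kappa> * s^2) * of_real e * (lift0 \<alpha>)^2" unfolding n by (simp only: of_real_mult ac_simps)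
      hence "of_real (\<kappa> * e) * (nu a)^2 + (nu b)^2 = of_real (t^2) * (of_real e * (lift0 \<alpha>)^2 + (lift0 \<beta>)^2)"
        unfolding ks n(2) by (simp add: algebra_simps)
      thus ?thesis unfolding k[symmetric] by (simp only: of_real_mult ac_simps)
    qed
    have "\<kappa> * e * NN i a + NN i b = Lf i (of_real (\<kappa> * e) * (nu a)^2 + (nu b)^2) (\<kappa> * e * qf a + qf b)"
      unfolding NN_Lf Lf_lin ..
    also have "\<dots> = t^2 * T0 * Lf i (kl (geodesic \<beta> \<alpha> u)) 1" unfolding Z T using Lf_scale[of i "t^2 * T0" "kl (geodesic \<beta> \<alpha> u)" 1] by simp
    finally show ?thesis unfolding e_def[symmetric] T by simp
  qed
  moreover have "\<kappa> > 0" unfolding \<kappa>_def using s t by simp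
  ultimately show thesis using that geodesic_kl0(1)[OF ne] by blast
qed

text \<open>At the entry point edge function 0 vanishes, so \<open>NN 0 b\<close> is a negative
  multiple of \<open>NN 0 a\<close>, and \<open>NN_wedge\<close> turns the inequalities for the two
  neighbouring edges into the signs of \<open>Ff 1\<close> and \<open>Ff 0\<close>. The sign of
  \<open>NN 0 a\<close> excludes geodesics that only touch the heptagon there.\<close>

lemma enters_ascent:
  assumes "rep \<alpha> a" "rep \<beta> b" "d2 a b > 0" "enters_from \<beta> \<alpha> 0" "NN 0 a < 0"
  shows "Ff 0 a b \<le> 0" "Ff 1 a b > 0"
proof -
  obtain \<kappa> where k: "\<kappa> > 0" "\<And>u. geodesic \<beta> \<alpha> u \<in> upper_half"
    "\<And>u i. (\<kappa> * exp (2 * u) * qf a + qf b) * Lf i (kl (geodesic \<beta> \<alpha> u)) 1 = \<kappa> * exp (2 * u) * NN i a + NN i b"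
    using geodesic_Lf[OF assms(1,2)] assms(3) by (metis less_irrefl)
  obtain u where u: "geodesic \<beta> \<alpha> u \<in> side_e 0" using assms(4) unfolding enters_from_def crosses_D_def by blast
  define T r where "T = \<kappa> * exp (2 * u) * qf a + qf b" and "r = \<kappa> * exp (2 * u)"
  have nz: "a \<noteq> 0" "b \<noteq> 0" using rep_nz assms by auto
  have T: "T > 0" unfolding T_def using k(1) qf_pos nz by (intro add_pos_pos mult_pos_pos) auto
  have L: "r * NN i a + NN i b = T * Lf i (kl (geodesic \<beta> \<alpha> u)) 1" for i unfolding r_def T_def k(3) ..
  have s: "r * NN 0 a + NN 0 b = 0" "r * NN 1 a + NN 1 b < 0" "r * NN 6 a + NN 6 b \<le> 0"
    unfolding L using u T unfolding side_iff[OF k(2)] by (simp_all add: mult_pos_neg mult_nonneg_nonpos)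
  have b0: "NN 0 b = - r * NN 0 a" using s(1) by simp
  have c: "2 * s7 * (c0 * d2 a b) > 0" using assms(3) by simp
  have "2 * s7 * (c0 * d2 a b) * Ff 1 a b = NN 0 a * (r * NN 1 a + NN 1 b)"
    using NN_wedge[of 0 a b] unfolding b0 by (simp add: algebra_simps)
  also have "\<dots> > 0" using assms(5) s(2) by (simp add: mult_neg_neg)
  finally show "Ff 1 a b > 0" using c zero_less_mult_pos by blast
  have "2 * s7 * (c0 * d2 a b) * Ff 0 a b = - NN 0 a * (r * NN 6 a + NN 6 b)"
    using NN_wedge[of 6 a b] unfolding b0 by (simp add: NN_7 Ff_7 b0 algebra_simps)
  also have "\<dots> \<le> 0" using assms(5) s(3) by (intro mult_nonneg_nonpos) auto
  finally show "Ff 0 a b \<le> 0" using c by (metis mult_pos_pos not_le)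
qed

lemma edge_point:
  assumes ab: "a \<noteq> 0" "b \<noteq> 0" and r: "r > 0" "r * NN j a + NN j b = 0"
    and n: "r * NN (j + 1) a + NN (j + 1) b \<le> 0" "r * NN (j + 6) a + NN (j + 6) b \<le> 0"
  shows "r * NN i a + NN i b \<le> 0"
proof -
  have L: "r * NN i a + NN i b = Lf i (of_real r * (nu a)^2 + (nu b)^2) (r * qf a + qf b)" for i
    unfolding NN_Lf Lf_lin ..
  have T: "r * qf a + qf b > 0" using r qf_pos ab by (intro add_pos_pos mult_pos_pos) auto
  show ?thesis using Lf_edge_all[OF T] r(2) n unfolding L by blast
qed

text \<open>The geodesic from \<open>b\<close> to \<open>a\<close> enters the heptagon through the half-open edge \<open>side_e 0\<close>.\<close>

definition Ent :: "real^2 \<Rightarrow> real^2 \<Rightarrow> bool" where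
  "Ent a b \<longleftrightarrow> d2 a b > 0 \<and> Ff 0 a b \<le> 0 \<and> Ff 1 a b > 0"

lemma Ent_nz: "Ent a b \<Longrightarrow> a \<noteq> 0 \<and> b \<noteq> 0" using d2_nz unfolding Ent_def by (metis less_irrefl)

lemma Ent_sign: assumes "Ent a b" shows "NN 0 a < 0" "NN 0 b > 0"
  and "qf a * qf b * (1 - hh^2 * (1 + tt^2)) \<le> (c0 * d2 a b)^2"
proof -
  have D: "Im (cnj (nu a) * nu b) > 0" using assms unfolding Im_nu Ent_def by simp
  have F: "Fc 0 (nu a) (nu b) \<le> 0" "Fc 1 (nu a) (nu b) > 0" using assms unfolding Ent_def Ff_def by auto
  show "NN 0 a < 0" "NN 0 b > 0" "qf a * qf b * (1 - hh^2 * (1 + tt^2)) \<le> (c0 * d2 a b)^2"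
    using ascent_sign[OF D F] unfolding NN_def qf_def Im_nu by auto
qed

lemma leave_sign: assumes "d2 a b > 0" "Ff j a b > 0" "Ff (Suc j) a b \<le> 0" shows "NN j a > 0" "NN j b < 0"
proof -
  have D: "Im (cnj (nu a) * nu b) > 0" using assms unfolding Im_nu by simp
  show "NN j a > 0" "NN j b < 0" using descent_sign[OF D] assms unfolding NN_def Ff_def by auto
qed

text \<open>Converse of \<open>enters_ascent\<close>: \<open>r\<close> is the parameter at which the
  geodesic meets the line of edge 0, and \<open>NN_wedge\<close> shows that this point is on the
  half-open edge.\<close>

lemma Ent_point:
  assumes "Ent a b" defines "r \<equiv> - NN 0 b / NN 0 a"
  shows "r > 0" "r * NN 0 a + NN 0 b = 0" "r * NN 1 a + NN 1 b < 0" "r * NN 6 a + NN 6 b \<le> 0" "r * NN i a + NN i b \<le> 0"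
proof -
  note N = Ent_sign[OF assms(1)]
  show r: "r > 0" unfolding r_def using N by (simp add: divide_less_0_iff)
  show 0: "r * NN 0 a + NN 0 b = 0" unfolding r_def using N by simp
  hence b0: "NN 0 b = - r * NN 0 a" by simp
  have c: "2 * s7 * (c0 * d2 a b) > 0" using assms(1) unfolding Ent_def by simp
  have "NN 0 a * (r * NN 1 a + NN 1 b) = 2 * s7 * (c0 * d2 a b) * Ff 1 a b"
    using NN_wedge[of 0 a b] unfolding b0 by (simp add: algebra_simps)
  also have "\<dots> > 0" using c assms(1) unfolding Ent_def by simp
  finally show 1: "r * NN 1 a + NN 1 b < 0" using N(1) by (simp add: zero_less_mult_iff)
  have "- NN 0 a * (r * NN 6 a + NN 6 b) = 2 * s7 * (c0 * d2 a b) * Ff 0 a b"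
    using NN_wedge[of 6 a b] unfolding b0 by (simp add: NN_7 Ff_7 b0 algebra_simps)
  also have "\<dots> \<le> 0" using less_imp_le[OF c] assms(1) unfolding Ent_def by (intro mult_nonneg_nonpos) blast+
  finally show 2: "r * NN 6 a + NN 6 b \<le> 0" using N(1) by (simp add: zero_le_mult_iff)
  show "r * NN i a + NN i b \<le> 0" using edge_point[of a b r 0 i] Ent_nz[OF assms(1)] r 0 1 2 by simp
qed

lemma leave_point:
  assumes "d2 a b > 0" "Ff j a b > 0" "Ff (Suc j) a b \<le> 0" defines "r \<equiv> - NN j b / NN j a"
  shows "r > 0" "r * NN j a + NN j b = 0" "r * NN (j + 1) a + NN (j + 1) b \<le> 0" "r * NN (j + 6) a + NN (j + 6) b < 0" "r * NN i a + NN i b \<le> 0"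
proof -
  note N = leave_sign[OF assms(1-3)]
  have nz: "a \<noteq> 0" "b \<noteq> 0" using assms(1) d2_nz by (metis less_irrefl)+
  show r: "r > 0" unfolding r_def using N by (simp add: divide_less_0_iff)
  show 0: "r * NN j a + NN j b = 0" unfolding r_def using N by simp
  hence b0: "NN j b = - r * NN j a" by simp
  have c: "2 * s7 * (c0 * d2 a b) > 0" using assms(1) by simp
  have "NN j a * (r * NN (j + 1) a + NN (j + 1) b) = 2 * s7 * (c0 * d2 a b) * Ff (Suc j) a b"
    using NN_wedge[of j a b] unfolding b0 by (simp add: algebra_simps)
  also have "\<dots> \<le> 0" using c assms(3) by (intro mult_nonneg_nonpos) auto
  finally show 1: "r * NN (j + 1) a + NN (j + 1) b \<le> 0" using N(1) by (simp add: mult_le_0_iff)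
  have s: "Suc (j + 6) = j + 7" by simp
  have "- NN j a * (r * NN (j + 6) a + NN (j + 6) b) = 2 * s7 * (c0 * d2 a b) * Ff j a b"
    using NN_wedge[of "j + 6" a b] unfolding s NN_7 Ff_7 b0 by (simp add: algebra_simps)
  also have "\<dots> > 0" using c assms(2) by simp
  finally show 2: "r * NN (j + 6) a + NN (j + 6) b < 0" using N(1) by (simp add: zero_less_mult_iff mult_less_0_iff)
  show "r * NN i a + NN i b \<le> 0" using edge_point[of a b r j i] nz r 0 1 2 by simp
qed

text \<open>Every edge function is affine in \<open>r\<close> and nonpositive at the entry and at
  the exit, hence in between; outside, edge function 0 or \<open>j\<close> is positive.\<close>

lemma inside_interval:
  assumes "Ent a b" "Ff j a b > 0" "Ff (Suc j) a b \<le> 0"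
  shows "(\<forall>i. r * NN i a + NN i b \<le> 0) \<longleftrightarrow> - NN 0 b / NN 0 a \<le> r \<and> r \<le> - NN j b / NN j a"
    "- NN 0 b / NN 0 a \<le> - NN j b / NN j a"
proof -
  define r1 r2 where "r1 = - NN 0 b / NN 0 a" and "r2 = - NN j b / NN j a"
  have d: "d2 a b > 0" using assms(1) unfolding Ent_def by simp
  note P = Ent_point[OF assms(1), folded r1_def] and Q = leave_point[OF d assms(2,3), folded r2_def]
  have N: "NN 0 a < 0" "NN j a > 0" using Ent_sign[OF assms(1)] leave_sign[OF d assms(2,3)] by auto
  have f: "r * NN 0 a + NN 0 b = (r - r1) * NN 0 a" "r * NN j a + NN j b = (r - r2) * NN j a" for r
    using P(2) Q(2) by (simp_all add: algebra_simps)
  have "(r1 - r2) * NN j a \<le> 0" unfolding f(2)[symmetric] by (rule P(5))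
  thus 12: "r1 \<le> r2" using N(2) by (simp add: mult_le_0_iff)
  show "(\<forall>i. r * NN i a + NN i b \<le> 0) \<longleftrightarrow> r1 \<le> r \<and> r \<le> r2"
  proof
    assume *: "\<forall>i. r * NN i a + NN i b \<le> 0"
    hence "(r - r1) * NN 0 a \<le> 0" "(r - r2) * NN j a \<le> 0" unfolding f[symmetric] by blast+
    thus "r1 \<le> r \<and> r \<le> r2" using N by (auto simp: mult_le_0_iff)
  next
    assume *: "r1 \<le> r \<and> r \<le> r2"
    show "\<forall>i. r * NN i a + NN i b \<le> 0"
    proof
      fix i
      show "r * NN i a + NN i b \<le> 0"
      proof (cases "NN i a \<ge> 0")
        case True
        hence "r * NN i a \<le> r2 * NN i a" using * by (intro mult_right_mono) auto
        thus ?thesis using Q(5)[of i] by linarith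
      next
        case False
        hence "r * NN i a \<le> r1 * NN i a" using * by (intro mult_right_mono_neg) auto
        thus ?thesis using P(5)[of i] by linarith
      qed
    qed
  qed
qed

lemma descent_leaves:
  assumes "rep \<alpha> a" "rep \<beta> b" "Ent a b" "Ff j a b > 0" "Ff (Suc j) a b \<le> 0"
  shows "leaves_from \<beta> \<alpha> j"
proof -
  have d: "d2 a b > 0" using assms(3) unfolding Ent_def by simp
  obtain \<kappa> where k: "\<kappa> > 0" "\<And>u. geodesic \<beta> \<alpha> u \<in> upper_half"
    "\<And>u i. (\<kappa> * exp (2 * u) * qf a + qf b) * Lf i (kl (geodesic \<beta> \<alpha> u)) 1 = \<kappa> * exp (2 * u) * NN i a + NN i b"
    using geodesic_Lf[OF assms(1,2)] d by (metis less_irrefl)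
  define r1 r2 where "r1 = - NN 0 b / NN 0 a" and "r2 = - NN j b / NN j a"
  note P = Ent_point[OF assms(3), folded r1_def] and Q = leave_point[OF d assms(4,5), folded r2_def]
    and I = inside_interval[OF assms(3-5), folded r1_def r2_def]
  \<comment> \<open>The logarithm converts the weights of the two end points of the crossing into
    unit speed parameters.\<close>
  define s t where "s = ln (r1 / \<kappa>) / 2" and "t = ln (r2 / \<kappa>) / 2"
  have st: "\<kappa> * exp (2 * s) = r1" "\<kappa> * exp (2 * t) = r2" unfolding s_def t_def using P(1) Q(1) k(1) by simp_all
  have mono: "\<kappa> * exp (2 * u) \<le> \<kappa> * exp (2 * v) \<longleftrightarrow> u \<le> v" for u v using k(1) by simp
  have T: "\<kappa> * exp (2 * u) * qf a + qf b > 0" for u using k(1) qf_pos Ent_nz[OF assms(3)] by (intro add_pos_pos mult_pos_pos) auto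
  have sg: "Lf i (kl (geodesic \<beta> \<alpha> u)) 1 \<le> 0 \<longleftrightarrow> \<kappa> * exp (2 * u) * NN i a + NN i b \<le> 0"
    "Lf i (kl (geodesic \<beta> \<alpha> u)) 1 < 0 \<longleftrightarrow> \<kappa> * exp (2 * u) * NN i a + NN i b < 0"
    "Lf i (kl (geodesic \<beta> \<alpha> u)) 1 = 0 \<longleftrightarrow> \<kappa> * exp (2 * u) * NN i a + NN i b = 0" for i u
    unfolding k(3)[symmetric] using T[of u] by (auto simp: mult_le_0_iff mult_less_0_iff)
  have "{u. geodesic \<beta> \<alpha> u \<in> heptagon_D} = {s..t}"
    unfolding heptagon_iff[OF k(2)] sg(1) I(1) unfolding st[symmetric] mono by auto
  moreover have "s \<le> t" using I(2) unfolding st[symmetric] mono .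
  moreover have "geodesic \<beta> \<alpha> t \<in> side_e' j"
    unfolding side_iff[OF k(2)] sg st using Q by simp
  ultimately show ?thesis unfolding leaves_from_def crosses_D_def by blast
qed

text \<open>Going round the heptagon from vertex 1 back to vertex 7 = 0, the sign has to change from
  positive to nonpositive.\<close>

lemma descent_exists: assumes "Ent a b" shows "\<exists>j\<in>{1..6}. Ff j a b > 0 \<and> Ff (Suc j) a b \<le> 0"
proof (rule ccontr)
  assume *: "\<not> ?thesis"
  have "Ff (Suc n) a b > 0" if "n \<le> 6" for n using that
  proof (induction n)
    case 0 thus ?case using assms unfolding Ent_def by simp
  next
    case (Suc n) thus ?case using * by force
  qed
  from this[of 6] show False using assms Ff_7(2)[of a b] unfolding Ent_def by simp
qed

section \<open>The action of the generators on lifted end points\<close>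

lemma g7_root: "(Complex g7c (c0 * g7s))^2 = w7" "Complex g7c (c0 * g7s) * cnj (Complex g7c (c0 * g7s)) = 1"
  using g7cs(1-3) by (simp_all add: complex_eq_iff w7_eq power2_eq_square algebra_simps)

lemma nu_g7: "nu (g7 *v v) = Complex g7c (c0 * g7s) * nu v"
  unfolding g7_c0 by (simp add: nu_def complex_eq_iff power2_eq_square algebra_simps)

lemma nu_g7_pow: "nu (mpow g7 j *v v) = (Complex g7c (c0 * g7s)) ^ j * nu v"
  by (induction j) (simp_all add: matrix_vector_mul_assoc[symmetric] nu_g7)

lemma Ff_g7_pow: "Ff (j + n) (mpow g7 j *v a) (mpow g7 j *v b) = Ff n a b"
  and NN_g7_pow: "NN (j + n) (mpow g7 j *v a) = NN n a"
  unfolding Ff_def NN_def nu_g7_pow by (rule Fc_rot_pow[OF g7_root] Nc_rot_pow[OF g7_root])+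

lemma qf_g7_pow: "qf (mpow g7 j *v a) = qf a"
proof -
  define K where "K = Complex g7c (c0 * g7s)"
  have "of_real ((cmod K)^2) = (1::complex)" unfolding complex_norm_square K_def by (rule g7_root)
  hence "(cmod K)^2 = 1" by (simp only: of_real_eq_1_iff)
  hence "cmod K = 1" by (simp add: power2_eq_1_iff) (use norm_ge_zero[of K] in linarith)
  thus ?thesis unfolding qf_def nu_g7_pow K_def[symmetric] by (simp add: norm_mult norm_power)
qed

lemma c0_hh: "c0^2 * (1 + hh) = eta * (1 - hh)"
  unfolding c0_sq using hh_bounds by simp

text \<open>The line of edge 0 has the end points \<plusminus> \<open>sqrt eta\<close>, so
  |\<alpha>| < \<open>sqrt eta\<close> places \<alpha> on the side of the heptagon.\<close>

lemma NN_0: "NN 0 v = (1 - hh) * ((v$1)^2 - eta * (v$2)^2)"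
proof -
  have "NN 0 v = (1 - hh) * (v$1)^2 - (c0^2 * (1 + hh)) * (v$2)^2"
    unfolding NN_Lf qf_eq Lf_def by (simp add: nu_def power2_eq_square algebra_simps)
  thus ?thesis unfolding c0_hh by (simp add: algebra_simps)
qed

lemma Ff_01:
  "Ff 0 a b = (1 - hh) * (a$1 * b$1 + eta * (a$2 * b$2)) + hh * tt * c0 * (a$1 * b$2 + a$2 * b$1)"
  "Ff 1 a b = (1 - hh) * (a$1 * b$1 + eta * (a$2 * b$2)) - hh * tt * c0 * (a$1 * b$2 + a$2 * b$1)"
proof -
  have "Re (nu a * cnj (nu b)) - hh * Re (nu a * nu b) = (1 - hh) * (a$1 * b$1) + (c0^2 * (1 + hh)) * (a$2 * b$2)"
    by (simp add: nu_def power2_eq_square algebra_simps)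
  hence "Re (nu a * cnj (nu b)) - hh * Re (nu a * nu b) = (1 - hh) * (a$1 * b$1 + eta * (a$2 * b$2))"
    unfolding c0_hh by (simp add: algebra_simps)
  moreover have "hh * tt * Im (nu a * nu b) = hh * tt * c0 * (a$1 * b$2 + a$2 * b$1)" by (simp add: nu_def algebra_simps)
  ultimately show "Ff 0 a b = (1 - hh) * (a$1 * b$1 + eta * (a$2 * b$2)) + hh * tt * c0 * (a$1 * b$2 + a$2 * b$1)"
    "Ff 1 a b = (1 - hh) * (a$1 * b$1 + eta * (a$2 * b$2)) - hh * tt * c0 * (a$1 * b$2 + a$2 * b$1)"
    unfolding Ff_def Fc_01 by linarith+
qed

lemma g2_vec: "(g2 *v v)$1 = - (sqrt eta * v$2)" "(g2 *v v)$2 = v$1 / sqrt eta"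
  by (simp_all add: g2_def)

lemma sqrt_cancel: "sqrt eta * x * (sqrt eta * y) = eta * (x * y)" "x / sqrt eta * (y / sqrt eta) = x * y / eta"
  "sqrt eta * x * (y / sqrt eta) = x * y" "y / sqrt eta * (sqrt eta * x) = x * y"
proof -
  have "sqrt eta * x * (sqrt eta * y) = (sqrt eta * sqrt eta) * (x * y)" by (simp only: ac_simps)
  thus "sqrt eta * x * (sqrt eta * y) = eta * (x * y)" unfolding sqrt_eta_sq .
  have "x / sqrt eta * (y / sqrt eta) = x * y / (sqrt eta * sqrt eta)" by (simp only: times_divide_times_eq)
  thus "x / sqrt eta * (y / sqrt eta) = x * y / eta" unfolding sqrt_eta_sq .
  show "sqrt eta * x * (y / sqrt eta) = x * y" "y / sqrt eta * (sqrt eta * x) = x * y" by simp_all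
qed

lemma g2_forms: "(g2 *v a)$1 * (g2 *v b)$1 = eta * (a$2 * b$2)" "(g2 *v a)$2 * (g2 *v b)$2 = a$1 * b$1 / eta"
  "(g2 *v a)$1 * (g2 *v b)$2 = - (a$2 * b$1)" "(g2 *v a)$2 * (g2 *v b)$1 = - (a$1 * b$2)"
  unfolding g2_vec minus_mult_minus mult_minus_left mult_minus_right sqrt_cancel by (simp_all add: mult.commute)

text \<open>\<open>g2\<close> is the half-turn about the midpoint of edge 0, so it exchanges the two
  vertices of this edge; it also exchanges the sides of the edge line, see
  \<open>NN_g2\<close>.\<close>

lemma Ff_g2: "Ff 0 (g2 *v a) (g2 *v b) = Ff 1 a b" "Ff 1 (g2 *v a) (g2 *v b) = Ff 0 a b"
  unfolding Ff_01 g2_forms by (simp_all add: algebra_simps)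

lemma NN_g2: "NN 0 (g2 *v v) = - NN 0 v"
  unfolding NN_0 power2_eq_square g2_forms by (simp add: algebra_simps)

text \<open>\<open>qf\<close> measures a vector against the centre of the heptagon. The neighbouring
  centre is the mirror image in the edge line, so the two heights differ by a multiple of the edge
  function.\<close>

lemma qf_g2: "qf (g2 *v v) = qf v - (2 * hh / (1 - hh^2)) * NN 0 v"
proof -
  have *: "eta - c0^2 = eta * (2 * hh / (1 + hh))" "c0^2 / eta - 1 = - (2 * hh / (1 + hh))"
  proof -
    have "c0^2 / eta = (1 - hh) / (1 + hh)" unfolding c0_sq by simp
    thus "c0^2 / eta - 1 = - (2 * hh / (1 + hh))" using hh_bounds by (simp add: field_simps)
  qed (use hh_bounds in \<open>simp add: c0_sq field_simps\<close>)
  have "2 * hh / (1 - hh^2) * (1 - hh) = 2 * hh / (1 + hh)"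
  proof -
    have "1 - hh^2 = (1 + hh) * (1 - hh)" by (simp add: power2_eq_square algebra_simps)
    thus ?thesis using hh_bounds by simp
  qed
  hence "(2 * hh / (1 - hh^2)) * NN 0 v = (2 * hh / (1 + hh)) * ((v$1)^2 - eta * (v$2)^2)"
    unfolding NN_0 by (metis mult.assoc)
  moreover have "qf (g2 *v v) - qf v = (c0^2 / eta - 1) * (v$1)^2 + (eta - c0^2) * (v$2)^2"
    unfolding qf_eq power2_eq_square g2_forms by (simp add: algebra_simps)
  ultimately show ?thesis unfolding * by (simp add: algebra_simps)
qed

lemma cf_A_vec: "cf_A j *v v = mpow g7 j *v (g2 *v v)"
  unfolding cf_A_def by (simp add: matrix_vector_mul_assoc)

text \<open>Edge 0 of the next heptagon is edge \<open>j\<close> of the present one with reversed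
  orientation: its vertices 0 and 1 are the old vertices \<open>Suc j\<close> and
  \<open>j\<close>.\<close>

lemma step_forms:
  "Ff 0 a b = Ff (Suc j) (cf_A j *v a) (cf_A j *v b)"
  "Ff 1 a b = Ff j (cf_A j *v a) (cf_A j *v b)"
  "NN 0 a = - NN j (cf_A j *v a)"
  "qf a = qf (cf_A j *v a) - (2 * hh / (1 - hh^2)) * NN j (cf_A j *v a)"
  unfolding cf_A_vec qf_g7_pow using Ff_g7_pow[of j 0] Ff_g7_pow[of j 1] NN_g7_pow[of j 0]
  by (simp_all add: Ff_g2[unfolded One_nat_def] NN_g2 qf_g2)

text \<open>The last claim says that the exit parameter of one heptagon is the entry parameter of
  the next, so the parameter intervals of consecutive tiles abut.\<close>

lemma Ent_step:
  assumes "d2 a b > 0" "Ff j (cf_A j *v a) (cf_A j *v b) > 0" "Ff (Suc j) (cf_A j *v a) (cf_A j *v b) \<le> 0"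
  shows "Ent a b" "qf a < qf (cf_A j *v a)" "- NN 0 b / NN 0 a = - NN j (cf_A j *v b) / NN j (cf_A j *v a)"
proof -
  show "Ent a b" unfolding Ent_def step_forms(1,2)[of a b j] using assms by simp
  have "d2 (cf_A j *v a) (cf_A j *v b) > 0" using assms(1) unfolding d2_act Delta_det[OF cf_A_Delta] by simp
  from leave_sign(1)[OF this assms(2,3)] have "NN j (cf_A j *v a) > 0" .
  moreover have "hh^2 < 1" using hh_sq eta_bounds by simp
  hence "2 * hh / (1 - hh^2) > 0" using hh_bounds by simp
  ultimately have "2 * hh / (1 - hh^2) * NN j (cf_A j *v a) > 0" by (rule mult_pos_pos[rotated])
  thus "qf a < qf (cf_A j *v a)" unfolding step_forms(4)[of a j] by simp
  show "- NN 0 b / NN 0 a = - NN j (cf_A j *v b) / NN j (cf_A j *v a)" unfolding step_forms(3)[of _ j] by simp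
qed

lemma d2_bound: "(c0 * d2 a b)^2 \<le> qf a * qf b"
proof -
  have "\<bar>Im (cnj (nu a) * nu b)\<bar> \<le> cmod (cnj (nu a) * nu b)" by (rule abs_Im_le_cmod)
  hence "\<bar>c0 * d2 a b\<bar> \<le> cmod (nu a) * cmod (nu b)" unfolding Im_nu norm_mult complex_mod_cnj .
  hence "\<bar>c0 * d2 a b\<bar>^2 \<le> (cmod (nu a) * cmod (nu b))^2" by (rule power_mono) simp
  thus ?thesis by (simp add: qf_def power_mult_distrib)
qed

lemma qf_bound: assumes "qf v \<le> R" shows "\<bar>v $ i\<bar> \<le> (1 + 1 / c0) * (1 + \<bar>R\<bar>)"
proof -
  have s: "\<bar>x\<bar> \<le> 1 + \<bar>R\<bar>" if "x^2 \<le> R" for x :: real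
  proof -
    have "x^2 \<le> (1 + \<bar>R\<bar>)^2" using that by (simp add: power2_eq_square algebra_simps) (smt (verit) zero_le_mult_iff)
    thus ?thesis using abs_le_square_iff[of x "1 + \<bar>R\<bar>"] by simp
  qed
  have nn: "c0^2 * (v$2)^2 \<ge> 0" "(v$1)^2 \<ge> 0" by simp_all
  have "(v$1)^2 \<le> R" "(c0 * v$2)^2 \<le> R" using assms nn unfolding qf_eq power_mult_distrib by linarith+
  hence 1: "\<bar>v$1\<bar> \<le> 1 + \<bar>R\<bar>" and 2: "c0 * \<bar>v$2\<bar> \<le> 1 + \<bar>R\<bar>" using s[of "v$1"] s[of "c0 * v$2"] by (simp_all add: abs_mult)
  have 3: "\<bar>v$2\<bar> \<le> 1 / c0 * (1 + \<bar>R\<bar>)" using 2 by (simp add: field_simps)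
  have "1 / c0 * (1 + \<bar>R\<bar>) \<ge> 0" by (intro mult_nonneg_nonneg) (simp_all add: less_imp_le)
  hence "\<bar>v$1\<bar> \<le> (1 + 1 / c0) * (1 + \<bar>R\<bar>)" "\<bar>v$2\<bar> \<le> (1 + 1 / c0) * (1 + \<bar>R\<bar>)" using 1 3 by (simp_all only: distrib_right[of 1] mult_1_left add_increasing2 add_increasing)
  thus ?thesis by (metis exhaust_2)
qed

text \<open>By Cramer's rule a matrix is determined by the images of two independent vectors,
  linearly in their coordinates.\<close>

lemma matrix_bound:
  assumes "d2 a b \<noteq> 0"
  shows "\<exists>C. \<forall>M. qf (M *v a) \<le> R \<and> qf (M *v b) \<le> R \<longrightarrow> (\<forall>i j. \<bar>M$i$j\<bar> \<le> C)"
proof -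
  define Q where "Q = (1 + 1 / c0) * (1 + \<bar>R\<bar>)"
  define m where "m = \<bar>a$1\<bar> + \<bar>a$2\<bar> + \<bar>b$1\<bar> + \<bar>b$2\<bar>"
  have "\<bar>M$i$j\<bar> \<le> (2 * (Q * m)) / \<bar>d2 a b\<bar>" if M: "qf (M *v a) \<le> R" "qf (M *v b) \<le> R" for M i j
  proof -
    have q: "\<bar>(M *v a)$i\<bar> \<le> Q" "\<bar>(M *v b)$i\<bar> \<le> Q" unfolding Q_def using qf_bound M by blast+
    hence Q0: "Q \<ge> 0" by linarith
    have p: "\<bar>x * y\<bar> \<le> Q * m" if "\<bar>x\<bar> \<le> Q" "\<bar>y\<bar> \<le> m" for x y unfolding abs_mult using that Q0 by (intro mult_mono) auto
    have mm: "\<bar>a$1\<bar> \<le> m" "\<bar>a$2\<bar> \<le> m" "\<bar>b$1\<bar> \<le> m" "\<bar>b$2\<bar> \<le> m" unfolding m_def by linarith+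
    have df: "\<bar>x - y\<bar> \<le> 2 * c" if "\<bar>x\<bar> \<le> c" "\<bar>y\<bar> \<le> c" for x y c :: real using that by linarith
    have e: "M$i$1 * d2 a b = (M *v a)$i * b$2 - (M *v b)$i * a$2" "M$i$2 * d2 a b = (M *v b)$i * a$1 - (M *v a)$i * b$1"
      by (simp_all add: d2_def algebra_simps)
    have "\<bar>M$i$1 * d2 a b\<bar> \<le> 2 * (Q * m)" "\<bar>M$i$2 * d2 a b\<bar> \<le> 2 * (Q * m)" unfolding e
      by (intro df p q mm)+
    hence "\<bar>M$i$1\<bar> \<le> (2 * (Q * m)) / \<bar>d2 a b\<bar>" "\<bar>M$i$2\<bar> \<le> (2 * (Q * m)) / \<bar>d2 a b\<bar>"
      using assms by (simp_all add: abs_mult field_simps)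
    thus ?thesis by (metis exhaust_2)
  qed
  thus ?thesis by blast
qed

lemma Delta_orbit_finite: assumes "d2 a b \<noteq> 0"
  shows "finite {M \<in> Delta237. qf (M *v a) \<le> R \<and> qf (M *v b) \<le> R}"
proof -
  obtain C where C: "\<forall>M. qf (M *v a) \<le> R \<and> qf (M *v b) \<le> R \<longrightarrow> (\<forall>i j. \<bar>M$i$j\<bar> \<le> C)" using matrix_bound[OF assms] by blast
  show ?thesis by (rule finite_subset[OF _ O_finite[of 1 C]]) (use C in \<open>auto simp: Delta_eq\<close>)
qed

section \<open>Expansions\<close>

text \<open>The lifts are normalized to \<open>d2 a b > 0\<close>, since the signs of the vertex
  functions describe the sides of the oriented geodesic only for this orientation.\<close>

locale expansion =
  fixes \<alpha> \<beta> :: rp1 and B0 :: "real^2^2" and i :: "nat \<Rightarrow> nat" and a b :: "real^2"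
  assumes cf: "geodesic_cf_expansion \<beta> \<alpha> B0 i"
    and repa: "rep \<alpha> a" and repb: "rep \<beta> b" and d2ab: "d2 a b > 0"
begin

definition av :: "nat \<Rightarrow> real^2" where "av k = matrix_inv (cf_B B0 i k) *v a"
definition bv :: "nat \<Rightarrow> real^2" where "bv k = matrix_inv (cf_B B0 i k) *v b"

lemma B_Delta: "cf_B B0 i k \<in> Delta237"
  using cf unfolding geodesic_cf_expansion_def by (induction k) (auto intro: Delta_mult cf_A_Delta)

lemma B_inv: "cf_B B0 i k ** matrix_inv (cf_B B0 i k) = mat 1" "matrix_inv (cf_B B0 i k) ** cf_B B0 i k = mat 1"
  using matrix_inv_mult_det1[OF Delta_det[OF B_Delta]] by blast+

lemma B_inv_Delta: "matrix_inv (cf_B B0 i k) \<in> Delta237" by (intro Delta_inv B_Delta)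

lemma B_step_inv: "matrix_inv (cf_B B0 i k) = cf_A (i (Suc k)) ** matrix_inv (cf_B B0 i (Suc k))"
proof -
  have "cf_A (i (Suc k)) ** matrix_inv (cf_B B0 i (Suc k))
     = (matrix_inv (cf_B B0 i k) ** cf_B B0 i k) ** cf_A (i (Suc k)) ** matrix_inv (cf_B B0 i (Suc k))"
    unfolding B_inv by simp
  also have "\<dots> = matrix_inv (cf_B B0 i k) ** (cf_B B0 i (Suc k) ** matrix_inv (cf_B B0 i (Suc k)))"
    by (simp add: matrix_mul_assoc)
  finally show ?thesis unfolding B_inv by simp
qed

lemma step: "matrix_inv (cf_B B0 i k) *v v = cf_A (i (Suc k)) *v (matrix_inv (cf_B B0 i (Suc k)) *v v)"
  unfolding matrix_vector_mul_assoc by (subst B_step_inv) simp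

lemma av_step: "av k = cf_A (i (Suc k)) *v av (Suc k)" and bv_step: "bv k = cf_A (i (Suc k)) *v bv (Suc k)"
  unfolding av_def bv_def by (rule step)+

lemma d2_inv: "d2 (matrix_inv (cf_B B0 i k) *v u) (matrix_inv (cf_B B0 i k) *v v) = d2 u v"
  unfolding d2_act Delta_det[OF B_inv_Delta] by simp

lemma rep_endpoint: assumes "rep x v" shows "rep (cf_endpoint B0 i x k) (matrix_inv (cf_B B0 i k) *v v)"
proof (induction k)
  case 0 show ?case using rep_act[OF assms] Delta_det[OF B_inv_Delta[of 0]] by simp
next
  case (Suc k)
  let ?A = "cf_A (i (Suc k))" and ?w = "matrix_inv (cf_B B0 i (Suc k)) *v v"
  have "matrix_inv ?A *v (matrix_inv (cf_B B0 i k) *v v) = matrix_inv ?A *v (?A *v ?w)" using step by simp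
  also have "\<dots> = (matrix_inv ?A ** ?A) *v ?w" by (simp only: matrix_vector_mul_assoc matrix_mul_assoc)
  also have "\<dots> = ?w" unfolding matrix_inv_mult_det1[OF Delta_det[OF cf_A_Delta]] by simp
  finally show ?case using rep_act[OF Suc, of "matrix_inv ?A"] Delta_det[OF Delta_inv[OF cf_A_Delta]] by simp
qed

lemma rep_act_B: "rep (act (matrix_inv (cf_B B0 i k)) \<alpha>) (av k)"
  unfolding av_def using rep_act[OF repa] Delta_det[OF B_inv_Delta] by simp

text \<open>A descent of signs exists and is an exit edge by \<open>descent_leaves\<close>; the
  expansion admits only one exit index in 1..6, so the descent is that index and is unique.\<close>

lemma descent_index:
  assumes "Ent (av k) (bv k)"
  shows "i (Suc k) \<in> {1..6}" "Ff (i (Suc k)) (av k) (bv k) > 0" "Ff (Suc (i (Suc k))) (av k) (bv k) \<le> 0"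
    "\<And>j. j \<in> {1..6} \<Longrightarrow> Ff j (av k) (bv k) > 0 \<Longrightarrow> Ff (Suc j) (av k) (bv k) \<le> 0 \<Longrightarrow> i (Suc k) = j"
proof -
  have r: "rep (cf_endpoint B0 i \<alpha> k) (av k)" "rep (cf_endpoint B0 i \<beta> k) (bv k)"
    unfolding av_def bv_def using rep_endpoint repa repb by blast+
  show u: "\<And>j. j \<in> {1..6} \<Longrightarrow> Ff j (av k) (bv k) > 0 \<Longrightarrow> Ff (Suc j) (av k) (bv k) \<le> 0 \<Longrightarrow> i (Suc k) = j"
    using descent_leaves[OF r assms] cf unfolding geodesic_cf_expansion_def by metis
  show "i (Suc k) \<in> {1..6}" "Ff (i (Suc k)) (av k) (bv k) > 0" "Ff (Suc (i (Suc k))) (av k) (bv k) \<le> 0"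
    using descent_exists[OF assms] u by metis+
qed

lemma Ent_chain: "Ent (av k) (bv k)"
proof (induction k)
  case 0
  have r: "rep (cf_endpoint B0 i \<alpha> 0) (av 0)" "rep (cf_endpoint B0 i \<beta> 0) (bv 0)"
    unfolding av_def bv_def using rep_endpoint repa repb by blast+
  have d: "d2 (av 0) (bv 0) > 0" unfolding av_def bv_def d2_inv by (rule d2ab)
  have red: "reduced (cf_endpoint B0 i \<beta> 0) (cf_endpoint B0 i \<alpha> 0)" using cf unfolding geodesic_cf_expansion_def by blast
  then obtain x where x: "cf_endpoint B0 i \<alpha> 0 = Pt x" "\<bar>x\<bar> < sqrt eta" and en: "enters_from (cf_endpoint B0 i \<beta> 0) (cf_endpoint B0 i \<alpha> 0) 0"
    unfolding reduced_def by blast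
  have v: "av 0 $ 2 \<noteq> 0" "av 0 $ 1 = x * av 0 $ 2" using r(1) unfolding x(1) by simp_all
  \<comment> \<open>The condition |\<alpha>| < \<open>sqrt eta\<close> enters here: it gives
    \<open>NN 0 (av 0)\<close> the sign that \<open>enters_ascent\<close> requires.\<close>
  have "\<bar>x\<bar>^2 < (sqrt eta)^2" using x(2) by (intro power_strict_mono) auto
  hence "x^2 - eta < 0" by simp
  hence "(av 0 $ 2)^2 * (x^2 - eta) < 0" using v(1) by (intro mult_pos_neg) simp_all
  hence "(av 0 $ 1)^2 - eta * (av 0 $ 2)^2 < 0" unfolding v(2) power_mult_distrib by (simp add: algebra_simps)
  hence "NN 0 (av 0) < 0" unfolding NN_0 using hh_bounds by (intro mult_pos_neg) simp_all
  from enters_ascent[OF r d en this] show ?case unfolding Ent_def using d by simp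
next
  case (Suc k)
  have "d2 (av (Suc k)) (bv (Suc k)) > 0" unfolding av_def bv_def d2_inv by (rule d2ab)
  from Ent_step(1)[OF this] descent_index(2,3)[OF Suc] show ?case unfolding av_step[of k] bv_step[of k] by blast
qed

lemmas chain_index = descent_index[OF Ent_chain]

lemma d2_chain: "d2 (av k) (bv k) = d2 a b" unfolding av_def bv_def by (rule d2_inv)

lemma qf_decreasing: "qf (av (Suc k)) < qf (av k)" and chain_times: "- NN 0 (bv (Suc k)) / NN 0 (av (Suc k)) = - NN (i (Suc k)) (bv k) / NN (i (Suc k)) (av k)"
proof -
  have "d2 (av (Suc k)) (bv (Suc k)) > 0" unfolding d2_chain by (rule d2ab)
  from Ent_step(2,3)[OF this, of "i (Suc k)"] chain_index(2,3)[of k]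
  show "qf (av (Suc k)) < qf (av k)" "- NN 0 (bv (Suc k)) / NN 0 (av (Suc k)) = - NN (i (Suc k)) (bv k) / NN (i (Suc k)) (av k)"
    unfolding av_step[symmetric] bv_step[symmetric] by blast+
qed

lemma qf_strict: "k < l \<Longrightarrow> qf (av l) < qf (av k)"
  by (rule lift_Suc_mono_less[of "\<lambda>k. - qf (av k)", simplified]) (auto simp: qf_decreasing)

lemma qf_mono: "k \<le> l \<Longrightarrow> qf (av l) \<le> qf (av k)"
  using qf_strict[of k l] by (cases "k = l") auto

definition qC :: real where "qC = (c0 * d2 a b)^2 / (1 - hh^2 * (1 + tt^2))"

lemma qf_product: "qf (av k) * qf (bv k) \<le> qC"
  using Ent_sign(3)[OF Ent_chain[of k]] hh_tt_less(1) unfolding d2_chain qC_def by (simp add: field_simps)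

lemma qf_small: assumes "e > 0" shows "\<exists>K. \<forall>k\<ge>K. qf (av k) < e"
proof -
  have "\<exists>K. qf (av K) < e"
  proof (rule ccontr)
    assume "\<not> ?thesis"
    hence ge: "qf (av k) \<ge> e" for k by (simp add: not_less)
    have qC0: "qC \<ge> 0" using qf_product[of 0] qf_nonneg[of "av 0"] qf_nonneg[of "bv 0"] mult_nonneg_nonneg order_trans by blast
    define R where "R = qf (av 0) + qC / e"
    have "qf (bv k) \<le> qC / e" for k
    proof -
      have "e * qf (bv k) \<le> qf (av k) * qf (bv k)" using ge qf_nonneg by (intro mult_right_mono) auto
      thus ?thesis using qf_product[of k] assms by (simp add: field_simps)
    qed
    moreover have "qC / e \<ge> 0" using qC0 assms by simp
    ultimately have b: "qf (bv k) \<le> R" "qf (av k) \<le> R" for k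
      unfolding R_def using qf_mono[of 0 k] qf_nonneg[of "av 0"] by (simp_all add: add_increasing add_increasing2)
    let ?f = "\<lambda>k. matrix_inv (cf_B B0 i k)"
    have "range ?f \<subseteq> {M \<in> Delta237. qf (M *v a) \<le> R \<and> qf (M *v b) \<le> R}"
      using b B_inv_Delta unfolding av_def bv_def by blast
    moreover have "d2 a b \<noteq> 0" using d2ab by simp
    ultimately have "finite (range ?f)" using Delta_orbit_finite finite_subset by blast
    moreover have "inj ?f"
    proof (rule injI)
      fix k l assume "?f k = ?f l"
      hence "qf (av k) = qf (av l)" unfolding av_def by simp
      thus "k = l" using qf_strict[of k l] qf_strict[of l k] by (metis less_irrefl linorder_neqE_nat)
    qed
    ultimately show False using finite_imageD by blast
  qed
  then obtain K where "qf (av K) < e" by blast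
  thus ?thesis using qf_mono by (meson le_less_trans)
qed

lemma endpoint_periodic_iff: "endpoint_periodic \<alpha> B0 i l k0 \<longleftrightarrow> (\<forall>k\<ge>k0. d2 (av (k + l)) (av k) = 0)"
  unfolding endpoint_periodic_def using rep_d2[OF rep_act_B rep_act_B] by blast

lemma index_imp_endpoint: assumes "index_periodic i l k0" shows "endpoint_periodic \<alpha> B0 i l k0"
  unfolding endpoint_periodic_iff
proof (intro allI impI)
  fix k assume k: "k \<ge> k0"
  have s: "d2 (av (m + l)) (av m) = d2 (av (Suc m + l)) (av (Suc m))" if "m \<ge> k0" for m
  proof -
    have "i (Suc m + l) = i (Suc m)" using assms[unfolded index_periodic_def, rule_format, of "Suc m"] that by simp
    hence "av (m + l) = cf_A (i (Suc m)) *v av (Suc m + l)" using av_step[of "m + l"] by simp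
    thus ?thesis unfolding av_step[of m] by (simp add: d2_act Delta_det[OF cf_A_Delta])
  qed
  have c: "d2 (av (k + n + l)) (av (k + n)) = d2 (av (k + l)) (av k)" for n
    by (induction n) (use s k in simp_all)
  show "d2 (av (k + l)) (av k) = 0"
  proof (rule ccontr)
    assume nz: "d2 (av (k + l)) (av k) \<noteq> 0"
    define e where "e = \<bar>c0 * d2 (av (k + l)) (av k)\<bar>"
    have e: "e > 0" using nz unfolding e_def by simp
    obtain K where K: "\<forall>k\<ge>K. qf (av k) < e" using qf_small[OF e] by blast
    have "e^2 \<le> qf (av (k + K + l)) * qf (av (k + K))" using d2_bound[of "av (k + K + l)" "av (k + K)"] unfolding c e_def by simp
    also have "\<dots> < e * e" using K qf_nonneg e by (intro mult_strict_mono') auto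
    finally show False by (simp add: power2_eq_square)
  qed
qed

end

section \<open>Small displacements of the heptagon\<close>

text \<open>In the coordinate \<open>nu\<close> a matrix acts by \<open>\<nu> \<mapsto> PP \<nu> + SS (cnj \<nu>)\<close>, as an element of \<open>SU(1,1)\<close>.\<close>

definition PP :: "real^2^2 \<Rightarrow> complex" where
  "PP G = Complex ((G$1$1 + G$2$2) / 2) ((c0 * G$2$1 - G$1$2 / c0) / 2)"

definition SS :: "real^2^2 \<Rightarrow> complex" where
  "SS G = Complex ((G$1$1 - G$2$2) / 2) ((c0 * G$2$1 + G$1$2 / c0) / 2)"

lemma nu_act: "nu (G *v v) = PP G * nu v + SS G * cnj (nu v)"
  by (simp add: nu_def PP_def SS_def complex_eq_iff field_simps)

lemma PP_SS_det: "(cmod (PP G))^2 - (cmod (SS G))^2 = det G"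
  unfolding cmod_power2 PP_def SS_def det_2 by (simp add: field_simps power2_eq_square)

lemma PP_mult: "PP (M ** N) = PP M * PP N + SS M * cnj (SS N)"
  and SS_mult: "SS (M ** N) = PP M * SS N + SS M * cnj (PP N)"
proof -
  define x y where "x = M$1$2 / c0" and "y = N$1$2 / c0"
  have *: "M$1$2 = c0 * x" "N$1$2 = c0 * y" unfolding x_def y_def by simp_all
  have c: "(m * (c0 * y) + c0 * x * n) / c0 = m * y + x * n" for m n by (simp add: add_divide_distrib)
  show "PP (M ** N) = PP M * PP N + SS M * cnj (SS N)" "SS (M ** N) = PP M * SS N + SS M * cnj (PP N)"
    unfolding PP_def SS_def matmul_nth * c by (simp_all add: complex_eq_iff) (simp_all add: field_simps)
qed

lemma PP_inv: assumes "det M = 1" shows "PP (matrix_inv M) = cnj (PP M)" "SS (matrix_inv M) = - SS M"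
  unfolding matrix_inv_det1[OF assms] by (simp_all add: PP_def SS_def complex_eq_iff field_simps)

lemma PP_SS_eqI: assumes "PP M = PP N" "SS M = SS N" shows "M = N"
proof -
  have *: "G$1$1 = Re (PP G) + Re (SS G)" "G$2$2 = Re (PP G) - Re (SS G)" "c0 * G$2$1 = Im (PP G) + Im (SS G)"
    "G$1$2 / c0 = Im (SS G) - Im (PP G)" for G
    unfolding PP_def SS_def complex.sel by (simp_all add: add_divide_distrib diff_divide_distrib)
  have e: "M$1$1 = N$1$1" "M$2$2 = N$2$2" using *(1,2) assms by simp_all
  have "c0 * M$2$1 = c0 * N$2$1" "M$1$2 / c0 = N$1$2 / c0" unfolding *(3,4) assms by simp_all
  thus ?thesis using e by (intro mat2_eqI) auto
qed

definition K7 :: complex where "K7 = Complex g7c (c0 * g7s)"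

lemma K7_root: "K7^2 = w7" "K7 * cnj K7 = 1" unfolding K7_def by (rule g7_root)+

lemma PP_g7: "PP g7 = K7" "SS g7 = 0"
  unfolding g7_c0 PP_def SS_def K7_def by (simp_all add: power2_eq_square complex_eq_iff)

lemma PP_1: "PP (mat 1) = 1" "SS (mat 1) = 0" by (simp_all add: PP_def SS_def complex_eq_iff)

lemma PP_g7_pow: "PP (mpow g7 i) = K7 ^ i" "SS (mpow g7 i) = 0"
  by (induction i) (simp_all add: PP_mult SS_mult PP_g7 PP_1)

lemma g7c_sq: "g7c^2 = (2 + eta) / 4"
  using g7cs(1,2) by simp

lemma K7_cis: "K7 = cis (pi / 7)" and cos_pi7: "cos (pi / 7) = g7c"
proof -
  have "(cis (pi / 7))^2 = w7" unfolding w7_def Complex.DeMoivre by simp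
  hence "K7 = cis (pi / 7) \<or> K7 = - cis (pi / 7)" using K7_root(1) by (simp add: power2_eq_iff[symmetric])
  moreover have "cos (pi / 7) > 0" by (rule cos_gt_zero_pi) (use pi_gt_zero in linarith)+
  ultimately show "K7 = cis (pi / 7)" using g7cs(4) by (auto simp: K7_def complex_eq_iff)
  thus "cos (pi / 7) = g7c" by (simp add: K7_def complex_eq_iff)
qed

text \<open>The multiple of 2 pi/m nearest to the argument does it; an argument in [0, 2 pi) keeps
  the index a natural number.\<close>

lemma rotate_to_sector:
  assumes "m > 0"
  shows "\<exists>i. Re (cnj (cis (2 * pi / real m)) ^ i * Z) \<ge> cos (pi / real m) * cmod Z"
proof -
  define \<phi> where "\<phi> = Arg2pi Z"
  have \<phi>: "0 \<le> \<phi>" unfolding \<phi>_def by (rule Arg2pi_ge_0)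
  define r where "r = cmod Z"
  have Z: "Z = of_real r * cis \<phi>" unfolding r_def \<phi>_def cis_conv_exp using Arg2pi_eq by simp
  define i where "i = nat \<lfloor>\<phi> * m / (2 * pi) + 1 / 2\<rfloor>"
  have "\<lfloor>\<phi> * m / (2 * pi) + 1 / 2\<rfloor> \<ge> 0" using \<phi> assms by simp
  hence "real i = of_int \<lfloor>\<phi> * m / (2 * pi) + 1 / 2\<rfloor>" unfolding i_def by simp
  hence "\<bar>\<phi> * m / (2 * pi) - real i\<bar> \<le> 1 / 2" by linarith
  hence "\<bar>\<phi> * m / (2 * pi) - real i\<bar> * (2 * pi / m) \<le> 1 / 2 * (2 * pi / m)" by (intro mult_right_mono) auto
  moreover have "\<bar>\<phi> * m / (2 * pi) - real i\<bar> * (2 * pi / m) = \<bar>\<phi> - i * (2 * pi / m)\<bar>"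
  proof -
    have "(\<phi> * m / (2 * pi) - real i) * (2 * pi / m) = \<phi> - i * (2 * pi / m)" using assms by (simp add: field_simps)
    moreover have "\<bar>2 * pi / m\<bar> = 2 * pi / m" by simp
    ultimately show ?thesis by (metis abs_mult)
  qed
  ultimately have b: "\<bar>\<phi> - i * (2 * pi / m)\<bar> \<le> pi / m" by simp
  have "pi / m \<le> pi" using assms by (simp add: field_simps)
  hence "cos (pi / m) \<le> cos \<bar>\<phi> - i * (2 * pi / m)\<bar>" using b by (intro cos_monotone_0_pi_le) auto
  hence c: "cos (pi / m) \<le> cos (\<phi> - i * (2 * pi / m))" by simp
  have "cnj (cis (2 * pi / real m)) ^ i * Z = of_real r * (cnj (cis (2 * pi / real m)) ^ i * cis \<phi>)"
    unfolding Z by (simp only: ac_simps)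
  also have "cnj (cis (2 * pi / real m)) ^ i * cis \<phi> = cis (\<phi> - i * (2 * pi / m))"
    unfolding cis_cnj Complex.DeMoivre cis_mult by (rule arg_cong[of _ _ cis]) simp
  finally have "Re (cnj (cis (2 * pi / real m)) ^ i * Z) = r * cos (\<phi> - i * (2 * pi / m))" by simp
  moreover have "r \<ge> 0" unfolding r_def by simp
  ultimately show ?thesis using mult_right_mono[OF c, of r] unfolding r_def[symmetric]
    by (intro exI[of _ i]) (simp add: mult.commute)
qed

section \<open>Estimates for the displacement of the centre\<close>

lemma heptagon_radius:
  assumes "\<forall>i. Lf i Z T \<le> 0" "T > 0" shows "(cmod Z)^2 \<le> hh^2 * (1 + tt^2) * T^2"
proof -
  define K where "K = Z / of_real T"
  have "Lf i K 1 \<le> 0" for i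
  proof -
    have "Lf i Z T = T * Lf i K 1" using Lf_scale[of i T K 1] assms(2) unfolding K_def by simp
    thus ?thesis using assms by (metis mult_pos_pos not_le)
  qed
  then obtain i where "K * cnj (w7 ^ i) \<in> convex hull {vert0, w7 * vert0, 0}" using sector by blast
  moreover have "convex hull {vert0, w7 * vert0, 0} \<subseteq> cball 0 (cmod vert0)"
    by (rule hull_minimal) (auto simp: norm_mult w7_def)
  moreover have "cmod (K * cnj (w7 ^ i)) = cmod K" by (simp add: norm_mult norm_power w7_def)
  ultimately have "cmod K \<le> cmod vert0" by auto
  hence "(cmod K)^2 \<le> (cmod vert0)^2" by (intro power_mono) auto
  also have "(cmod vert0)^2 = hh^2 * (1 + tt^2)" unfolding cmod_power2 vert0_def by (simp add: power_mult_distrib algebra_simps)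
  finally have "(cmod K)^2 * T^2 \<le> hh^2 * (1 + tt^2) * T^2" by (rule mult_right_mono) simp
  moreover have "(cmod K)^2 * T^2 = (cmod Z)^2" unfolding K_def using assms(2) by (simp add: norm_divide power_divide)
  ultimately show ?thesis by simp
qed

lemma qf_act: "qf (G *v v) = ((cmod (PP G))^2 + (cmod (SS G))^2) * qf v + 2 * Re (PP G * cnj (SS G) * (nu v)^2)"
  unfolding qf_def nu_act cmod_power2 by (simp add: power2_eq_square algebra_simps)

text \<open>With n = cosh^2(d/2), where d is the distance by which \<open>G\<close> moves the
  centre, the factor is cosh d - tanh R sinh d. Here R is the hyperbolic circumradius of the
  heptagon, whose Klein radius is tanh R.\<close>

lemma height_lower:
  fixes a b G r defines "Z \<equiv> of_real r * (nu a)^2 + (nu b)^2" and "T \<equiv> r * qf a + qf b"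
    and "n \<equiv> (cmod (PP G))^2"
  assumes "det G = 1" "(cmod Z)^2 \<le> hh^2 * (1 + tt^2) * T^2" "T \<ge> 0"
  shows "r * qf (G *v a) + qf (G *v b) \<ge> (2 * n - 1 - 2 * sqrt (n * (n - 1) * (hh^2 * (1 + tt^2)))) * T"
proof -
  have s: "(cmod (SS G))^2 = n - 1" using PP_SS_det[of G] assms(4) unfolding n_def by simp
  have "r * qf (G *v a) + qf (G *v b) = (n + (n - 1)) * T + 2 * Re (PP G * cnj (SS G) * Z)"
    unfolding qf_act s n_def[symmetric] Z_def T_def by (simp add: algebra_simps)
  moreover have "\<bar>Re (PP G * cnj (SS G) * Z)\<bar> \<le> cmod (PP G * cnj (SS G) * Z)" by (rule abs_Re_le_cmod)
  moreover have "cmod (PP G * cnj (SS G) * Z) \<le> sqrt (n * (n - 1) * (hh^2 * (1 + tt^2))) * T"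
  proof (rule power2_le_imp_le)
    have "n - 1 \<ge> 0" using s zero_le_power2[of "cmod (SS G)"] by linarith
    hence nn: "n * (n - 1) \<ge> 0" by simp
    have "(cmod (PP G * cnj (SS G) * Z))^2 = n * (n - 1) * (cmod Z)^2" unfolding norm_mult power_mult_distrib complex_mod_cnj s n_def ..
    also have "\<dots> \<le> n * (n - 1) * (hh^2 * (1 + tt^2) * T^2)" by (rule mult_left_mono[OF assms(5) nn])
    also have "\<dots> = (sqrt (n * (n - 1) * (hh^2 * (1 + tt^2))) * T)^2" using nn by (simp add: power_mult_distrib)
    finally show "(cmod (PP G * cnj (SS G) * Z))^2 \<le> (sqrt (n * (n - 1) * (hh^2 * (1 + tt^2))) * T)^2" .
    show "0 \<le> sqrt (n * (n - 1) * (hh^2 * (1 + tt^2))) * T" using nn assms(6) by simp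
  qed
  ultimately show ?thesis by (simp add: algebra_simps) 
qed

text \<open>If the heptagon contains a point together with its image, the centre moves by at most 2
  R. Applying \<open>height_lower\<close> to \<open>G\<close> and to its inverse gives n at most
  cosh^2 R = (2 + eta) / (3 (2 - eta)), and (2 + eta)/3 < eta.\<close>

lemma displacement_bound:
  assumes G: "det G = 1" and nz: "a \<noteq> 0" "b \<noteq> 0" "r > 0"
    and 1: "\<forall>i. r * NN i a + NN i b \<le> 0" and 2: "\<forall>i. r * NN i (G *v a) + NN i (G *v b) \<le> 0"
  shows "(2 - eta) * (cmod (PP G))^2 < eta"
proof -
  define n where "n = (cmod (PP G))^2"
  define \<rho> where "\<rho> = hh^2 * (1 + tt^2)"
  define \<mu> where "\<mu> = 2 * n - 1 - 2 * sqrt (n * (n - 1) * \<rho>)"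
  define G' where "G' = matrix_inv G"
  have G': "det G' = 1" "G' *v (G *v v) = v" for v
  proof -
    have "det (G' ** G) = 1" unfolding G'_def matrix_inv_mult_det1[OF G] by simp
    thus "det G' = 1" using G by (simp add: det_mul)
    show "G' *v (G *v v) = v" unfolding G'_def matrix_vector_mul_assoc matrix_inv_mult_det1[OF G] by simp
  qed
  have nz': "G *v a \<noteq> 0" "G *v b \<noteq> 0" using nz G'(2) by (metis matrix_vector_mult_0_right)+
  have L: "r * NN i a + NN i b = Lf i (of_real r * (nu a)^2 + (nu b)^2) (r * qf a + qf b)" for i a b
    unfolding NN_Lf Lf_lin ..
  define T T' where "T = r * qf a + qf b" and "T' = r * qf (G *v a) + qf (G *v b)"
  have T: "T > 0" "T' > 0" unfolding T_def T'_def using nz nz' qf_pos by (intro add_pos_pos mult_pos_pos; simp)+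
  have "T' \<ge> \<mu> * T" unfolding \<mu>_def T_def T'_def n_def \<rho>_def
    using heptagon_radius[OF 1[unfolded L]] T(1) unfolding T_def by (intro height_lower[OF G]) auto
  moreover have "T \<ge> \<mu> * T'"
  proof -
    have "(cmod (PP G'))^2 = n" unfolding G'_def PP_inv[OF G] n_def by simp
    hence "r * qf (G' *v (G *v a)) + qf (G' *v (G *v b)) \<ge> \<mu> * T'" unfolding \<mu>_def T'_def \<rho>_def
      using heptagon_radius[OF 2[unfolded L]] T(2) height_lower[OF G'(1), of r "G *v a" "G *v b"] unfolding T'_def by auto
    thus ?thesis unfolding G'(2) T_def .
  qed
  ultimately have "\<mu> * (T + T') \<le> 1 * (T + T')" by (simp add: algebra_simps)
  hence "\<mu> \<le> 1" using T by (intro mult_right_le_imp_le[of \<mu> "T + T'" 1]) auto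
  hence le: "n - 1 \<le> sqrt (n * (n - 1) * \<rho>)" unfolding \<mu>_def by simp
  have n1: "n \<ge> 1" using PP_SS_det[of G] G zero_le_power2[of "cmod (SS G)"] unfolding n_def by linarith
  have \<rho>: "\<rho> \<ge> 0" unfolding \<rho>_def by simp
  have "(n - 1)^2 \<le> (sqrt (n * (n - 1) * \<rho>))^2" using le n1 by (intro power_mono) auto
  also have "\<dots> = n * (n - 1) * \<rho>" using n1 \<rho> by simp
  finally have q: "(n - 1) * (n - 1) \<le> (n - 1) * (n * \<rho>)" by (simp add: power2_eq_square algebra_simps)
  have "n - 1 \<le> n * \<rho>"
  proof (cases "n = 1")
    case False
    thus ?thesis using q n1 by (intro mult_left_le_imp_le[of "n - 1" "n - 1"]) auto
  qed (use \<rho> in simp)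
  hence "n * (1 - \<rho>) \<le> 1" by (simp add: algebra_simps)
  moreover have "1 - \<rho> = 3 * (2 - eta) / (2 + eta)" unfolding \<rho>_def hh_tt_sq using eta_gt_1 by (simp add: field_simps)
  ultimately have "3 * ((2 - eta) * n) \<le> 2 + eta" using eta_gt_1 by (simp add: field_simps)
  thus ?thesis using eta_gt_1 unfolding n_def by linarith
qed

text \<open>The factors are equal rotations about the image of the centre and about the centre
  itself; the trace of their product depends only on the distance of the two centres.\<close>

lemma trace_conj_g7:
  assumes "det G = 1"
  shows "(2 - eta) * (cmod (PP G))^2 = 2 - ((G ** g7 ** matrix_inv G ** g7)$1$1 + (G ** g7 ** matrix_inv G ** g7)$2$2)"
proof -
  have tr: "M$1$1 + M$2$2 = 2 * Re (PP M)" for M by (simp add: PP_def)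
  have "(cmod (PP G))^2 - 1 = (cmod (SS G))^2" using PP_SS_det[of G] assms by linarith
  hence PS: "PP G * cnj (PP G) = of_real ((cmod (PP G))^2)" "SS G * cnj (SS G) = of_real ((cmod (PP G))^2 - 1)"
    by (simp_all only: complex_norm_square)
  have "PP (G ** g7 ** matrix_inv G ** g7) = (PP G * cnj (PP G)) * (K7 * K7) - (SS G * cnj (SS G)) * (K7 * cnj K7)"
    unfolding PP_mult SS_mult PP_inv[OF assms] PP_g7 by (simp add: algebra_simps)
  also have "\<dots> = of_real ((cmod (PP G))^2) * w7 - of_real ((cmod (PP G))^2 - 1)"
    unfolding PS K7_root by (simp add: power2_eq_square[symmetric] K7_root)
  finally have "Re (PP (G ** g7 ** matrix_inv G ** g7)) = (cmod (PP G))^2 * (eta / 2) - ((cmod (PP G))^2 - 1)"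
    by (simp add: w7_eq del: of_real_power)
  thus ?thesis unfolding tr by (simp add: algebra_simps)
qed

text \<open>By \<open>trace_conj_g7\<close>, \<open>m = (2 - \<eta>) * (cmod (PP G))\<^sup>2\<close> lies in \<open>\<int>[\<eta>]\<close>; as traces are bounded by 2 at the two
  definite places, the norm of \<open>m - 1\<close> is at most \<open>1\<close>, with equality only for \<open>m = 2 - \<eta>\<close>.\<close>

lemma displacement_cases:
  assumes G: "G \<in> Delta237" and small: "(2 - eta) * (cmod (PP G))^2 < eta"
  shows "(cmod (PP G))^2 = 1 \<or> (2 - eta) * (cmod (PP G))^2 = 1"
proof -
  have dG: "det G = 1" by (rule Delta_det[OF G])
  define m where "m = (2 - eta) * (cmod (PP G))^2"
  have n1: "(cmod (PP G))^2 \<ge> 1" using PP_SS_det[of G] dG zero_le_power2[of "cmod (SS G)"] by linarith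
  have e2: "2 - eta > 0" using eta_bounds by simp
  have m1: "m \<ge> 2 - eta" unfolding m_def using mult_left_mono[OF n1, of "2 - eta"] e2 by simp
  define W where "W = G ** g7 ** matrix_inv G"
  have W: "W \<in> Delta237" unfolding W_def by (intro Delta_mult G g7_Delta Delta_inv)
  define t1 where "t1 = (W ** g7)$1$1 + (W ** g7)$2$2"
  define t2 where "t2 = (W ** matrix_inv g7)$1$1 + (W ** matrix_inv g7)$2$2"
  have mt: "m = 2 - t1" unfolding m_def t1_def W_def trace_conj_g7[OF dG] ..
  obtain y1 z1 where 1: "zrel t1 y1 z1" "\<bar>y1\<bar> \<le> 2" "\<bar>z1\<bar> \<le> 2"
    using Delta_trace[OF Delta_mult[OF W g7_Delta]] unfolding t1_def by blast
  obtain y2 z2 where 2: "zrel t2 y2 z2" "\<bar>y2\<bar> \<le> 2" "\<bar>z2\<bar> \<le> 2"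
    using Delta_trace[OF Delta_mult[OF W Delta_inv[OF g7_Delta]]] unfolding t2_def by blast
  \<comment> \<open>For determinant one, tr(W X) + tr(W X^-1) = tr W tr X, and W is conjugate to X =
    \<open>g7\<close>; so the sum is (2 cos(pi/7))^2. As both conjugate traces are at most 2, each
    is also bounded below, by \<open>eta2\<close> and \<open>eta3\<close> respectively, which
    improves on -2.\<close>
  have "t1 + t2 = 2 + eta"
  proof -
    have tr: "M$1$1 + M$2$2 = 2 * Re (PP M)" for M by (simp add: PP_def)
    have "PP W = K7 * (PP G * cnj (PP G)) - cnj K7 * (SS G * cnj (SS G))"
      unfolding W_def PP_mult SS_mult PP_inv[OF dG] PP_g7 by (simp add: algebra_simps)
    hence PW: "PP W = K7 * of_real ((cmod (PP G))^2) - cnj K7 * of_real ((cmod (SS G))^2)"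
      unfolding complex_norm_square .
    have "Re (PP W) = g7c * ((cmod (PP G))^2 - (cmod (SS G))^2)" unfolding PW
      by (simp add: K7_def algebra_simps del: of_real_power)
    hence w: "Re (PP W) = g7c" unfolding PP_SS_det dG by simp
    have "PP (W ** g7) + PP (W ** matrix_inv g7) = PP W * (K7 + cnj K7)"
      unfolding PP_mult PP_inv[OF Delta_det[OF g7_Delta]] PP_g7 by (simp add: algebra_simps)
    hence "Re (PP (W ** g7)) + Re (PP (W ** matrix_inv g7)) = Re (PP W) * (2 * g7c)"
      by (simp add: K7_def complex_eq_iff)
    thus ?thesis unfolding t1_def t2_def tr w using g7c_sq by (simp add: power2_eq_square)
  qed
  moreover have "zrel (t1 + t2) (y1 + y2) (z1 + z2)" by (rule zrel_add[OF 1(1) 2(1)])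
  ultimately have "zrel (2 + eta) (y1 + y2) (z1 + z2)" by simp
  moreover have "zrel (2 + eta) (2 + eta2) (2 + eta3)" by (intro zrel_intros)
  ultimately have s: "y1 + y2 = 2 + eta2" "z1 + z2 = 2 + eta3" using zrel_unique by blast+
  have zm: "zrel (m - 1) (1 - y1) (1 - z1)" 
  proof -
    have "zrel (2 - t1 - 1) (2 - y1 - 1) (2 - z1 - 1)" by (intro zrel_diff zrel_numeral zrel_1 1(1))
    thus ?thesis unfolding mt by simp
  qed
  have yz: "\<bar>1 - y1\<bar> \<le> 1 - eta2" "\<bar>1 - z1\<bar> \<le> 1 - eta3" 
  proof -
    have b: "\<bar>1 - y\<bar> \<le> 1 - e" if "\<bar>y\<bar> \<le> 2" "\<bar>y'\<bar> \<le> 2" "y + y' = 2 + e" "e < 0" for y y' e :: real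
      using that by linarith
    show "\<bar>1 - y1\<bar> \<le> 1 - eta2" by (rule b[OF 1(2) 2(2) s(1) eta23_neg(1)])
    show "\<bar>1 - z1\<bar> \<le> 1 - eta3" by (rule b[OF 1(3) 2(3) s(2) eta23_neg(2)])
  qed
  \<comment> \<open>1 - eta is a unit, so the bounds at the two definite places leave |m - 1| >= eta
    - 1 unless m = 1, whereas m lies in [2 - eta, eta).\<close>
  have N1: "(1 - eta2) * (1 - eta3) * (eta - 1) = 1" unfolding eta2_def eta3_def using eta_cubic by algebra
  show ?thesis
  proof (cases "m = 1")
    case True thus ?thesis unfolding m_def by simp
  next
    case False
    have "1 \<le> \<bar>(m - 1) * (1 - y1) * (1 - z1)\<bar>" using zrel_norm_ge_1[OF zm] False by simp
    also have "\<dots> = \<bar>m - 1\<bar> * (\<bar>1 - y1\<bar> * \<bar>1 - z1\<bar>)" by (simp add: abs_mult)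
    also have "\<dots> \<le> \<bar>m - 1\<bar> * ((1 - eta2) * (1 - eta3))" using yz by (intro mult_left_mono mult_mono) auto
    finally have "(1 - eta2) * (1 - eta3) * (eta - 1) \<le> (1 - eta2) * (1 - eta3) * \<bar>m - 1\<bar>" unfolding N1 by (simp add: mult.commute)
    moreover have "(1 - eta2) * (1 - eta3) > 0" using eta2_bounds eta3_bounds by (intro mult_pos_pos) auto
    ultimately have "eta - 1 \<le> \<bar>m - 1\<bar>" by (rule mult_left_le_imp_le)
    hence "m = 2 - eta" using small m1 eta_bounds unfolding m_def[symmetric] by (simp add: abs_if split: if_splits)
    thus ?thesis unfolding m_def using e2 by simp
  qed
qed

text \<open>By \<open>n1\<close> the centre is fixed and \<open>G\<close> is a rotation. A power of
  \<open>g7\<close> brings the argument of \<open>PP\<close> within pi/14 of 0, so the trace t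
  exceeds 1.94; as its conjugates are at most 2 in modulus, the norm of 2 - t is at most 0.06 * 16 <
  1, hence t = 2.\<close>

lemma stabilizer_g7:
  assumes G: "G \<in> Delta237" and n1: "(cmod (PP G))^2 = 1"
  shows "\<exists>i. G = mpow g7 i"
proof -
  have dG: "det G = 1" by (rule Delta_det[OF G])
  have S: "SS G = 0" using PP_SS_det[of G] dG n1 by simp
  have cK: "cis (2 * pi / real 14) = K7" unfolding K7_cis by simp
  have P1: "cmod (PP G) = 1" using n1 by (simp add: power2_eq_1_iff) (use norm_ge_zero[of "PP G"] in linarith)
  obtain i where i: "Re (cnj K7 ^ i * PP G) \<ge> cos (pi / 14)"
    using rotate_to_sector[of 14 "PP G"] unfolding cK P1 by auto
  define H where "H = matrix_inv (mpow g7 i) ** G"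
  have dg: "det (mpow g7 i) = 1" by (rule det_mpow_g7)
  have H: "H \<in> Delta237" unfolding H_def by (intro Delta_mult Delta_inv mpow_Delta g7_Delta G)
  have PH: "PP H = cnj K7 ^ i * PP G" "SS H = 0"
    unfolding H_def PP_mult SS_mult PP_inv[OF dg] PP_g7_pow S by simp_all
  have cH: "cmod (PP H) = 1" unfolding PH norm_mult norm_power P1 complex_mod_cnj K7_cis by simp
  define t where "t = 2 * Re (PP H)"
  have tr: "H$1$1 + H$2$2 = t" by (simp add: PP_def t_def)
  have c: "cos (pi / 14) > 0.97"
  proof (rule power2_less_imp_less)
    have "2 * (cos (pi / 14))^2 - 1 = g7c" using cos_double_cos[of "pi / 14"] unfolding cos_pi7[symmetric] by simp
    moreover have "g7c > 0.9" unfolding g7c_def using eta_bounds eta_sq_bounds by simp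
    ultimately show "0.97^2 < (cos (pi / 14))^2" by (simp add: power2_eq_square)
    show "0 \<le> cos (pi / 14)" by (rule cos_ge_zero) auto
  qed
  have t: "t > 1.94" "t \<le> 2" using i c abs_Re_le_cmod[of "PP H"] cH unfolding t_def PH by auto
  obtain y z where yz: "zrel t y z" "\<bar>y\<bar> \<le> 2" "\<bar>z\<bar> \<le> 2" using Delta_trace[OF H] unfolding tr by blast
  have zt: "zrel (2 - t) (2 - y) (2 - z)" by (intro zrel_diff zrel_numeral yz)
  have "t = 2"
  proof (rule ccontr)
    assume "t \<noteq> 2"
    hence "1 \<le> \<bar>(2 - t) * (2 - y) * (2 - z)\<bar>" using zrel_norm_ge_1[OF zt] by simp
    also have "\<dots> = \<bar>2 - t\<bar> * (\<bar>2 - y\<bar> * \<bar>2 - z\<bar>)" by (simp add: abs_mult)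
    also have "\<dots> \<le> 0.06 * (4 * 4)" using t yz by (intro mult_mono) auto
    finally show False by simp
  qed
  hence "Re (PP H) = 1" unfolding t_def by simp
  moreover have "(Re (PP H))^2 + (Im (PP H))^2 = 1" unfolding cmod_power2[symmetric] cH by simp
  ultimately have "PP H = 1" by (simp add: complex_eq_iff)
  hence H1: "H = mat 1" using PH(2) PP_1 by (intro PP_SS_eqI) simp_all
  have "G = (mpow g7 i ** matrix_inv (mpow g7 i)) ** G" unfolding matrix_inv_mult_det1[OF dg] by simp
  also have "\<dots> = mpow g7 i ** H" unfolding H_def by (simp only: matrix_mul_assoc)
  finally show ?thesis unfolding H1 by auto
qed

text \<open>The half-turn moves the centre to that of the neighbour across edge 0; this distance is
  the second alternative of \<open>displacement_cases\<close>.\<close>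

lemma PP_g2: "\<exists>p s. PP g2 = \<i> * of_real p \<and> SS g2 = \<i> * of_real s \<and> p^2 = 1 / (2 - eta) \<and> s^2 = 1 / (2 - eta) - 1 \<and> p * s = - hh / (2 - eta)"
proof -
  define x where "x = c0 / sqrt eta"
  have x0: "x > 0" unfolding x_def by simp
  have x2: "x^2 = (1 - hh) / (1 + hh)" unfolding x_def power_divide sqrt_eta_sq c0_sq by simp
  have ix2: "(1 / x)^2 = (1 + hh) / (1 - hh)" unfolding power_divide x2 by simp
  have x1: "1 / x = sqrt eta / c0" unfolding x_def by simp
  define p s where "p = (x + 1 / x) / 2" and "s = (x - 1 / x) / 2"
  have P: "PP g2 = \<i> * of_real p" "SS g2 = \<i> * of_real s"
    unfolding PP_def SS_def g2_def p_def s_def x1 by (simp_all add: x_def complex_eq_iff)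
  have q: "x^2 + (1 / x)^2 = (2 + 2 * hh^2) / (1 - hh^2)" "x^2 - (1 / x)^2 = - 4 * hh / (1 - hh^2)"
  proof -
    have gen: "(1 - h) / (1 + h) + (1 + h) / (1 - h) = (2 + 2 * h^2) / (1 - h^2)"
      "(1 - h) / (1 + h) - (1 + h) / (1 - h) = - 4 * h / (1 - h^2)" if "0 < h" "h < 1" for h :: real
    proof -
      have e: "1 - h^2 = (1 + h) * (1 - h)" by algebra
      have "(1 - h) / (1 + h) = (1 - h) * (1 - h) / (1 - h^2)" "(1 + h) / (1 - h) = (1 + h) * (1 + h) / (1 - h^2)"
        unfolding e using that by simp_all
      thus "(1 - h) / (1 + h) + (1 + h) / (1 - h) = (2 + 2 * h^2) / (1 - h^2)"
        "(1 - h) / (1 + h) - (1 + h) / (1 - h) = - 4 * h / (1 - h^2)"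
        by (simp_all add: add_divide_distrib[symmetric] diff_divide_distrib[symmetric] power2_eq_square algebra_simps)
    qed
    show "x^2 + (1 / x)^2 = (2 + 2 * hh^2) / (1 - hh^2)" "x^2 - (1 / x)^2 = - 4 * hh / (1 - hh^2)"
      unfolding x2 ix2 using gen[OF hh_bounds] by blast+
  qed
  have h: "1 - hh^2 = 2 - eta" "2 + 2 * hh^2 = 2 * eta" unfolding hh_sq by simp_all
  have xx: "x * (1 / x) = 1" using x0 by simp
  have gen: "((x + y) / 2)^2 = (x^2 + y^2 + 2 * (x * y)) / 4" "((x - y) / 2)^2 = ((x + y) / 2)^2 - x * y"
    "(x + y) / 2 * ((x - y) / 2) = (x^2 - y^2) / 4" for x y :: real by (simp_all add: power2_eq_square field_simps)
  have "p^2 = (x^2 + (1 / x)^2 + 2 * (x * (1 / x))) / 4" unfolding p_def by (rule gen)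
  hence p2: "p^2 = 1 / (2 - eta)" unfolding q h xx using eta_bounds by (simp add: field_simps)
  have "s^2 = p^2 - x * (1 / x)" unfolding s_def p_def by (rule gen)
  hence s2: "s^2 = 1 / (2 - eta) - 1" unfolding p2 xx .
  have "p * s = (x^2 - (1 / x)^2) / 4" unfolding p_def s_def by (rule gen)
  hence "p * s = - hh / (2 - eta)" unfolding q h using eta_bounds by (simp add: field_simps)
  thus ?thesis using P p2 s2 by blast
qed

text \<open>A power of \<open>g7\<close> turns the image of the centre to within the angle pi/7 of
  the neighbouring centre across edge 0. Removing \<open>g2\<close> then leaves a displacement
  smaller than that of a neighbour, and by \<open>displacement_cases\<close> only a rotation
  remains.\<close>

lemma neighbour_case:
  assumes G: "G \<in> Delta237" and n: "(2 - eta) * (cmod (PP G))^2 = 1"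
  shows "\<exists>i k. G = mpow g7 i ** g2 ** mpow g7 k"
proof -
  have dG: "det G = 1" by (rule Delta_det[OF G])
  define n where "n = (cmod (PP G))^2"
  have e2: "2 - eta > 0" using eta_bounds by simp
  have nn: "n = 1 / (2 - eta)" using n e2 unfolding n_def by (simp add: field_simps)
  have s: "(cmod (SS G))^2 = n - 1" using PP_SS_det[of G] dG unfolding n_def by simp
  have n1: "n > 1" unfolding nn using e2 eta_gt_1 by simp
  have hn: "hh^2 * n = n - 1" unfolding nn hh_sq using e2 by (simp add: field_simps)
  have cK: "cis (2 * pi / real 7) = w7" unfolding w7_def by simp
  have PSn: "cmod (PP G * SS G) = hh * n"
  proof (rule power2_eq_imp_eq)
    have "(cmod (PP G * SS G))^2 = n * (hh^2 * n)" unfolding norm_mult power_mult_distrib s hn n_def[symmetric] ..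
    thus "(cmod (PP G * SS G))^2 = (hh * n)^2" by (simp add: power2_eq_square)
  qed (use hh_bounds n1 in auto)
  obtain i where i: "Re (cnj w7 ^ i * (PP G * SS G)) \<ge> g7c * (hh * n)"
    using rotate_to_sector[of 7 "PP G * SS G"] unfolding cK PSn by (auto simp: cos_pi7)
  obtain p q where pq: "PP g2 = \<i> * of_real p" "SS g2 = \<i> * of_real q" "p^2 = n" "q^2 = n - 1" "p * q = - hh * n"
    using PP_g2 unfolding nn by auto
  define G' where "G' = matrix_inv (mpow g7 i) ** G"
  define H where "H = matrix_inv g2 ** G'"
  have dg: "det (mpow g7 i) = 1" "det g2 = 1" by (rule det_mpow_g7 Delta_det[OF g2_Delta])+
  have H: "H \<in> Delta237" unfolding H_def G'_def by (intro Delta_mult Delta_inv mpow_Delta g7_Delta g2_Delta G)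
  have P': "PP G' = cnj K7 ^ i * PP G" "SS G' = cnj K7 ^ i * SS G"
    unfolding G'_def PP_mult SS_mult PP_inv[OF dg(1)] PP_g7_pow by simp_all
  have cK7: "cmod K7 = 1" unfolding K7_cis by simp
  have P'n: "(cmod (PP G'))^2 = n" "(cmod (SS G'))^2 = n - 1" "PP G' * SS G' = cnj w7 ^ i * (PP G * SS G)"
  proof -
    show "(cmod (PP G'))^2 = n" "(cmod (SS G'))^2 = n - 1"
      unfolding P' norm_mult norm_power complex_mod_cnj cK7 s n_def[symmetric] by (simp_all add: s n_def)
    have "PP G' * SS G' = (cnj (K7^2)) ^ i * (PP G * SS G)" unfolding P' by (simp add: power2_eq_square power_mult_distrib)
    thus "PP G' * SS G' = cnj w7 ^ i * (PP G * SS G)" unfolding K7_root by simp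
  qed
  have "PP H = - \<i> * (of_real p * PP G' + of_real q * cnj (SS G'))"
    unfolding H_def PP_mult PP_inv[OF dg(2)] pq by (simp add: algebra_simps)
  hence "(cmod (PP H))^2 = (cmod (of_real p * PP G' + of_real q * cnj (SS G')))^2" by (simp add: norm_mult)
  also have "\<dots> = p^2 * (cmod (PP G'))^2 + q^2 * (cmod (SS G'))^2 + 2 * (p * q) * Re (PP G' * SS G')"
    unfolding cmod_power2 by (simp add: power2_eq_square algebra_simps)
  also have "\<dots> = n * n + (n - 1) * (n - 1) - 2 * hh * n * Re (cnj w7 ^ i * (PP G * SS G))"
    unfolding P'n pq by simp
  also have "\<dots> \<le> n * n + (n - 1) * (n - 1) - 2 * hh * n * (g7c * (hh * n))"
    using i hh_bounds n1 by (intro diff_left_mono mult_left_mono) auto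
  also have "2 * hh * n * (g7c * (hh * n)) = 2 * n * g7c * (hh^2 * n)" by (simp add: power2_eq_square)
  also have "n * n + (n - 1) * (n - 1) - 2 * n * g7c * (hh^2 * n) = n - (n - 1) * (2 * n * g7c - (2 * n - 1))"
    unfolding hn by algebra
  also have "\<dots> < n"
  proof -
    \<comment> \<open>cos(2 pi/7) < cos(pi/7); this is where the rotation into the sector makes the
      displacement strictly smaller.\<close>
    have "eta / 2 < g7c" unfolding g7c_def using eta_sq_bounds by simp
    hence "2 * n * (eta / 2) < 2 * n * g7c" using n1 by (intro mult_strict_left_mono) auto
    moreover have "2 * n * (eta / 2) = 2 * n - 1" using nn e2 by (simp add: field_simps)
    ultimately have "2 * n * g7c - (2 * n - 1) > 0" by linarith
    hence "(n - 1) * (2 * n * g7c - (2 * n - 1)) > 0" using n1 by (intro mult_pos_pos) simp_all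
    thus ?thesis by simp
  qed
  finally have "(2 - eta) * (cmod (PP H))^2 < (2 - eta) * n" using e2 by simp
  hence lt: "(2 - eta) * (cmod (PP H))^2 < 1" using n unfolding n_def by simp
  hence "(cmod (PP H))^2 = 1" using displacement_cases[OF H] eta_gt_1 by auto
  then obtain k where k: "H = mpow g7 k" using stabilizer_g7[OF H] by blast
  have "G = (mpow g7 i ** matrix_inv (mpow g7 i)) ** G" unfolding matrix_inv_mult_det1[OF dg(1)] by simp
  also have "\<dots> = mpow g7 i ** (g2 ** matrix_inv g2) ** G'" unfolding matrix_inv_mult_det1[OF dg(2)] G'_def by (simp add: matrix_mul_assoc)
  also have "\<dots> = mpow g7 i ** g2 ** H" unfolding H_def by (simp only: matrix_mul_assoc)
  finally show ?thesis unfolding k by blast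
qed

text \<open>A translate of the heptagon meeting its interior is the heptagon itself.\<close>

lemma tile_unique:
  assumes G: "G \<in> Delta237" and nz: "a \<noteq> 0" "b \<noteq> 0" "r > 0"
    and 1: "\<forall>i. r * NN i a + NN i b \<le> 0" and 2: "\<forall>i. r * NN i (G *v a) + NN i (G *v b) < 0"
  shows "\<exists>i. G = mpow g7 i"
proof -
  have "(2 - eta) * (cmod (PP G))^2 < eta"
    by (rule displacement_bound[OF Delta_det[OF G] nz 1]) (use 2 less_imp_le in blast)
  from displacement_cases[OF G this] show ?thesis
  proof
    assume "(cmod (PP G))^2 = 1" thus ?thesis by (rule stabilizer_g7[OF G])
  next
    assume "(2 - eta) * (cmod (PP G))^2 = 1"
    then obtain i k where ik: "G = mpow g7 i ** g2 ** mpow g7 k" using neighbour_case[OF G] by blast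
    \<comment> \<open>Adjacent heptagons lie on opposite sides of the line of their common edge, so
      a point of one cannot be interior to the other.\<close>
    have "NN i (G *v v) = - NN (6 * k) v" for v
    proof -
      have "NN i (G *v v) = - NN 0 (mpow g7 k *v v)"
        unfolding ik matrix_vector_mul_assoc[symmetric] using NN_g7_pow[of i 0] by (simp add: NN_g2)
      also have "NN 0 (mpow g7 k *v v) = NN (k + 6 * k) (mpow g7 k *v v)"
        using Lf_mod7[of "k + 6 * k"] by (simp add: NN_Lf)
      finally show ?thesis unfolding NN_g7_pow .
    qed
    hence "r * NN i (G *v a) + NN i (G *v b) = - (r * NN (6 * k) a + NN (6 * k) b)" by simp
    thus ?thesis using 1 2 by (metis neg_less_0_iff_less not_le)
  qed
qed

section \<open>Quadratic points and eigenvectors\<close>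

lemma d2_linear: "d2 (u + v) w = d2 u w + d2 v w" "d2 u (v + w) = d2 u v + d2 u w"
  "d2 (r *s u) v = r * d2 u v" "d2 u (r *s v) = r * d2 u v" "d2 u u = 0" "d2 (- u) v = - d2 u v" "d2 u (- v) = - d2 u v"
  "d2 (u - v) w = d2 u w - d2 v w" "d2 u (v - w) = d2 u v - d2 u w"
  by (simp_all add: d2_def algebra_simps)

lemma vec2_eqI: "u$1 = v$1 \<Longrightarrow> u$2 = v$2 \<Longrightarrow> u = (v::real^2)"
  by (simp add: vec_eq_iff forall_2)

lemma d2_basis: assumes "d2 a b \<noteq> 0" shows "v = (d2 v b / d2 a b) *s a + (d2 a v / d2 a b) *s b"
proof (rule vec2_eqI)
  have "d2 a b * v$1 = d2 v b * a$1 + d2 a v * b$1" "d2 a b * v$2 = d2 v b * a$2 + d2 a v * b$2"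
    by (simp_all add: d2_def algebra_simps)
  thus "v$1 = ((d2 v b / d2 a b) *s a + (d2 a v / d2 a b) *s b)$1" "v$2 = ((d2 v b / d2 a b) *s a + (d2 a v / d2 a b) *s b)$2"
    using assms by (simp_all add: field_simps)
qed

lemma d2_parallel: assumes "d2 u a = 0" "a \<noteq> 0" shows "\<exists>r. u = r *s a"
proof -
  have e: "u$1 * a$2 = u$2 * a$1" using assms(1) by (simp add: d2_def)
  show ?thesis
  proof (cases "a$1 = 0")
    case True
    hence "a$2 \<noteq> 0" using assms(2) by (metis vec2_eqI zero_index)
    thus ?thesis using e True by (intro exI[of _ "u$2 / a$2"] vec2_eqI) auto
  next
    case False
    thus ?thesis using e by (intro exI[of _ "u$1 / a$1"] vec2_eqI) (auto simp: field_simps)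
  qed
qed

lemma eigen_iff: "a \<noteq> 0 \<Longrightarrow> d2 (M *v a) a = 0 \<longleftrightarrow> (\<exists>\<mu>. M *v a = \<mu> *s a)"
  using d2_parallel by (auto simp: d2_linear)

definition mdisc :: "real^2^2 \<Rightarrow> real" where "mdisc M = (M$1$1 - M$2$2)^2 + 4 * M$1$2 * M$2$1"

lemma mdisc_eq: "mdisc M = (M$1$1 + M$2$2)^2 - 4 * det M"
  by (simp add: mdisc_def det_2 power2_eq_square algebra_simps)

lemma eigen_char: fixes M :: "real^2^2" assumes "M *v a = \<mu> *s a" "a \<noteq> 0" shows "\<mu>^2 - (M$1$1 + M$2$2) * \<mu> + det M = 0"
proof -
  have e: "M$1$1 * a$1 + M$1$2 * a$2 = \<mu> * a$1" "M$2$1 * a$1 + M$2$2 * a$2 = \<mu> * a$2"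
    using assms(1) by (simp_all add: vec_eq_iff forall_2)
  have "(\<mu>^2 - (M$1$1 + M$2$2) * \<mu> + det M) * a$1 = 0" "(\<mu>^2 - (M$1$1 + M$2$2) * \<mu> + det M) * a$2 = 0"
    unfolding det_2 using e by algebra+
  thus ?thesis using assms(2) by (metis mult_eq_0_iff vec2_eqI zero_index)
qed

lemma theta_om: assumes "z \<in> field_L" "w \<in> field_L"
  obtains y0 y1 y2 y3 where "y0 \<in> field_F" "y1 \<in> field_F" "y2 \<in> field_F" "y3 \<in> field_F"
    "theta z w = om y0 y1 y2 y3"
proof -
  obtain y0 y2 where z: "y0 \<in> field_F" "y2 \<in> field_F" "z = y0 + y2 * sqrt eta" using assms(1) unfolding field_L_eq FL_def by blast
  obtain y1 y3 where w: "y1 \<in> field_F" "y3 \<in> field_F" "w = y1 + y3 * sqrt eta" using assms(2) unfolding field_L_eq FL_def by blast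
  have "theta z w = om y0 y1 y2 y3" unfolding theta_def om_def z w conj_L_eq[OF z(1,2)] conj_L_eq[OF w(1,2)] ..
  thus thesis using that z w by blast
qed

lemma om_theta: assumes "y0 \<in> field_F" "y1 \<in> field_F" "y2 \<in> field_F" "y3 \<in> field_F"
  shows "\<exists>z\<in>field_L. \<exists>w\<in>field_L. om y0 y1 y2 y3 = theta z w"
proof (intro bexI)
  show "om y0 y1 y2 y3 = theta (y0 + y2 * sqrt eta) (y1 + y3 * sqrt eta)"
    unfolding theta_def om_def conj_L_eq[OF assms(1,3)] conj_L_eq[OF assms(2,4)] ..
  show "y0 + y2 * sqrt eta \<in> field_L" "y1 + y3 * sqrt eta \<in> field_L" unfolding field_L_eq FL_def using assms by blast+
qed

lemma disc_mdisc: "disc z w = mdisc (theta z w)"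
  by (simp add: disc_def mdisc_def theta_def)

lemma conj_L_0: "conj_L 0 = 0" using conj_L_eq[OF F_closed(1) F_closed(1)] by simp

text \<open>\<alpha> is a root of w x^2 - (z - conj z) x - eta conj w, the fixed-point equation of
  \<open>theta z w\<close>; for w = 0 the fixed points are 0 and \<infinity>.\<close>

lemma quad_point_iff:
  assumes "disc z w > 0" "rep \<alpha> a"
  shows "(\<exists>\<sigma>\<in>{1, -1}. \<alpha> = quad_point \<sigma> z w) \<longleftrightarrow> d2 (theta z w *v a) a = 0"
proof -
  define m where "m = z - conj_L z"
  have dd: "disc z w = m^2 + 4 * (eta * conj_L w) * w" unfolding disc_def m_def by simp
  have d: "d2 (theta z w *v a) a = - (w * (a$1)^2 - m * a$1 * a$2 - eta * conj_L w * (a$2)^2)"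
    by (simp add: d2_def theta_def m_def power2_eq_square algebra_simps)
  show ?thesis
  proof (cases "w = 0")
    case True
    have m: "m \<noteq> 0" using assms(1) dd True by auto
    have d': "d2 (theta z w *v a) a = m * a$1 * a$2" using d by (simp add: True conj_L_0)
    show ?thesis
    proof (cases \<alpha>)
      case (Pt x) thus ?thesis using assms(2) m d' True unfolding quad_point_def by auto
    next
      case Infty thus ?thesis using assms(2) m d' True unfolding quad_point_def by auto
    qed
  next
    case False
    show ?thesis
    proof (cases \<alpha>)
      case (Pt x)
      hence a: "a$2 \<noteq> 0" "a$1 = x * a$2" using assms(2) by auto
      have "d2 (theta z w *v a) a = 0 \<longleftrightarrow> w * x^2 - m * x - eta * conj_L w = 0"
      proof -
        have "d2 (theta z w *v a) a = - ((a$2)^2 * (w * x^2 - m * x - eta * conj_L w))"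
          unfolding d a(2) by (simp add: power2_eq_square algebra_simps)
        thus ?thesis using a(1) by simp
      qed
      also have "\<dots> \<longleftrightarrow> (2 * w * x - m)^2 = disc z w"
      proof -
        have "(2 * w * x - m)^2 - disc z w = 4 * w * (w * x^2 - m * x - eta * conj_L w)"
          unfolding dd by (simp add: power2_eq_square algebra_simps)
        thus ?thesis using False by auto
      qed
      also have "\<dots> \<longleftrightarrow> (2 * w * x - m)^2 = (sqrt (disc z w))^2" using assms(1) by simp
      also have "\<dots> \<longleftrightarrow> 2 * w * x - m = sqrt (disc z w) \<or> 2 * w * x - m = - sqrt (disc z w)" by (rule power2_eq_iff)
      also have "\<dots> \<longleftrightarrow> x = (m + 1 * sqrt (disc z w)) / (2 * w) \<or> x = (m + (-1) * sqrt (disc z w)) / (2 * w)"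
        using False by (auto simp: field_simps)
      finally show ?thesis using False unfolding Pt quad_point_def m_def[symmetric] by simp
    next
      case Infty
      hence "a$2 = 0" "a$1 \<noteq> 0" using assms(2) by auto
      thus ?thesis using False unfolding d Infty quad_point_def by auto
    qed
  qed
qed

section \<open>Commuting elements and the unit group of the quadratic order\<close>

lemma O_commute:
  assumes "M \<in> order_O" "N \<in> order_O" "a \<noteq> 0" "d2 (M *v a) a = 0" "d2 (N *v a) a = 0"
  shows "M ** N = N ** M"
proof -
  obtain m n where mn: "M *v a = m *s a" "N *v a = n *s a" using assms eigen_iff by blast
  have "(M ** N - N ** M) *v a = M *v (N *v a) - N *v (M *v a)"
    by (simp add: matrix_vector_mult_diff_rdistrib matrix_vector_mul_assoc)
  also have "M *v (N *v a) = N *v (M *v a)" by (simp add: mn vector_scalar_commute vector_smult_assoc mult.commute)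
  also have "N *v (M *v a) - N *v (M *v a) = 0 *s a" by simp
  \<comment> \<open>The commutator kills the common eigenvector; in a division algebra such an
    element is zero.\<close>
  finally have "det (M ** N - N ** M) = 0" using eigen_char[of "M ** N - N ** M" a 0] assms(3) by simp
  moreover have "M ** N - N ** M \<in> order_O" using assms by (intro O_closed)
  ultimately show ?thesis using O_division by fastforce
qed

lemma F_common_scale:
  assumes "y0 \<in> field_F" "y1 \<in> field_F" "y2 \<in> field_F" "y3 \<in> field_F"
  obtains n :: real where "n \<noteq> 0" "n *\<^sub>R om y0 y1 y2 y3 \<in> order_O"
proof -
  obtain n0 where 0: "n0 \<noteq> 0" "of_int n0 * y0 \<in> Zring" using F_scale assms(1) by blast
  obtain n1 where 1: "n1 \<noteq> 0" "of_int n1 * y1 \<in> Zring" using F_scale assms(2) by blast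
  obtain n2 where 2: "n2 \<noteq> 0" "of_int n2 * y2 \<in> Zring" using F_scale assms(3) by blast
  obtain n3 where 3: "n3 \<noteq> 0" "of_int n3 * y3 \<in> Zring" using F_scale assms(4) by blast
  define n where "n = real_of_int (n0 * n1 * n2 * n3)"
  have "n * y0 = of_int (n1 * n2 * n3) * (of_int n0 * y0)" "n * y1 = of_int (n0 * n2 * n3) * (of_int n1 * y1)"
    "n * y2 = of_int (n0 * n1 * n3) * (of_int n2 * y2)" "n * y3 = of_int (n0 * n1 * n2) * (of_int n3 * y3)"
    unfolding n_def by simp_all
  moreover have "of_int k * y \<in> Zring" if "y \<in> Zring" for k y using that by (intro Zring_closed)
  ultimately have "n * y0 \<in> Zring" "n * y1 \<in> Zring" "n * y2 \<in> Zring" "n * y3 \<in> Zring" using 0 1 2 3 by metis+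
  hence "n *\<^sub>R om y0 y1 y2 y3 \<in> order_O" unfolding om_scaleR by (intro om_in_O)
  moreover have "n \<noteq> 0" unfolding n_def using 0 1 2 3 by simp
  ultimately show thesis using that by blast
qed

lemma scaleR_mult_mat: "M ** (r *\<^sub>R N) = r *\<^sub>R (M ** N)" "(r *\<^sub>R M) ** N = r *\<^sub>R (M ** N)" for M N :: "real^2^2"
  by (rule mat2_eqI; simp add: algebra_simps)+

lemma scaleR_act: "(r *\<^sub>R M) *v v = r *s (M *v v)" for M :: "real^2^2"
  by (rule vec2_eqI) (simp_all add: algebra_simps)

lemma mdisc_scaleR: "mdisc (r *\<^sub>R M) = r^2 * mdisc M"
  by (simp add: mdisc_def power2_eq_square algebra_simps)

lemma quad_point_O:
  assumes "is_quad_point \<alpha> z w" "rep \<alpha> a"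
  obtains n where "n \<noteq> 0" "n *\<^sub>R theta z w \<in> order_O" "mdisc (n *\<^sub>R theta z w) > 0" "d2 ((n *\<^sub>R theta z w) *v a) a = 0"
proof -
  have q: "z \<in> field_L" "w \<in> field_L" "disc z w > 0" "\<exists>\<sigma>\<in>{1, -1}. \<alpha> = quad_point \<sigma> z w"
    using assms(1) unfolding is_quad_point_def by auto
  obtain y0 y1 y2 y3 where x: "y0 \<in> field_F" "y1 \<in> field_F" "y2 \<in> field_F" "y3 \<in> field_F"
    "theta z w = om y0 y1 y2 y3" using theta_om[OF q(1,2)] by blast
  obtain n where n: "n \<noteq> 0" "n *\<^sub>R theta z w \<in> order_O" using F_common_scale[OF x(1-4)] unfolding x(5) by blast
  have "d2 (theta z w *v a) a = 0" using quad_point_iff[OF q(3) assms(2)] q(4) by blast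
  thus thesis using that[OF n] q(3) n(1) unfolding disc_mdisc by (simp add: scaleR_act d2_linear mdisc_scaleR)
qed

lemma mat_subring_eigen: assumes "a \<noteq> 0" shows "mat_subring {M. d2 (M *v a) a = 0}"
  unfolding mat_subring_def
proof (intro conjI ballI)
  show "mat 1 \<in> {M. d2 (M *v a) a = 0}" by (simp add: d2_linear)
next
  fix M N assume "M \<in> {M. d2 (M *v a) a = 0}" "N \<in> {M. d2 (M *v a) a = 0}"
  then obtain m n where mn: "M *v a = m *s a" "N *v a = n *s a" using eigen_iff[OF assms] by blast
  have "(M - N) *v a = (m - n) *s a" unfolding matrix_vector_mult_diff_rdistrib mn by (rule vec2_eqI) (simp_all add: algebra_simps)
  moreover have "(M ** N) *v a = (m * n) *s a"
    by (simp add: matrix_vector_mul_assoc[symmetric] mn vector_scalar_commute vector_smult_assoc mult.commute)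
  ultimately show "M - N \<in> {M. d2 (M *v a) a = 0}" "M ** N \<in> {M. d2 (M *v a) a = 0}" using eigen_iff[OF assms] by blast+
qed

text \<open>Commuting quaternions have proportional vector parts, and \<open>disc z w > 0\<close>
  keeps the vector part of \<open>theta z w\<close> from vanishing.\<close>

lemma commute_in_F_theta:
  assumes M: "M \<in> order_O" and zw: "z \<in> field_L" "w \<in> field_L" "disc z w > 0" and c: "M ** theta z w = theta z w ** M"
  shows "\<exists>p\<in>field_F. \<exists>c\<in>field_F. M = mat p + c *\<^sub>R theta z w"
proof -
  obtain y0 y1 y2 y3 where x: "y0 \<in> field_F" "y1 \<in> field_F" "y2 \<in> field_F" "y3 \<in> field_F"
    "theta z w = om y0 y1 y2 y3" using theta_om[OF zw(1,2)] by blast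
  obtain X0 X1 X2 X3 where X: "X0 \<in> Zring" "X1 \<in> Zring" "X2 \<in> Zring" "X3 \<in> Zring"
    "M = om (X0/2) (X1/2) (X2/2) (X3/2)" using order_O_om[OF M] by blast
  define m0 m1 m2 m3 where "m0 = X0/2" and "m1 = X1/2" and "m2 = X2/2" and "m3 = X3/2"
  have m: "m0 \<in> field_F" "m1 \<in> field_F" "m2 \<in> field_F" "m3 \<in> field_F" "M = om m0 m1 m2 m3"
    unfolding m0_def m1_def m2_def m3_def X(5) using X(1-4) Zring_subset_F by (auto intro!: F_closed)
  note FI = F_closed eta_in_F x(1-4) m(1-4)
  have "(m0*y1 + m1*y0 - eta*m2*y3 + eta*m3*y2) = (y0*m1 + y1*m0 - eta*y2*m3 + eta*y3*m2)
    \<and> (m0*y2 + m2*y0 + eta*m1*y3 - eta*m3*y1) = (y0*m2 + y2*m0 + eta*y1*m3 - eta*y3*m1)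
    \<and> (m0*y3 + m3*y0 + m1*y2 - m2*y1) = (y0*m3 + y3*m0 + y1*m2 - y2*m1)"
    using om_inject[OF c[unfolded x(5) m(5) om_mult]] FI by (metis (no_types, lifting))
  hence "2 * eta * (m3 * y2 - m2 * y3) = 0" "2 * eta * (m1 * y3 - m3 * y1) = 0" "2 * (m1 * y2 - m2 * y1) = 0"
    by (simp_all add: algebra_simps)
  hence r: "m3 * y2 = m2 * y3" "m1 * y3 = m3 * y1" "m1 * y2 = m2 * y1" by simp_all
  have "y1 \<noteq> 0 \<or> y2 \<noteq> 0 \<or> y3 \<noteq> 0"
  proof (rule ccontr)
    assume "\<not> ?thesis"
    hence "disc z w = 0" unfolding disc_mdisc x(5) by (simp add: mdisc_def om_def)
    thus False using zw(3) by simp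
  qed
  then obtain c where c: "c \<in> field_F" "m1 = c * y1" "m2 = c * y2" "m3 = c * y3"
  proof (elim disjE)
    assume "y1 \<noteq> 0" thus thesis using r FI by (intro that[of "m1 / y1"]) (auto simp: field_simps intro: F_closed)
  next
    assume "y2 \<noteq> 0" thus thesis using r FI by (intro that[of "m2 / y2"]) (auto simp: field_simps intro: F_closed)
  next
    assume "y3 \<noteq> 0" thus thesis using r FI by (intro that[of "m3 / y3"]) (auto simp: field_simps intro: F_closed)
  qed
  have "M = mat (m0 - c * y0) + c *\<^sub>R theta z w" unfolding m(5) x(5) mat_om om_scaleR om_add c by simp
  moreover have "m0 - c * y0 \<in> field_F" using FI c(1) by (intro F_closed)
  ultimately show ?thesis using c(1) by blast
qed

lemma stabilizer_in_F_theta: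
  assumes q: "is_quad_point \<alpha> z w" and a: "rep \<alpha> a" and M: "M \<in> order_O" "d2 (M *v a) a = 0"
  shows "\<exists>p\<in>field_F. \<exists>c\<in>field_F. M = mat p + c *\<^sub>R theta z w"
proof -
  obtain n where n: "n \<noteq> 0" "n *\<^sub>R theta z w \<in> order_O" "d2 ((n *\<^sub>R theta z w) *v a) a = 0"
    using quad_point_O[OF q a] by metis
  have "M ** (n *\<^sub>R theta z w) = (n *\<^sub>R theta z w) ** M" by (rule O_commute[OF M(1) n(2) rep_nz[OF a] M(2) n(3)])
  hence "n *\<^sub>R (M ** theta z w) = n *\<^sub>R (theta z w ** M)" by (simp only: scaleR_mult_mat)
  hence "M ** theta z w = theta z w ** M" using n(1) by simp
  thus ?thesis using commute_in_F_theta[OF M(1)] q unfolding is_quad_point_def by blast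
qed

text \<open>Turns the arithmetic unit group into the stabilizer of the end point. Elements of
  \<open>field_K z w\<close> have \<open>a\<close> as an eigenvector; conversely, an element of the
  order fixing \<alpha> commutes with a multiple of \<open>theta z w\<close> and so lies in F + F
  theta.\<close>

lemma order1_zw_eq:
  assumes q: "is_quad_point \<alpha> z w" and a: "rep \<alpha> a"
  shows "order1_zw z w = {M \<in> Delta237. d2 (M *v a) a = 0}"
proof
  have zw: "z \<in> field_L" "w \<in> field_L" "disc z w > 0" "\<exists>\<sigma>\<in>{1, -1}. \<alpha> = quad_point \<sigma> z w"
    using q unfolding is_quad_point_def by auto
  have ta: "d2 (theta z w *v a) a = 0" using quad_point_iff[OF zw(3) a] zw(4) by blast
  have "field_K z w \<subseteq> {M. d2 (M *v a) a = 0}"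
    unfolding field_K_def mat_adjoin_def
  proof (rule hull_minimal[where S = mat_subring, OF _ mat_subring_eigen[OF rep_nz[OF a]]])
    have "d2 (mat x *v a) a = 0" for x by (simp add: d2_def)
    thus "mat ` field_F \<union> {theta z w} \<subseteq> {M. d2 (M *v a) a = 0}" using ta by auto
  qed
  thus "order1_zw z w \<subseteq> {M \<in> Delta237. d2 (M *v a) a = 0}"
    unfolding order1_zw_def mat_units_def order_zw_def by blast
  have K: "mat_subring (field_K z w)" unfolding field_K_def mat_adjoin_def by (rule hull_in) (auto simp: mat_subring_def)
  have gen: "mat x \<in> field_K z w" "theta z w \<in> field_K z w" if "x \<in> field_F" for x
    unfolding field_K_def mat_adjoin_def using that by (auto intro!: hull_inc)
  have in_order: "M \<in> order_zw z w" if M: "M \<in> Delta237" "d2 (M *v a) a = 0" for M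
  proof -
    have O: "M \<in> order_O" using M(1) unfolding Delta_eq by blast
    obtain p c where "p \<in> field_F" "c \<in> field_F" "M = mat p + c *\<^sub>R theta z w"
      using stabilizer_in_F_theta[OF q a O M(2)] by blast
    hence "M \<in> field_K z w" using gen mat_subring_closed[OF K] mat_mult_scaleR by metis
    thus ?thesis unfolding order_zw_def using O by blast
  qed
  show "{M \<in> Delta237. d2 (M *v a) a = 0} \<subseteq> order1_zw z w"
  proof safe
    fix M assume M: "M \<in> Delta237" "d2 (M *v a) a = 0"
    have dM: "det M = 1" by (rule Delta_det[OF M(1)])
    have "d2 (matrix_inv M *v (M *v a)) (matrix_inv M *v a) = d2 (M *v a) a"
      unfolding d2_act Delta_det[OF Delta_inv[OF M(1)]] by simp
    hence "d2 a (matrix_inv M *v a) = 0" unfolding matrix_vector_mul_assoc matrix_inv_mult_det1[OF dM] using M(2) by simp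
    hence "d2 (matrix_inv M *v a) a = 0" using d2_swap by (metis neg_equal_0_iff_equal)
    hence "matrix_inv M \<in> order_zw z w" by (intro in_order Delta_inv M(1))
    thus "M \<in> order1_zw z w" unfolding order1_zw_def mat_units_def using in_order[OF M] M(1) matrix_inv_mult_det1[OF dM] by blast
  qed
qed

lemma rho_eigen: assumes "rep \<alpha> a" "M *v a = \<mu> *s a" shows "rho \<alpha> M = \<mu>"
proof (cases \<alpha>)
  case (Pt x)
  hence "a$2 \<noteq> 0" "a$1 = x * a$2" using assms(1) by auto
  moreover have "M$2$1 * a$1 + M$2$2 * a$2 = \<mu> * a$2" using assms(2) by (simp add: vec_eq_iff forall_2)
  ultimately have "(M$2$1 * x + M$2$2) * a$2 = \<mu> * a$2" by (simp add: algebra_simps)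
  thus ?thesis using \<open>a$2 \<noteq> 0\<close> Pt by simp
next
  case Infty
  hence "a$2 = 0" "a$1 \<noteq> 0" using assms(1) by auto
  moreover have "M$1$1 * a$1 + M$1$2 * a$2 = \<mu> * a$1" using assms(2) by (simp add: vec_eq_iff forall_2)
  ultimately show ?thesis using Infty by simp
qed

lemma rho_in_adjoin:
  assumes q: "is_quad_point \<alpha> z w" and a: "rep \<alpha> a" and M: "M \<in> order_O" "d2 (M *v a) a = 0"
  shows "rho \<alpha> M \<in> adjoin_F (sqrt (disc z w))"
proof -
  have zw: "z \<in> field_L" "w \<in> field_L" "disc z w > 0" "\<exists>\<sigma>\<in>{1, -1}. \<alpha> = quad_point \<sigma> z w"
    using q unfolding is_quad_point_def by auto
  define E where "E = adjoin_F (sqrt (disc z w))"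
  have E: "real_subfield E" unfolding E_def adjoin_F_def by (rule real_subfield_hull)
  have "insert (sqrt (disc z w)) field_F \<subseteq> E" unfolding E_def adjoin_F_def by (rule hull_subset)
  hence sE: "sqrt (disc z w) \<in> E" "\<And>x. x \<in> field_F \<Longrightarrow> x \<in> E" by auto
  obtain p c where pc: "p \<in> field_F" "c \<in> field_F" "M = mat p + c *\<^sub>R theta z w"
    using stabilizer_in_F_theta[OF q a M] by blast
  have "d2 (theta z w *v a) a = 0" using quad_point_iff[OF zw(3) a] zw(4) by blast
  then obtain l where l: "theta z w *v a = l *s a" using eigen_iff[OF rep_nz[OF a]] by blast
  obtain y0 y1 y2 y3 where x: "y0 \<in> field_F" "theta z w = om y0 y1 y2 y3" using theta_om[OF zw(1,2)] by metis
  have tr: "theta z w $1$1 + theta z w $2$2 = 2 * y0" unfolding x(2) by (simp add: om_def)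
  have "l^2 - (2 * y0) * l + det (theta z w) = 0" using eigen_char[OF l rep_nz[OF a]] unfolding tr .
  moreover have "disc z w = (2 * y0)^2 - 4 * det (theta z w)" unfolding disc_mdisc mdisc_eq tr ..
  ultimately have "(2 * (l - y0))^2 = disc z w" by (simp add: power2_eq_square algebra_simps)
  hence "(2 * (l - y0))^2 = (sqrt (disc z w))^2" using zw(3) by simp
  hence "2 * (l - y0) = sqrt (disc z w) \<or> 2 * (l - y0) = - sqrt (disc z w)" by (rule power2_eq_iff[THEN iffD1])
  hence "l = y0 + sqrt (disc z w) / 2 \<or> l = y0 + - sqrt (disc z w) / 2" by auto
  moreover have "y0 + sqrt (disc z w) / 2 \<in> E" "y0 + - sqrt (disc z w) / 2 \<in> E"
    using sE x(1) by (auto intro!: field_closed[OF E])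
  ultimately have lE: "l \<in> E" by blast
  have "M *v a = (p + c * l) *s a"
    unfolding pc(3) matrix_vector_mult_add_rdistrib scaleR_act l by (rule vec2_eqI) (simp_all add: algebra_simps)
  hence "rho \<alpha> M = p + c * l" by (rule rho_eigen[OF a])
  thus ?thesis using lE sE(2) pc(1,2) unfolding E_def[symmetric] by (auto intro!: field_closed[OF E])
qed

text \<open>In the basis \<open>a, b\<close> the matrix is triangular with diagonal entries
  \<open>l\<close> and \<open>q\<close>, which differ because \<open>mdisc M = (l - q)^2\<close>;
  the coefficient \<tau> diagonalizes it.\<close>

lemma second_eigenvector:
  assumes "d2 a b \<noteq> 0" "mdisc M > 0" "d2 (M *v a) a = 0"
  shows "\<exists>l q \<tau>. l \<noteq> q \<and> M *v a = l *s a \<and> M *v (b - \<tau> *s a) = q *s (b - \<tau> *s a)"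
proof -
  obtain l where l: "M *v a = l *s a" using eigen_iff assms(3) d2_nz[OF assms(1)] by blast
  define p q where "p = d2 (M *v b) b / d2 a b" and "q = d2 a (M *v b) / d2 a b"
  have Mb: "M *v b = p *s a + q *s b" unfolding p_def q_def by (rule d2_basis[OF assms(1)])
  have "d2 (M *v a) (M *v b) = det M * d2 a b" by (rule d2_act)
  hence det: "l * q = det M" unfolding l Mb d2_linear using assms(1) by (simp add: mult.commute)
  have "d2 (M *v a) b + d2 a (M *v b) = (M$1$1 + M$2$2) * d2 a b" by (simp add: d2_def algebra_simps)
  hence "(l + q) * d2 a b = (M$1$1 + M$2$2) * d2 a b" unfolding l Mb d2_linear by (simp add: algebra_simps)
  hence tr: "l + q = M$1$1 + M$2$2" using assms(1) by simp
  have "mdisc M = (l - q)^2" unfolding mdisc_eq tr[symmetric] det[symmetric] by algebra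
  hence lq: "l \<noteq> q" using assms(2) by auto
  define \<tau> where "\<tau> = p / (l - q)"
  have "\<tau> * (l - q) = p" unfolding \<tau>_def using lq by simp
  hence t: "p = \<tau> * l - q * \<tau>" by (simp add: algebra_simps)
  have "M *v (b - \<tau> *s a) = M *v b - \<tau> *s (M *v a)" by (rule vec2_eqI) (simp_all add: algebra_simps)
  also have "\<dots> = q *s (b - \<tau> *s a)" unfolding Mb l t by (rule vec2_eqI) (simp_all add: algebra_simps)
  finally show ?thesis using lq l by blast
qed

section \<open>Periodicity\<close>

lemma Ff_coords: "Ff j u v = (1 - Re (w7 ^ j * vert0)) * (u$1 * v$1) + (1 + Re (w7 ^ j * vert0)) * c0^2 * (u$2 * v$2)
   - Im (w7 ^ j * vert0) * c0 * (u$1 * v$2 + u$2 * v$1)"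
proof -
  define p where "p = w7 ^ j * vert0"
  show ?thesis unfolding Ff_def Fc_def p_def[symmetric] by (simp add: nu_def power2_eq_square algebra_simps)
qed

lemma Ff_linear: "Ff j u (v + w) = Ff j u v + Ff j u w" "Ff j (r *s u) v = r * Ff j u v" "Ff j u (r *s v) = r * Ff j u v"
  unfolding Ff_coords by (simp_all add: algebra_simps)

text \<open>The vertices lie inside the disc, so each form is positive definite. Adding t a to c
  therefore moves the value at (a, c) in the direction of the sign of t, by an amount that vanishes
  with \<open>qf a\<close>.\<close>

lemma Ff_self: assumes "u \<noteq> 0" shows "Ff j u u > 0" "Ff j u u \<le> 2 * qf u"
proof -
  have "(cmod vert0)^2 = hh^2 * (1 + tt^2)" unfolding cmod_power2 vert0_def by (simp add: power_mult_distrib algebra_simps)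
  hence v: "cmod vert0 < 1" using hh_tt_less(1) by (metis abs_norm_cancel abs_square_less_1)
  have "cmod (w7 ^ j * vert0 * cnj (nu u * nu u)) = cmod vert0 * qf u"
    by (simp add: norm_mult norm_power w7_def qf_def power2_eq_square)
  hence r: "\<bar>Re (w7 ^ j * vert0 * cnj (nu u * nu u))\<bar> \<le> cmod vert0 * qf u" by (metis abs_Re_le_cmod)
  have F: "Ff j u u = qf u - Re (w7 ^ j * vert0 * cnj (nu u * nu u))"
    unfolding Ff_def Fc_def qf_def cmod_power2 by (simp add: power2_eq_square)
  have "cmod vert0 * qf u < 1 * qf u" using v qf_pos[OF assms] by (rule mult_strict_right_mono)
  thus "Ff j u u > 0" "Ff j u u \<le> 2 * qf u" using r unfolding F by linarith+
qed

text \<open>For given distinct eigenvalues and given nonzero \<open>d2 a c\<close>, the matrix and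
  the products of coordinates of the two eigenvectors determine each other. One direction recovers
  the vertex functions from the matrix, the other bounds the matrix by
  \<open>qf a * qf c\<close>.\<close>

lemma matrix_from_eigen:
  assumes "M *v a = l *s a" "M *v c = q *s c"
  shows "d2 a c * M$1$1 = l * (a$1 * c$2) - q * (a$2 * c$1)" "d2 a c * M$1$2 = - (l - q) * (a$1 * c$1)"
    "d2 a c * M$2$1 = (l - q) * (a$2 * c$2)" "d2 a c * M$2$2 = q * (a$1 * c$2) - l * (a$2 * c$1)"
proof -
  have e: "M$1$1 * a$1 + M$1$2 * a$2 = l * a$1" "M$2$1 * a$1 + M$2$2 * a$2 = l * a$2"
    "M$1$1 * c$1 + M$1$2 * c$2 = q * c$1" "M$2$1 * c$1 + M$2$2 * c$2 = q * c$2"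
    using assms by (simp_all add: vec_eq_iff forall_2)
  show "d2 a c * M$1$1 = l * (a$1 * c$2) - q * (a$2 * c$1)" unfolding d2_def using e(1,3) by algebra
  show "d2 a c * M$1$2 = - (l - q) * (a$1 * c$1)" unfolding d2_def using e(1,3) by algebra
  show "d2 a c * M$2$1 = (l - q) * (a$2 * c$2)" unfolding d2_def using e(2,4) by algebra
  show "d2 a c * M$2$2 = q * (a$1 * c$2) - l * (a$2 * c$1)" unfolding d2_def using e(2,4) by algebra
qed

lemma Ff_from_matrix:
  assumes "M *v a = l *s a" "M *v c = q *s c" "M *v a' = l *s a'" "M *v c' = q *s c'" "l \<noteq> q" "d2 a c = d2 a' c'"
  shows "Ff j a c = Ff j a' c'"
proof -
  note E = matrix_from_eigen[OF assms(1,2)] and E' = matrix_from_eigen[OF assms(3,4), folded assms(6)]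
  have nz: "- (l - q) \<noteq> 0" "l - q \<noteq> 0" using assms(5) by auto
  have "- (l - q) * (a$1 * c$1) = - (l - q) * (a'$1 * c'$1)" by (rule trans[OF E(2)[symmetric] E'(2)])
  hence 1: "a$1 * c$1 = a'$1 * c'$1" by (rule mult_left_cancel[OF nz(1), THEN iffD1])
  have "(l - q) * (a$2 * c$2) = (l - q) * (a'$2 * c'$2)" by (rule trans[OF E(3)[symmetric] E'(3)])
  hence 2: "a$2 * c$2 = a'$2 * c'$2" by (rule mult_left_cancel[OF nz(2), THEN iffD1])
  have "(l - q) * (a$1 * c$2 + a$2 * c$1) = (l - q) * (a'$1 * c'$2 + a'$2 * c'$1)"
    using E(1,4) E'(1,4) by (simp add: algebra_simps)
  hence 3: "a$1 * c$2 + a$2 * c$1 = a'$1 * c'$2 + a'$2 * c'$1" by (rule mult_left_cancel[OF nz(2), THEN iffD1])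
  show ?thesis unfolding Ff_coords 1 2 3 ..
qed

lemma eigen_entries_bound:
  assumes "d \<noteq> 0"
  shows "\<exists>R. \<forall>M a c. M *v a = l *s a \<and> M *v c = q *s c \<and> d2 a c = d \<and> qf a * qf c \<le> C \<longrightarrow> (\<forall>i j. \<bar>M$i$j\<bar> \<le> R)"
proof -
  define m where "m = 1 + 1 / c0^2"
  define Q where "Q = 1 + m^2 * C"
  define R where "R = ((\<bar>l\<bar> + \<bar>q\<bar>) * (2 * Q)) / \<bar>d\<bar>"
  have m0: "m \<ge> 0" unfolding m_def by simp
  have sq: "(v$i)^2 \<le> m * qf v" for v and i :: 2
  proof -
    have "m * qf v = (v$1)^2 + (v$2)^2 + ((v$1)^2 / c0^2 + c0^2 * (v$2)^2)" unfolding m_def qf_eq by (simp add: algebra_simps)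
    moreover have "(v$1)^2 / c0^2 + c0^2 * (v$2)^2 \<ge> 0" by simp
    ultimately have "(v$1)^2 \<le> m * qf v" "(v$2)^2 \<le> m * qf v" using zero_le_power2[of "v$1"] zero_le_power2[of "v$2"] by linarith+
    thus ?thesis by (metis exhaust_2)
  qed
  have "\<bar>M$i$j\<bar> \<le> R" if M: "M *v a = l *s a" "M *v c = q *s c" and d: "d2 a c = d" and C: "qf a * qf c \<le> C" for M a c and i j :: 2
  proof -
    have p: "\<bar>a$i * c$j\<bar> \<le> Q" for i j :: 2
    proof -
      have "(a$i * c$j)^2 \<le> (m * qf a) * (m * qf c)" unfolding power_mult_distrib using sq m0 qf_nonneg by (intro mult_mono) auto
      also have "\<dots> = m^2 * (qf a * qf c)" by (simp add: power2_eq_square)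
      also have "\<dots> \<le> m^2 * C" using C by (rule mult_left_mono) simp
      finally have "(a$i * c$j)^2 \<le> m^2 * C" .
      moreover have "\<bar>x\<bar> \<le> 1 + x^2" for x :: real
      proof -
        have "0 \<le> (\<bar>x\<bar> - 1)^2" by simp
        also have "(\<bar>x\<bar> - 1)^2 = x^2 - 2 * \<bar>x\<bar> + 1" by (simp add: power2_eq_square algebra_simps)
        finally show ?thesis using abs_ge_zero[of x] by linarith
      qed
      ultimately show ?thesis unfolding Q_def by (metis add_left_mono order_trans)
    qed
    have Q0: "Q \<ge> 0" using p[of 1 1] by linarith
    have t: "\<bar>x * y\<bar> \<le> \<bar>x\<bar> * Q" if "\<bar>y\<bar> \<le> Q" for x y unfolding abs_mult using that by (rule mult_left_mono) simp
    have df: "\<bar>x - y\<bar> \<le> s + r" if "\<bar>x\<bar> \<le> s" "\<bar>y\<bar> \<le> r" for x y s r :: real using that by linarith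
    have e: "(\<bar>l\<bar> + \<bar>q\<bar>) * (2 * Q) = (\<bar>l\<bar> * Q + \<bar>q\<bar> * Q) + (\<bar>l\<bar> * Q + \<bar>q\<bar> * Q)" by (simp add: algebra_simps)
    have n: "\<bar>l\<bar> * Q + \<bar>q\<bar> * Q \<ge> 0" using Q0 by simp
    note E = matrix_from_eigen[OF M, unfolded d]
    have le: "x \<le> (\<bar>l\<bar> + \<bar>q\<bar>) * (2 * Q)" if "x \<le> \<bar>l\<bar> * Q + \<bar>q\<bar> * Q" for x using that n unfolding e by linarith
    have "- (l - q) * (a$1 * c$1) = q * (a$1 * c$1) - l * (a$1 * c$1)" "(l - q) * (a$2 * c$2) = l * (a$2 * c$2) - q * (a$2 * c$2)"
      by (simp_all add: algebra_simps)
    note E' = E(1) E(2)[unfolded this] E(3)[unfolded this] E(4)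
    have "\<bar>d * M$1$1\<bar> \<le> (\<bar>l\<bar> + \<bar>q\<bar>) * (2 * Q)" unfolding E' by (rule le) (rule df[OF t[OF p] t[OF p]])
    moreover have "\<bar>d * M$2$1\<bar> \<le> (\<bar>l\<bar> + \<bar>q\<bar>) * (2 * Q)" unfolding E' by (rule le) (rule df[OF t[OF p] t[OF p]])
    moreover have "\<bar>d * M$1$2\<bar> \<le> (\<bar>l\<bar> + \<bar>q\<bar>) * (2 * Q)" unfolding E'
      by (rule le, subst add.commute) (rule df[OF t[OF p] t[OF p]])
    moreover have "\<bar>d * M$2$2\<bar> \<le> (\<bar>l\<bar> + \<bar>q\<bar>) * (2 * Q)" unfolding E'
      by (rule le, subst add.commute) (rule df[OF t[OF p] t[OF p]])
    ultimately have "\<bar>d * M$i$j\<bar> \<le> (\<bar>l\<bar> + \<bar>q\<bar>) * (2 * Q)"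
      using exhaust_2[of i] exhaust_2[of j] by (elim disjE) (simp_all only:)
    thus ?thesis unfolding R_def abs_mult using assms by (simp add: pos_le_divide_eq mult.commute)
  qed
  thus ?thesis by blast
qed

lemma qf_diff: "qf (u - v) \<le> 2 * qf u + 2 * qf v"
proof -
  have e: "qf (u - v) + qf (u + v) = 2 * qf u + 2 * qf v" unfolding qf_eq by (simp add: power2_eq_square algebra_simps)
  show ?thesis using qf_nonneg[of "u + v"] e by linarith
qed

context expansion
begin

lemma unit_action:
  "matrix_inv (cf_B B0 i (k0 + l0)) *v ((cf_B B0 i (k0 + l0) ** matrix_inv (cf_B B0 i k0)) *v a) = av k0"
proof -
  have "matrix_inv (cf_B B0 i (k0 + l0)) ** (cf_B B0 i (k0 + l0) ** matrix_inv (cf_B B0 i k0)) = matrix_inv (cf_B B0 i k0)"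
    by (simp only: matrix_mul_assoc B_inv) simp
  thus ?thesis unfolding av_def matrix_vector_mul_assoc by simp
qed

lemma unit_stabilizes:
  assumes "endpoint_periodic \<alpha> B0 i l0 k0"
  shows "d2 ((cf_B B0 i (k0 + l0) ** matrix_inv (cf_B B0 i k0)) *v a) a = 0"
proof -
  let ?g = "cf_B B0 i (k0 + l0) ** matrix_inv (cf_B B0 i k0)"
  have "d2 (?g *v a) a = d2 (av k0) (av (k0 + l0))"
    unfolding d2_inv[of "k0 + l0" "?g *v a" a, symmetric] unit_action av_def[of "k0 + l0", symmetric] ..
  also have "\<dots> = 0" using assms unfolding endpoint_periodic_iff using d2_swap by (metis neg_equal_0_iff_equal order_refl)
  finally show ?thesis .
qed

lemma endpoint_imp_quad:
  assumes "l \<ge> 1" "endpoint_periodic \<alpha> B0 i l k0"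
  shows "\<exists>z w. is_quad_point \<alpha> z w"
proof -
  define \<gamma> where "\<gamma> = cf_B B0 i (k0 + l) ** matrix_inv (cf_B B0 i k0)"
  have G: "\<gamma> \<in> Delta237" unfolding \<gamma>_def by (intro Delta_mult B_Delta B_inv_Delta)
  have Bg: "matrix_inv (cf_B B0 i (k0 + l)) *v (\<gamma> *v a) = av k0" unfolding \<gamma>_def by (rule unit_action)
  have d0: "d2 (\<gamma> *v a) a = 0" unfolding \<gamma>_def by (rule unit_stabilizes[OF assms(2)])
  have nz: "a \<noteq> 0" by (rule rep_nz[OF repa])
  obtain \<mu> where mu: "\<gamma> *v a = \<mu> *s a" using d0 eigen_iff[OF nz] by blast
  have "av k0 = \<mu> *s av (k0 + l)" using Bg unfolding mu av_def vector_scalar_commute by simp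
  hence "qf (av k0) = \<mu>^2 * qf (av (k0 + l))" by (simp add: qf_scale)
  moreover have "qf (av (k0 + l)) < qf (av k0)" using assms(1) by (intro qf_strict) simp
  moreover have "qf (av (k0 + l)) > 0" using Ent_nz[OF Ent_chain] qf_pos by blast
  \<comment> \<open>Since \<open>qf\<close> decreases strictly along the expansion, the eigenvalue
    is not of modulus one and the matrix is hyperbolic.\<close>
  ultimately have "\<mu>^2 > 1" by (metis mult_less_cancel_right_pos mult_1)
  have "\<mu>^2 - (\<gamma>$1$1 + \<gamma>$2$2) * \<mu> + 1 = 0" using eigen_char[OF mu nz] unfolding Delta_det[OF G] .
  hence "mdisc \<gamma> * \<mu>^2 = (\<mu>^2 - 1)^2" unfolding mdisc_eq Delta_det[OF G] by algebra
  moreover have "(\<mu>^2 - 1)^2 > 0" using \<open>\<mu>^2 > 1\<close> by simp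
  ultimately have md: "mdisc \<gamma> > 0" using \<open>\<mu>^2 > 1\<close> by (metis zero_less_mult_pos2 less_trans zero_less_one)
  have "\<gamma> \<in> order_O" using G unfolding Delta_eq by blast
  then obtain y0 y1 y2 y3 where y: "y0 \<in> Zring" "y1 \<in> Zring" "y2 \<in> Zring" "y3 \<in> Zring"
    "\<gamma> = om (y0/2) (y1/2) (y2/2) (y3/2)" by (rule order_O_om)
  have "\<exists>z\<in>field_L. \<exists>w\<in>field_L. \<gamma> = theta z w" unfolding y(5)
    using y(1-4) Zring_subset_F by (intro om_theta) (auto intro!: F_closed)
  then obtain z w where zw: "z \<in> field_L" "w \<in> field_L" "\<gamma> = theta z w" by blast
  have d: "disc z w > 0" using md unfolding disc_mdisc zw(3) .
  show ?thesis unfolding is_quad_point_def using zw d quad_point_iff[OF d repa] d0 by blast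
qed

end

text \<open>\<theta> will be a multiple of \<open>theta z w\<close> that lies in the order;
  \<open>b - \<tau> *s a\<close> lifts its other fixed point.\<close>

locale quadratic_expansion = expansion +
  fixes \<theta> :: "real^2^2" and l q \<tau> :: real
  assumes thO: "\<theta> \<in> order_O" and lq: "l \<noteq> q"
    and tha: "\<theta> *v a = l *s a" and thc: "\<theta> *v (b - \<tau> *s a) = q *s (b - \<tau> *s a)"
begin

definition cc :: "real^2" where "cc = b - \<tau> *s a"
definition cv :: "nat \<Rightarrow> real^2" where "cv k = matrix_inv (cf_B B0 i k) *v cc"
definition th :: "nat \<Rightarrow> real^2^2" where "th k = matrix_inv (cf_B B0 i k) ** \<theta> ** cf_B B0 i k"

lemma bv_cv: "bv k = cv k + \<tau> *s av k"
  unfolding bv_def cv_def av_def cc_def by (simp add: matrix_vector_mult_diff_distrib vector_scalar_commute)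

lemma d2_cv: "d2 (av k) (cv k) = d2 a b"
proof -
  have "d2 a cc = d2 a b" unfolding cc_def by (simp add: d2_linear)
  thus ?thesis unfolding av_def cv_def d2_inv .
qed

lemma th_act: "th k *v (matrix_inv (cf_B B0 i k) *v v) = matrix_inv (cf_B B0 i k) *v (\<theta> *v v)"
proof -
  have "th k *v (matrix_inv (cf_B B0 i k) *v v) = (matrix_inv (cf_B B0 i k) ** \<theta> ** (cf_B B0 i k ** matrix_inv (cf_B B0 i k))) *v v"
    unfolding th_def matrix_vector_mul_assoc by (simp only: matrix_mul_assoc)
  thus ?thesis unfolding B_inv by (simp add: matrix_vector_mul_assoc)
qed

lemma th_eigen: "th k *v av k = l *s av k" "th k *v cv k = q *s cv k"
  unfolding av_def cv_def th_act tha cc_def thc vector_scalar_commute by blast+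

lemma th_step: "th (Suc k) = matrix_inv (cf_A (i (Suc k))) ** th k ** cf_A (i (Suc k))"
proof -
  let ?A = "cf_A (i (Suc k))"
  have "matrix_inv (cf_B B0 i (Suc k)) = matrix_inv ?A ** matrix_inv (cf_B B0 i k)"
    unfolding B_step_inv[of k] matrix_mul_assoc matrix_inv_mult_det1[OF Delta_det[OF cf_A_Delta]] by simp
  thus ?thesis unfolding th_def by (simp add: matrix_mul_assoc)
qed

lemma th_O: "th k \<in> order_O" "det (th k) = det \<theta>"
proof -
  show "th k \<in> order_O" unfolding th_def using thO B_Delta B_inv_Delta unfolding Delta_eq by (intro O_closed) blast+
  show "det (th k) = det \<theta>" unfolding th_def det_mul Delta_det[OF B_Delta] Delta_det[OF B_inv_Delta] by simp
qed

lemma th_finite: "finite (range th)"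
proof -
  \<comment> \<open>As \<open>cv k\<close> and \<open>bv k\<close> differ by a multiple of
    \<open>av k\<close>, whose form decreases, \<open>qf_diff\<close> transfers the bound of
    \<open>qf_product\<close>.\<close>
  define C where "C = 2 * qC + 2 * \<tau>^2 * (qf (av 0) * qf (av 0))"
  have C: "qf (av k) * qf (cv k) \<le> C" for k
  proof -
    have "cv k = bv k - \<tau> *s av k" unfolding bv_cv by simp
    hence "qf (cv k) \<le> 2 * qf (bv k) + 2 * (\<tau>^2 * qf (av k))" using qf_diff[of "bv k" "\<tau> *s av k"] unfolding qf_scale by simp
    hence "qf (av k) * qf (cv k) \<le> qf (av k) * (2 * qf (bv k) + 2 * (\<tau>^2 * qf (av k)))" using qf_nonneg by (rule mult_left_mono)
    also have "\<dots> = 2 * (qf (av k) * qf (bv k)) + 2 * \<tau>^2 * (qf (av k) * qf (av k))" by (simp add: algebra_simps)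
    also have "\<dots> \<le> 2 * qC + 2 * \<tau>^2 * (qf (av 0) * qf (av 0))"
      using qf_product[of k] qf_mono[of 0 k] qf_nonneg by (intro add_mono mult_left_mono mult_mono) auto
    finally show ?thesis unfolding C_def .
  qed
  obtain R where R: "\<forall>M a c. M *v a = l *s a \<and> M *v c = q *s c \<and> d2 a c = d2 (av 0) (cv 0) \<and> qf a * qf c \<le> C \<longrightarrow> (\<forall>i j. \<bar>M$i$j\<bar> \<le> R)"
    using eigen_entries_bound[of "d2 (av 0) (cv 0)" l q C] d2ab unfolding d2_cv by auto
  have "\<forall>i j. \<bar>th k $ i $ j\<bar> \<le> R" for k using R th_eigen[of k] C[of k] unfolding d2_cv by (metis d2_cv)
  hence "range th \<subseteq> {M \<in> order_O. det M = det \<theta> \<and> (\<forall>i j. \<bar>M$i$j\<bar> \<le> R)}" using th_O by blast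
  thus ?thesis using O_finite finite_subset by blast
qed

lemma Ff_th: assumes "th k = th m" shows "Ff j (av k) (cv k) = Ff j (av m) (cv m)"
  using Ff_from_matrix[OF th_eigen[of k] th_eigen[of m, folded assms] lq] unfolding d2_cv by simp

text \<open>The side of a vertex is determined by \<open>cv\<close>, up to ties, which are broken by the sign of the coefficient of \<open>av\<close>.\<close>

lemma eventual_sign:
  "\<exists>K. \<forall>k\<ge>K. \<forall>j. (Ff j (av k) (cv k + t *s av k) > 0 \<longleftrightarrow> Ff j (av k) (cv k) > 0 \<or> Ff j (av k) (cv k) = 0 \<and> t > 0)
     \<and> (t \<noteq> 0 \<longrightarrow> Ff j (av k) (cv k + t *s av k) \<noteq> 0)"
proof -
  define V where "V = (\<lambda>(j, k). Ff j (av k) (cv k)) ` ({..<7} \<times> UNIV)"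
  have "finite V"
  proof -
    have "V \<subseteq> (\<lambda>(j, M). Ff j (av (SOME k. th k = M)) (cv (SOME k. th k = M))) ` ({..<7} \<times> range th)"
    proof
      fix x assume "x \<in> V"
      then obtain j k where jk: "j < 7" "x = Ff j (av k) (cv k)" unfolding V_def by auto
      have "th (SOME m. th m = th k) = th k" by (rule someI) (rule refl)
      hence "x = Ff j (av (SOME m. th m = th k)) (cv (SOME m. th m = th k))" unfolding jk using Ff_th by metis
      thus "x \<in> (\<lambda>(j, M). Ff j (av (SOME k. th k = M)) (cv (SOME k. th k = M))) ` ({..<7} \<times> range th)"
        using jk(1) by (intro image_eqI[of _ _ "(j, th k)"]) auto
    qed
    thus ?thesis by (rule finite_subset) (intro finite_imageI finite_cartesian_product th_finite finite_lessThan)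
  qed
  \<comment> \<open>The least nonzero modulus among the finitely many values of the vertex functions
    is wanted; the inserted 1 keeps the set nonempty.\<close>
  define W where "W = insert 1 (abs ` (V - {0}))"
  have W: "finite W" "W \<noteq> {}" "\<forall>x\<in>W. x > 0" unfolding W_def using \<open>finite V\<close> by auto
  define e where "e = Min W"
  have e: "e > 0" "\<And>x. x \<in> W \<Longrightarrow> e \<le> x" unfolding e_def using W by auto
  have V: "x = 0 \<or> \<bar>x\<bar> \<ge> e" if "x \<in> V" for x using e(2)[of "\<bar>x\<bar>"] that unfolding W_def by auto
  have "e / (2 * (\<bar>t\<bar> + 1)) > 0" using e(1) by simp
  then obtain K where K: "\<forall>k\<ge>K. qf (av k) < e / (2 * (\<bar>t\<bar> + 1))" using qf_small by blast
  show ?thesis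
  proof (rule exI[of _ K], intro allI impI)
    fix k j assume k: "K \<le> k"
    define f g where "f = Ff j (av k) (cv k)" and "g = Ff j (av k) (av k)"
    have nz: "av k \<noteq> 0" using Ent_nz[OF Ent_chain] by blast
    have g: "g > 0" "g \<le> 2 * qf (av k)" unfolding g_def using Ff_self[OF nz] by auto
    have "2 * qf (av k) * (\<bar>t\<bar> + 1) < e" using K[rule_format, OF k] by (simp add: field_simps)
    moreover have "g * (\<bar>t\<bar> + 1) \<le> 2 * qf (av k) * (\<bar>t\<bar> + 1)" using g by (intro mult_right_mono) auto
    moreover have "\<bar>t * g\<bar> \<le> g * (\<bar>t\<bar> + 1)" using g(1) by (simp add: abs_mult algebra_simps)
    ultimately have small: "\<bar>t * g\<bar> < e" by linarith
    have "Ff (j mod 7) (av k) (cv k) \<in> V" unfolding V_def by (intro image_eqI[of _ _ "(j mod 7, k)"]) auto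
    hence f: "f = 0 \<or> \<bar>f\<bar> \<ge> e" unfolding f_def using V Ff_mod7 by metis
    have F: "Ff j (av k) (cv k + t *s av k) = f + t * g" unfolding Ff_linear f_def g_def ..
    show "(Ff j (av k) (cv k + t *s av k) > 0 \<longleftrightarrow> Ff j (av k) (cv k) > 0 \<or> Ff j (av k) (cv k) = 0 \<and> t > 0)
      \<and> (t \<noteq> 0 \<longrightarrow> Ff j (av k) (cv k + t *s av k) \<noteq> 0)"
    proof (cases "f = 0")
      case True
      thus ?thesis unfolding F f_def[symmetric] using g(1) by (auto simp: zero_less_mult_iff)
    next
      case False
      hence "\<bar>f\<bar> > \<bar>t * g\<bar>" using f small by linarith
      hence "(f + t * g > 0 \<longleftrightarrow> f > 0) \<and> f + t * g \<noteq> 0" by linarith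
      thus ?thesis unfolding F f_def[symmetric] using False by auto
    qed
  qed
qed

lemma th_imp_index:
  "\<exists>K. \<forall>k\<ge>K. \<forall>m\<ge>K. th k = th m \<longrightarrow> i (Suc k) = i (Suc m)"
proof -
  obtain K where K: "\<forall>k\<ge>K. \<forall>j. (Ff j (av k) (bv k) > 0 \<longleftrightarrow> Ff j (av k) (cv k) > 0 \<or> Ff j (av k) (cv k) = 0 \<and> \<tau> > 0)"
    using eventual_sign[of \<tau>] unfolding bv_cv by blast
  have "i (Suc k) = i (Suc m)" if "k \<ge> K" "m \<ge> K" "th k = th m" for k m
  proof -
    have s: "Ff j (av k) (bv k) > 0 \<longleftrightarrow> Ff j (av m) (bv m) > 0" for j using K that Ff_th[OF that(3)] by simp
    show ?thesis
    proof (rule chain_index(4))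
      show "i (Suc m) \<in> {1..6}" by (rule chain_index(1))
      show "Ff (i (Suc m)) (av k) (bv k) > 0" unfolding s by (rule chain_index(2))
      show "Ff (Suc (i (Suc m))) (av k) (bv k) \<le> 0" using s chain_index(3)[of m] not_le by metis
    qed
  qed
  thus ?thesis by blast
qed

text \<open>From some point on \<open>th k\<close> determines the next index and thereby, through
  \<open>th_step\<close>, its own successor; a repeated value repeats for ever.\<close>

lemma index_periodic_ex: "\<exists>p\<ge>1. \<exists>k0. index_periodic i p k0"
proof -
  obtain K where K: "\<forall>k\<ge>K. \<forall>m\<ge>K. th k = th m \<longrightarrow> i (Suc k) = i (Suc m)" using th_imp_index by blast
  have "\<not> inj_on th {K..}"
  proof
    assume "inj_on th {K..}"
    moreover have "finite (th ` {K..})" using th_finite by (rule finite_subset[rotated]) auto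
    ultimately have "finite {K..}" using finite_imageD by blast
    thus False by (simp add: infinite_Ici)
  qed
  then obtain k m where km: "k \<ge> K" "m \<ge> K" "k < m" "th k = th m"
    unfolding inj_on_def by (metis atLeast_iff linorder_neqE_nat)
  have *: "th (k + n) = th (m + n)" for n
  proof (induction n)
    case 0 thus ?case using km by simp
  next
    case (Suc n)
    have "i (Suc (k + n)) = i (Suc (m + n))" using K km Suc by simp
    thus ?case using th_step[of "k + n"] th_step[of "m + n"] Suc by simp
  qed
  have "index_periodic i (m - k) k"
    unfolding index_periodic_def
  proof (intro allI impI)
    fix x assume "k < x"
    then obtain n where n: "x = Suc (k + n)" using less_imp_Suc_add by blast
    have "i (Suc (k + n)) = i (Suc (m + n))" using K km * by simp
    thus "i (x + (m - k)) = i x" unfolding n using km by (simp add: add.commute)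
  qed
  moreover have "m - k \<ge> 1" using km by simp
  ultimately show ?thesis by blast
qed

end

section \<open>The stabilizer of an end point\<close>

text \<open>Makes the entry parameter r tend to infinity as \<open>qf a\<close> tends to 0. The
  entry point lies in the circumscribed disc, while |Z|^2 = T^2 - 4 r D and D is at most qf a *
  T.\<close>

lemma entry_time_lower:
  assumes "Ent a b" shows "(1 - hh^2 * (1 + tt^2)) * (c0 * d2 a b)^2 \<le> 4 * (- NN 0 b / NN 0 a) * (qf a)^2"
proof -
  define r where "r = - NN 0 b / NN 0 a"
  define D where "D = (c0 * d2 a b)^2"
  define \<rho> where "\<rho> = hh^2 * (1 + tt^2)"
  note P = Ent_point[OF assms, folded r_def]
  define T where "T = r * qf a + qf b"
  define Z where "Z = of_real r * (nu a)^2 + (nu b)^2"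
  have L: "r * NN i a + NN i b = Lf i Z T" for i unfolding NN_Lf Z_def T_def Lf_lin ..
  have T: "T \<ge> qf b" "T > 0" unfolding T_def using P(1) qf_pos qf_nonneg Ent_nz[OF assms] by (auto intro: add_pos_pos)
  have D0: "D > 0" unfolding D_def using assms unfolding Ent_def by simp
  have "(cmod Z)^2 \<le> \<rho> * T^2" unfolding \<rho>_def using heptagon_radius[of Z T] P(5) T(2) unfolding L by blast
  moreover have "(cmod Z)^2 = T^2 - 4 * r * D"
    unfolding D_def Im_nu[symmetric] Z_def T_def qf_def cmod_power2 by (simp add: power2_eq_square algebra_simps)
  ultimately have 1: "(1 - \<rho>) * T^2 \<le> 4 * r * D" by (simp add: algebra_simps)
  have r1: "1 - \<rho> > 0" unfolding \<rho>_def using hh_tt_less(1) by simp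
  have "D \<le> qf a * qf b" unfolding D_def by (rule d2_bound)
  also have "\<dots> \<le> qf a * T" using T(1) qf_nonneg by (rule mult_left_mono)
  finally have "D^2 \<le> (qf a * T)^2" using D0 by (intro power_mono) auto
  hence "(1 - \<rho>) * D^2 \<le> (1 - \<rho>) * (qf a * T)^2" using r1 by (intro mult_left_mono) auto
  also have "\<dots> = (qf a)^2 * ((1 - \<rho>) * T^2)" by (simp add: power_mult_distrib)
  also have "\<dots> \<le> (qf a)^2 * (4 * r * D)" using 1 by (rule mult_left_mono) simp
  finally have "((1 - \<rho>) * D) * D \<le> (4 * r * (qf a)^2) * D" by (simp add: power2_eq_square algebra_simps)
  thus ?thesis using D0 unfolding D_def \<rho>_def r_def by (rule mult_right_le_imp_le)
qed

text \<open>By \<open>F0\<close> the geodesic also misses vertex 0, so at the entry point no other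
  edge function vanishes. The crossing thus has positive length, and its open part lies in the
  interior of the heptagon.\<close>

lemma strictly_inside:
  assumes E: "Ent a b" and F0: "Ff 0 a b < 0" and j: "j \<in> {1..6}" "Ff j a b > 0" "Ff (Suc j) a b \<le> 0"
  defines "r1 \<equiv> - NN 0 b / NN 0 a" and "r2 \<equiv> - NN j b / NN j a"
  shows "r1 < r2" "r1 < r \<Longrightarrow> r < r2 \<Longrightarrow> r * NN i a + NN i b < 0"
proof -
  have d: "d2 a b > 0" using E unfolding Ent_def by simp
  note P = Ent_point[OF E, folded r1_def] and Q = leave_point[OF d j(2,3), folded r2_def]
  have N: "NN 0 a < 0" "NN j a > 0" using Ent_sign[OF E] leave_sign[OF d j(2,3)] by auto
  have b0: "NN 0 b = - r1 * NN 0 a" using P(2) by simp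
  have c: "2 * s7 * (c0 * d2 a b) > 0" using d by simp
  have "- NN 0 a * (r1 * NN 6 a + NN 6 b) = 2 * s7 * (c0 * d2 a b) * Ff 0 a b"
    using NN_wedge[of 6 a b] unfolding b0 by (simp add: NN_7 Ff_7 b0 algebra_simps)
  also have "\<dots> < 0" using c F0 by (rule mult_pos_neg)
  finally have 6: "r1 * NN 6 a + NN 6 b < 0" using N(1) by (simp add: zero_less_mult_iff mult_less_0_iff)
  have L: "r * NN i a + NN i b = Lf i (of_real r * (nu a)^2 + (nu b)^2) (r * qf a + qf b)" for r i
    unfolding NN_Lf Lf_lin ..
  have T: "r1 * qf a + qf b > 0" using P(1) qf_pos Ent_nz[OF E] by (intro add_pos_pos mult_pos_pos) auto
  have neg: "r1 * NN i a + NN i b < 0" if "i mod 7 \<noteq> 0" for i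
  proof -
    have m: "r1 * NN i a + NN i b = r1 * NN (i mod 7) a + NN (i mod 7) b" unfolding NN_Lf Lf_mod7 ..
    have "i mod 7 < 7" by simp
    hence "i mod 7 = 1 \<or> i mod 7 = 6 \<or> i mod 7 \<in> {2..5}" using that by auto
    thus ?thesis
    proof (elim disjE)
      assume "i mod 7 \<in> {2..5}"
      thus ?thesis unfolding m using Lf_edge[OF T, of 0 _ "i mod 7"] P(2,3) 6 unfolding L by simp
    qed (use P(3) 6 m in simp_all)
  qed
  have "(r1 - r2) * NN j a = r1 * NN j a + NN j b" using Q(2) by (simp add: algebra_simps)
  also have "\<dots> < 0" using j(1) by (intro neg) auto
  finally show "r1 < r2" using N(2) by (simp add: mult_less_0_iff)
  show "r * NN i a + NN i b < 0" if r: "r1 < r" "r < r2"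
  proof (cases "i mod 7 = 0")
    case True
    have "r * NN i a + NN i b = r * NN (i mod 7) a + NN (i mod 7) b" unfolding NN_Lf Lf_mod7 ..
    also have "\<dots> = (r - r1) * NN 0 a" unfolding True b0 by (simp add: algebra_simps)
    also have "\<dots> < 0" using r N(1) by (simp add: mult_less_0_iff)
    finally show ?thesis .
  next
    case False
    show ?thesis
    proof (cases "NN i a > 0")
      case True
      hence "r * NN i a < r2 * NN i a" using r by simp
      thus ?thesis using Q(5)[of i] by linarith
    next
      case ni: False
      hence "r * NN i a \<le> r1 * NN i a" using r by (intro mult_right_mono_neg) auto
      thus ?thesis using neg[OF False] by linarith
    qed
  qed
qed

lemma first_failure: fixes P :: "nat \<Rightarrow> bool"
  assumes "P m" "\<not> P n" "m < n" shows "\<exists>j. m \<le> j \<and> j < n \<and> P j \<and> \<not> P (Suc j)"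
proof (rule ccontr)
  assume *: "\<not> ?thesis"
  have "P k" if "m \<le> k" "k \<le> n" for k using that
    by (induction k rule: dec_induct) (use assms(1) * in auto)
  thus False using assms by simp
qed

text \<open>\<open>K7 = cis (pi / 7)\<close> has seventh power -1, so a rotation that fixes all
  edges is a sign.\<close>

lemma g7_pow_7: assumes "7 dvd n" shows "\<exists>e\<in>{1, -1}. mpow g7 n = e *\<^sub>R mat 1"
proof -
  obtain t where t: "n = 7 * t" using assms by (elim dvdE)
  have "K7 ^ 7 = -1" unfolding K7_cis Complex.DeMoivre by simp
  hence "PP (mpow g7 n) = (-1) ^ t" unfolding PP_g7_pow t power_mult by simp
  moreover have "PP (r *\<^sub>R M) = of_real r * PP M" "SS (r *\<^sub>R M) = of_real r * SS M" for r M
    by (simp_all add: PP_def SS_def complex_eq_iff algebra_simps)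
  ultimately have "mpow g7 n = ((-1) ^ t) *\<^sub>R mat 1" by (intro PP_SS_eqI) (simp_all add: PP_g7_pow PP_1)
  moreover have "(-1::real) ^ t \<in> {1, -1}" by (cases "even t") auto
  ultimately show ?thesis by blast
qed

text \<open>The remainder \<open>p mod l0\<close> is again an eventual period, against minimality
  unless it is 0.\<close>

lemma index_period_dvd:
  assumes "index_periodic i l0 k0" "l0 \<ge> 1" "\<forall>l\<ge>1. \<forall>k. index_periodic i l k \<longrightarrow> l0 \<le> l" "index_periodic i p k1"
  shows "l0 dvd p"
proof (rule ccontr)
  assume nd: "\<not> l0 dvd p"
  have *: "i (k + t * l0) = i k" if "k > k0" for k t
  proof (induction t)
    case (Suc t)
    have "i (k + t * l0 + l0) = i (k + t * l0)" using assms(1) that unfolding index_periodic_def by simp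
    thus ?case using Suc by (simp add: algebra_simps)
  qed simp
  have "index_periodic i (p mod l0) (max k0 k1)"
    unfolding index_periodic_def
  proof (intro allI impI)
    fix k assume k: "max k0 k1 < k"
    have "i (k + p mod l0) = i (k + p mod l0 + (p div l0) * l0)" using *[of "k + p mod l0" "p div l0"] k by simp
    also have "k + p mod l0 + (p div l0) * l0 = k + p" by simp
    also have "i (k + p) = i k" using assms(4) k unfolding index_periodic_def by simp
    finally show "i (k + p mod l0) = i k" .
  qed
  moreover have "p mod l0 \<ge> 1" using nd by (metis One_nat_def Suc_leI dvd_eq_mod_eq_0 not_gr_zero)
  ultimately have "l0 \<le> p mod l0" using assms(3) by blast
  thus False using assms(2) by (metis mod_less_divisor not_le less_le_trans zero_less_one)
qed

section \<open>Transport of neighbouring geodesics along the expansion\<close>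

context expansion
begin

text \<open>A pair of vectors transported along the expansion whose geodesic lies eventually on the same sides of all vertices
  as the given one crosses the same sequence of heptagons.\<close>

lemma parallel_chain:
  assumes st: "u k = cf_A (i (Suc k)) *v u (Suc k)" "v k = cf_A (i (Suc k)) *v v (Suc k)"
    and d: "d2 (u (Suc k)) (v (Suc k)) > 0" 
    and sg: "\<And>j. Ff j (u k) (v k) > 0 \<longleftrightarrow> Ff j (av k) (bv k) > 0"
  shows "Ent (u k) (v k)" "Ff (i (Suc k)) (u k) (v k) > 0" "Ff (Suc (i (Suc k))) (u k) (v k) \<le> 0"
    "- NN 0 (v (Suc k)) / NN 0 (u (Suc k)) = - NN (i (Suc k)) (v k) / NN (i (Suc k)) (u k)"
proof -
  have "d2 (u k) (v k) > 0" using d unfolding st d2_act Delta_det[OF cf_A_Delta] by simp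
  thus "Ent (u k) (v k)" unfolding Ent_def using sg[of 0] sg[of 1] Ent_chain[of k] unfolding Ent_def by auto
  show F: "Ff (i (Suc k)) (u k) (v k) > 0" "Ff (Suc (i (Suc k))) (u k) (v k) \<le> 0"
    using sg chain_index(2,3)[of k] by (auto simp: not_less[symmetric])
  show "- NN 0 (v (Suc k)) / NN 0 (u (Suc k)) = - NN (i (Suc k)) (v k) / NN (i (Suc k)) (u k)"
    using Ent_step(3)[OF d, of "i (Suc k)"] F unfolding st[symmetric] by blast
qed

text \<open>The vectors \<open>u k\<close> shrink with \<open>av k\<close>, so the entry parameters
  tend to infinity by \<open>entry_time_lower\<close>, and the tiles reach every later point of the
  geodesic.\<close>

lemma times_unbounded:
  assumes "s > 0" "\<And>k. k \<ge> K \<Longrightarrow> Ent (u k) (v k)" "\<And>k. d2 (u k) (v k) = d2 a b" "\<And>k. qf (u k) = s * qf (av k)"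
  shows "\<exists>K'. \<forall>k\<ge>K'. - NN 0 (v k) / NN 0 (u k) > R"
proof -
  define d where "d = (1 - hh^2 * (1 + tt^2)) * (c0 * d2 a b)^2"
  have d: "d > 0" unfolding d_def using hh_tt_less(1) d2ab by simp
  \<comment> \<open>The minimum with 1 allows x^2 to be estimated by x.\<close>
  define e where "e = min 1 (d / (4 * (\<bar>R\<bar> + 1) * s^2))"
  have e: "e > 0" unfolding e_def using d assms(1) by simp
  obtain K' where K': "\<forall>k\<ge>K'. qf (av k) < e" using qf_small[OF e] by blast
  have "- NN 0 (v k) / NN 0 (u k) > R" if "k \<ge> max K K'" for k
  proof (rule ccontr)
    assume R: "\<not> ?thesis"
    define x where "x = qf (av k)"
    have x: "0 \<le> x" "x < 1" "x < d / (4 * (\<bar>R\<bar> + 1) * s^2)" using K' that qf_nonneg unfolding x_def e_def by auto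
    have "d \<le> 4 * (- NN 0 (v k) / NN 0 (u k)) * (qf (u k))^2"
      using entry_time_lower[OF assms(2), of k] that unfolding assms(3) d_def by simp
    also have "\<dots> \<le> 4 * (\<bar>R\<bar> + 1) * (qf (u k))^2" using R by (intro mult_right_mono) auto
    also have "(qf (u k))^2 = s^2 * (x * x)" unfolding assms(4) x_def by (simp add: power2_eq_square)
    also have "4 * (\<bar>R\<bar> + 1) * (s^2 * (x * x)) \<le> 4 * (\<bar>R\<bar> + 1) * (s^2 * (x * 1))"
      using x by (intro mult_left_mono) auto
    also have "\<dots> = x * (4 * (\<bar>R\<bar> + 1) * s^2)" by simp
    also have "\<dots> < d"
    proof -
      have "4 * (\<bar>R\<bar> + 1) * s^2 > 0" using assms(1) by (intro mult_pos_pos) auto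
      thus ?thesis using x(3) by (simp only: pos_less_divide_eq)
    qed
    finally show False by simp
  qed
  thus ?thesis by blast
qed

text \<open>A second ascent of the sign on the way round the heptagon would force a second descent,
  but the descent is the next index and unique. This pins down a power of \<open>g7\<close> modulo
  7.\<close>

lemma ascent_unique:
  assumes "\<not> Ff n (av k) (bv k) > 0" "Ff (Suc n) (av k) (bv k) > 0"
  shows "7 dvd n"
proof (rule ccontr)
  assume nd: "\<not> 7 dvd n"
  define m where "m = n mod 7"
  have m: "m \<noteq> 0" "m < 7" unfolding m_def using nd by (auto simp: dvd_eq_mod_eq_0)
  let ?P = "\<lambda>j. Ff j (av k) (bv k) > 0"
  have Pm: "\<not> ?P m" unfolding m_def Ff_mod7 using assms(1) .
  have P1: "?P 1" "\<not> ?P 7" using Ent_chain[of k] unfolding Ent_def Ff_7 by auto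
  have Ps: "?P (Suc m)"
  proof -
    have "Suc m mod 7 = Suc n mod 7" unfolding m_def by presburger
    thus ?thesis using assms(2) Ff_mod7[of "Suc m"] Ff_mod7[of "Suc n"] by metis
  qed
  have "m \<noteq> 1" using Pm P1 by metis
  hence "1 < m" using m by simp
  then obtain j where j: "1 \<le> j" "j < m" "?P j" "\<not> ?P (Suc j)" using first_failure[of ?P 1 m] P1 Pm by blast
  have "Suc m \<noteq> 7" using Ps P1 by metis
  hence "Suc m < 7" using m by simp
  then obtain j' where j': "Suc m \<le> j'" "j' < 7" "?P j'" "\<not> ?P (Suc j')" using first_failure[of ?P "Suc m" 7] P1 Ps by blast
  have "i (Suc k) = j" "i (Suc k) = j'" using chain_index(4)[of j k] chain_index(4)[of j' k] j j' m by auto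
  thus False using j j' by simp
qed

end

section \<open>Comparison of two sequences of heptagons along one geodesic\<close>

context quadratic_expansion
begin

text \<open>For large k only the sign of the coefficient of \<open>av k\<close> matters, \<tau> = 0
  counting as negative; a nonzero coefficient moreover keeps the vertices off the geodesic.\<close>

lemma strict_signs:
  assumes "t \<noteq> 0" "t > 0 \<longleftrightarrow> \<tau> > 0"
  shows "\<exists>K. \<forall>k\<ge>K. \<forall>j. (Ff j (av k) (cv k + t *s av k) > 0 \<longleftrightarrow> Ff j (av k) (bv k) > 0) \<and> Ff j (av k) (cv k + t *s av k) \<noteq> 0"
proof -
  obtain K where K: "\<forall>k\<ge>K. \<forall>j. (Ff j (av k) (cv k + t *s av k) > 0 \<longleftrightarrow> Ff j (av k) (cv k) > 0 \<or> Ff j (av k) (cv k) = 0 \<and> t > 0)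
     \<and> (t \<noteq> 0 \<longrightarrow> Ff j (av k) (cv k + t *s av k) \<noteq> 0)" using eventual_sign[of t] by (elim exE)
  obtain K' where K': "\<forall>k\<ge>K'. \<forall>j. (Ff j (av k) (cv k + \<tau> *s av k) > 0 \<longleftrightarrow> Ff j (av k) (cv k) > 0 \<or> Ff j (av k) (cv k) = 0 \<and> \<tau> > 0)
     \<and> (\<tau> \<noteq> 0 \<longrightarrow> Ff j (av k) (cv k + \<tau> *s av k) \<noteq> 0)" using eventual_sign[of \<tau>] by (elim exE)
  show ?thesis using K K' assms unfolding bv_cv by (intro exI[of _ "max K K'"]) auto
qed

text \<open>\<open>M\<close> commutes with \<theta>, so it preserves the second eigenline, and
  determinant one gives the inverse eigenvalue there.\<close>

lemma eigen_cc:
  assumes "M \<in> Delta237" "M *v a = \<mu> *s a"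
  shows "\<mu> \<noteq> 0" "M *v cc = (1 / \<mu>) *s cc"
proof -
  have nz: "a \<noteq> 0" by (rule rep_nz[OF repa])
  have dc: "d2 a cc = d2 a b" unfolding cc_def by (simp add: d2_linear)
  hence dc0: "d2 a cc \<noteq> 0" using d2ab by simp
  have MO: "M \<in> order_O" using assms(1) unfolding Delta_eq by blast
  have "M ** \<theta> = \<theta> ** M" using O_commute[OF MO thO nz] assms(2) tha by (simp add: d2_linear)
  hence com: "M *v (\<theta> *v cc) = \<theta> *v (M *v cc)" by (simp add: matrix_vector_mul_assoc)
  obtain x y where Mc: "M *v cc = x *s a + y *s cc" using d2_basis[OF dc0] by blast
  have "q *s (M *v cc) = \<theta> *v (M *v cc)" using com thc unfolding cc_def[symmetric] by (simp add: vector_scalar_commute)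
  also have "\<dots> = x *s (l *s a) + y *s (q *s cc)"
    unfolding Mc matrix_vector_right_distrib vector_scalar_commute tha thc[folded cc_def] ..
  finally have "d2 (q *s (M *v cc)) cc = d2 (x *s (l *s a) + y *s (q *s cc)) cc" by simp
  hence "q * (x * d2 a cc) = x * (l * d2 a cc)" unfolding Mc d2_linear by simp
  hence "x * (l - q) * d2 a cc = 0" by algebra
  hence x: "x = 0" using dc0 lq by simp
  have "d2 (M *v a) (M *v cc) = d2 a cc" unfolding d2_act Delta_det[OF assms(1)] by simp
  hence "\<mu> * y * d2 a cc = d2 a cc" unfolding assms(2) Mc x d2_linear by (simp add: ac_simps del: mult_cancel_right1 mult_cancel_right2 mult_cancel_left1 mult_cancel_left2)
  hence my: "\<mu> * y = 1" using mult_cancel_right2[of "\<mu> * y" "d2 a cc"] dc0 by blast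
  thus mu: "\<mu> \<noteq> 0" by auto
  have "y = 1 / \<mu>" using my mu by (simp add: field_simps)
  thus "M *v cc = (1 / \<mu>) *s cc" unfolding Mc x by simp
qed

lemma B_av: "cf_B B0 i k *v (matrix_inv (cf_B B0 i k) *v u) = u"
  unfolding matrix_vector_mul_assoc B_inv by simp

lemma stabilizer_chain:
  assumes M: "M \<in> Delta237" and Ma: "d2 (M *v a) a = 0"
  shows "\<exists>k\<ge>K. \<exists>m\<ge>K. \<exists>e\<in>{1, -1}. M ** cf_B B0 i m = e *\<^sub>R cf_B B0 i k \<and> (\<forall>n. i (Suc (m + n)) = i (Suc (k + n)))"
proof -
  obtain \<mu> where mu: "M *v a = \<mu> *s a" using Ma eigen_iff[OF rep_nz[OF repa]] by blast
  note mu0 = eigen_cc(1)[OF M mu] and Mc = eigen_cc(2)[OF M mu]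
  define t where "t = (if \<tau> = 0 then -1 else \<tau>)"
  define t' where "t' = t / \<mu>^2"
  have t: "t \<noteq> 0" "t > 0 \<longleftrightarrow> \<tau> > 0" unfolding t_def by auto
  have t': "t' \<noteq> 0" "t' > 0 \<longleftrightarrow> \<tau> > 0" unfolding t'_def using t mu0 by (auto simp: zero_less_divide_iff)
  define bp where "bp = (\<lambda>k. cv k + t *s av k)"
  \<comment> \<open>\<open>x k\<close> and \<open>y k\<close> are the images of \<open>a\<close> and
    \<open>cc + t *s a\<close> under B_k^-1 M^-1. Since M^-1 divides \<open>a\<close> by \<mu> and
    multiplies \<open>cc\<close> by \<mu>, the coefficient becomes t / \<mu>^2.\<close>
  define x where "x = (\<lambda>k. (1 / \<mu>) *s av k)"
  define y where "y = (\<lambda>k. \<mu> *s (cv k + t' *s av k))"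
  have cv_step: "cv k = cf_A (i (Suc k)) *v cv (Suc k)" for k unfolding cv_def by (rule step)
  have bp_step: "bp k = cf_A (i (Suc k)) *v bp (Suc k)" for k
    unfolding bp_def av_step[of k] cv_step[of k] by (simp add: matrix_vector_right_distrib vector_scalar_commute)
  have x_step: "x k = cf_A (i (Suc k)) *v x (Suc k)" for k
    unfolding x_def av_step[of k] by (simp add: vector_scalar_commute)
  have y_step: "y k = cf_A (i (Suc k)) *v y (Suc k)" for k
    unfolding y_def av_step[of k] cv_step[of k] by (simp add: matrix_vector_right_distrib vector_scalar_commute)
  have d2bp: "d2 (av k) (bp k) = d2 a b" for k unfolding bp_def d2_linear d2_cv by simp
  have d2xy: "d2 (x k) (y k) = d2 a b" for k unfolding x_def y_def d2_linear d2_cv using mu0 by simp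
  have Fxy: "Ff j (x k) (y k) = Ff j (av k) (cv k + t' *s av k)" for j k
    unfolding x_def y_def Ff_linear(2) Ff_linear(3) using mu0 by simp
  obtain K1 where K1: "\<forall>k\<ge>K1. \<forall>j. (Ff j (av k) (bp k) > 0 \<longleftrightarrow> Ff j (av k) (bv k) > 0) \<and> Ff j (av k) (bp k) \<noteq> 0"
    using strict_signs[OF t] unfolding bp_def by (elim exE)
  obtain K2 where K2: "\<forall>k\<ge>K2. \<forall>j. (Ff j (x k) (y k) > 0 \<longleftrightarrow> Ff j (av k) (bv k) > 0) \<and> Ff j (x k) (y k) \<noteq> 0"
    using strict_signs[OF t'] unfolding Fxy by (elim exE)
  define rb where "rb = (\<lambda>k. - NN 0 (bp k) / NN 0 (av k))"
  define rx where "rx = (\<lambda>k. - NN 0 (y k) / NN 0 (x k))"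
  have cb: "Ent (av k) (bp k)" "Ff (i (Suc k)) (av k) (bp k) > 0" "Ff (Suc (i (Suc k))) (av k) (bp k) \<le> 0"
    "rb (Suc k) = - NN (i (Suc k)) (bp k) / NN (i (Suc k)) (av k)" if "k \<ge> K1" for k
    using parallel_chain[of av k bp, OF av_step bp_step] K1 that d2bp d2ab unfolding rb_def by simp_all
  have cx: "Ent (x k) (y k)" "Ff (i (Suc k)) (x k) (y k) > 0" "Ff (Suc (i (Suc k))) (x k) (y k) \<le> 0"
    "rx (Suc k) = - NN (i (Suc k)) (y k) / NN (i (Suc k)) (x k)" if "k \<ge> K2" for k
    using parallel_chain[of x k y, OF x_step y_step] K2 that d2xy d2ab unfolding rx_def by simp_all
  define Kx where "Kx = max K K2"
  \<comment> \<open>Tile \<open>k\<close> of the first sequence is taken so late that the second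
    sequence, counted from \<open>Kx\<close>, has already entered its own tiles there.\<close>
  obtain k where k: "k \<ge> max K K1" "rb k > rx Kx"
  proof -
    have "\<exists>K'. \<forall>k\<ge>K'. - NN 0 (bp k) / NN 0 (av k) > rx Kx"
      by (rule times_unbounded[of 1 K1]) (use cb d2bp in simp_all)
    then obtain K' where "\<forall>k\<ge>K'. rb k > rx Kx" unfolding rb_def by blast
    thus thesis by (intro that[of "max (max K K1) K'"]) auto
  qed
  have kK1: "k \<ge> K1" using k(1) by simp
  have F0: "Ff 0 (av k) (bp k) < 0" using cb(1)[OF kK1] K1 kK1 unfolding Ent_def by (metis less_eq_real_def)
  note SI = strictly_inside[OF cb(1)[OF kK1] F0 chain_index(1) cb(2,3)[OF kK1], folded cb(4)[OF kK1] rb_def]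
  define r where "r = (rb k + rb (Suc k)) / 2"
  have lt: "rb k < rb (Suc k)" using SI(1) unfolding rb_def .
  have r: "rb k < r" "r < rb (Suc k)" unfolding r_def using lt by (simp_all add: field_simps)
  have inside: "\<forall>j. r * NN j (av k) + NN j (bp k) < 0" using SI(2)[of r] r unfolding rb_def by blast
  have r0: "r > 0" using Ent_point(1)[OF cb(1)[OF kK1]] r(1) unfolding rb_def by linarith
  \<comment> \<open>An index \<open>m\<close> whose tile in the second sequence contains the point
    of parameter \<open>r\<close>, an interior point of tile \<open>k\<close> of the first.\<close>
  obtain m where m: "m \<ge> Kx" "rx m \<le> r" "r < rx (Suc m)"
  proof -
    have "\<exists>K'. \<forall>k\<ge>K'. - NN 0 (y k) / NN 0 (x k) > r"
      by (rule times_unbounded[of "(1 / \<mu>)^2" K2]) (use cx d2xy mu0 in \<open>simp_all add: x_def qf_scale\<close>)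
    then obtain K' where K': "\<forall>k\<ge>K'. rx k > r" unfolding rx_def by blast
    have "\<not> rx Kx > r" using k(2) r(1) by simp
    moreover have "rx (max (Suc Kx) K') > r" using K' by simp
    moreover have "Kx < max (Suc Kx) K'" by simp
    ultimately obtain j where "Kx \<le> j" "\<not> rx j > r" "rx (Suc j) > r"
      using first_failure[of "\<lambda>n. \<not> rx n > r" Kx "max (Suc Kx) K'"] by blast
    thus thesis using that by auto
  qed
  have mK2: "m \<ge> K2" using m(1) unfolding Kx_def by simp
  have xin: "\<forall>j. r * NN j (x m) + NN j (y m) \<le> 0"
    using inside_interval(1)[OF cx(1-3)[OF mK2], folded cx(4)[OF mK2]] m(2,3) unfolding rx_def by simp
  have MBx: "M *v (cf_B B0 i n *v x n) = a" for n
    unfolding x_def av_def vector_scalar_commute B_av mu using mu0 by (simp add: vector_smult_assoc)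
  have MBy: "M *v (cf_B B0 i n *v y n) = cc + t *s a" for n
  proof -
    have "cf_B B0 i n *v y n = \<mu> *s (cc + t' *s a)"
      unfolding y_def av_def cv_def matrix_vector_right_distrib vector_scalar_commute B_av ..
    hence "M *v (cf_B B0 i n *v y n) = \<mu> *s ((1 / \<mu>) *s cc + t' *s (\<mu> *s a))"
      by (simp only: matrix_vector_right_distrib vector_scalar_commute Mc mu)
    also have "\<dots> = (\<mu> * (1 / \<mu>)) *s cc + (\<mu>^2 * t') *s a" by (rule vec2_eqI) (simp_all add: power2_eq_square algebra_simps)
    also have "\<dots> = cc + t *s a" unfolding t'_def using mu0 by simp
    finally show ?thesis .
  qed
  have bpB: "matrix_inv (cf_B B0 i n) *v (cc + t *s a) = bp n" for n
    unfolding bp_def cv_def av_def by (simp add: matrix_vector_right_distrib vector_scalar_commute)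
  define G where "G = matrix_inv (cf_B B0 i k) ** M ** cf_B B0 i m"
  have G: "G \<in> Delta237" unfolding G_def by (intro Delta_mult B_inv_Delta M B_Delta)
  have Gv: "G *v v = matrix_inv (cf_B B0 i k) *v (M *v (cf_B B0 i m *v v))" for v
    unfolding G_def by (simp only: matrix_vector_mul_assoc matrix_mul_assoc)
  have Gx: "G *v x m = av k" unfolding Gv MBx av_def ..
  have Gy: "G *v y m = bp k" unfolding Gv MBy bpB ..
  have "\<exists>n. G = mpow g7 n"
    by (rule tile_unique[OF G _ _ r0 xin]) (use Ent_nz[OF cx(1)[OF mK2]] inside Gx Gy in simp_all)
  then obtain n where n: "G = mpow g7 n" by blast
  have Fn: "Ff (n + j) (av k) (bp k) = Ff j (x m) (y m)" for j
    unfolding Gx[symmetric] Gy[symmetric] n by (rule Ff_g7_pow)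
  \<comment> \<open>Both geodesics enter through edge 0, so a rotation taking one picture to the
    other has to preserve the place of the ascent.\<close>
  have "7 dvd n"
  proof (rule ascent_unique)
    have "\<not> Ff n (av k) (bp k) > 0" "Ff (Suc n) (av k) (bp k) > 0"
      using Fn[of 0] Fn[of 1] cx(1)[OF mK2] unfolding Ent_def by simp_all
    thus "\<not> Ff n (av k) (bv k) > 0" "Ff (Suc n) (av k) (bv k) > 0" using K1 kK1 by blast+
  qed
  then obtain e where e: "e \<in> {1, -1}" "mpow g7 n = e *\<^sub>R mat 1" using g7_pow_7 by blast
  have ee: "e * e = 1" using e(1) by auto
  have MB: "M ** cf_B B0 i m = e *\<^sub>R cf_B B0 i k"
  proof -
    have "M ** cf_B B0 i m = (cf_B B0 i k ** matrix_inv (cf_B B0 i k)) ** (M ** cf_B B0 i m)" unfolding B_inv by simp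
    also have "\<dots> = cf_B B0 i k ** G" unfolding G_def by (simp only: matrix_mul_assoc)
    finally show ?thesis unfolding n e(2) scaleR_mult_mat by simp
  qed
  have ind: "i (Suc (m + n)) = i (Suc (k + n))" if eq: "M ** cf_B B0 i (m + n) = e *\<^sub>R cf_B B0 i (k + n)" for n
  proof -
    have *: "cf_B B0 i (k + n) *v (e *s v) = M *v (cf_B B0 i (m + n) *v v)" for v
      unfolding matrix_vector_mul_assoc eq by (simp add: scaleR_act vector_scalar_commute)
    have inv: "e *s v = matrix_inv (cf_B B0 i (k + n)) *v (M *v (cf_B B0 i (m + n) *v v))" for v
      unfolding *[symmetric] unfolding matrix_vector_mul_assoc B_inv by simp
    have "e *s x (m + n) = av (k + n)" "e *s y (m + n) = bp (k + n)" unfolding inv MBx MBy bpB av_def by simp_all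
    hence "Ff j (av (k + n)) (bp (k + n)) = (e * e) * Ff j (x (m + n)) (y (m + n))" for j
      by (metis Ff_linear(2,3) mult.assoc)
    hence F: "Ff j (av (k + n)) (bp (k + n)) = Ff j (x (m + n)) (y (m + n))" for j unfolding ee by simp
    have s: "Ff j (av (k + n)) (bv (k + n)) > 0 \<longleftrightarrow> Ff j (av (m + n)) (bv (m + n)) > 0" for j
    proof -
      have "k + n \<ge> K1" "m + n \<ge> K2" using kK1 mK2 by auto
      thus ?thesis using K1 K2 F by metis
    qed
    show ?thesis
    proof (rule chain_index(4))
      show "i (Suc (k + n)) \<in> {1..6}" by (rule chain_index(1))
      show "Ff (i (Suc (k + n))) (av (m + n)) (bv (m + n)) > 0" using s chain_index(2) by blast
      show "Ff (Suc (i (Suc (k + n)))) (av (m + n)) (bv (m + n)) \<le> 0" using s chain_index(3)[of "k + n"] not_le by metis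
    qed
  qed
  \<comment> \<open>Equality up to sign propagates: it forces equal next indices, and these give the
    next pair of matrices with the same sign.\<close>
  have all: "M ** cf_B B0 i (m + n) = e *\<^sub>R cf_B B0 i (k + n)" for n
  proof (induction n)
    case 0 thus ?case using MB by simp
  next
    case (Suc n)
    have "M ** cf_B B0 i (m + Suc n) = (M ** cf_B B0 i (m + n)) ** cf_A (i (Suc (m + n)))" by (simp add: matrix_mul_assoc)
    also have "\<dots> = e *\<^sub>R cf_B B0 i (k + Suc n)" unfolding Suc ind[OF Suc] by (simp add: scaleR_mult_mat)
    finally show ?case .
  qed
  have "k \<ge> K" "m \<ge> K" using k(1) m(1) unfolding Kx_def by auto
  thus ?thesis using e(1) MB ind[OF all] by blast
qed

end

section \<open>The fundamental unit\<close>

lemma mpow_comm: "mpow M n ** M = M ** mpow M n"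
  by (induction n) (simp_all add: matrix_mul_assoc[symmetric])

lemma mpow_inv: assumes "det M = 1" shows "mpow (matrix_inv M) n ** mpow M n = mat 1"
proof (induction n)
  case (Suc n)
  have "mpow (matrix_inv M) (Suc n) ** mpow M (Suc n) = mpow (matrix_inv M) n ** (matrix_inv M ** M) ** mpow M n"
    using mpow_comm[of "matrix_inv M" n] by (simp add: matrix_mul_assoc)
  thus ?case using Suc unfolding matrix_inv_mult_det1[OF assms] by simp
qed simp

lemma eigen_inv: fixes M :: "real^2^2" assumes "det M = 1" "M *v a = \<mu> *s a" "a \<noteq> 0" shows "\<mu> \<noteq> 0" "matrix_inv M *v a = inverse \<mu> *s a"
proof -
  have e: "a = \<mu> *s (matrix_inv M *v a)"
    using arg_cong[OF assms(2), of "\<lambda>v. matrix_inv M *v v"] 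
    unfolding matrix_vector_mul_assoc matrix_inv_mult_det1[OF assms(1)] vector_scalar_commute by simp
  show mu: "\<mu> \<noteq> 0"
  proof
    assume "\<mu> = 0"
    thus False using e assms(3) by simp
  qed
  have "inverse \<mu> *s a = inverse \<mu> *s (\<mu> *s (matrix_inv M *v a))" using e by simp
  thus "matrix_inv M *v a = inverse \<mu> *s a" using mu by (simp add: vector_smult_assoc)
qed

lemma eigen_mpow: assumes "M *v a = \<mu> *s a" shows "mpow M n *v a = \<mu> ^ n *s a"
  by (induction n) (simp_all add: matrix_vector_mul_assoc[symmetric] vector_scalar_commute assms vector_smult_assoc mult.commute)

lemma eigen_mpowi: assumes "det M = 1" "M *v a = \<mu> *s a" "a \<noteq> 0" shows "mpowi M k *v a = (\<mu> powi k) *s a"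
  unfolding mpowi_def power_int_def using eigen_mpow[OF assms(2)] eigen_mpow[OF eigen_inv(2)[OF assms]] by simp

lemma mpowi_Delta: "M \<in> Delta237 \<Longrightarrow> mpowi M k \<in> Delta237"
  unfolding mpowi_def by (auto intro: mpow_Delta Delta_inv)

lemma uminus_act: "(- M) *v v = - (M *v v)" for M :: "real^2^2"
  by (rule vec2_eqI) simp_all

context expansion
begin

text \<open>Beyond \<open>k0\<close> both sides are extended by the same matrices, so a shift by
  \<open>l0\<close> is left multiplication by one fixed group element, independent of
  \<open>k\<close>.\<close>

lemma period_unit:
  assumes "index_periodic i l0 k0" "k \<ge> k0"
  shows "cf_B B0 i (k + t * l0) = mpow (cf_B B0 i (k0 + l0) ** matrix_inv (cf_B B0 i k0)) t ** cf_B B0 i k"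
proof -
  define g where "g = cf_B B0 i (k0 + l0) ** matrix_inv (cf_B B0 i k0)"
  have 1: "cf_B B0 i (k + l0) = g ** cf_B B0 i k" if "k \<ge> k0" for k using that
  proof (induction k rule: dec_induct)
    case base
    have "g ** cf_B B0 i k0 = cf_B B0 i (k0 + l0) ** (matrix_inv (cf_B B0 i k0) ** cf_B B0 i k0)"
      unfolding g_def by (simp only: matrix_mul_assoc)
    thus ?case unfolding B_inv by simp
  next
    case (step k)
    have "i (Suc k + l0) = i (Suc k)" using assms(1)[unfolded index_periodic_def, rule_format, of "Suc k"] step(1) by simp
    thus ?case using step(3) by (simp add: matrix_mul_assoc)
  qed
  show ?thesis unfolding g_def[symmetric]
  proof (induction t)
    case (Suc t)
    have "cf_B B0 i (k + Suc t * l0) = cf_B B0 i ((k + t * l0) + l0)" by (simp add: algebra_simps)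
    also have "\<dots> = g ** cf_B B0 i (k + t * l0)" using assms(2) by (intro 1) simp
    finally show ?case unfolding Suc by (simp add: matrix_mul_assoc)
  qed simp
qed

lemma quadratic_expansion_ex:
  assumes "is_quad_point \<alpha> z w"
  obtains \<theta> l q \<tau> where "quadratic_expansion \<alpha> \<beta> B0 i a b \<theta> l q \<tau>"
proof -
  obtain n where n: "n *\<^sub>R theta z w \<in> order_O" "mdisc (n *\<^sub>R theta z w) > 0" "d2 ((n *\<^sub>R theta z w) *v a) a = 0"
    using quad_point_O[OF assms repa] by metis
  have "d2 a b \<noteq> 0" using d2ab by simp
  from second_eigenvector[OF this n(2,3)] obtain l q \<tau> where
    "l \<noteq> q" "(n *\<^sub>R theta z w) *v a = l *s a" "(n *\<^sub>R theta z w) *v (b - \<tau> *s a) = q *s (b - \<tau> *s a)" by blast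
  hence "quadratic_expansion \<alpha> \<beta> B0 i a b (n *\<^sub>R theta z w) l q \<tau>" by unfold_locales (use n in auto)
  thus thesis by (rule that)
qed

lemma stabilizer_generated:
  assumes q: "is_quad_point \<alpha> z w" and ip: "index_periodic i l0 k0" "l0 \<ge> 1"
    and minimal: "\<forall>l\<ge>1. \<forall>k. index_periodic i l k \<longrightarrow> l0 \<le> l"
    and M: "M \<in> Delta237" "d2 (M *v a) a = 0"
  defines "g \<equiv> cf_B B0 i (k0 + l0) ** matrix_inv (cf_B B0 i k0)"
  shows "\<exists>k. M = mpowi g k \<or> M = - mpowi g k"
proof -
  obtain \<theta> l q \<tau> where "quadratic_expansion \<alpha> \<beta> B0 i a b \<theta> l q \<tau>" using quadratic_expansion_ex[OF q] .
  then interpret quadratic_expansion \<alpha> \<beta> B0 i a b \<theta> l q \<tau> .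
  obtain k m e where km: "k \<ge> k0" "m \<ge> k0" "e \<in> {1, -1}" "M ** cf_B B0 i m = e *\<^sub>R cf_B B0 i k"
    "\<forall>n. i (Suc (m + n)) = i (Suc (k + n))" using stabilizer_chain[OF M, of k0] by blast
  have dg: "det g = 1" unfolding g_def by (intro Delta_det Delta_mult B_Delta B_inv_Delta)
  have "\<exists>j. M = e *\<^sub>R mpowi g j"
  proof (cases "m \<le> k")
    case True
    have "index_periodic i (k - m) m" unfolding index_periodic_def
    proof (intro allI impI)
      fix x assume "m < x"
      then obtain n where n: "x = Suc (m + n)" using less_imp_Suc_add by blast
      show "i (x + (k - m)) = i x" using km(5)[rule_format, of n] True unfolding n by (simp add: add.commute)
    qed
    then obtain t where t: "k - m = t * l0" using index_period_dvd[OF ip minimal] by (metis dvd_div_mult_self)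
    have k: "cf_B B0 i k = mpow g t ** cf_B B0 i m" 
    proof -
      have "k = m + t * l0" using t True by linarith
      thus ?thesis using period_unit[OF ip(1) km(2), of t] unfolding g_def by (simp only:)
    qed
    have "M = (M ** cf_B B0 i m) ** matrix_inv (cf_B B0 i m)" unfolding matrix_mul_assoc[symmetric] B_inv by simp
    also have "\<dots> = e *\<^sub>R (mpow g t ** (cf_B B0 i m ** matrix_inv (cf_B B0 i m)))"
      unfolding km(4) k scaleR_mult_mat matrix_mul_assoc ..
    also have "\<dots> = e *\<^sub>R mpowi g (int t)" unfolding B_inv by (simp add: mpowi_def)
    finally show ?thesis by blast
  next
    case False
    have "index_periodic i (m - k) k" unfolding index_periodic_def
    proof (intro allI impI)
      fix x assume "k < x"
      then obtain n where n: "x = Suc (k + n)" using less_imp_Suc_add by blast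
      show "i (x + (m - k)) = i x" using km(5)[rule_format, of n] False unfolding n by (simp add: add.commute)
    qed
    then obtain t where t: "m - k = t * l0" using index_period_dvd[OF ip minimal] by (metis dvd_div_mult_self)
    have m: "cf_B B0 i m = mpow g t ** cf_B B0 i k" 
    proof -
      have "m = k + t * l0" using t False by linarith
      thus ?thesis using period_unit[OF ip(1) km(1), of t] unfolding g_def by (simp only:)
    qed
    have inv2: "mpow g t ** mpow (matrix_inv g) t = mat 1"
      using mpow_inv[OF dg, of t] matrix_left_right_inverse by blast
    have "M ** mpow g t = (M ** (mpow g t ** cf_B B0 i k)) ** matrix_inv (cf_B B0 i k)" unfolding matrix_mul_assoc[symmetric] B_inv by simp
    also have "\<dots> = e *\<^sub>R mat 1" unfolding m[symmetric] km(4) scaleR_mult_mat B_inv ..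
    finally have "(M ** mpow g t) ** mpow (matrix_inv g) t = e *\<^sub>R mpow (matrix_inv g) t" by (simp add: scaleR_mult_mat)
    hence "M = e *\<^sub>R mpow (matrix_inv g) t" unfolding matrix_mul_assoc[symmetric] inv2 by simp
    \<comment> \<open>For t = 0 the exponent -t is not negative, and \<open>mpowi\<close> takes its
      other branch.\<close>
    also have "mpow (matrix_inv g) t = mpowi g (- int t)" by (cases "t = 0") (simp_all add: mpowi_def)
    finally show ?thesis by blast
  qed
  thus ?thesis using km(3) by auto
qed

end

theorem theorem3p23:
  fixes \<alpha> \<beta> :: rp1 and B0 :: "real^2^2" and i :: "nat \<Rightarrow> nat"
  assumes "\<alpha> \<noteq> \<beta>"
    and "geodesic_cf_expansion \<beta> \<alpha> B0 i"
  shows "((\<exists>z w. is_quad_point \<alpha> z w) \<longleftrightarrow> (\<exists>l\<^sub>0\<ge>1. \<exists>k\<^sub>0. endpoint_periodic \<alpha> B0 i l\<^sub>0 k\<^sub>0))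
       \<and> ((\<exists>l\<^sub>0\<ge>1. \<exists>k\<^sub>0. endpoint_periodic \<alpha> B0 i l\<^sub>0 k\<^sub>0) \<longleftrightarrow> (\<exists>l\<^sub>0\<ge>1. \<exists>k\<^sub>0. index_periodic i l\<^sub>0 k\<^sub>0))
       \<and> (\<forall>z w l\<^sub>0 k\<^sub>0. is_quad_point \<alpha> z w \<and> l\<^sub>0 \<ge> 1 \<and> k\<^sub>0 \<ge> 1
            \<and> endpoint_periodic \<alpha> B0 i l\<^sub>0 k\<^sub>0 \<and> index_periodic i l\<^sub>0 k\<^sub>0
            \<and> (\<forall>l\<ge>1. \<forall>k. index_periodic i l k \<longrightarrow> l\<^sub>0 \<le> l)
          \<longrightarrow> (let \<gamma>\<^sub>0 = cf_B B0 i (k\<^sub>0 + l\<^sub>0) ** matrix_inv (cf_B B0 i k\<^sub>0) in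
                 \<gamma>\<^sub>0 \<in> order1_zw z w
               \<and> order1_zw z w = (\<Union>k::int. {mpowi \<gamma>\<^sub>0 k, - mpowi \<gamma>\<^sub>0 k})
               \<and> rho \<alpha> \<gamma>\<^sub>0 \<in> adjoin_F (sqrt (disc z w))
               \<and> rho \<alpha> \<gamma>\<^sub>0 \<in> U_zw \<alpha> z w
               \<and> U_zw \<alpha> z w = (\<Union>k::int. {rho \<alpha> \<gamma>\<^sub>0 powi k, - (rho \<alpha> \<gamma>\<^sub>0 powi k)})))"
proof -
  obtain a where a: "rep \<alpha> a" using rep_ex by blast
  obtain b' where b': "rep \<beta> b'" using rep_ex by blast
  have nz: "d2 a b' \<noteq> 0" using rep_d2[OF a b'] assms(1) by simp
  \<comment> \<open>A change of sign of the lift makes \<open>d2 a b\<close> positive without moving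
    the end point.\<close>
  define b where "b = (if d2 a b' > 0 then b' else (-1) *s b')"
  have b: "rep \<beta> b" unfolding b_def using b' rep_scale[of "-1" \<beta> b'] by simp
  have "d2 a b > 0" unfolding b_def using nz by (simp add: d2_linear)
  then interpret expansion \<alpha> \<beta> B0 i a b using assms(2) a b by unfold_locales
  have anz: "a \<noteq> 0" by (rule rep_nz[OF a])
  have 23: "\<exists>l\<^sub>0\<ge>1. \<exists>k\<^sub>0. endpoint_periodic \<alpha> B0 i l\<^sub>0 k\<^sub>0" if "\<exists>l\<^sub>0\<ge>1. \<exists>k\<^sub>0. index_periodic i l\<^sub>0 k\<^sub>0"
    using that index_imp_endpoint by blast
  have 31: "\<exists>z w. is_quad_point \<alpha> z w" if "\<exists>l\<^sub>0\<ge>1. \<exists>k\<^sub>0. endpoint_periodic \<alpha> B0 i l\<^sub>0 k\<^sub>0"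
    using that endpoint_imp_quad by blast
  have 12: "\<exists>l\<^sub>0\<ge>1. \<exists>k\<^sub>0. index_periodic i l\<^sub>0 k\<^sub>0" if zw: "\<exists>z w. is_quad_point \<alpha> z w"
  proof -
    obtain z w where "is_quad_point \<alpha> z w" using zw by blast
    then obtain \<theta> l q \<tau> where "quadratic_expansion \<alpha> \<beta> B0 i a b \<theta> l q \<tau>" using quadratic_expansion_ex by blast
    then interpret quadratic_expansion \<alpha> \<beta> B0 i a b \<theta> l q \<tau> .
    show ?thesis by (rule index_periodic_ex)
  qed
  have unit: "\<gamma> \<in> order1_zw z w \<and> order1_zw z w = (\<Union>k::int. {mpowi \<gamma> k, - mpowi \<gamma> k})
      \<and> rho \<alpha> \<gamma> \<in> adjoin_F (sqrt (disc z w)) \<and> rho \<alpha> \<gamma> \<in> U_zw \<alpha> z w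
      \<and> U_zw \<alpha> z w = (\<Union>k::int. {rho \<alpha> \<gamma> powi k, - (rho \<alpha> \<gamma> powi k)})"
    if q: "is_quad_point \<alpha> z w" and l: "l0 \<ge> 1" "endpoint_periodic \<alpha> B0 i l0 k0" "index_periodic i l0 k0"
      "\<forall>l\<ge>1. \<forall>k. index_periodic i l k \<longrightarrow> l0 \<le> l"
      and \<gamma>: "\<gamma> = cf_B B0 i (k0 + l0) ** matrix_inv (cf_B B0 i k0)" for z w l0 k0 \<gamma>
  proof -
    have G: "\<gamma> \<in> Delta237" unfolding \<gamma> by (intro Delta_mult B_Delta B_inv_Delta)
    have Ga: "d2 (\<gamma> *v a) a = 0" unfolding \<gamma> by (rule unit_stabilizes[OF l(2)])
    obtain \<mu> where mu: "\<gamma> *v a = \<mu> *s a" using Ga eigen_iff[OF anz] by blast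
    note pw = eigen_mpowi[OF Delta_det[OF G] mu anz]
    have r: "rho \<alpha> \<gamma> = \<mu>" by (rule rho_eigen[OF a mu])
    have rk: "rho \<alpha> (mpowi \<gamma> k) = \<mu> powi k" "rho \<alpha> (- mpowi \<gamma> k) = - (\<mu> powi k)" for k
    proof -
      show "rho \<alpha> (mpowi \<gamma> k) = \<mu> powi k" by (rule rho_eigen[OF a pw])
      have "(- mpowi \<gamma> k) *v a = (- (\<mu> powi k)) *s a" unfolding uminus_act pw by simp
      thus "rho \<alpha> (- mpowi \<gamma> k) = - (\<mu> powi k)" by (rule rho_eigen[OF a])
    qed
    note O1 = order1_zw_eq[OF q a]
    have eq: "order1_zw z w = (\<Union>k::int. {mpowi \<gamma> k, - mpowi \<gamma> k})"
    proof
      show "order1_zw z w \<subseteq> (\<Union>k::int. {mpowi \<gamma> k, - mpowi \<gamma> k})"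
        unfolding O1 \<gamma> using stabilizer_generated[OF q l(3,1,4)] by blast
      show "(\<Union>k::int. {mpowi \<gamma> k, - mpowi \<gamma> k}) \<subseteq> order1_zw z w"
        unfolding O1 using mpowi_Delta[OF G] Delta_minus by (auto simp: uminus_act pw d2_linear)
    qed
    have g1: "\<gamma> \<in> order1_zw z w" unfolding O1 using G Ga by blast
    moreover have "rho \<alpha> \<gamma> \<in> adjoin_F (sqrt (disc z w))"
      using rho_in_adjoin[OF q a _ Ga] G unfolding Delta_eq by blast
    moreover have "rho \<alpha> \<gamma> \<in> U_zw \<alpha> z w" unfolding U_zw_def using g1 by blast
    moreover have "U_zw \<alpha> z w = (\<Union>k::int. {rho \<alpha> \<gamma> powi k, - (rho \<alpha> \<gamma> powi k)})"
      unfolding U_zw_def eq image_UN image_insert image_empty rk r ..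
    ultimately show ?thesis using eq by blast
  qed
  show ?thesis
    unfolding Let_def
  proof (rule conjI[OF _ conjI], goal_cases)
    case 1 show ?case by (rule iffI) (rule 23, rule 12, assumption, rule 31, assumption)
  next
    case 2 show ?case by (rule iffI) (rule 12, rule 31, assumption, rule 23, assumption)
  next
    case 3 show ?case by (intro allI impI, elim conjE, rule unit) (assumption | rule refl)+
  qed
qed

end
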